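(* Let $\delta>0$ and $4/3<q\le\infty$. Then there exists a constant $C_\delta>0$, independent of $\mu$, $\Omega$, $f_1$, $f_2$, such that for every integer $\mu\ge\mu_0$, every $\Omega\in L^q(\mathbb S^{2n-1})$ with $\int_{\mathbb S^{2n-1}}\Omega\,d\sigma=0$, and all Schwartz functions $f_1,f_2$ on $\mathbb R^n$, $$\|\mathcal L_\mu(f_1,f_2)\|_{L^{1,\infty}(\mathbb R^n)}\le C_\delta\,2^{\delta\mu}\,\|\Omega\|_{L^q(\mathbb S^{2n-1})}\,\|f_1\|_{L^1(\mathbb R^n)}\,\|f_2\|_{L^\infty(\mathbb R^n)}$$ and $$\|\mathcal L_\mu(f_1,f_2)\|_{L^{1,\infty}(\mathbb R^n)}\le C_\delta\,2^{\delta\mu}\,\|\Omega\|_{L^q(\mathbb S^{2n-1})}\,\|f_1\|_{L^\infty(\mathbb R^n)}\,\|f_2\|_{L^1(\mathbb R^n)} .$$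
   Context: Let $n\ge1$ and write $\vec y=(y_1,y_2)\in(\mathbb R^n)^2$, $\vec\xi=(\xi_1,\xi_2)\in(\mathbb R^n)^2$. The Fourier transform is $\widehat f(\xi)=\int f(x)e^{-2\pi i\langle x,\xi\rangle}dx$. Fix a Schwartz function $\Phi$ on $(\mathbb R^n)^2$ whose Fourier transform is supported in $\{\vec\xi:1/2\le|\vec\xi|\le2\}$ and such that $\sum_{j\in\mathbb Z}\widehat{\Phi_j}(\vec\xi)=1$ for $\vec\xi\ne0$, where $\widehat{\Phi_j}(\vec\xi):=\widehat\Phi(\vec\xi/2^j)$. For $\Omega\in L^q(\mathbb S^{2n-1})$ with mean value zero let $K(\vec y):=\Omega(\vec y/|\vec y|)\,|\vec y|^{-2n}$ for $\vec y\ne0$, and for $\gamma,\mu\in\mathbb Z$ put $$K^\gamma(\vec y):=\widehat\Phi(2^\gamma\vec y)K(\vec y),\qquad K^\gamma_\mu:=\Phi_{\mu+\gamma}*K^\gamma,\qquad K_\mu:=\sum_{\gamma\in\mathbb Z}K_\mu^\gamma,$$ $$\mathcal L_\mu(f_1,f_2)(x):=\int_{(\mathbb R^n)^2}K_\mu(\vec y)f_1(x-y_1)f_2(x-y_2)\,d\vec y=\sum_{\gamma\in\mathbb Z}\int_{(\mathbb R^n)^2}K^\gamma_\mu(\vec y)f_1(x-y_1)f_2(x-y_2)\,d\vec y .$$ (The integral against $K_\mu$ is understood as the sum over $\gamma$ on the right.) The number $\mu_0$ is a fixed positive integer for which, for the given $q>4/3$, there are constants $\epsilon_1,C_1>0$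 such that for all integers $\mu\ge\mu_0$, all mean-zero $\Omega\in L^q(\mathbb S^{2n-1})$ and all Schwartz $f_1,f_2$: $\|\mathcal L_\mu(f_1,f_2)\|_{L^1(\mathbb R^n)}\le C_1 2^{-\epsilon_1\mu}\|\Omega\|_{L^q(\mathbb S^{2n-1})}\|f_1\|_{L^2(\mathbb R^n)}\|f_2\|_{L^2(\mathbb R^n)}$ (the existence of such a $\mu_0$ is known from earlier work). The weak $L^1$ quasi-norm is $\|f\|_{L^{1,\infty}(\mathbb R^n)}:=\sup_{t>0}t\,|\{x\in\mathbb R^n:|f(x)|>t\}|$. *)

theory Defs
  imports "HOL-Probability.Essential_Supremum"
begin

section \<open>Function spaces\<close>

primrec iter_partial ::
  "'a list \<Rightarrow> ('a::euclidean_space \<Rightarrow> complex) \<Rightarrow> 'a \<Rightarrow> complex" where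
  "iter_partial [] f = f"
| "iter_partial (b # bs) f = (\<lambda>x. frechet_derivative (iter_partial bs f) (at x) b)"

definition schwartz :: "('a::euclidean_space \<Rightarrow> complex) \<Rightarrow> bool" where
  "schwartz f \<longleftrightarrow> (\<forall>bs \<in> lists Basis.
     (\<forall>x. iter_partial bs f differentiable (at x)) \<and>
     (\<forall>k::nat. bounded (range (\<lambda>x. of_real (norm x ^ k) * iter_partial bs f x))))"

text \<open>The \<open>L\<^sup>p\<close> norm (\<open>0 < p \<le> \<infinity>\<close>) with values in \<open>[0,\<infinity>]\<close>. Since \<^const>\<open>powr\<close> is not available
  on \<^typ>\<open>ennreal\<close>, the case of an infinite integral is separated.\<close>

definition Lp_norm :: "ennreal \<Rightarrow> 'a measure \<Rightarrow> ('a \<Rightarrow> complex) \<Rightarrow> ennreal" where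
  "Lp_norm p M f =
    (if p = \<infinity> then esssup M (\<lambda>x. ennreal (norm (f x)))
     else let I = (\<integral>\<^sup>+ x. ennreal (norm (f x) powr enn2real p) \<partial>M)
          in if I = \<infinity> then \<infinity> else ennreal (enn2real I powr (1 / enn2real p)))"

definition Lp_space :: "ennreal \<Rightarrow> 'a measure \<Rightarrow> ('a \<Rightarrow> complex) set" where
  "Lp_space p M = {f \<in> borel_measurable M. Lp_norm p M f < \<infinity>}"

definition weak_L1_norm :: "'a measure \<Rightarrow> ('a \<Rightarrow> complex) \<Rightarrow> ennreal" where
  "weak_L1_norm M f = (SUP t\<in>{0<..}. ennreal t * emeasure M {x \<in> space M. norm (f x) > t})"

section \<open>Surface measure on the unit sphere\<close>

text \<open>The surface measure \<open>\<sigma>\<close> of the unit sphere in dimension \<open>d\<close> is the measure appearing in the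
  polar coordinates formula; it is given by \<open>\<sigma>(A) = d \<cdot> |{r \<theta>. 0 < r < 1, \<theta> \<in> A}|\<close>.\<close>

definition sphere_measure :: "'a::euclidean_space measure" where
  "sphere_measure = scale_measure (of_nat DIM('a))
     (distr (restrict_space lborel (ball 0 1 - {0})) (restrict_space borel (sphere 0 1))
        (\<lambda>x. x /\<^sub>R norm x))"

lemma space_sphere_measure [simp]: "space sphere_measure = sphere 0 1"
  by (simp add: sphere_measure_def space_scale_measure space_restrict_space)

lemma sets_sphere_measure [simp, measurable_cong]:
  "sets sphere_measure = sets (restrict_space borel (sphere 0 1))"
  by (simp add: sphere_measure_def)

lemma emeasure_sphere_measure:
  fixes A :: "'a::euclidean_space set"
  assumes A: "A \<in> sets borel" "A \<subseteq> sphere 0 1"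
  shows "emeasure sphere_measure A =
    of_nat DIM('a) * emeasure lborel {r *\<^sub>R \<theta> | r \<theta>. 0 < r \<and> r < 1 \<and> \<theta> \<in> A}"
proof -
  let ?N = "restrict_space lborel (ball 0 1 - {0}) :: 'a measure"
  let ?S = "restrict_space borel (sphere 0 1) :: 'a measure"
  have meas: "(\<lambda>x. x /\<^sub>R norm x) \<in> measurable ?N ?S"
  proof (rule measurable_restrict_space2)
    show "(\<lambda>x. x /\<^sub>R norm x) \<in> space ?N \<rightarrow> sphere 0 1"
      by (auto simp: space_restrict_space)
    show "(\<lambda>x. x /\<^sub>R norm x) \<in> borel_measurable ?N"
      by (intro measurable_restrict_space1) simp
  qed
  have A': "A \<in> sets ?S"
    using A by (auto simp: sets_restrict_space image_iff intro!: bexI[of _ A])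
  have pre: "(\<lambda>x. x /\<^sub>R norm x) -` A \<inter> space ?N = {r *\<^sub>R \<theta> | r \<theta>. 0 < r \<and> r < 1 \<and> \<theta> \<in> A}"
  proof (intro set_eqI iffI)
    fix x assume "x \<in> (\<lambda>x. x /\<^sub>R norm x) -` A \<inter> space ?N"
    then have x: "x /\<^sub>R norm x \<in> A" "norm x < 1" "x \<noteq> 0"
      by (auto simp: space_restrict_space)
    then have "x = norm x *\<^sub>R (x /\<^sub>R norm x)" by simp
    with x show "x \<in> {r *\<^sub>R \<theta> | r \<theta>. 0 < r \<and> r < 1 \<and> \<theta> \<in> A}"
      by (metis (mono_tags, lifting) mem_Collect_eq zero_less_norm_iff)
  next
    fix x assume "x \<in> {r *\<^sub>R \<theta> | r \<theta>. 0 < r \<and> r < 1 \<and> \<theta> \<in> A}"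
    then obtain r \<theta> where x: "x = r *\<^sub>R \<theta>" "0 < r" "r < 1" "\<theta> \<in> A" by auto
    with A(2) have "norm \<theta> = 1" by auto
    with x show "x \<in> (\<lambda>x. x /\<^sub>R norm x) -` A \<inter> space ?N"
      by (auto simp: space_restrict_space)
  qed
  have "emeasure sphere_measure A = of_nat DIM('a) * emeasure ?N ((\<lambda>x. x /\<^sub>R norm x) -` A \<inter> space ?N)"
    by (simp add: sphere_measure_def emeasure_distr[OF meas A'])
  also have "emeasure ?N ((\<lambda>x. x /\<^sub>R norm x) -` A \<inter> space ?N) =
      emeasure lborel ((\<lambda>x. x /\<^sub>R norm x) -` A \<inter> space ?N)"
    by (subst emeasure_restrict_space) (auto simp: space_restrict_space)
  finally show ?thesis
    unfolding pre .
qed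

section \<open>Fourier transform, convolution and dilations\<close>

definition fourier :: "('a::euclidean_space \<Rightarrow> complex) \<Rightarrow> 'a \<Rightarrow> complex" where
  "fourier f \<xi> = (LINT x|lborel. f x * exp (- 2 * of_real pi * \<i> * of_real (x \<bullet> \<xi>)))"

definition convol ::
  "('a::euclidean_space \<Rightarrow> complex) \<Rightarrow> ('a \<Rightarrow> complex) \<Rightarrow> 'a \<Rightarrow> complex" where
  "convol g h y = (LINT z|lborel. g (y - z) * h z)"

text \<open>The function \<open>\<Phi>\<^sub>j\<close> whose Fourier transform is \<open>\<xi> \<mapsto> fourier \<Phi> (\<xi> / 2\<^sup>j)\<close>; this property is
  \<open>fourier_dyadic\<close> below.\<close>

definition dyadic :: "('a::euclidean_space \<Rightarrow> complex) \<Rightarrow> int \<Rightarrow> 'a \<Rightarrow> complex" where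
  "dyadic \<Phi> j y = of_real ((2 powi j) ^ DIM('a)) * \<Phi> ((2 powi j) *\<^sub>R y)"

lemma fourier_dyadic:
  fixes \<Phi> :: "'a::euclidean_space \<Rightarrow> complex"
  assumes [measurable]: "\<Phi> \<in> borel_measurable borel"
  shows "fourier (dyadic \<Phi> j) \<xi> = fourier \<Phi> (\<xi> /\<^sub>R (2 powi j))"
proof -
  define c :: real where "c = 2 powi j"
  have c: "c > 0" by (simp add: c_def)
  let ?g = "\<lambda>x. \<Phi> x * exp (- 2 * of_real pi * \<i> * of_real (x \<bullet> (\<xi> /\<^sub>R c)))"
  have "fourier \<Phi> (\<xi> /\<^sub>R c) = (LINT x|lborel. ?g x)"
    by (simp add: fourier_def)
  also have "\<dots> = (LINT x|density (distr lborel borel (\<lambda>x. 0 + c *\<^sub>R x)) (\<lambda>_. ennreal (\<bar>c\<bar> ^ DIM('a))). ?g x)"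
    by (subst lborel_affine[of c 0]) (use c in auto)
  also have "\<dots> = (LINT x|lborel. (c ^ DIM('a)) *\<^sub>R ?g (c *\<^sub>R x))"
    using c by (subst integral_density) (auto simp: integral_distr)
  also have "\<dots> = fourier (dyadic \<Phi> j) \<xi>"
  proof -
    have "(c *\<^sub>R x) \<bullet> (\<xi> /\<^sub>R c) = x \<bullet> \<xi>" for x
      using c by simp
    then show ?thesis
      unfolding fourier_def dyadic_def c_def[symmetric]
      by (intro Bochner_Integration.integral_cong)
         (simp_all only: scaleR_conv_of_real mult_ac of_real_power)
  qed
  finally show ?thesis by (simp add: c_def)
qed

definition littlewood_paley :: "('a::euclidean_space \<Rightarrow> complex) \<Rightarrow> bool" where
  "littlewood_paley \<Phi> \<longleftrightarrow>
     schwartz \<Phi> \<and>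
     closure {\<xi>. fourier \<Phi> \<xi> \<noteq> 0} \<subseteq> {\<xi>. 1 / 2 \<le> norm \<xi> \<and> norm \<xi> \<le> 2} \<and>
     (\<forall>\<xi>. \<xi> \<noteq> 0 \<longrightarrow> ((\<lambda>j::int. fourier (dyadic \<Phi> j) \<xi>) has_sum 1) UNIV)"

section \<open>The bilinear operators\<close>

text \<open>\<open>(\<real>\<^sup>n)\<^sup>2\<close> is the product type with its Euclidean norm, a space of dimension \<open>2n\<close>.\<close>

type_synonym 'n vpair = "(real ^ 'n) \<times> (real ^ 'n)"

definition rough_kernel :: "('n::finite vpair \<Rightarrow> complex) \<Rightarrow> 'n vpair \<Rightarrow> complex" where
  "rough_kernel \<Omega> y =
    (if y = 0 then 0 else \<Omega> (y /\<^sub>R norm y) / of_real (norm y ^ (2 * CARD('n))))"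

text \<open>\<open>K\<^sup>\<gamma>\<close>\<close>
definition kernel_piece ::
  "('n::finite vpair \<Rightarrow> complex) \<Rightarrow> ('n vpair \<Rightarrow> complex) \<Rightarrow> int \<Rightarrow> 'n vpair \<Rightarrow> complex" where
  "kernel_piece \<Phi> \<Omega> \<gamma> y = fourier \<Phi> ((2 powi \<gamma>) *\<^sub>R y) * rough_kernel \<Omega> y"

text \<open>\<open>K\<^sup>\<gamma>\<^sub>\<mu>\<close>\<close>
definition kernel_smooth_piece ::
  "('n::finite vpair \<Rightarrow> complex) \<Rightarrow> ('n vpair \<Rightarrow> complex) \<Rightarrow> int \<Rightarrow> int \<Rightarrow> 'n vpair \<Rightarrow> complex" where
  "kernel_smooth_piece \<Phi> \<Omega> \<mu> \<gamma> = convol (dyadic \<Phi> (\<mu> + \<gamma>)) (kernel_piece \<Phi> \<Omega> \<gamma>)"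

text \<open>\<open>\<L>\<^sub>\<mu>\<close>: the integral against \<open>K\<^sub>\<mu> = \<Sum>\<^sub>\<gamma> K\<^sup>\<gamma>\<^sub>\<mu>\<close> is taken termwise.\<close>
definition bilinear_op ::
  "('n::finite vpair \<Rightarrow> complex) \<Rightarrow> ('n vpair \<Rightarrow> complex) \<Rightarrow> int \<Rightarrow>
    (real ^ 'n \<Rightarrow> complex) \<Rightarrow> (real ^ 'n \<Rightarrow> complex) \<Rightarrow> real ^ 'n \<Rightarrow> complex" where
  "bilinear_op \<Phi> \<Omega> \<mu> f1 f2 x =
    (\<Sum>\<^sub>\<infinity>\<gamma>\<in>(UNIV::int set). LINT y|lborel.
       kernel_smooth_piece \<Phi> \<Omega> \<mu> \<gamma> y * f1 (x - fst y) * f2 (x - snd y))"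

definition mean_zero_Lq :: "ennreal \<Rightarrow> ('a::euclidean_space \<Rightarrow> complex) set" where
  "mean_zero_Lq q = {\<Omega> \<in> Lp_space q sphere_measure. (LINT \<theta>|sphere_measure. \<Omega> \<theta>) = 0}"

text \<open>The property characterising the fixed positive integer \<open>\<mu>\<^sub>0\<close>: exponential decay in \<open>\<mu>\<close> of
  the \<open>L\<^sup>2 \<times> L\<^sup>2 \<rightarrow> L\<^sup>1\<close> bounds for \<open>\<mu> \<ge> \<mu>\<^sub>0\<close>.\<close>

definition L2_decay :: "('n::finite vpair \<Rightarrow> complex) \<Rightarrow> ennreal \<Rightarrow> int \<Rightarrow> bool" where
  "L2_decay \<Phi> q \<mu>0 \<longleftrightarrow>
    (\<exists>\<epsilon>1>0. \<exists>C1>0. \<forall>\<mu>\<ge>\<mu>0. \<forall>\<Omega>\<in>mean_zero_Lq q. \<forall>f1 f2. schwartz f1 \<longrightarrow> schwartz f2 \<longrightarrow>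
       Lp_norm 1 lborel (bilinear_op \<Phi> \<Omega> \<mu> f1 f2)
         \<le> ennreal (C1 * 2 powr (- \<epsilon>1 * real_of_int \<mu>)) * Lp_norm q sphere_measure \<Omega>
            * Lp_norm 2 lborel f1 * Lp_norm 2 lborel f2)"

end

theory Submission
  imports Defs "HOL-Probability.Sinc_Integral"
begin

text \<open>
  Of \<open>\<Omega>\<close> only the bound \<open>\<parallel>\<Omega>\<parallel>\<^sub>1 \<lesssim> \<parallel>\<Omega>\<parallel>\<^sub>q\<close> is used directly: each piece of the kernel, indexed by \<open>\<gamma>\<close>, then
  has mass \<open>O(1)\<close>, first moment \<open>O(2\<^sup>-\<^sup>\<gamma>)\<close>, \<open>L\<^sup>1\<close>-modulus of continuity \<open>O(2\<^sup>\<mu>\<^sup>+\<^sup>\<gamma>)\<close> and integral zero.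
  Hence at every scale the sum over \<open>\<gamma>\<close> of the oscillations is \<open>O(1 + \<mu>)\<close>, which \<open>2\<^sup>\<delta>\<^sup>\<mu>\<close> absorbs.

  The \<open>L\<^sup>2 \<times> L\<^sup>2 \<rightarrow> L\<^sup>1\<close> hypothesis concerns the full sum over \<open>\<gamma>\<close>, but mollifying both inputs at scale
  \<open>2\<^sup>-\<^sup>\<mu>\<^sup>-\<^sup>b\<close> amounts to keeping the pieces with \<open>\<gamma> \<le> b\<close>, up to an error of size \<open>O(1 + \<mu>)\<close>.  Differences of
  two such mollifications give the finite truncations, which therefore map bounded functions supported
  in \<open>E\<close> into \<open>L\<^sup>1\<close> with norm \<open>O(|E|)\<close>.

  For a truncation with the bounded input frozen, the bad part of a Calderon--Zygmund decomposition of the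
  other input at height \<open>h\<close> is controlled by the oscillation sums.  There is no linear \<open>L\<^sup>2\<close> bound for
  the good part.  Instead, the local estimate gives a good-\<open>\<lambda>\<close> inequality bounding its contribution by a
  small multiple of the a priori weak-type constant \<open>W\<close>, finite because the truncated kernel is
  integrable.  So \<open>W\<close> improves to \<open>W/2 + C/2\<close>, and iteration gives \<open>W \<le> C\<close>.
\<close>

section \<open>Integrals against a bilinear kernel\<close>

text \<open>With one input frozen in L^\<infinity>, the L^2 hypothesis says nothing directly, since
  a bounded function need not be in L^2. It becomes usable once both inputs are cut to a common
  bounded set E, where two factors |E|^(1/2) multiply to |E|. Cutting to a dilate of a dyadic cube
  leaves a tail whose variation over the cube is an oscillation sum. The mollifier is Gaussian
  because a Gaussian on the product space is a tensor product: smoothing both inputs is the same as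
  smoothing the kernel. The improvement of W needs a class of inputs stable under the
  Calderon--Zygmund decomposition, since the a priori bound is applied again to the good part.
  Integrable functions constant on the dyadic cubes of one fixed generation form such a class;
  Schwartz functions follow by approximation. W is halved by comparing level 2t with level t at
  height about \<eta> t, where \<eta> is so small that the good-\<lambda> factor outweighs the loss
  from s = 4t to t. The factor \<mu> + 5 counts the scales between smoothness and size of a piece,
  plus two geometric tails.\<close>

lemma nn_integral_lborel_shift:
  fixes f :: "'a::euclidean_space \<Rightarrow> ennreal"
  assumes [measurable]: "f \<in> borel_measurable borel"
  shows "(\<integral>\<^sup>+x. f (x + a) \<partial>lborel) = (\<integral>\<^sup>+x. f x \<partial>lborel)"
proof -
  have "(\<integral>\<^sup>+x. f x \<partial>lborel) = (\<integral>\<^sup>+x. f x \<partial>(distr lborel borel ((+) a)))"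
    by (simp add: lborel_distr_plus)
  also have "\<dots> = (\<integral>\<^sup>+x. f (x + a) \<partial>lborel)"
    by (subst nn_integral_distr) (auto simp: add.commute)
  finally show ?thesis by simp
qed

lemma lborel_distr_reflect: "distr lborel borel (\<lambda>x::'a::euclidean_space. a - x) = lborel"
proof -
  have "lborel = density (distr lborel borel (\<lambda>x::'a. a + (-1) *\<^sub>R x)) (\<lambda>_. 1)"
    by (subst lborel_affine[of "-1" a]) auto
  then show ?thesis by (simp add: density_1)
qed

lemma nn_integral_lborel_reflect:
  fixes f :: "'a::euclidean_space \<Rightarrow> ennreal"
  assumes [measurable]: "f \<in> borel_measurable borel"
  shows "(\<integral>\<^sup>+x. f (a - x) \<partial>lborel) = (\<integral>\<^sup>+x. f x \<partial>lborel)"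
proof -
  have "(\<integral>\<^sup>+x. f x \<partial>lborel) = (\<integral>\<^sup>+x. f x \<partial>(distr lborel borel (\<lambda>x. a - x)))"
    by (simp add: lborel_distr_reflect)
  also have "\<dots> = (\<integral>\<^sup>+x. f (a - x) \<partial>lborel)"
    by (subst nn_integral_distr) auto
  finally show ?thesis by simp
qed

lemma integral_lborel_reflect:
  fixes f :: "'a::euclidean_space \<Rightarrow> complex"
  assumes [measurable]: "f \<in> borel_measurable borel"
  shows "(LINT x|lborel. f (a - x)) = (LINT x|lborel. f x)"
proof -
  have "(LINT x|lborel. f x) = (LINT x|distr lborel borel (\<lambda>x. a - x). f x)"
    by (simp add: lborel_distr_reflect)
  also have "\<dots> = (LINT x|lborel. f (a - x))"
    by (subst integral_distr) auto
  finally show ?thesis by simp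
qed

lemma nn_integral_lborel_prod_fst:
  fixes f :: "'a::euclidean_space \<times> 'b::euclidean_space \<Rightarrow> ennreal"
  assumes "f \<in> borel_measurable borel"
  shows "(\<integral>\<^sup>+y. f y \<partial>lborel) = (\<integral>\<^sup>+x. \<integral>\<^sup>+z. f (x, z) \<partial>lborel \<partial>lborel)"
proof -
  have "f \<in> borel_measurable (lborel \<Otimes>\<^sub>M lborel)"
    using assms by (simp add: lborel_prod)
  from lborel.nn_integral_fst[OF this] show ?thesis by (simp add: lborel_prod)
qed

text \<open>No integrability is assumed: the Bochner integral of a non-integrable function is 0 by
  convention. This frees later L^1 estimates from integrability side conditions.\<close>

lemma norm_le_nn:
  fixes f :: "'a \<Rightarrow> complex"
  shows "ennreal (norm (LINT x|M. f x)) \<le> (\<integral>\<^sup>+x. ennreal (norm (f x)) \<partial>M)"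
proof (cases "integrable M f")
  case True then show ?thesis by (rule integral_norm_bound_ennreal)
next
  case False then show ?thesis by (simp add: not_integrable_integral_eq)
qed

text \<open>One term of \<open>bilinear_op\<close>, for an arbitrary kernel on the square of a
  Euclidean space.\<close>

definition bil :: "('a::euclidean_space \<times> 'a \<Rightarrow> complex) \<Rightarrow> ('a \<Rightarrow> complex) \<Rightarrow> ('a \<Rightarrow> complex) \<Rightarrow> 'a \<Rightarrow> complex"
  where "bil k f g x = (LINT y|lborel. k y * f (x - fst y) * g (x - snd y))"

lemma fst_snd_borel [measurable]:
  "fst \<in> borel_measurable (borel :: ('a::euclidean_space \<times> 'b::euclidean_space) measure)"
  "snd \<in> borel_measurable (borel :: ('a::euclidean_space \<times> 'b::euclidean_space) measure)"
  by (auto intro!: borel_measurable_continuous_onI continuous_intros)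

lemma bil_borel [measurable]:
  assumes [measurable]: "k \<in> borel_measurable borel" "f \<in> borel_measurable borel" "g \<in> borel_measurable borel"
  shows "bil k f g \<in> borel_measurable borel"
proof -
  have "(\<lambda>x. LINT y|lborel. k y * f (x - fst y) * g (x - snd y)) \<in> borel_measurable borel"
    by measurable
  then show ?thesis by (simp add: bil_def[abs_def])
qed

text \<open>The substitution z = (x, x) - y moves the whole dependence on x into the kernel, so that
  differences of the output become differences of \<open>k\<close> integrated against a fixed
  function.\<close>

lemma bil_reflect:
  assumes [measurable]: "k \<in> borel_measurable borel" "f \<in> borel_measurable borel" "g \<in> borel_measurable borel"
  shows "bil k f g x = (LINT z|lborel. k ((x,x) - z) * (f (fst z) * g (snd z)))"
  unfolding bil_def
  by (subst integral_lborel_reflect[of _ "(x,x)", symmetric]) (auto simp: mult.assoc intro!: Bochner_Integration.integral_cong)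

lemma bil_norm_nn:
  assumes "\<And>x. norm (g x) \<le> 1"
  shows "ennreal (norm (bil k f g x)) \<le> (\<integral>\<^sup>+y. ennreal (norm (k y)) * ennreal (norm (f (x - fst y))) \<partial>lborel)"
proof -
  have "ennreal (norm (bil k f g x)) \<le> (\<integral>\<^sup>+y. ennreal (norm (k y * f (x - fst y) * g (x - snd y))) \<partial>lborel)"
    unfolding bil_def by (rule norm_le_nn)
  also have "\<dots> \<le> (\<integral>\<^sup>+y. ennreal (norm (k y)) * ennreal (norm (f (x - fst y))) \<partial>lborel)"
  proof (intro nn_integral_mono)
    fix y
    have "norm (k y * f (x - fst y)) * norm (g (x - snd y)) \<le> norm (k y * f (x - fst y)) * 1"
      by (intro mult_left_mono assms) auto
    then show "ennreal (norm (k y * f (x - fst y) * g (x - snd y))) \<le> ennreal (norm (k y)) * ennreal (norm (f (x - fst y)))"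
      by (simp add: norm_mult ennreal_mult'[symmetric])
  qed
  finally show ?thesis .
qed

text \<open>With \<open>g\<close> bounded by 1, the output is dominated by a superposition of
  translates of |f| with weight |k|, and Lebesgue measure is translation invariant. This crude bound
  makes the weak-type constant of a truncated kernel finite and controls error kernels that are
  small in L^1.\<close>

lemma bil_L1_bound:
  assumes [measurable]: "k \<in> borel_measurable borel" "f \<in> borel_measurable borel" "g \<in> borel_measurable borel"
    and g: "\<And>x. norm (g x) \<le> 1"
  shows "(\<integral>\<^sup>+x. ennreal (norm (bil k f g x)) \<partial>lborel)
    \<le> (\<integral>\<^sup>+y. ennreal (norm (k y)) \<partial>lborel) * (\<integral>\<^sup>+x. ennreal (norm (f x)) \<partial>lborel)"
proof -
  have "(\<integral>\<^sup>+x. ennreal (norm (bil k f g x)) \<partial>lborel)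
    \<le> (\<integral>\<^sup>+x. \<integral>\<^sup>+y. ennreal (norm (k y)) * ennreal (norm (f (x - fst y))) \<partial>lborel \<partial>lborel)"
    by (intro nn_integral_mono bil_norm_nn g)
  also have "\<dots> = (\<integral>\<^sup>+y. \<integral>\<^sup>+x. ennreal (norm (k y)) * ennreal (norm (f (x - fst y))) \<partial>lborel \<partial>lborel)"
    by (subst lborel_pair.Fubini') auto
  also have "\<dots> = (\<integral>\<^sup>+y. ennreal (norm (k y)) * (\<integral>\<^sup>+x. ennreal (norm (f x)) \<partial>lborel) \<partial>lborel)"
  proof (rule nn_integral_cong)
    fix y :: "'a \<times> 'a"
    have "(\<integral>\<^sup>+x. ennreal (norm (f (x - fst y))) \<partial>lborel) = (\<integral>\<^sup>+x. ennreal (norm (f x)) \<partial>lborel)"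
      using nn_integral_lborel_shift[of "\<lambda>x. ennreal (norm (f x))" "- fst y"] by simp
    then show "(\<integral>\<^sup>+x. ennreal (norm (k y)) * ennreal (norm (f (x - fst y))) \<partial>lborel) = ennreal (norm (k y)) * (\<integral>\<^sup>+x. ennreal (norm (f x)) \<partial>lborel)"
      by (subst nn_integral_cmult) auto
  qed
  also have "\<dots> = (\<integral>\<^sup>+y. ennreal (norm (k y)) \<partial>lborel) * (\<integral>\<^sup>+x. ennreal (norm (f x)) \<partial>lborel)"
    by (subst nn_integral_multc) auto
  finally show ?thesis .
qed

lemma bil_integrable:
  fixes k :: "'a::euclidean_space \<times> 'a \<Rightarrow> complex"
  assumes "integrable lborel k" and [measurable]: "f \<in> borel_measurable borel" "g \<in> borel_measurable borel"
    and "\<And>x. norm (f x) \<le> u" "\<And>x. norm (g x) \<le> v"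
  shows "integrable lborel (\<lambda>y. k y * f (x - fst y) * g (x - snd y))"
proof (rule Bochner_Integration.integrable_bound)
  have [measurable]: "k \<in> borel_measurable borel" using assms(1) by auto
  show "integrable lborel (\<lambda>y. norm (k y) * (u * v))" using assms(1) by auto
  show "(\<lambda>y. k y * f (x - fst y) * g (x - snd y)) \<in> borel_measurable lborel" by measurable
  have "0 \<le> u" using assms(4)[of 0] norm_ge_zero order_trans by blast
  then show "AE y in lborel. norm (k y * f (x - fst y) * g (x - snd y)) \<le> norm (norm (k y) * (u * v))"
    using assms(4,5) by (auto simp: norm_mult abs_mult mult.assoc intro!: mult_mono AE_I2)
      (meson abs_ge_self order_trans)
qed

lemma bil_norm_bound:
  assumes k: "integrable lborel k" and [measurable]: "f \<in> borel_measurable borel" "g \<in> borel_measurable borel"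
    and f: "\<And>x. norm (f x) \<le> u" and g: "\<And>x. norm (g x) \<le> v"
  shows "norm (bil k f g x) \<le> (LINT y|lborel. norm (k y)) * (u * v)"
proof -
  have "norm (bil k f g x) \<le> (LINT y|lborel. norm (k y * f (x - fst y) * g (x - snd y)))"
    unfolding bil_def by (rule integral_norm_bound)
  also have "\<dots> \<le> (LINT y|lborel. norm (k y) * (u * v))"
  proof (rule integral_mono)
    show "integrable lborel (\<lambda>y. norm (k y * f (x - fst y) * g (x - snd y)))"
      by (intro integrable_norm bil_integrable[OF k _ _ f g]) auto
    show "integrable lborel (\<lambda>y. norm (k y) * (u * v))" using k by auto
    have "0 \<le> u" using f[of 0] norm_ge_zero order_trans by blast
    then show "norm (k y * f (x - fst y) * g (x - snd y)) \<le> norm (k y) * (u * v)" for y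
      using f g by (auto simp: norm_mult mult.assoc intro!: mult_mono)
  qed
  finally show ?thesis by simp
qed

lemma bil_diff:
  assumes k: "integrable lborel k" and [measurable]: "f \<in> borel_measurable borel" "f' \<in> borel_measurable borel" "g \<in> borel_measurable borel"
    and f: "\<And>x. norm (f x) \<le> u" and f': "\<And>x. norm (f' x) \<le> u'" and g: "\<And>x. norm (g x) \<le> v"
  shows "bil k (\<lambda>x. f x - f' x) g x = bil k f g x - bil k f' g x"
  unfolding bil_def
  by (subst Bochner_Integration.integral_diff[symmetric])
    (auto simp: ring_distribs intro!: bil_integrable[OF k _ _ f g] bil_integrable[OF k _ _ f' g])

lemma bil_sum:
  assumes k: "\<And>i. i \<in> F \<Longrightarrow> integrable lborel (k i)" and [measurable]: "f \<in> borel_measurable borel" "g \<in> borel_measurable borel"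
    and f: "\<And>x. norm (f x) \<le> u" and g: "\<And>x. norm (g x) \<le> v"
  shows "bil (\<lambda>y. \<Sum>i\<in>F. k i y) f g x = (\<Sum>i\<in>F. bil (k i) f g x)"
  unfolding bil_def
  by (subst Bochner_Integration.integral_sum[symmetric]) (auto simp: sum_distrib_right intro!: bil_integrable[OF k _ _ f g])

lemma bil_sum_right:
  assumes k: "integrable lborel k" and [measurable]: "\<And>i. i \<in> F \<Longrightarrow> f i \<in> borel_measurable borel" "g \<in> borel_measurable borel"
    and f: "\<And>i x. i \<in> F \<Longrightarrow> norm (f i x) \<le> u" and g: "\<And>x. norm (g x) \<le> v"
  shows "bil k (\<lambda>x. \<Sum>i\<in>F. f i x) g x = (\<Sum>i\<in>F. bil k (f i) g x)"
  unfolding bil_def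
  by (subst Bochner_Integration.integral_sum[symmetric]) (auto simp: sum_distrib_right sum_distrib_left intro!: bil_integrable[OF k _ _ f g])

lemma bil_cmult: "bil k (\<lambda>x. c * f x) g x = c * bil k f g x"
  unfolding bil_def by (subst integral_mult_right_zero[symmetric]) (auto simp: algebra_simps)

lemma bil_cmult2: "bil k f (\<lambda>x. c * g x) x = c * bil k f g x"
  unfolding bil_def by (subst integral_mult_right_zero[symmetric]) (auto simp: algebra_simps)

section \<open>Exchange of the two inputs\<close>

lemma swap_borel [measurable]:
  "prod.swap \<in> borel_measurable (borel :: ('a::euclidean_space \<times> 'b::euclidean_space) measure)"
  by (auto intro!: borel_measurable_continuous_onI continuous_intros simp: prod.swap_def)

lemma lborel_distr_swap: "distr lborel borel (prod.swap :: 'a::euclidean_space \<times> 'b::euclidean_space \<Rightarrow> 'b \<times> 'a) = lborel"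
proof -
  have "(lborel :: ('b \<times> 'a) measure) = distr lborel (borel :: ('b \<times> 'a) measure) (\<lambda>(x, y). (y, x))"
    using lborel_pair.distr_pair_swap[where ?'a='b and ?'b='a]
    by (simp only: lborel_prod sets_lborel cong: distr_cong)
  then show ?thesis by (simp add: prod.swap_def[abs_def] case_prod_unfold)
qed

text \<open>Reduces the estimate with the first input bounded to the one with the second input
  bounded, for the kernel with exchanged coordinates.\<close>

lemma bil_swap:
  assumes [measurable]: "k \<in> borel_measurable borel" "f \<in> borel_measurable borel" "g \<in> borel_measurable borel"
  shows "bil (k \<circ> prod.swap) g f x = bil k f g x"
proof -
  have "bil k f g x = (LINT y|distr lborel borel prod.swap. k y * f (x - fst y) * g (x - snd y))"
    by (simp add: lborel_distr_swap bil_def)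
  also have "\<dots> = bil (k \<circ> prod.swap) g f x"
    by (subst integral_distr) (auto simp: bil_def mult_ac)
  finally show ?thesis by simp
qed

section \<open>Dyadic cubes and the Calderon--Zygmund decomposition\<close>

text \<open>A half-open cube of side 2^-k, named by any of its points. Larger \<open>k\<close> means
  a smaller cube, and for fixed \<open>k\<close> the cubes are the classes of an equivalence
  relation.\<close>

definition dyadic_cube :: "int \<Rightarrow> 'a::euclidean_space \<Rightarrow> 'a set" where
  "dyadic_cube k x = {y. \<forall>b\<in>Basis. \<lfloor>2 powi k * (y \<bullet> b)\<rfloor> = \<lfloor>2 powi k * (x \<bullet> b)\<rfloor>}"

lemma dyadic_cube_self [simp]: "x \<in> dyadic_cube k x"
  by (simp add: dyadic_cube_def)

lemma dyadic_cube_eq: "y \<in> dyadic_cube k x \<Longrightarrow> dyadic_cube k y = dyadic_cube k x"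
  by (auto simp: dyadic_cube_def)

lemma dyadic_cube_sym: "y \<in> dyadic_cube k x \<longleftrightarrow> x \<in> dyadic_cube k y"
  by (auto simp: dyadic_cube_def)

text \<open>The coarse integer coordinate is the fine one divided by 2^(l-k) and rounded down, so
  equal fine coordinates force equal coarse ones.\<close>

lemma dyadic_cube_nested:
  assumes "k \<le> l" shows "dyadic_cube l x \<subseteq> dyadic_cube k x"
proof
  fix y assume y: "y \<in> dyadic_cube l x"
  define m where "m = nat (l - k)"
  have l: "l = k + int m" using assms by (simp add: m_def)
  have fl: "\<lfloor>2 powi k * a\<rfloor> = \<lfloor>2 powi l * a\<rfloor> div (2 ^ m)" for a :: real
  proof -
    have "2 powi k * a = (2 powi l * a) / real_of_int (2 ^ m)"
      by (simp add: l power_int_add)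
    then show ?thesis by (simp only: floor_divide_real_eq_div[of "2^m", simplified])
        (metis floor_divide_real_eq_div zero_le_numeral zero_le_power)
  qed
  show "y \<in> dyadic_cube k x"
    using y unfolding dyadic_cube_def by (auto simp: fl)
qed

text \<open>An open and a closed box with the same corner and side squeeze the half-open cube. Their
  volumes agree, which yields the volume of the cube.\<close>

lemma dyadic_cube_box:
  fixes x :: "'a::euclidean_space" and k :: int
  defines "c \<equiv> (\<Sum>b\<in>Basis. (of_int \<lfloor>2 powi k * (x \<bullet> b)\<rfloor> * 2 powi (-k)) *\<^sub>R b)"
    and "e \<equiv> (\<Sum>b\<in>Basis. (2 powi (-k)) *\<^sub>R b)"
  shows "box c (c + e) \<subseteq> dyadic_cube k x" "dyadic_cube k x \<subseteq> cbox c (c + e)"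
proof -
  have c: "b \<in> Basis \<Longrightarrow> c \<bullet> b = of_int \<lfloor>2 powi k * (x \<bullet> b)\<rfloor> * 2 powi (-k)" for b
    by (simp add: c_def inner_sum_left_Basis)
  have e: "b \<in> Basis \<Longrightarrow> e \<bullet> b = 2 powi (-k)" for b
    by (simp add: e_def inner_sum_left_Basis)
  have p: "(2::real) powi (-k) * 2 powi k = 1" by (simp add: power_int_minus)
  have p': "(2::real) powi k * 2 powi (-k) = 1" using p by (simp add: mult.commute)
  have q: "(2::real) powi k * (r * 2 powi (-k)) = r" for r using p' by (metis mult.left_commute mult.right_neutral)
  have pos: "(2::real) powi k > 0" by simp
  have "\<lfloor>2 powi k * (y \<bullet> b)\<rfloor> = \<lfloor>2 powi k * (x \<bullet> b)\<rfloor>" if "y \<in> box c (c + e)" "b \<in> Basis" for y b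
  proof -
    let ?m = "\<lfloor>2 powi k * (x \<bullet> b)\<rfloor>"
    have "of_int ?m * 2 powi (-k) < y \<bullet> b" "y \<bullet> b < of_int ?m * 2 powi (-k) + 2 powi (-k)"
      using that by (auto simp: mem_box c e inner_add_left)
    then have "2 powi k * (of_int ?m * 2 powi (-k)) < 2 powi k * (y \<bullet> b)"
      "2 powi k * (y \<bullet> b) < 2 powi k * (of_int ?m * 2 powi (-k) + 2 powi (-k))"
      using pos by (auto intro: mult_strict_left_mono)
    then have "of_int ?m < 2 powi k * (y \<bullet> b)" "2 powi k * (y \<bullet> b) < of_int ?m + 1"
      using q[of "of_int ?m"] by (auto simp: distrib_left p')
    then show ?thesis by (intro floor_unique) auto
  qed
  then show "box c (c + e) \<subseteq> dyadic_cube k x" by (auto simp: dyadic_cube_def)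
  have "c \<bullet> b \<le> y \<bullet> b \<and> y \<bullet> b \<le> (c + e) \<bullet> b" if "y \<in> dyadic_cube k x" "b \<in> Basis" for y b
  proof -
    let ?m = "\<lfloor>2 powi k * (x \<bullet> b)\<rfloor>"
    have "\<lfloor>2 powi k * (y \<bullet> b)\<rfloor> = ?m" using that by (auto simp: dyadic_cube_def)
    then have "of_int ?m \<le> 2 powi k * (y \<bullet> b)" "2 powi k * (y \<bullet> b) \<le> of_int ?m + 1"
      by linarith+
    then have "2 powi (-k) * of_int ?m \<le> 2 powi (-k) * (2 powi k * (y \<bullet> b))"
      "2 powi (-k) * (2 powi k * (y \<bullet> b)) \<le> 2 powi (-k) * (of_int ?m + 1)"
      by (auto intro: mult_left_mono)
    then show ?thesis using that(2)
      by (simp add: c e inner_add_left mult.assoc[symmetric] p) (simp add: algebra_simps)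
  qed
  then show "dyadic_cube k x \<subseteq> cbox c (c + e)" by (auto simp: mem_box)
qed

lemma dyadic_cube_borel [measurable]: "dyadic_cube k x \<in> sets borel"
proof -
  have "dyadic_cube k x = (\<Inter>b\<in>Basis. {y \<in> space borel. \<lfloor>2 powi k * (y \<bullet> b)\<rfloor> = \<lfloor>2 powi k * (x \<bullet> b)\<rfloor>})"
    by (auto simp: dyadic_cube_def)
  also have "\<dots> \<in> sets borel"
    by (intro sets.finite_INT) auto
  finally show ?thesis .
qed

lemma emeasure_dyadic_cube:
  fixes x :: "'a::euclidean_space"
  shows "emeasure lborel (dyadic_cube k x) = ennreal ((2 powi (-k)) ^ DIM('a))"
proof -
  define c where "c = (\<Sum>b\<in>Basis. (of_int \<lfloor>2 powi k * (x \<bullet> b)\<rfloor> * 2 powi (-k)) *\<^sub>R b)"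
  define e :: 'a where "e = (\<Sum>b\<in>Basis. (2 powi (-k)) *\<^sub>R b)"
  have e: "b \<in> Basis \<Longrightarrow> e \<bullet> b = 2 powi (-k)" for b
    by (simp add: e_def inner_sum_left_Basis)
  have "emeasure lborel (box c (c + e)) = ennreal ((2 powi (-k)) ^ DIM('a))"
    by (subst emeasure_lborel_box) (auto simp: e inner_add_left)
  moreover have "emeasure lborel (cbox c (c + e)) = ennreal ((2 powi (-k)) ^ DIM('a))"
    by (subst emeasure_lborel_cbox) (auto simp: e inner_add_left)
  moreover have "emeasure lborel (box c (c + e)) \<le> emeasure lborel (dyadic_cube k x)"
    "emeasure lborel (dyadic_cube k x) \<le> emeasure lborel (cbox c (c + e))"
    using dyadic_cube_box[of k x] by (auto simp: c_def e_def intro!: emeasure_mono)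
  ultimately show ?thesis by auto
qed

lemma measure_dyadic_cube:
  fixes x :: "'a::euclidean_space"
  shows "measure lborel (dyadic_cube k x) = (2 powi (-k)) ^ DIM('a)"
  by (simp add: measure_def emeasure_dyadic_cube)

text \<open>The l^1 norm gives d 2^-k, with d the dimension; a sharper constant would bring no gain.
  This quantity is the radius attached to a cube throughout.\<close>

lemma dyadic_cube_dist:
  fixes x y :: "'a::euclidean_space"
  assumes "y \<in> dyadic_cube k x"
  shows "norm (y - x) \<le> real DIM('a) * 2 powi (-k)"
proof -
  have "norm (y - x) \<le> (\<Sum>b\<in>Basis. \<bar>(y - x) \<bullet> b\<bar>)" by (rule norm_le_l1)
  also have "\<dots> \<le> (\<Sum>b\<in>(Basis::'a set). 2 powi (-k))"
  proof (rule sum_mono)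
    fix b :: 'a assume b: "b \<in> Basis"
    have "\<lfloor>2 powi k * (y \<bullet> b)\<rfloor> = \<lfloor>2 powi k * (x \<bullet> b)\<rfloor>" using assms b by (auto simp: dyadic_cube_def)
    then have "\<bar>2 powi k * (y \<bullet> b) - 2 powi k * (x \<bullet> b)\<bar> \<le> 1" by linarith
    then have "2 powi k * \<bar>(y - x) \<bullet> b\<bar> \<le> 1"
      by (simp add: inner_diff_left algebra_simps abs_if split: if_splits)
    then show "\<bar>(y - x) \<bullet> b\<bar> \<le> 2 powi (-k)"
      by (simp add: power_int_minus field_simps)
  qed
  finally show ?thesis by simp
qed

lemma countable_dyadic_cubes: "countable (range (\<lambda>(k, x::'a::euclidean_space). dyadic_cube k x))"
proof -
  have "range (\<lambda>(k, x::'a). dyadic_cube k x) \<subseteq>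
    (\<lambda>(k, m). {y. \<forall>b\<in>Basis. \<lfloor>2 powi k * (y \<bullet> b)\<rfloor> = m b}) ` (UNIV \<times> (Basis \<rightarrow>\<^sub>E UNIV))"
  proof (clarsimp)
    fix k :: int and x :: 'a
    show "dyadic_cube k x \<in> (\<lambda>(k, m). {y. \<forall>b\<in>Basis. \<lfloor>2 powi k * (y \<bullet> b)\<rfloor> = m b}) ` (UNIV \<times> (Basis \<rightarrow>\<^sub>E UNIV))"
      by (rule image_eqI[where x="(k, restrict (\<lambda>b. \<lfloor>2 powi k * (x \<bullet> b)\<rfloor>) Basis)"])
         (auto simp: dyadic_cube_def)
  qed
  moreover have "countable ((UNIV::int set) \<times> ((Basis::'a set) \<rightarrow>\<^sub>E (UNIV::int set)))"
    by (intro countable_SIGMA countable_PiE) auto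
  ultimately show ?thesis by (meson countable_image countable_subset)
qed

text \<open>Every point at which \<open>P\<close> holds for some generation receives the largest
  such cube, which exists because \<open>k0\<close> bounds the generations from below. Two chosen
  cubes that meet are nested, and minimality of both generations makes them equal. The failure of
  \<open>P\<close> at k - 1 is what controls the parent cube.\<close>

lemma stopping_cubes:
  fixes P :: "int \<Rightarrow> 'a::euclidean_space \<Rightarrow> bool"
  assumes inv: "\<And>k x y. y \<in> dyadic_cube k x \<Longrightarrow> P k x \<Longrightarrow> P k y"
    and lb: "\<And>k x. P k x \<Longrightarrow> k0 \<le> k"
  shows "\<exists>\<Q>. countable \<Q> \<and> disjoint \<Q> \<and> \<Union>\<Q> = {x. \<exists>k. P k x} \<and>
    (\<forall>Q\<in>\<Q>. \<exists>k x. Q = dyadic_cube k x \<and> P k x \<and> \<not> P (k - 1) x)"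
proof -
  \<comment> \<open>The integers are not well-ordered, so the least generation is found as a natural
    number counted from \<open>k0\<close>.\<close>
  define kk where "kk x = k0 + int (LEAST n. P (k0 + int n) x)" for x
  have kk: "P (kk x) x" and least: "kk x \<le> k" if "P k x" for k x
  proof -
    have "P (k0 + int (nat (k - k0))) x" using lb[OF that] that by simp
    then show "P (kk x) x" unfolding kk_def by (rule LeastI)
    show "kk x \<le> k" using Least_le[of "\<lambda>n. P (k0 + int n) x", OF \<open>P (k0 + int (nat (k - k0))) x\<close>] lb[OF that]
      by (simp add: kk_def)
  qed
  define \<Q> where "\<Q> = {dyadic_cube (kk x) x | x. \<exists>k. P k x}"
  have c1: "countable \<Q>"
    by (rule countable_subset[OF _ countable_dyadic_cubes]) (auto simp: \<Q>_def)
  have c2: "disjoint \<Q>"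
  proof -
    \<comment> \<open>The larger cube is the one of x. It contains y, so \<open>P\<close> holds at y
      already at generation \<open>kk x\<close>, and minimality at y leaves no room for a strictly
      smaller cube.\<close>
    have eq: "dyadic_cube (kk x) x = dyadic_cube (kk y) y"
      if x: "P k x" and y: "P l y" and z: "z \<in> dyadic_cube (kk x) x" "z \<in> dyadic_cube (kk y) y"
        and le: "kk x \<le> kk y" for x y z k l
    proof -
      have "dyadic_cube (kk x) y = dyadic_cube (kk x) z"
        using dyadic_cube_nested[OF le, of y] z(2) dyadic_cube_eq by blast
      then have *: "dyadic_cube (kk x) y = dyadic_cube (kk x) x"
        using dyadic_cube_eq[OF z(1)] by simp
      then have "P (kk x) y" using inv[of y "kk x" x] kk[OF x] by (metis dyadic_cube_self)
      then have "kk y \<le> kk x" by (rule least)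
      then show ?thesis using le * by simp
    qed
    show ?thesis
    proof (rule disjointI)
      fix a b assume "a \<in> \<Q>" "b \<in> \<Q>" and ne: "a \<noteq> b"
      then obtain x y k l where xy: "a = dyadic_cube (kk x) x" "P k x" "b = dyadic_cube (kk y) y" "P l y"
        by (auto simp: \<Q>_def)
      show "a \<inter> b = {}"
      proof (rule ccontr)
        assume "a \<inter> b \<noteq> {}"
        then obtain z where "z \<in> a" "z \<in> b" by auto
        then have "a = b" using eq[of k x l y z] eq[of l y k x z] xy
          by (cases "kk x \<le> kk y") auto
        with ne show False by simp
      qed
    qed
  qed
  have c3: "\<Union>\<Q> = {x. \<exists>k. P k x}"
  proof (intro set_eqI iffI)
    fix x assume "x \<in> \<Union>\<Q>"
    then obtain y k where "x \<in> dyadic_cube (kk y) y" "P k y" by (auto simp: \<Q>_def)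
    then show "x \<in> {x. \<exists>k. P k x}" using inv kk by blast
  next
    fix x assume "x \<in> {x. \<exists>k. P k x}"
    then have "dyadic_cube (kk x) x \<in> \<Q>" by (auto simp: \<Q>_def)
    then show "x \<in> \<Union>\<Q>" using dyadic_cube_self by blast
  qed
  have c4: "\<exists>k x. Q = dyadic_cube k x \<and> P k x \<and> \<not> P (k - 1) x" if Q: "Q \<in> \<Q>" for Q
  proof -
    obtain x k where "Q = dyadic_cube (kk x) x" "P k x" using Q by (auto simp: \<Q>_def)
    moreover have "\<not> P (kk x - 1) x" using least[of "kk x - 1" x] by auto
    ultimately show ?thesis using kk by blast
  qed
  show ?thesis by (intro exI[of _ \<Q>] conjI ballI c1 c2 c3 c4)
qed

text \<open>Countable additivity turns a comparison on each cube into a global one. The cubes must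
  cover S; of E only the portion inside them enters.\<close>

lemma emeasure_le_sum_disjoint:
  assumes \<Q>: "countable \<Q>" "disjoint \<Q>" "\<And>Q. Q \<in> \<Q> \<Longrightarrow> Q \<in> sets M"
    and S: "S \<in> sets M" "S \<subseteq> \<Union>\<Q>" and E: "E \<in> sets M"
    and le: "\<And>Q. Q \<in> \<Q> \<Longrightarrow> emeasure M (S \<inter> Q) \<le> c * emeasure M (E \<inter> Q)"
  shows "emeasure M S \<le> c * emeasure M E"
proof -
  have dj: "disjoint_family_on (\<lambda>Q. A \<inter> Q) \<Q>" for A
    using \<Q>(2) by (auto simp: disjoint_family_on_def disjoint_def)
  have "emeasure M S = emeasure M (\<Union>Q\<in>\<Q>. S \<inter> Q)"
    using S by (intro arg_cong[where f="emeasure M"]) auto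
  also have "\<dots> = (\<integral>\<^sup>+Q. emeasure M (S \<inter> Q) \<partial>count_space \<Q>)"
    using \<Q> S by (intro emeasure_UN_countable dj) auto
  also have "\<dots> \<le> (\<integral>\<^sup>+Q. c * emeasure M (E \<inter> Q) \<partial>count_space \<Q>)"
    by (intro nn_integral_mono le) auto
  also have "\<dots> = c * (\<integral>\<^sup>+Q. emeasure M (E \<inter> Q) \<partial>count_space \<Q>)"
    by (intro nn_integral_cmult) auto
  also have "(\<integral>\<^sup>+Q. emeasure M (E \<inter> Q) \<partial>count_space \<Q>) = emeasure M (\<Union>Q\<in>\<Q>. E \<inter> Q)"
    using \<Q> E by (intro emeasure_UN_countable[symmetric] dj) auto
  also have "c * emeasure M (\<Union>Q\<in>\<Q>. E \<inter> Q) \<le> c * emeasure M E"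
    using E by (intro mult_left_mono emeasure_mono) auto
  finally show ?thesis .
qed

text \<open>A cube whose volume is bounded cannot be arbitrarily large. This supplies the lower
  bound on generations that the stopping argument requires.\<close>

lemma powi_neg_le_imp_ge:
  assumes "(0::real) < h" "0 < d"
  obtains k0 :: int where "\<And>k. h * (2 powi (-k)) ^ d \<le> N \<Longrightarrow> k0 \<le> k"
proof -
  obtain n :: nat where n: "N / h < 2 ^ n" using real_arch_pow[of 2 "N / h"] by auto
  have "- int n \<le> k" if "h * (2 powi (-k)) ^ d \<le> N" for k
  proof (rule ccontr)
    assume "\<not> - int n \<le> k"
    then have k: "int n \<le> - k" by simp
    have "(2::real) ^ n = 2 powi (int n)" by simp
    also have "\<dots> \<le> 2 powi (-k)" using k by (intro power_int_increasing) auto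
    also have "\<dots> \<le> (2 powi (-k)) ^ d"
      using k assms(2) by (intro self_le_power) (auto intro: one_le_power_int)
    finally have "N / h < (2 powi (-k)) ^ d" using n by simp
    then have "N < h * (2 powi (-k)) ^ d" using assms by (simp add: field_simps)
    with that show False by simp
  qed
  then show ?thesis using that by blast
qed

text \<open>Only generations up to \<open>M\<close> are tested, and \<open>f\<close> is constant on
  the cubes of generation \<open>M\<close>. Hence every selected cube has volume at least that of
  generation \<open>M\<close> and there are finitely many; the good part \<open>u\<close> is again
  constant on generation \<open>M\<close>; and off the cubes its bound is read off the average over
  a cube of generation \<open>M\<close>, without a differentiation theorem. This stability is what
  permits the decomposition to be iterated.\<close>

lemma calderon_zygmund:
  fixes f :: "'a::euclidean_space \<Rightarrow> complex"
  assumes int: "integrable lborel f"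
    and step: "\<And>x y. y \<in> dyadic_cube M x \<Longrightarrow> f y = f x" and h: "h > 0"
  shows "\<exists>u \<Q>. finite \<Q> \<and> disjoint \<Q> \<and> (\<forall>Q\<in>\<Q>. \<exists>k x. Q = dyadic_cube k x) \<and>
    integrable lborel u \<and> (\<forall>x y. y \<in> dyadic_cube M x \<longrightarrow> u y = u x) \<and>
    (\<forall>x. norm (u x) \<le> 2 ^ DIM('a) * h) \<and>
    (LINT x|lborel. norm (u x)) \<le> (LINT x|lborel. norm (f x)) \<and>
    (\<forall>x. x \<notin> \<Union>\<Q> \<longrightarrow> f x = u x) \<and>
    (\<forall>Q\<in>\<Q>. (LINT x|lborel. indicator Q x * (f x - u x)) = 0) \<and>
    h * (\<Sum>Q\<in>\<Q>. measure lborel Q) \<le> (LINT x|lborel. norm (f x))"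
proof -
  have [measurable]: "f \<in> borel_measurable borel" using int by auto
  define N where "N = (LINT x|lborel. norm (f x))"
  define J where "J Q = (LINT x|lborel. indicator Q x * norm (f x))" for Q :: "'a set"
  have Jint: "integrable lborel (\<lambda>x. indicator Q x * norm (f x))" if [measurable]: "Q \<in> sets borel" for Q
    by (rule Bochner_Integration.integrable_bound[OF integrable_norm[OF int]]) (auto simp: indicator_def)
  have Jmono: "J Q \<le> J R" if "Q \<subseteq> R" "Q \<in> sets borel" "R \<in> sets borel" for Q R
    unfolding J_def using that by (intro integral_mono Jint) (auto simp: indicator_def)
  have JN: "J Q \<le> N" if "Q \<in> sets borel" for Q
    unfolding J_def N_def using that int by (intro integral_mono Jint) (auto simp: indicator_def)
  \<comment> \<open>The mean of |f| over the cube exceeds h, written without division.\<close>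
  define P where "P k x \<longleftrightarrow> k \<le> M \<and> h * (2 powi (-k)) ^ DIM('a) < J (dyadic_cube k x)" for k x
  obtain k0 where k0: "\<And>k. h * (2 powi (-k)) ^ DIM('a) \<le> N \<Longrightarrow> k0 \<le> k"
    using powi_neg_le_imp_ge[OF h, of "DIM('a)" N] by auto
  have inv: "P k y" if "y \<in> dyadic_cube k x" "P k x" for k x y
    using that by (simp add: P_def dyadic_cube_eq)
  have lb: "k0 \<le> k" if "P k x" for k x
    using that JN[of "dyadic_cube k x"] by (intro k0) (auto simp: P_def)
  have "\<exists>\<Q>. countable \<Q> \<and> disjoint \<Q> \<and> \<Union>\<Q> = {x. \<exists>k. P k x} \<and>
    (\<forall>Q\<in>\<Q>. \<exists>k x. Q = dyadic_cube k x \<and> P k x \<and> \<not> P (k - 1) x)"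
    by (rule stopping_cubes[of P k0]) (use inv lb in blast)+
  then obtain \<Q> where QQ: "countable \<Q> \<and> disjoint \<Q> \<and> \<Union>\<Q> = {x. \<exists>k. P k x} \<and>
    (\<forall>Q\<in>\<Q>. \<exists>k x. Q = dyadic_cube k x \<and> P k x \<and> \<not> P (k - 1) x)" by (rule exE)
  then have \<Q>: "countable \<Q>" "disjoint \<Q>" "\<Union>\<Q> = {x. \<exists>k. P k x}" by simp_all
  have \<Q>4: "\<exists>k x. Q = dyadic_cube k x \<and> P k x \<and> \<not> P (k - 1) x" if "Q \<in> \<Q>" for Q
    using QQ that by (elim conjE bspec)
  have meas: "Q \<in> sets borel" if "Q \<in> \<Q>" for Q using \<Q>4[OF that] by auto
  have vol: "h * measure lborel Q < J Q" "J Q \<le> h * 2 ^ DIM('a) * measure lborel Q"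
    "(2 powi (-M)) ^ DIM('a) \<le> measure lborel Q" if Q: "Q \<in> \<Q>" for Q
  proof -
    obtain k x where kx: "Q = dyadic_cube k x" "P k x" "\<not> P (k - 1) x" using \<Q>4[OF Q] by auto
    have km: "k \<le> M" using kx by (auto simp: P_def)
    show "h * measure lborel Q < J Q" using kx by (simp add: P_def measure_dyadic_cube)
    show "(2 powi (-M)) ^ DIM('a) \<le> measure lborel Q"
      using km unfolding kx(1) measure_dyadic_cube
      by (intro power_mono power_int_increasing) auto
    \<comment> \<open>The parent also has generation at most \<open>M\<close>, so its failure to be
      selected means that its mean is at most h. Passing from parent to child costs the factor
      2^d.\<close>
    have "J Q \<le> J (dyadic_cube (k - 1) x)"
      unfolding kx by (intro Jmono dyadic_cube_nested) auto
    also have "\<dots> \<le> h * (2 powi (-(k-1))) ^ DIM('a)"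
      using kx(3) km by (simp add: P_def)
    also have "(2::real) powi (-(k-1)) = 2 * 2 powi (-k)"
      by (simp add: power_int_diff power_int_minus field_simps)
    also have "h * (2 * 2 powi (-k)) ^ DIM('a) = h * 2 ^ DIM('a) * measure lborel Q"
      by (simp add: kx(1) measure_dyadic_cube power_mult_distrib)
    finally show "J Q \<le> h * 2 ^ DIM('a) * measure lborel Q" .
  qed
  have sumJ: "(\<Sum>Q\<in>\<R>. J Q) \<le> N" if \<R>: "finite \<R>" "\<R> \<subseteq> \<Q>" for \<R>
  proof -
    have "(\<Sum>Q\<in>\<R>. J Q) = (LINT x|lborel. (\<Sum>Q\<in>\<R>. indicator Q x * norm (f x)))"
      unfolding J_def using \<R> meas by (intro Bochner_Integration.integral_sum[symmetric] Jint) auto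
    also have "\<dots> \<le> N" unfolding N_def
    proof (rule integral_mono)
      show "integrable lborel (\<lambda>x. \<Sum>Q\<in>\<R>. indicator Q x * norm (f x))"
        using \<R> meas by (intro Bochner_Integration.integrable_sum Jint) auto
      show "integrable lborel (\<lambda>x. norm (f x))" using int by auto
      fix x
      have "(\<Sum>Q\<in>\<R>. indicator Q x :: real) \<le> 1"
      proof (cases "x \<in> \<Union>\<R>")
        case True
        then obtain Q where Q: "Q \<in> \<R>" "x \<in> Q" by auto
        have "(\<Sum>R\<in>\<R>. indicator R x :: real) = (\<Sum>R\<in>{Q}. indicator R x)"
          using Q \<R> \<Q>(2) by (intro sum.mono_neutral_right) (auto simp: indicator_def disjoint_def)
        then show ?thesis using Q by simp
      next
        case False then show ?thesis by (auto simp: indicator_def intro!: sum_nonpos)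
      qed
      then show "(\<Sum>Q\<in>\<R>. indicator Q x * norm (f x)) \<le> norm (f x)"
        by (simp add: sum_distrib_right[symmetric] mult_left_le_one_le sum_nonneg)
    qed
    finally show ?thesis .
  qed
  have fin: "finite \<Q>"
  proof -
    \<comment> \<open>The least possible contribution of a selected cube to the total mass N; thus
      at most N / v cubes can be selected.\<close>
    define v where "v = h * (2 powi (-M)) ^ DIM('a)"
    have v: "v > 0" using h by (simp add: v_def)
    have "card \<R> \<le> nat \<lceil>N / v\<rceil>" if \<R>: "finite \<R>" "\<R> \<subseteq> \<Q>" for \<R>
    proof -
      have "real (card \<R>) * v = (\<Sum>Q\<in>\<R>. v)" by simp
      also have "\<dots> \<le> (\<Sum>Q\<in>\<R>. J Q)"
      proof (rule sum_mono)
        fix Q assume "Q \<in> \<R>"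
        then have Q: "Q \<in> \<Q>" using \<R> by auto
        have "v \<le> h * measure lborel Q" using vol(3)[OF Q] h by (simp add: v_def)
        with vol(1)[OF Q] show "v \<le> J Q" by simp
      qed
      also have "\<dots> \<le> N" by (rule sumJ[OF \<R>])
      finally have "real (card \<R>) \<le> N / v" using v by (simp add: field_simps)
      then show ?thesis by linarith
    qed
    then show ?thesis using finite_if_finite_subsets_card_bdd[of \<Q>] by blast
  qed
  define av where "av Q = (LINT x|lborel. indicator Q x * f x) / measure lborel Q" for Q
  have pos: "measure lborel Q > 0" if "Q \<in> \<Q>" for Q
    using vol(3)[OF that] by (smt (verit) zero_less_power zero_less_power_int)
  have emq: "emeasure lborel Q < \<infinity>" if "Q \<in> \<Q>" for Q
    using \<Q>4[OF that] by (auto simp: emeasure_dyadic_cube)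
  have fint: "integrable lborel (\<lambda>x. indicator Q x * f x)" if [measurable]: "Q \<in> sets borel" for Q
    by (rule Bochner_Integration.integrable_bound[OF integrable_norm[OF int]]) (auto simp: indicator_def)
  have cint: "integrable lborel (\<lambda>x. indicator Q x * c)" if "Q \<in> \<Q>" for Q and c :: complex
    using meas[OF that] emq[OF that]
    by (intro integrableI_bounded_set[where A=Q and B="norm c"]) (auto simp: indicator_def)
  have cval: "(LINT x|lborel. indicator Q x * c) = of_real (measure lborel Q) * c" if "Q \<in> \<Q>" for Q and c :: complex
  proof -
    have "(LINT x|lborel. indicator Q x * c) = (LINT x|lborel. indicat_real Q x *\<^sub>R c)"
      by (intro Bochner_Integration.integral_cong) (auto simp: indicator_def)
    also have "\<dots> = measure lborel Q *\<^sub>R c"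
      using meas[OF that] emq[OF that] by (subst integral_scaleR_left) (auto simp: less_top)
    finally show ?thesis by (simp add: scaleR_conv_of_real)
  qed
  have av_le: "norm (av Q) * measure lborel Q \<le> J Q" if Q: "Q \<in> \<Q>" for Q
  proof -
    have "norm (av Q) * measure lborel Q = norm (LINT x|lborel. indicator Q x * f x)"
      using pos[OF Q] by (simp add: av_def norm_divide)
    also have "\<dots> \<le> (LINT x|lborel. norm (indicator Q x * f x))" by (rule integral_norm_bound)
    also have "\<dots> = J Q" unfolding J_def by (intro Bochner_Integration.integral_cong) (auto simp: indicator_def)
    finally show ?thesis .
  qed
  define u where "u x = f x - (\<Sum>Q\<in>\<Q>. indicator Q x * (f x - av Q))" for x
  have sum1: "(\<Sum>R\<in>\<Q>. indicator R x * \<phi> R) = \<phi> Q" if "Q \<in> \<Q>" "x \<in> Q" for Q x and \<phi> :: "'a set \<Rightarrow> 'b::comm_ring_1"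
  proof -
    have "(\<Sum>R\<in>\<Q>. indicator R x * \<phi> R) = (\<Sum>R\<in>{Q}. indicator R x * \<phi> R)"
      using that fin \<Q>(2) by (intro sum.mono_neutral_right) (auto simp: indicator_def disjoint_def)
    then show ?thesis using that by (simp add: indicator_def)
  qed
  have sum0: "(\<Sum>R\<in>\<Q>. indicator R x * \<phi> R) = 0" if "x \<notin> \<Union>\<Q>" for x and \<phi> :: "'a set \<Rightarrow> 'b::comm_ring_1"
    using that by (intro sum.neutral) (auto simp: indicator_def)
  have uQ: "u x = av Q" if "Q \<in> \<Q>" "x \<in> Q" for Q x
    by (simp add: u_def sum1[OF that])
  have u0: "u x = f x" if "x \<notin> \<Union>\<Q>" for x
    by (simp add: u_def sum0[OF that])
  have uint: "integrable lborel u"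
    unfolding u_def[abs_def] right_diff_distrib
    using int meas by (intro Bochner_Integration.integrable_diff Bochner_Integration.integrable_sum fint cint) auto
  have c1: "u y = u x" if "y \<in> dyadic_cube M x" for x y
  proof -
    \<comment> \<open>A selected cube has generation at most \<open>M\<close>, hence it is a union
      of cubes of generation \<open>M\<close> and cannot separate x from y.\<close>
    have "y \<in> Q \<longleftrightarrow> x \<in> Q" if Q: "Q \<in> \<Q>" for Q
    proof -
      obtain k w where kw: "Q = dyadic_cube k w" "k \<le> M" using \<Q>4[OF Q] by (auto simp: P_def)
      have "dyadic_cube k y = dyadic_cube k x"
        using dyadic_cube_nested[OF kw(2), of x] \<open>y \<in> dyadic_cube M x\<close> by (intro dyadic_cube_eq) auto
      then show ?thesis unfolding kw by (metis dyadic_cube_sym)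
    qed
    then have "(\<Sum>Q\<in>\<Q>. indicator Q y * (f y - av Q)) = (\<Sum>Q\<in>\<Q>. indicator Q x * (f x - av Q))"
      using step[OF that] by (intro sum.cong) (auto simp: indicator_def)
    then show ?thesis using step[OF that] by (simp add: u_def)
  qed
  have c2: "norm (u x) \<le> 2 ^ DIM('a) * h" for x
  proof (cases "x \<in> \<Union>\<Q>")
    case True
    then obtain Q where Q: "Q \<in> \<Q>" "x \<in> Q" by auto
    have "norm (av Q) * measure lborel Q \<le> h * 2 ^ DIM('a) * measure lborel Q"
      using av_le[OF Q(1)] vol(2)[OF Q(1)] by simp
    then show ?thesis using pos[OF Q(1)] uQ[OF Q] by (simp add: mult.commute)
  next
    case False
    \<comment> \<open>No generation is selected at x, in particular not \<open>M\<close>. There the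
      mean of |f| is the value |f x| itself.\<close>
    then have "\<not> P M x" using \<Q>(3) by auto
    then have "J (dyadic_cube M x) \<le> h * (2 powi (-M)) ^ DIM('a)" by (simp add: P_def)
    moreover have "J (dyadic_cube M x) = (LINT y|lborel. indicator (dyadic_cube M x) y * norm (f x))"
      unfolding J_def
    proof (intro Bochner_Integration.integral_cong refl)
      fix y show "indicator (dyadic_cube M x) y * norm (f y) = indicator (dyadic_cube M x) y * norm (f x)"
        by (cases "y \<in> dyadic_cube M x") (simp_all only: step indicator_simps mult_zero_left not_False_eq_True)
    qed
    then have "J (dyadic_cube M x) = (2 powi (-M)) ^ DIM('a) * norm (f x)"
      by (simp add: measure_dyadic_cube)
    ultimately have "norm (f x) \<le> h" by (simp add: mult.commute)
    also have "h \<le> 2 ^ DIM('a) * h" using h by simp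
    finally show ?thesis using u0[OF False] by simp
  qed
  have c3: "(LINT x|lborel. norm (u x)) \<le> (LINT x|lborel. norm (f x))"
  proof -
    have eq: "norm (u x) = norm (f x) - (\<Sum>Q\<in>\<Q>. indicator Q x * (norm (f x) - norm (av Q)))" for x
      by (cases "x \<in> \<Union>\<Q>") (auto simp: uQ sum1 u0 sum0)
    have c': "integrable lborel (\<lambda>x. indicator Q x * norm (av Q))" if "Q \<in> \<Q>" for Q
      using meas[OF that] emq[OF that] by (intro integrable_mult_left integrable_real_indicator) (auto simp: less_top)
    have c'val: "(LINT x|lborel. indicator Q x * norm (av Q)) = measure lborel Q * norm (av Q)" for Q
      by simp
    have dint: "integrable lborel (\<lambda>x. indicator Q x * (norm (f x) - norm (av Q)))" if "Q \<in> \<Q>" for Q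
      unfolding right_diff_distrib using meas[OF that] that by (intro Bochner_Integration.integrable_diff Jint c')
    have dval: "(LINT x|lborel. indicator Q x * (norm (f x) - norm (av Q))) = J Q - measure lborel Q * norm (av Q)" if "Q \<in> \<Q>" for Q
      unfolding right_diff_distrib J_def c'val[symmetric] using meas[OF that] that
      by (intro Bochner_Integration.integral_diff Jint c')
    have "(LINT x|lborel. norm (u x)) = N - (LINT x|lborel. (\<Sum>Q\<in>\<Q>. indicator Q x * (norm (f x) - norm (av Q))))"
      unfolding eq N_def using int
      by (intro Bochner_Integration.integral_diff Bochner_Integration.integrable_sum dint integrable_norm)
    also have "\<dots> = N - (\<Sum>Q\<in>\<Q>. J Q - measure lborel Q * norm (av Q))"
      by (simp add: Bochner_Integration.integral_sum dint dval)
    also have "\<dots> \<le> N" using av_le by (simp add: sum_nonneg mult.commute)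
    finally show ?thesis by (simp add: N_def)
  qed
  have c4: "f x = u x" if "x \<notin> \<Union>\<Q>" for x using u0[OF that] by simp
  have c5: "(LINT x|lborel. indicator Q x * (f x - u x)) = 0" if Q: "Q \<in> \<Q>" for Q
  proof -
    have "(LINT x|lborel. indicator Q x * (f x - u x)) = (LINT x|lborel. indicator Q x * f x - indicator Q x * av Q)"
      using uQ[OF Q] by (intro Bochner_Integration.integral_cong) (auto simp: indicator_def)
    also have "\<dots> = (LINT x|lborel. indicator Q x * f x) - measure lborel Q * av Q"
      unfolding cval[OF Q, symmetric] using meas[OF Q] Q by (intro Bochner_Integration.integral_diff fint cint)
    also have "\<dots> = 0" using pos[OF Q] by (simp add: av_def)
    finally show ?thesis .
  qed
  have c6: "h * (\<Sum>Q\<in>\<Q>. measure lborel Q) \<le> (LINT x|lborel. norm (f x))"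
  proof -
    have "h * (\<Sum>Q\<in>\<Q>. measure lborel Q) \<le> (\<Sum>Q\<in>\<Q>. J Q)"
      unfolding sum_distrib_left using vol(1) by (intro sum_mono) (auto intro: less_imp_le)
    with sumJ[OF fin] show ?thesis by (simp add: N_def)
  qed
  have c7: "\<exists>k x. Q = dyadic_cube k x" if "Q \<in> \<Q>" for Q using \<Q>4[OF that] by auto
  show ?thesis
    by (intro exI[of _ u] exI[of _ \<Q>] conjI allI ballI impI fin \<Q>(2) uint c2 c3 c6)
      (rule c1 c4 c5 c7, assumption)+
qed

section \<open>Oscillation sums and the bad part\<close>

lemma sum_powi_upper:
  fixes G :: "int set"
  assumes "finite G" "\<And>i. i \<in> G \<Longrightarrow> a \<le> i"
  shows "(\<Sum>i\<in>G. 2 powi (a - i)) \<le> (2::real)"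
proof -
  have "(\<Sum>i\<in>G. (2::real) powi (a - i)) = (\<Sum>i\<in>G. (1/2) ^ nat (i - a))"
  proof (rule sum.cong)
    fix i assume "i \<in> G"
    then have "a - i = - int (nat (i - a))" using assms(2) by auto
    then have "(2::real) powi (a - i) = 2 powi (- int (nat (i - a)))" by (simp only:)
    also have "\<dots> = (1/2) ^ nat (i - a)"
      by (simp only: power_int_minus power_int_of_nat power_one_over inverse_eq_divide)
    finally show "(2::real) powi (a - i) = (1/2) ^ nat (i - a)" .
  qed simp
  also have "\<dots> = (\<Sum>n\<in>(\<lambda>i. nat (i - a)) ` G. (1/2) ^ n)"
    using assms(2) by (subst sum.reindex) (auto simp: inj_on_def dest!: assms(2))
  also have "\<dots> \<le> (\<Sum>n. (1/2::real) ^ n)"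
    using assms(1) by (intro sum_le_suminf summable_geometric) auto
  also have "\<dots> = 2" by (simp add: suminf_geometric)
  finally show ?thesis .
qed

lemma sum_powi_lower:
  fixes G :: "int set"
  assumes "finite G" "\<And>i. i \<in> G \<Longrightarrow> i \<le> a"
  shows "(\<Sum>i\<in>G. 2 powi (i - a)) \<le> (2::real)"
proof -
  have "(\<Sum>i\<in>G. 2 powi (i - a)) = (\<Sum>i\<in>uminus ` G. 2 powi ((- a) - i) :: real)"
    by (subst sum.reindex) (auto simp: inj_on_def)
  also have "\<dots> \<le> 2" using assms by (intro sum_powi_upper) auto
  finally show ?thesis .
qed

text \<open>Let 2^m be about 1/r. For i < m - \<mu> the smoothness term decays geometrically and
  sums to at most 2; for i > m the moment term does the same; the \<mu> + 1 scales in between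
  contribute at most 1 each. The result does not depend on r or on the size of
  \<open>F\<close>.\<close>

lemma dyadic_sum_bound:
  fixes F :: "int set" and r :: real
  assumes "finite F" "r > 0" "\<mu> \<ge> 0"
  shows "(\<Sum>i\<in>F. min 1 (min (2 powi (\<mu> + i) * r) (1 / (2 powi i * r)))) \<le> real_of_int \<mu> + 5"
proof -
  \<comment> \<open>Chosen so that 2^m r \<le> 1 < 2^(m+1) r.\<close>
  define m where "m = \<lfloor>log 2 (1 / r)\<rfloor>"
  have "2 powr (of_int m) \<le> 2 powr (log 2 (1/r))" "2 powr (log 2 (1/r)) < 2 powr (of_int (m + 1))"
    unfolding m_def by (intro powr_mono powr_less_mono; linarith)+
  then have "2 powr (of_int m) \<le> 1 / r" "1 / r < 2 powr (of_int (m+1))" using assms(2) by (auto simp: powr_log_cancel)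
  then have m: "2 powi m * r \<le> 1" "1 < 2 powi (m + 1) * r"
    using assms(2) powr_real_of_int'[of 2 m] powr_real_of_int'[of 2 "m + 1"] by (auto simp: field_simps)
  let ?t = "\<lambda>i. min 1 (min (2 powi (\<mu> + i) * r) (1 / (2 powi i * r)))"
  define F1 where "F1 = {i \<in> F. i \<le> m - \<mu> - 1}"
  define F2 where "F2 = {i \<in> F. m - \<mu> \<le> i \<and> i \<le> m}"
  define F3 where "F3 = {i \<in> F. m + 1 \<le> i}"
  have F: "F = F1 \<union> (F2 \<union> F3)" using assms by (auto simp: F1_def F2_def F3_def)
  have fin: "finite F1" "finite F2" "finite F3" using assms by (auto simp: F1_def F2_def F3_def)
  have "(\<Sum>i\<in>F. ?t i) = (\<Sum>i\<in>F1. ?t i) + ((\<Sum>i\<in>F2. ?t i) + (\<Sum>i\<in>F3. ?t i))"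
    unfolding F using fin assms(3) by (subst sum.union_disjoint; auto simp: F1_def F2_def F3_def)+
  moreover have "(\<Sum>i\<in>F1. ?t i) \<le> 2"
  proof -
    have "(\<Sum>i\<in>F1. ?t i) \<le> (\<Sum>i\<in>F1. 2 powi (i - (m - \<mu> - 1)))"
    proof (rule sum_mono)
      fix i
      have "2 powi (\<mu> + i) * r = 2 powi (\<mu> + i - m) * (2 powi m * r)"
        by (simp add: power_int_diff)
      also have "\<dots> \<le> 2 powi (\<mu> + i - m) * 1" using m by (intro mult_left_mono) auto
      also have "\<dots> \<le> 2 powi (i - (m - \<mu> - 1))" by (simp add: power_int_increasing)
      finally show "?t i \<le> 2 powi (i - (m - \<mu> - 1))" by linarith
    qed
    also have "\<dots> \<le> 2" using fin by (intro sum_powi_lower) (auto simp: F1_def)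
    finally show ?thesis .
  qed
  moreover have "(\<Sum>i\<in>F2. ?t i) \<le> real_of_int \<mu> + 1"
  proof -
    have "(\<Sum>i\<in>F2. ?t i) \<le> (\<Sum>i\<in>F2. 1)" by (rule sum_mono) auto
    also have "\<dots> = real (card F2)" by simp
    also have "\<dots> \<le> real (card {m - \<mu>..m})"
      by (intro of_nat_mono card_mono) (auto simp: F2_def)
    also have "\<dots> = real_of_int \<mu> + 1" using assms by simp
    finally show ?thesis .
  qed
  moreover have "(\<Sum>i\<in>F3. ?t i) \<le> 2"
  proof -
    have "(\<Sum>i\<in>F3. ?t i) \<le> (\<Sum>i\<in>F3. 2 powi ((m + 1) - i))"
    proof (rule sum_mono)
      fix i
      have "1 / (2 powi i * r) = 2 powi (m + 1 - i) / (2 powi (m + 1) * r)"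
        by (simp add: power_int_diff)
      also have "\<dots> \<le> 2 powi (m + 1 - i)"
        using m zero_less_power_int[of "2::real" "m + 1 - i"] by (simp add: divide_le_eq mult_le_cancel_left1 del: zero_less_power_int)
      finally show "?t i \<le> 2 powi ((m + 1) - i)" by linarith
    qed
    also have "\<dots> \<le> 2" using fin by (intro sum_powi_upper) (auto simp: F3_def)
    finally show ?thesis .
  qed
  ultimately show ?thesis by linarith
qed

lemma integrable_lborel_reflect:
  fixes f :: "'a::euclidean_space \<Rightarrow> complex"
  assumes "integrable lborel f"
  shows "integrable lborel (\<lambda>x. f (a - x))"
proof -
  have [measurable]: "f \<in> borel_measurable borel" using assms by auto
  have "integrable (distr lborel borel (\<lambda>x. a - x)) f" using assms by (simp add: lborel_distr_reflect)
  then show ?thesis by (subst (asm) integrable_distr_eq) auto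
qed

lemma integrable_tensor:
  fixes u :: "'a::euclidean_space \<Rightarrow> complex" and v :: "'b::euclidean_space \<Rightarrow> complex"
  assumes u: "integrable lborel u" and v: "integrable lborel v"
  shows "integrable lborel (\<lambda>z. u (fst z) * v (snd z))"
    and "(LINT z|lborel. u (fst z) * v (snd z)) = (LINT x|lborel. u x) * (LINT y|lborel. v y)"
proof -
  have [measurable]: "u \<in> borel_measurable borel" "v \<in> borel_measurable borel" using u v by auto
  have "(\<integral>\<^sup>+z. ennreal (norm (u (fst z) * v (snd z))) \<partial>lborel) = (\<integral>\<^sup>+x. \<integral>\<^sup>+y. ennreal (norm (u x)) * ennreal (norm (v y)) \<partial>lborel \<partial>lborel)"
    by (subst nn_integral_lborel_prod_fst) (auto simp: norm_mult ennreal_mult')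
  also have "\<dots> = (\<integral>\<^sup>+x. ennreal (norm (u x)) * (\<integral>\<^sup>+y. ennreal (norm (v y)) \<partial>lborel) \<partial>lborel)"
    by (intro nn_integral_cong nn_integral_cmult) auto
  also have "\<dots> = (\<integral>\<^sup>+x. ennreal (norm (u x)) \<partial>lborel) * (\<integral>\<^sup>+y. ennreal (norm (v y)) \<partial>lborel)"
    by (rule nn_integral_multc) auto
  also have "\<dots> < \<infinity>" using u v by (simp add: integrable_iff_bounded ennreal_mult_less_top)
  finally show i: "integrable lborel (\<lambda>z. u (fst z) * v (snd z))"
    by (intro integrableI_bounded) auto
  have "integrable (lborel \<Otimes>\<^sub>M lborel) (\<lambda>z. u (fst z) * v (snd z))"
    using i by (simp only: lborel_prod)
  from lborel_pair.integral_fst'[OF this]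
  show "(LINT z|lborel. u (fst z) * v (snd z)) = (LINT x|lborel. u x) * (LINT y|lborel. v y)"
    by (simp add: lborel_prod)
qed

text \<open>A truncated kernel: the piece \<open>k i\<close> has size 2^-i and is smooth at the
  finer scale 2^-(\<mu>+i), with bounds \<open>A\<close> uniform in i. The constant \<open>B\<close>
  belongs to the finite sum over \<open>F\<close> and replaces an L^2 bound. The set E in
  \<open>local\<close> is common to both inputs, which is what a cut to one ball produces. Strict
  positivity of \<open>B\<close> keeps the later denominator 32BU + 2H away from 0.\<close>

locale bilinear_kernel =
  fixes k :: "int \<Rightarrow> 'a::euclidean_space \<times> 'a \<Rightarrow> complex" and F :: "int set" and A B :: real and \<mu> :: int
  assumes finite_F: "finite F" and A_nonneg: "0 \<le> A" and B_pos: "0 < B" and mu_nonneg: "0 \<le> \<mu>"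
    and meas [measurable]: "\<And>i. k i \<in> borel_measurable borel"
    and mass: "\<And>i. (\<integral>\<^sup>+y. ennreal (norm (k i y)) \<partial>lborel) \<le> ennreal A"
    and moment: "\<And>i. (\<integral>\<^sup>+y. ennreal (norm y * norm (k i y)) \<partial>lborel) \<le> ennreal (A * 2 powi (-i))"
    and smooth: "\<And>i v. (\<integral>\<^sup>+y. ennreal (norm (k i (y + v) - k i y)) \<partial>lborel) \<le> ennreal (A * 2 powi (\<mu> + i) * norm v)"
    and local: "\<And>E f g. E \<in> sets borel \<Longrightarrow> bounded E \<Longrightarrow> f \<in> borel_measurable borel \<Longrightarrow> g \<in> borel_measurable borel \<Longrightarrow>
      (\<And>x. norm (f x) \<le> indicator E x) \<Longrightarrow> (\<And>x. norm (g x) \<le> indicator E x) \<Longrightarrow>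
      (\<integral>\<^sup>+x. ennreal (norm (bil (\<lambda>y. \<Sum>i\<in>F. k i y) f g x)) \<partial>lborel) \<le> ennreal B * emeasure lborel E"
begin

definition K :: "'a \<times> 'a \<Rightarrow> complex" where "K y = (\<Sum>i\<in>F. k i y)"

text \<open>The bound for oscillation sums: the number of effective scales times 2A, the 2
  accounting for the two terms of a difference and for shifts of length up to 2r.\<close>

definition H :: real where "H = 2 * A * (of_int \<mu> + 5)"

lemma H_nonneg: "0 \<le> H"
  using A_nonneg mu_nonneg by (simp add: H_def)

lemma K_borel [measurable]: "K \<in> borel_measurable borel"
  unfolding K_def[abs_def] by measurable

lemma k_integrable: "integrable lborel (k i)"
  using mass[of i] by (intro integrableI_bounded) (auto simp: less_top[symmetric] top_unique)

lemma K_integrable: "integrable lborel K"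
  unfolding K_def[abs_def] by (intro Bochner_Integration.integrable_sum k_integrable)

text \<open>Three competing bounds. The triangle inequality and \<open>mass\<close> give the
  constant one; \<open>smooth\<close> with |v| \<le> 2r gives the one for coarse scales; and since
  both y and y + v have norm at least r on \<open>D\<close>, a factor |y|/r or |y+v|/r can be
  inserted, so that \<open>moment\<close> gives the one for fine scales.\<close>

lemma oscillation_piece:
  assumes D [measurable]: "D \<in> sets borel" and r: "r > 0" and v: "norm v \<le> 2 * r"
    and far: "\<And>y. y \<in> D \<Longrightarrow> r \<le> norm y \<and> r \<le> norm (y + v)"
  shows "(\<integral>\<^sup>+y. indicator D y * ennreal (norm (k i (y + v) - k i y)) \<partial>lborel)
    \<le> ennreal (2 * A * min 1 (min (2 powi (\<mu> + i) * r) (1 / (2 powi i * r))))" (is "?I \<le> _")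
proof -
  have shift: "(\<integral>\<^sup>+y. ennreal (norm (y + v) * norm (k i (y + v))) \<partial>lborel) = (\<integral>\<^sup>+y. ennreal (norm y * norm (k i y)) \<partial>lborel)"
    "(\<integral>\<^sup>+y. ennreal (norm (k i (y + v))) \<partial>lborel) = (\<integral>\<^sup>+y. ennreal (norm (k i y)) \<partial>lborel)"
    using nn_integral_lborel_shift[of "\<lambda>y. ennreal (norm y * norm (k i y))" v]
      nn_integral_lborel_shift[of "\<lambda>y. ennreal (norm (k i y))" v] by simp_all
  have tri: "norm (k i (y + v) - k i y) \<le> norm (k i (y + v)) + norm (k i y)" for y
    by (rule norm_triangle_ineq4)
  have 1: "?I \<le> ennreal (2 * A)"
  proof -
    have "?I \<le> (\<integral>\<^sup>+y. ennreal (norm (k i (y + v))) + ennreal (norm (k i y)) \<partial>lborel)"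
      using tri by (intro nn_integral_mono) (auto simp: indicator_def ennreal_plus[symmetric] simp del: ennreal_plus)
    also have "\<dots> = (\<integral>\<^sup>+y. ennreal (norm (k i y)) \<partial>lborel) + (\<integral>\<^sup>+y. ennreal (norm (k i y)) \<partial>lborel)"
      by (subst nn_integral_add) (auto simp: shift)
    also have "\<dots> \<le> ennreal A + ennreal A" by (intro add_mono mass)
    also have "\<dots> = ennreal (2 * A)" using A_nonneg by (simp add: ennreal_plus[symmetric] del: ennreal_plus)
    finally show ?thesis .
  qed
  have 2: "?I \<le> ennreal (2 * A * (2 powi (\<mu> + i) * r))"
  proof -
    have "?I \<le> (\<integral>\<^sup>+y. ennreal (norm (k i (y + v) - k i y)) \<partial>lborel)"
      by (intro nn_integral_mono) (auto simp: indicator_def)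
    also have "\<dots> \<le> ennreal (A * 2 powi (\<mu> + i) * norm v)" by (rule smooth)
    also have "\<dots> \<le> ennreal (A * 2 powi (\<mu> + i) * (2 * r))"
      using v A_nonneg by (intro ennreal_leI mult_left_mono) auto
    finally show ?thesis by (simp add: mult_ac)
  qed
  have 3: "?I \<le> ennreal (2 * A * (1 / (2 powi i * r)))"
  proof -
    have pt: "indicator D y * ennreal (norm (k i (y + v) - k i y)) \<le>
      ennreal (1 / r) * (ennreal (norm (y + v) * norm (k i (y + v))) + ennreal (norm y * norm (k i y)))" for y
    proof (cases "y \<in> D")
      case True
      have "r * norm (k i (y + v) - k i y) \<le> r * norm (k i (y + v)) + r * norm (k i y)"
        using tri[of y] r by (metis distrib_left less_imp_le mult_left_mono)
      also have "\<dots> \<le> norm (y + v) * norm (k i (y + v)) + norm y * norm (k i y)"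
        using far[OF True] by (intro add_mono mult_right_mono) auto
      finally have "norm (k i (y + v) - k i y) \<le> 1 / r * (norm (y + v) * norm (k i (y + v)) + norm y * norm (k i y))"
        using r by (simp add: field_simps)
      then show ?thesis using True r
        by (simp add: ennreal_plus[symmetric] ennreal_mult'[symmetric] del: ennreal_plus)
    qed simp
    have "?I \<le> (\<integral>\<^sup>+y. ennreal (1 / r) * (ennreal (norm (y + v) * norm (k i (y + v))) + ennreal (norm y * norm (k i y))) \<partial>lborel)"
      by (intro nn_integral_mono pt)
    also have "\<dots> = ennreal (1 / r) * ((\<integral>\<^sup>+y. ennreal (norm y * norm (k i y)) \<partial>lborel) + (\<integral>\<^sup>+y. ennreal (norm y * norm (k i y)) \<partial>lborel))"
      by (subst nn_integral_cmult, measurable, subst nn_integral_add) (auto simp: shift)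
    also have "\<dots> \<le> ennreal (1 / r) * (ennreal (A * 2 powi (-i)) + ennreal (A * 2 powi (-i)))"
      by (intro mult_left_mono add_mono moment) auto
    also have "\<dots> = ennreal (2 * A * (1 / (2 powi i * r)))"
      using A_nonneg r
      by (simp add: ennreal_plus[symmetric] ennreal_mult'[symmetric] power_int_minus field_simps del: ennreal_plus)
    finally show ?thesis .
  qed
  show ?thesis using 1 2 3 by (auto simp: min_def)
qed

text \<open>The bound is the same for every r: rescaling r only moves the window of relevant scales
  in \<open>dyadic_sum_bound\<close>.\<close>

lemma oscillation:
  assumes D [measurable]: "D \<in> sets borel" and r: "r > 0" and v: "norm v \<le> 2 * r"
    and far: "\<And>y. y \<in> D \<Longrightarrow> r \<le> norm y \<and> r \<le> norm (y + v)"
  shows "(\<integral>\<^sup>+y. indicator D y * ennreal (norm (K (y + v) - K y)) \<partial>lborel) \<le> ennreal H"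
proof -
  let ?m = "\<lambda>i. min 1 (min (2 powi (\<mu> + i) * r) (1 / (2 powi i * r)))"
  have m0: "0 \<le> ?m i" for i using r by auto
  have "(\<integral>\<^sup>+y. indicator D y * ennreal (norm (K (y + v) - K y)) \<partial>lborel)
    \<le> (\<integral>\<^sup>+y. (\<Sum>i\<in>F. indicator D y * ennreal (norm (k i (y + v) - k i y))) \<partial>lborel)"
  proof (rule nn_integral_mono)
    fix y
    have "norm (K (y + v) - K y) \<le> (\<Sum>i\<in>F. norm (k i (y + v) - k i y))"
      unfolding K_def sum_subtractf[symmetric] by (rule norm_sum)
    then show "indicator D y * ennreal (norm (K (y + v) - K y)) \<le> (\<Sum>i\<in>F. indicator D y * ennreal (norm (k i (y + v) - k i y)))"
      by (auto simp: indicator_def sum_ennreal ennreal_leI)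
  qed
  also have "\<dots> = (\<Sum>i\<in>F. \<integral>\<^sup>+y. indicator D y * ennreal (norm (k i (y + v) - k i y)) \<partial>lborel)"
    by (intro nn_integral_sum) auto
  also have "\<dots> \<le> (\<Sum>i\<in>F. ennreal (2 * A * ?m i))"
    by (intro sum_mono oscillation_piece assms)
  also have "\<dots> = ennreal (2 * A * (\<Sum>i\<in>F. ?m i))"
    using m0 A_nonneg by (subst sum_ennreal) (auto simp: sum_distrib_left)
  also have "\<dots> \<le> ennreal H"
    unfolding H_def using A_nonneg dyadic_sum_bound[OF finite_F r mu_nonneg] by (intro ennreal_leI mult_left_mono) auto
  finally show ?thesis .
qed

text \<open>A Hormander condition with the second kernel variable integrated out, as befits a second
  input that is merely bounded. Only the first variable is displaced, so the shift is (c - z, 0), of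
  norm at most r, while the first coordinate stays at distance 2r.\<close>

lemma hormander:
  assumes r: "r > 0" and z: "norm (z - c) \<le> r"
  shows "(\<integral>\<^sup>+x. indicator {x. 2 * r \<le> norm (x - c)} x * (\<integral>\<^sup>+y. ennreal (norm (K (x - z, y) - K (x - c, y))) \<partial>lborel) \<partial>lborel)
    \<le> ennreal H"
proof -
  define D :: "('a \<times> 'a) set" where "D = {y. 2 * r \<le> norm (fst y)}"
  define v :: "'a \<times> 'a" where "v = (c - z, 0)"
  have [measurable]: "D \<in> sets borel" unfolding D_def by measurable
  have v: "norm v \<le> r" using z by (simp add: v_def norm_Pair norm_minus_commute)
  have "(\<integral>\<^sup>+x. indicator {x. 2 * r \<le> norm (x - c)} x * (\<integral>\<^sup>+y. ennreal (norm (K (x - z, y) - K (x - c, y))) \<partial>lborel) \<partial>lborel)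
    = (\<integral>\<^sup>+x. \<integral>\<^sup>+y. indicator D (x + (- c), y) * ennreal (norm (K ((x + (- c), y) + v) - K (x + (- c), y))) \<partial>lborel \<partial>lborel)"
    by (subst nn_integral_cmult[symmetric], measurable)
       (auto simp: D_def v_def indicator_def intro!: nn_integral_cong)
  also have "\<dots> = (\<integral>\<^sup>+x. \<integral>\<^sup>+y. indicator D (x, y) * ennreal (norm (K ((x, y) + v) - K (x, y))) \<partial>lborel \<partial>lborel)"
    by (rule nn_integral_lborel_shift[where f="\<lambda>x. \<integral>\<^sup>+y. indicator D (x, y) * ennreal (norm (K ((x, y) + v) - K (x, y))) \<partial>lborel"]) measurable
  also have "\<dots> = (\<integral>\<^sup>+y. indicator D y * ennreal (norm (K (y + v) - K y)) \<partial>lborel)"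
    by (rule nn_integral_lborel_prod_fst[symmetric]) measurable
  also have "\<dots> \<le> ennreal H"
  proof (rule oscillation)
    show "r > 0" "norm v \<le> 2 * r" using r v by auto
    fix y assume y: "y \<in> D"
    have "norm (fst y) \<le> norm y" using norm_fst_le[of "fst y" "snd y"] by simp
    then have "2 * r \<le> norm y" using y by (simp add: D_def)
    moreover have "norm y \<le> norm (y + v) + norm v" by (metis add_diff_cancel norm_triangle_ineq4)
    ultimately show "r \<le> norm y \<and> r \<le> norm (y + v)" using v r by linarith
  qed measurable
  finally show ?thesis .
qed

text \<open>Since \<open>b\<close> has integral zero, K (x - c, x - snd z) may be subtracted from
  the kernel: it does not see fst z, so its contribution factors into the integral of
  \<open>b\<close> times another integral. This factorisation needs an integrable slice K (x - c, y)
  in y, which Fubini provides for almost every x. What remains is the integral in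
  \<open>hormander\<close>, averaged against |b|.\<close>

lemma bad_part:
  assumes [measurable]: "b \<in> borel_measurable borel" "g \<in> borel_measurable borel"
    and r: "r > 0" and supp: "\<And>z. b z \<noteq> 0 \<Longrightarrow> norm (z - c) \<le> r" and bw: "\<And>x. norm (b x) \<le> w"
    and g: "\<And>x. norm (g x) \<le> 1" and b0: "(LINT z|lborel. b z) = 0"
  shows "(\<integral>\<^sup>+x. indicator {x. 2 * r \<le> norm (x - c)} x * ennreal (norm (bil K b g x)) \<partial>lborel)
    \<le> ennreal H * (\<integral>\<^sup>+x. ennreal (norm (b x)) \<partial>lborel)"
proof -
  let ?X = "{x. 2 * r \<le> norm (x - c)}"
  have bint: "integrable lborel b"
  proof (rule integrableI_bounded_set[where A="cball c r" and B=w])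
    show "emeasure lborel (cball c r) < \<infinity>" by (rule emeasure_lborel_cball_finite)
  qed (use bw supp in \<open>auto simp: dist_norm norm_minus_commute\<close>)
  let ?d = "\<lambda>x z. K ((x, x) - z) - K (x - c, x - snd z)"
  have bound: "ennreal (norm (bil K b g x)) \<le> (\<integral>\<^sup>+z. ennreal (norm (b (fst z))) * ennreal (norm (?d x z)) \<partial>lborel)"
    if fin: "(\<integral>\<^sup>+y. ennreal (norm (K (x - c, y))) \<partial>lborel) \<noteq> \<infinity>" for x
  proof -
    have "integrable lborel (\<lambda>y. K (x - c, y))"
      using fin by (intro integrableI_bounded) (auto simp: less_top)
    then have "integrable lborel (\<lambda>y. K (x - c, x - y))" by (rule integrable_lborel_reflect)
    then have G: "integrable lborel (\<lambda>y. K (x - c, x - y) * g y)"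
      by (rule Bochner_Integration.integrable_bound) (auto simp: norm_mult g mult_left_le)
    let ?G = "\<lambda>z. b (fst z) * (K (x - c, x - snd z) * g (snd z))"
    have Gp: "integrable lborel ?G" and G0: "(LINT z|lborel. ?G z) = 0"
      using integrable_tensor[OF bint G] b0 by simp_all
    have I1: "integrable lborel (\<lambda>z. K ((x, x) - z) * (b (fst z) * g (snd z)))"
    proof -
      have "integrable lborel (\<lambda>y. K y * b (x - fst y) * g (x - snd y))"
        by (rule bil_integrable[OF K_integrable _ _ bw g]) measurable
      from integrable_lborel_reflect[OF this, of "(x, x)"] show ?thesis by (simp add: mult.assoc)
    qed
    have "bil K b g x = (LINT z|lborel. K ((x, x) - z) * (b (fst z) * g (snd z))) - (LINT z|lborel. ?G z)"
      by (simp add: bil_reflect G0)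
    also have "\<dots> = (LINT z|lborel. ?d x z * (b (fst z) * g (snd z)))"
      using I1 Gp by (subst Bochner_Integration.integral_diff[symmetric]) (auto simp: algebra_simps)
    finally have e: "bil K b g x = (LINT z|lborel. ?d x z * (b (fst z) * g (snd z)))" .
    have "ennreal (norm (bil K b g x)) \<le> (\<integral>\<^sup>+z. ennreal (norm (?d x z * (b (fst z) * g (snd z)))) \<partial>lborel)"
      unfolding e by (rule norm_le_nn)
    also have "\<dots> \<le> (\<integral>\<^sup>+z. ennreal (norm (b (fst z))) * ennreal (norm (?d x z)) \<partial>lborel)"
    proof (rule nn_integral_mono)
      fix z
      have "norm (?d x z * (b (fst z) * g (snd z))) = norm (b (fst z)) * norm (?d x z) * norm (g (snd z))"
        by (simp add: norm_mult mult_ac)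
      also have "\<dots> \<le> norm (b (fst z)) * norm (?d x z) * 1" by (intro mult_left_mono g) auto
      finally show "ennreal (norm (?d x z * (b (fst z) * g (snd z)))) \<le> ennreal (norm (b (fst z))) * ennreal (norm (?d x z))"
        by (simp add: ennreal_mult'[symmetric] ennreal_leI)
    qed
    finally show ?thesis .
  qed
  have "(\<integral>\<^sup>+x. (\<integral>\<^sup>+y. ennreal (norm (K (x + (- c), y))) \<partial>lborel) \<partial>lborel) = (\<integral>\<^sup>+y. ennreal (norm (K y)) \<partial>lborel)"
    by (subst nn_integral_lborel_shift[where f="\<lambda>x. \<integral>\<^sup>+y. ennreal (norm (K (x, y))) \<partial>lborel"], measurable)
       (rule nn_integral_lborel_prod_fst[symmetric], measurable)
  also have "\<dots> \<noteq> \<infinity>" using K_integrable by (simp add: integrable_iff_bounded)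
  finally have "AE x in lborel. (\<integral>\<^sup>+y. ennreal (norm (K (x - c, y))) \<partial>lborel) \<noteq> \<infinity>"
    by (intro nn_integral_PInf_AE) auto
  then have "(\<integral>\<^sup>+x. indicator ?X x * ennreal (norm (bil K b g x)) \<partial>lborel)
    \<le> (\<integral>\<^sup>+x. indicator ?X x * (\<integral>\<^sup>+z. ennreal (norm (b (fst z))) * ennreal (norm (?d x z)) \<partial>lborel) \<partial>lborel)"
    by (intro nn_integral_mono_AE) (auto elim!: eventually_mono intro!: mult_left_mono bound)
  also have "\<dots> = (\<integral>\<^sup>+x. indicator ?X x * (\<integral>\<^sup>+z. \<integral>\<^sup>+y. ennreal (norm (b z)) * ennreal (norm (K (x - z, y) - K (x - c, y))) \<partial>lborel \<partial>lborel) \<partial>lborel)"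
  proof (intro nn_integral_cong arg_cong2[where f="(*)"] refl)
    fix x
    have "(\<integral>\<^sup>+z. ennreal (norm (b (fst z))) * ennreal (norm (?d x z)) \<partial>lborel) =
      (\<integral>\<^sup>+z. \<integral>\<^sup>+y. ennreal (norm (b z)) * ennreal (norm (K (x - z, x - y) - K (x - c, x - y))) \<partial>lborel \<partial>lborel)"
      by (subst nn_integral_lborel_prod_fst) auto
    also have "\<dots> = (\<integral>\<^sup>+z. \<integral>\<^sup>+y. ennreal (norm (b z)) * ennreal (norm (K (x - z, y) - K (x - c, y))) \<partial>lborel \<partial>lborel)"
      by (intro nn_integral_cong nn_integral_lborel_reflect[where f="\<lambda>y. ennreal (norm (b _)) * ennreal (norm (K (x - _, y) - K (x - c, y)))"]) measurable
    finally show "(\<integral>\<^sup>+z. ennreal (norm (b (fst z))) * ennreal (norm (?d x z)) \<partial>lborel) = \<dots>" .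
  qed
  also have "\<dots> = (\<integral>\<^sup>+x. \<integral>\<^sup>+z. ennreal (norm (b z)) * (indicator ?X x * (\<integral>\<^sup>+y. ennreal (norm (K (x - z, y) - K (x - c, y))) \<partial>lborel)) \<partial>lborel \<partial>lborel)"
  proof (rule nn_integral_cong)
    fix x
    have "(\<integral>\<^sup>+z. \<integral>\<^sup>+y. ennreal (norm (b z)) * ennreal (norm (K (x - z, y) - K (x - c, y))) \<partial>lborel \<partial>lborel)
      = (\<integral>\<^sup>+z. ennreal (norm (b z)) * (\<integral>\<^sup>+y. ennreal (norm (K (x - z, y) - K (x - c, y))) \<partial>lborel) \<partial>lborel)"
      by (intro nn_integral_cong nn_integral_cmult) measurable
    then have "indicator ?X x * (\<integral>\<^sup>+z. \<integral>\<^sup>+y. ennreal (norm (b z)) * ennreal (norm (K (x - z, y) - K (x - c, y))) \<partial>lborel \<partial>lborel)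
      = (\<integral>\<^sup>+z. indicator ?X x * (ennreal (norm (b z)) * (\<integral>\<^sup>+y. ennreal (norm (K (x - z, y) - K (x - c, y))) \<partial>lborel)) \<partial>lborel)"
      by (simp only:) (rule nn_integral_cmult[symmetric], measurable)
    then show "indicator ?X x * (\<integral>\<^sup>+z. \<integral>\<^sup>+y. ennreal (norm (b z)) * ennreal (norm (K (x - z, y) - K (x - c, y))) \<partial>lborel \<partial>lborel)
      = (\<integral>\<^sup>+z. ennreal (norm (b z)) * (indicator ?X x * (\<integral>\<^sup>+y. ennreal (norm (K (x - z, y) - K (x - c, y))) \<partial>lborel)) \<partial>lborel)"
      by (simp only: mult.left_commute)
  qed
  also have "\<dots> = (\<integral>\<^sup>+z. \<integral>\<^sup>+x. ennreal (norm (b z)) * (indicator ?X x * (\<integral>\<^sup>+y. ennreal (norm (K (x - z, y) - K (x - c, y))) \<partial>lborel)) \<partial>lborel \<partial>lborel)"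
    by (rule lborel_pair.Fubini') measurable
  also have "\<dots> \<le> (\<integral>\<^sup>+z. ennreal H * ennreal (norm (b z)) \<partial>lborel)"
  proof (rule nn_integral_mono)
    fix z
    show "(\<integral>\<^sup>+x. ennreal (norm (b z)) * (indicator ?X x * (\<integral>\<^sup>+y. ennreal (norm (K (x - z, y) - K (x - c, y))) \<partial>lborel)) \<partial>lborel)
      \<le> ennreal H * ennreal (norm (b z))"
    proof (cases "b z = 0")
      case False
      have "(\<integral>\<^sup>+x. ennreal (norm (b z)) * (indicator ?X x * (\<integral>\<^sup>+y. ennreal (norm (K (x - z, y) - K (x - c, y))) \<partial>lborel)) \<partial>lborel)
        = ennreal (norm (b z)) * (\<integral>\<^sup>+x. indicator ?X x * (\<integral>\<^sup>+y. ennreal (norm (K (x - z, y) - K (x - c, y))) \<partial>lborel) \<partial>lborel)"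
        by (rule nn_integral_cmult) measurable
      also have "\<dots> \<le> ennreal (norm (b z)) * ennreal H"
        by (intro mult_left_mono hormander r supp False) auto
      finally show ?thesis by (simp add: mult.commute)
    qed simp
  qed
  also have "\<dots> = ennreal H * (\<integral>\<^sup>+x. ennreal (norm (b x)) \<partial>lborel)"
    by (rule nn_integral_cmult) measurable
  finally show ?thesis .
qed

end

section \<open>Weak type estimates for truncated kernels\<close>

lemma markov_le:
  assumes [measurable]: "S \<in> sets M" "h \<in> borel_measurable M" and "\<And>x. x \<in> S \<Longrightarrow> a \<le> h x"
  shows "a * emeasure M S \<le> (\<integral>\<^sup>+x. h x \<partial>M)"
proof -
  have "a * emeasure M S = (\<integral>\<^sup>+x. a * indicator S x \<partial>M)" by (simp add: nn_integral_cmult_indicator)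
  also have "\<dots> \<le> (\<integral>\<^sup>+x. h x \<partial>M)" using assms(3) by (intro nn_integral_mono) (auto simp: indicator_def)
  finally show ?thesis .
qed

text \<open>The ratio of the volume of a ball of radius 3d 2^-k to that of a cube of side 2^-k,
  where d 2^-k is the diameter bound of \<open>dyadic_cube_dist\<close>.\<close>

definition ball_const :: "nat \<Rightarrow> real" where
  "ball_const d = unit_ball_vol d * (3 * d) ^ d"

lemma ball_const_pos: "0 < d \<Longrightarrow> 0 < ball_const d"
  by (simp add: ball_const_def)

lemma emeasure_cball_dyadic:
  fixes c x :: "'a::euclidean_space"
  shows "emeasure lborel (cball c (3 * (DIM('a) * 2 powi (-k)))) = ennreal (ball_const DIM('a) * measure lborel (dyadic_cube k x))"
  by (simp add: emeasure_cball measure_dyadic_cube ball_const_def power_mult_distrib mult_ac)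

context bilinear_kernel
begin

text \<open>Moving the output point from x' to x is a diagonal shift of the kernel. The function
  \<open>h\<close> stands for the tensor product of the inputs or for a part of it, and
  \<open>D\<close> records where (x', x') - z can lie when \<open>h z\<close> is nonzero.\<close>

lemma diff_bound:
  assumes [measurable]: "h \<in> borel_measurable borel" "D \<in> sets borel"
    and w: "\<And>z. norm (h z) \<le> w" and supp: "\<And>z. h z \<noteq> 0 \<Longrightarrow> (x', x') - z \<in> D"
  shows "ennreal (norm ((LINT z|lborel. K ((x, x) - z) * h z) - (LINT z|lborel. K ((x', x') - z) * h z)))
    \<le> ennreal w * (\<integral>\<^sup>+y. indicator D y * ennreal (norm (K (y + (x - x', x - x')) - K y)) \<partial>lborel)"
proof -
  have w0: "0 \<le> w" using w[of undefined] norm_ge_zero order_trans by blast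
  have int: "integrable lborel (\<lambda>z. K ((x, x) - z) * h z)" for x
  proof (rule Bochner_Integration.integrable_bound)
    show "integrable lborel (\<lambda>z. w * norm (K ((x, x) - z)))"
      by (intro integrable_mult_right integrable_norm integrable_lborel_reflect K_integrable)
    show "AE z in lborel. norm (K ((x, x) - z) * h z) \<le> norm (w * norm (K ((x, x) - z)))"
      using w w0 by (intro AE_I2) (auto simp: norm_mult mult.commute[of w] intro!: mult_left_mono)
  qed measurable
  have e: "(LINT z|lborel. K ((x, x) - z) * h z) - (LINT z|lborel. K ((x', x') - z) * h z)
    = (LINT z|lborel. (K ((x, x) - z) - K ((x', x') - z)) * h z)"
    unfolding left_diff_distrib by (intro Bochner_Integration.integral_diff[symmetric] int)
  have "ennreal (norm (LINT z|lborel. (K ((x, x) - z) - K ((x', x') - z)) * h z))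
    \<le> (\<integral>\<^sup>+z. ennreal (norm ((K ((x, x) - z) - K ((x', x') - z)) * h z)) \<partial>lborel)"
    by (rule norm_le_nn)
  also have "\<dots> \<le> (\<integral>\<^sup>+z. ennreal w * (indicator D ((x', x') - z) *
      ennreal (norm (K (((x', x') - z) + (x - x', x - x')) - K ((x', x') - z)))) \<partial>lborel)"
  proof (rule nn_integral_mono)
    fix z
    have q: "((x', x') - z) + (x - x', x - x') = (x, x) - z" by (simp add: prod_eq_iff)
    show "ennreal (norm ((K ((x, x) - z) - K ((x', x') - z)) * h z)) \<le> ennreal w * (indicator D ((x', x') - z) *
      ennreal (norm (K (((x', x') - z) + (x - x', x - x')) - K ((x', x') - z))))"
    proof (cases "h z = 0")
      case False
      have "norm ((K ((x, x) - z) - K ((x', x') - z)) * h z) \<le> w * norm (K ((x, x) - z) - K ((x', x') - z))"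
        using w[of z] by (simp add: norm_mult mult.commute[of w] mult_left_mono)
      then show ?thesis unfolding q using supp[OF False] w0 by (simp add: ennreal_mult'[symmetric] ennreal_leI)
    qed simp
  qed
  also have "\<dots> = (\<integral>\<^sup>+y. ennreal w * (indicator D y * ennreal (norm (K (y + (x - x', x - x')) - K y))) \<partial>lborel)"
    by (rule nn_integral_lborel_reflect[where f="\<lambda>y. ennreal w * (indicator D y * ennreal (norm (K (y + (x - x', x - x')) - K y)))"]) measurable
  also have "\<dots> = ennreal w * (\<integral>\<^sup>+y. indicator D y * ennreal (norm (K (y + (x - x', x - x')) - K y)) \<partial>lborel)"
    by (rule nn_integral_cmult) measurable
  finally show ?thesis unfolding e .
qed

text \<open>The Lipschitz constant depends on the truncation \<open>F\<close>; it serves only to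
  make the output continuous.\<close>

lemma bil_K_lipschitz:
  assumes [measurable]: "f \<in> borel_measurable borel" "g \<in> borel_measurable borel"
    and f: "\<And>x. norm (f x) \<le> w" and g: "\<And>x. norm (g x) \<le> 1"
  shows "norm (bil K f g x - bil K f g x') \<le> (w * (\<Sum>i\<in>F. A * 2 powi (\<mu> + i)) * 2) * norm (x - x')"
proof -
  let ?v = "(x - x', x - x')"
  have w0: "0 \<le> w" using f[of 0] norm_ge_zero order_trans by blast
  have "ennreal (norm (bil K f g x - bil K f g x')) \<le> ennreal w * (\<integral>\<^sup>+y. indicator UNIV y * ennreal (norm (K (y + ?v) - K y)) \<partial>lborel)"
    unfolding bil_reflect[OF K_borel assms(1,2)]
  proof (rule diff_bound)
    fix z show "norm (f (fst z) * g (snd z)) \<le> w"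
      using mult_mono[OF f[of "fst z"] g[of "snd z"]] w0 by (simp add: norm_mult)
  qed auto
  also have "(\<integral>\<^sup>+y. indicator UNIV y * ennreal (norm (K (y + ?v) - K y)) \<partial>lborel) \<le> ennreal ((\<Sum>i\<in>F. A * 2 powi (\<mu> + i)) * norm ?v)"
  proof -
    have "(\<integral>\<^sup>+y. indicator UNIV y * ennreal (norm (K (y + ?v) - K y)) \<partial>lborel) \<le> (\<integral>\<^sup>+y. (\<Sum>i\<in>F. ennreal (norm (k i (y + ?v) - k i y))) \<partial>lborel)"
    proof (rule nn_integral_mono)
      fix y
      have "norm (K (y + ?v) - K y) \<le> (\<Sum>i\<in>F. norm (k i (y + ?v) - k i y))"
        unfolding K_def sum_subtractf[symmetric] by (rule norm_sum)
      then show "indicator UNIV y * ennreal (norm (K (y + ?v) - K y)) \<le> (\<Sum>i\<in>F. ennreal (norm (k i (y + ?v) - k i y)))"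
        by (auto simp: sum_ennreal ennreal_leI)
    qed
    also have "\<dots> = (\<Sum>i\<in>F. \<integral>\<^sup>+y. ennreal (norm (k i (y + ?v) - k i y)) \<partial>lborel)"
      by (intro nn_integral_sum) measurable
    also have "\<dots> \<le> (\<Sum>i\<in>F. ennreal (A * 2 powi (\<mu> + i) * norm ?v))" by (intro sum_mono smooth)
    also have "\<dots> = ennreal ((\<Sum>i\<in>F. A * 2 powi (\<mu> + i)) * norm ?v)"
      using A_nonneg by (simp add: sum_ennreal sum_distrib_right)
    finally show ?thesis .
  qed
  also have "norm ?v \<le> 2 * norm (x - x')"
    using norm_Pair_le[of "x - x'" "x - x'"] by simp
  finally have "ennreal (norm (bil K f g x - bil K f g x')) \<le> ennreal w * ennreal ((\<Sum>i\<in>F. A * 2 powi (\<mu> + i)) * (2 * norm (x - x')))"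
    using A_nonneg by (auto simp: mult_left_mono ennreal_leI sum_nonneg)
  also have "\<dots> = ennreal ((w * (\<Sum>i\<in>F. A * 2 powi (\<mu> + i)) * 2) * norm (x - x'))"
    using w0 by (simp add: ennreal_mult'[symmetric] mult_ac)
  finally show ?thesis using w0 A_nonneg by (subst (asm) ennreal_le_iff) (auto simp: sum_nonneg)
qed

lemma bil_K_open:
  assumes [measurable]: "f \<in> borel_measurable borel" "g \<in> borel_measurable borel"
    and f: "\<And>x. norm (f x) \<le> w" and g: "\<And>x. norm (g x) \<le> 1"
  shows "open {x. t < norm (bil K f g x)}"
proof -
  let ?L = "w * (\<Sum>i\<in>F. A * 2 powi (\<mu> + i)) * 2"
  have "0 \<le> w" using f[of 0] norm_ge_zero order_trans by blast
  then have "?L-lipschitz_on UNIV (bil K f g)"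
    using bil_K_lipschitz[OF assms] A_nonneg by (intro lipschitz_onI) (auto simp: dist_norm sum_nonneg)
  then have "continuous_on UNIV (bil K f g)" by (rule lipschitz_on_continuous_on)
  then show ?thesis by (intro open_Collect_less continuous_intros) auto
qed

text \<open>After both inputs are cut to the ball of radius 3r, the remainder of the tensor product
  lives where at least one coordinate is more than 3r from c, hence at distance at least 2r from (x,
  x) and from (x', x'). There the difference of kernels is governed by
  \<open>oscillation\<close>.\<close>

lemma tail_oscillation:
  assumes [measurable]: "f \<in> borel_measurable borel" "g \<in> borel_measurable borel"
    and f: "\<And>x. norm (f x) \<le> w" and g: "\<And>x. norm (g x) \<le> 1" and r: "r > 0"
    and x: "norm (x - c) \<le> r" and x': "norm (x' - c) \<le> r"
    and f1: "f1 = (\<lambda>z. indicator (cball c (3 * r)) z * f z)" and g1: "g1 = (\<lambda>z. indicator (cball c (3 * r)) z * g z)"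
  shows "norm ((bil K f g x - bil K f1 g1 x) - (bil K f g x' - bil K f1 g1 x')) \<le> w * H"
proof -
  have w0: "0 \<le> w" using f[of 0] norm_ge_zero order_trans by blast
  have [measurable]: "cball c (3 * r) \<in> sets borel" by simp
  have [measurable]: "f1 \<in> borel_measurable borel" "g1 \<in> borel_measurable borel" unfolding f1 g1 by measurable
  define h where "h z = f (fst z) * g (snd z) - f1 (fst z) * g1 (snd z)" for z
  have [measurable]: "h \<in> borel_measurable borel" unfolding h_def[abs_def] by measurable
  have h_eq: "h z = (if fst z \<in> cball c (3 * r) \<and> snd z \<in> cball c (3 * r) then 0 else f (fst z) * g (snd z))" for z
    by (auto simp: h_def f1 g1)
  have fg: "norm (f y * g z) \<le> w" for y z
    using mult_mono[OF f[of y] g[of z]] w0 by (simp add: norm_mult)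
  have bd: "norm (h z) \<le> w" for z using fg w0 by (auto simp: h_eq)
  define v where "v = (x - x', x - x')"
  define D where "D = {y. 2 * r \<le> norm y \<and> 2 * r \<le> norm (y + v)}"
  have [measurable]: "D \<in> sets borel" unfolding D_def by measurable
  have far: "2 * r \<le> norm ((p, p) - z)" if p: "norm (p - c) \<le> r" and h: "h z \<noteq> 0" for p z
  proof -
    have "3 * r < dist c (fst z) \<or> 3 * r < dist c (snd z)" using h by (auto simp: h_eq split: if_splits)
    then have "2 * r \<le> norm (p - fst z) \<or> 2 * r \<le> norm (p - snd z)"
      using p by (smt (verit) dist_commute dist_norm dist_triangle)
    moreover have "norm (p - fst z) \<le> norm ((p, p) - z)" "norm (p - snd z) \<le> norm ((p, p) - z)"
      using norm_fst_le[of "p - fst z" "p - snd z"] norm_snd_le[of "p - snd z" "p - fst z"]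
      by (simp_all add: minus_prod_def)
    ultimately show ?thesis by linarith
  qed
  have eq: "bil K f g p - bil K f1 g1 p = (LINT z|lborel. K ((p, p) - z) * h z)" for p
  proof -
    have fgi: "integrable lborel (\<lambda>z. K ((p, p) - z) * (f (fst z) * g (snd z)))"
    proof -
      have "integrable lborel (\<lambda>y. K y * f (p - fst y) * g (p - snd y))"
        by (rule bil_integrable[OF K_integrable _ _ f g]) measurable
      from integrable_lborel_reflect[OF this, of "(p, p)"] show ?thesis by (simp add: mult.assoc)
    qed
    have fgi1: "integrable lborel (\<lambda>z. K ((p, p) - z) * (f1 (fst z) * g1 (snd z)))"
    proof -
      have b1: "norm (f1 x) \<le> w" "norm (g1 x) \<le> 1" for x
        using f g w0 by (auto simp: f1 g1 indicator_def)
      have "integrable lborel (\<lambda>y. K y * f1 (p - fst y) * g1 (p - snd y))"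
        by (rule bil_integrable[OF K_integrable _ _ b1]) measurable
      from integrable_lborel_reflect[OF this, of "(p, p)"] show ?thesis by (simp add: mult.assoc)
    qed
    show ?thesis
      unfolding bil_reflect[OF K_borel assms(1,2)] bil_reflect[OF K_borel \<open>f1 \<in> _\<close> \<open>g1 \<in> _\<close>] h_def right_diff_distrib
      by (rule Bochner_Integration.integral_diff[OF fgi fgi1, symmetric])
  qed
  have "ennreal (norm ((bil K f g x - bil K f1 g1 x) - (bil K f g x' - bil K f1 g1 x')))
    \<le> ennreal w * (\<integral>\<^sup>+y. indicator D y * ennreal (norm (K (y + (x - x', x - x')) - K y)) \<partial>lborel)"
    unfolding eq
  proof (rule diff_bound)
    fix z assume h: "h z \<noteq> 0"
    have "(x', x') - z + v = (x, x) - z" by (simp add: v_def prod_eq_iff)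
    then show "(x', x') - z \<in> D" using far[OF x h] far[OF x' h] by (simp only: D_def mem_Collect_eq simp_thms)
  qed (use bd in auto)
  also have "\<dots> \<le> ennreal w * ennreal H"
  proof (intro mult_left_mono)
    have "norm (x - x') \<le> 2 * r"
      using x x' norm_triangle_ineq4[of "x - c" "x' - c"] by simp
    then have nv: "norm v \<le> 2 * (2 * r)"
      using norm_Pair_le[of "x - x'" "x - x'"] by (simp add: v_def)
    show "(\<integral>\<^sup>+y. indicator D y * ennreal (norm (K (y + (x - x', x - x')) - K y)) \<partial>lborel) \<le> ennreal H"
      \<comment> \<open>Radius 2 * r is used here: \<open>D\<close> keeps that distance from the
        origin, and the diagonal shift has norm at most 4 * r.\<close>
      unfolding v_def[symmetric] using r by (intro oscillation[OF _ _ nv]) (auto simp: D_def)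
  qed auto
  also have "\<dots> = ennreal (w * H)" using w0 by (simp add: ennreal_mult')
  finally show ?thesis using w0 H_nonneg by (subst (asm) ennreal_le_iff) auto
qed

lemma local_scaled:
  assumes E: "E \<in> sets borel" "bounded E" and [measurable]: "f \<in> borel_measurable borel" "g \<in> borel_measurable borel"
    and w: "w > 0" and f: "\<And>x. norm (f x) \<le> w * indicator E x" and g: "\<And>x. norm (g x) \<le> indicator E x"
  shows "(\<integral>\<^sup>+x. ennreal (norm (bil K f g x)) \<partial>lborel) \<le> ennreal (w * B) * emeasure lborel E"
proof -
  define f' where "f' x = of_real (1 / w) * f x" for x
  have [measurable]: "f' \<in> borel_measurable borel" unfolding f'_def[abs_def] by measurable
  have "norm (f' x) \<le> indicator E x" for x
    using f[of x] w by (simp add: f'_def norm_mult norm_divide field_simps)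
  then have "(\<integral>\<^sup>+x. ennreal (norm (bil K f' g x)) \<partial>lborel) \<le> ennreal B * emeasure lborel E"
    unfolding K_def[abs_def] by (intro local E g) auto
  then have "ennreal w * (\<integral>\<^sup>+x. ennreal (norm (bil K f' g x)) \<partial>lborel) \<le> ennreal w * (ennreal B * emeasure lborel E)"
    by (rule mult_left_mono) simp
  moreover have "bil K f g x = of_real w * bil K f' g x" for x
    using w unfolding f'_def[abs_def] bil_cmult by simp
  then have "(\<integral>\<^sup>+x. ennreal (norm (bil K f g x)) \<partial>lborel) = ennreal w * (\<integral>\<^sup>+x. ennreal (norm (bil K f' g x)) \<partial>lborel)"
    using w by (simp add: norm_mult ennreal_mult' nn_integral_cmult)
  ultimately show ?thesis using w B_pos by (simp add: ennreal_mult' mult.assoc)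
qed

text \<open>Take the maximal dyadic cubes in which \<open>{x. t < norm (bil K f g x)}\<close> has density above \<open>1/2\<close>.
  The parent has density at most \<open>1/2\<close>, so by Markov it contains a point outside the set where the
  local part is small too.  As the tail oscillates little, \<open>bil K f g\<close> can exceed \<open>2 * t\<close> on the cube
  only where the local part exceeds \<open>t / 2\<close>.\<close>

lemma good_lambda:
  assumes [measurable]: "f \<in> borel_measurable borel" "g \<in> borel_measurable borel"
    and fint: "(\<integral>\<^sup>+x. ennreal (norm (f x)) \<partial>lborel) < \<infinity>"
    and f: "\<And>x. norm (f x) \<le> w" and g: "\<And>x. norm (g x) \<le> 1" and t: "t > 0" and w: "w > 0"
    and small: "w * (4 * B * ball_const DIM('a) + H) \<le> t / 2"
  shows "emeasure lborel {x. 2 * t < norm (bil K f g x)}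
    \<le> ennreal (4 * w * B * ball_const DIM('a) * 2 ^ DIM('a) / t) * emeasure lborel {x. t < norm (bil K f g x)}"
proof -
  define V where "V = ball_const DIM('a)"
  have V: "V > 0" unfolding V_def by (rule ball_const_pos) simp
  define E where "E = {x. t < norm (bil K f g x)}"
  have openE: "open E" unfolding E_def by (rule bil_K_open[OF assms(1,2) f g])
  have Em [measurable]: "E \<in> sets borel" using openE by simp
  \<comment> \<open>Purely qualitative, from the integrability of the truncated kernel. Without it
    arbitrarily large cubes could have density above 1/2.\<close>
  have finE: "emeasure lborel E < \<infinity>"
  proof -
    have "ennreal t * emeasure lborel E \<le> (\<integral>\<^sup>+x. ennreal (norm (bil K f g x)) \<partial>lborel)"
      by (rule markov_le) (auto simp: E_def intro!: ennreal_leI)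
    also have "\<dots> \<le> (\<integral>\<^sup>+y. ennreal (norm (K y)) \<partial>lborel) * (\<integral>\<^sup>+x. ennreal (norm (f x)) \<partial>lborel)"
      by (rule bil_L1_bound) (use g in auto)
    also have "\<dots> < \<infinity>"
      using fint K_integrable by (auto simp: integrable_iff_bounded ennreal_mult_less_top)
    finally show ?thesis using t by (auto simp: ennreal_mult_less_top)
  qed
  define e where "e = measure lborel E"
  have subfin: "emeasure lborel (E \<inter> Q) = ennreal (measure lborel (E \<inter> Q))" "emeasure lborel (E \<inter> Q) < \<infinity>" if "Q \<in> sets borel" for Q
  proof -
    have "emeasure lborel (E \<inter> Q) \<le> emeasure lborel E" using that by (intro emeasure_mono) auto
    then show "emeasure lborel (E \<inter> Q) < \<infinity>" using finE by (rule le_less_trans)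
    then show "emeasure lborel (E \<inter> Q) = ennreal (measure lborel (E \<inter> Q))"
      by (intro emeasure_eq_ennreal_measure) auto
  qed
  have msub: "measure lborel (E \<inter> Q) \<le> e" if "Q \<in> sets borel" for Q
    unfolding e_def using that finE by (intro measure_mono_fmeasurable) (auto simp: fmeasurable_def)
  \<comment> \<open>Density of E above 1/2. Such a cube has volume at most twice the measure of E,
    which yields the lower bound \<open>k0\<close> on its generation.\<close>
  define P where "P k x \<longleftrightarrow> measure lborel (dyadic_cube k x) < 2 * measure lborel (E \<inter> dyadic_cube k x)" for k x
  obtain k0 where k0: "\<And>k. 1 * (2 powi (-k)) ^ DIM('a) \<le> 2 * e \<Longrightarrow> k0 \<le> k"
    using powi_neg_le_imp_ge[of 1 "DIM('a)" "2 * e"] by auto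
  have inv: "P k y" if "y \<in> dyadic_cube k x" "P k x" for k x y
    using that by (simp add: P_def dyadic_cube_eq)
  have lb: "k0 \<le> k" if "P k x" for k x
    using that msub[of "dyadic_cube k x"] by (intro k0) (simp add: P_def measure_dyadic_cube)
  have "\<exists>\<Q>. countable \<Q> \<and> disjoint \<Q> \<and> \<Union>\<Q> = {x. \<exists>k. P k x} \<and>
    (\<forall>Q\<in>\<Q>. \<exists>k x. Q = dyadic_cube k x \<and> P k x \<and> \<not> P (k - 1) x)"
    by (rule stopping_cubes[of P k0]) (use inv lb in blast)+
  then obtain \<Q> where QQ: "countable \<Q> \<and> disjoint \<Q> \<and> \<Union>\<Q> = {x. \<exists>k. P k x} \<and>
    (\<forall>Q\<in>\<Q>. \<exists>k x. Q = dyadic_cube k x \<and> P k x \<and> \<not> P (k - 1) x)" by (rule exE)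
  then have \<Q>: "countable \<Q>" "disjoint \<Q>" "\<Union>\<Q> = {x. \<exists>k. P k x}" by simp_all
  have \<Q>4: "\<exists>k x. Q = dyadic_cube k x \<and> P k x \<and> \<not> P (k - 1) x" if "Q \<in> \<Q>" for Q
    using QQ that by (elim conjE bspec)
  have cover: "E \<subseteq> \<Union>\<Q>"
  proof
    fix x assume x: "x \<in> E"
    obtain \<epsilon> where \<epsilon>: "\<epsilon> > 0" "ball x \<epsilon> \<subseteq> E" using openE x open_contains_ball by blast
    obtain n :: nat where n: "real DIM('a) / \<epsilon> < 2 ^ n" using real_arch_pow[of 2 "real DIM('a) / \<epsilon>"] by auto
    have sub: "dyadic_cube (int n) x \<subseteq> E"
    proof
      fix y assume "y \<in> dyadic_cube (int n) x"
      then have "norm (y - x) \<le> real DIM('a) * 2 powi (- int n)" by (rule dyadic_cube_dist)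
      also have "\<dots> < \<epsilon>" using n \<epsilon> by (simp add: power_int_minus field_simps)
      finally show "y \<in> E" using \<epsilon>(2) by (auto simp: dist_norm norm_minus_commute)
    qed
    \<comment> \<open>A cube contained in the open set E has density 1.\<close>
    then have "P (int n) x" unfolding P_def by (simp add: Int_absorb1 measure_dyadic_cube)
    then show "x \<in> \<Union>\<Q>" using \<Q>(3) by blast
  qed
  have S2m: "{x. 2 * t < norm (bil K f g x)} \<in> sets borel" by measurable
  have "emeasure lborel {x. 2 * t < norm (bil K f g x)} \<le> ennreal (4 * w * B * V * 2 ^ DIM('a) / t) * emeasure lborel E"
  proof (rule emeasure_le_sum_disjoint[OF \<Q>(1,2)])
    show "{x. 2 * t < norm (bil K f g x)} \<subseteq> \<Union>\<Q>"
      using cover t by (auto simp: E_def subset_iff)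
    show "Q \<in> sets lborel" if "Q \<in> \<Q>" for Q using \<Q>4[OF that] by auto
    fix Q assume Q: "Q \<in> \<Q>"
    then obtain k c where kc: "Q = dyadic_cube k c" "P k c" "\<not> P (k - 1) c" using \<Q>4 by blast
    define R where "R = dyadic_cube (k - 1) c"
    have [measurable]: "R \<in> sets borel" "Q \<in> sets borel" unfolding R_def kc by auto
    have QR: "Q \<subseteq> R" unfolding R_def kc by (rule dyadic_cube_nested) simp
    \<comment> \<open>The local ball is built from the parent R, because the comparison point x' is
      found in R and need not lie in Q.\<close>
    define r where "r = real DIM('a) * 2 powi (-(k-1))"
    have r: "r > 0" by (simp add: r_def)
    have Rr: "norm (x - c) \<le> r" if "x \<in> R" for x using dyadic_cube_dist that unfolding R_def r_def by blast
    define C where "C = cball c (3 * r)"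
    have [measurable]: "C \<in> sets borel" unfolding C_def by simp
    define f1 where "f1 z = indicator C z * f z" for z
    define g1 where "g1 z = indicator C z * g z" for z
    have [measurable]: "f1 \<in> borel_measurable borel" "g1 \<in> borel_measurable borel"
      unfolding f1_def[abs_def] g1_def[abs_def] by measurable
    define L where "L = bil K f1 g1"
    have [measurable]: "L \<in> borel_measurable borel" unfolding L_def by measurable
    have mR: "emeasure lborel R = ennreal (measure lborel R)"
      unfolding R_def by (simp add: emeasure_dyadic_cube measure_dyadic_cube)
    have mRp: "measure lborel R > 0" unfolding R_def by (simp add: measure_dyadic_cube)
    have Lint: "(\<integral>\<^sup>+x. ennreal (norm (L x)) \<partial>lborel) \<le> ennreal (w * B * V * measure lborel R)"
    proof -
      have "(\<integral>\<^sup>+x. ennreal (norm (L x)) \<partial>lborel) \<le> ennreal (w * B) * emeasure lborel C"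
        unfolding L_def using w f g
        by (intro local_scaled) (auto simp: f1_def g1_def C_def indicator_def)
      also have "emeasure lborel C = ennreal (V * measure lborel R)"
        unfolding C_def r_def V_def R_def by (rule emeasure_cball_dyadic)
      finally show ?thesis using w B_pos V by (simp add: ennreal_mult'[symmetric] mult_ac)
    qed
    have tail: "norm ((bil K f g x - L x) - (bil K f g x' - L x')) \<le> w * H" if "x \<in> R" "x' \<in> R" for x x'
      unfolding L_def
      by (rule tail_oscillation[OF assms(1,2) f g r Rr[OF that(1)] Rr[OF that(2)]])
         (auto simp: f1_def[abs_def] g1_def[abs_def] C_def)
    \<comment> \<open>The threshold 4 * w * B * V is four times the bound for the mean of |L| over
      R, so |L| exceeds it on at most a quarter of R, whereas at least half of R lies outside
      E.\<close>
    have "\<exists>x'\<in>R. norm (bil K f g x') \<le> t \<and> norm (L x') \<le> 4 * w * B * V"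
    proof (rule ccontr)
      assume no: "\<not> ?thesis"
      have "ennreal (4 * w * B * V) * emeasure lborel (R - E) \<le> (\<integral>\<^sup>+x. ennreal (norm (L x)) \<partial>lborel)"
      proof (rule markov_le)
        fix x assume "x \<in> R - E"
        then have "4 * w * B * V \<le> norm (L x)" using no by (force simp: E_def)
        then show "ennreal (4 * w * B * V) \<le> ennreal (norm (L x))" by (rule ennreal_leI)
      qed measurable
      also note Lint
      finally have le: "ennreal (4 * w * B * V) * emeasure lborel (R - E) \<le> ennreal (w * B * V * measure lborel R)" .
      have "measure lborel (R - E \<inter> R) = measure lborel R - measure lborel (E \<inter> R)"
        by (rule measure_Diff) (auto simp: mR)
      moreover have "R - E \<inter> R = R - E" by auto
      moreover have "2 * measure lborel (E \<inter> R) \<le> measure lborel R"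
        using kc(3) by (simp add: P_def R_def)
      ultimately have half: "measure lborel R / 2 \<le> measure lborel (R - E)" by simp
      have "emeasure lborel (R - E) = ennreal (measure lborel (R - E))"
        using mR emeasure_mono[of "R - E" R lborel] by (intro emeasure_eq_ennreal_measure) (auto simp: top_unique)
      with le have "4 * w * B * V * measure lborel (R - E) \<le> w * B * V * measure lborel R"
        using w B_pos V by (simp add: ennreal_mult'[symmetric])
      then have "(w * B * V) * (4 * measure lborel (R - E)) \<le> (w * B * V) * measure lborel R" by (simp add: mult_ac)
      then have "4 * measure lborel (R - E) \<le> measure lborel R"
        using w B_pos V by (simp add: mult_le_cancel_left_pos)
      with half mRp show False by simp
    qed
    then obtain x' where x': "x' \<in> R" "norm (bil K f g x') \<le> t" "norm (L x') \<le> 4 * w * B * V" by blast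
    have big: "t / 2 \<le> norm (L x)" if x: "x \<in> Q" "2 * t < norm (bil K f g x)" for x
    proof -
      have "norm (bil K f g x) \<le> norm (L x) + norm (bil K f g x') + norm (L x') + norm ((bil K f g x - L x) - (bil K f g x' - L x'))"
      proof -
        have "norm (bil K f g x) = norm (L x + bil K f g x' + (- L x') + ((bil K f g x - L x) - (bil K f g x' - L x')))"
          by simp
        also have "\<dots> \<le> norm (L x) + norm (bil K f g x') + norm (- L x') + norm ((bil K f g x - L x) - (bil K f g x' - L x'))"
          by (intro order_trans[OF norm_triangle_ineq] add_mono order_refl)
        finally show ?thesis by simp
      qed
      also have "\<dots> \<le> norm (L x) + t + 4 * w * B * V + w * H"
        using x' tail[of x x'] x QR by auto
      \<comment> \<open>The hypothesis \<open>small\<close> makes the local value at x' and the tail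
        oscillation together at most t / 2, so that of the excess over t at least t / 2 is due to L
        at x.\<close>
      finally have "norm (bil K f g x) \<le> norm (L x) + t + t / 2"
        using small by (simp add: V_def algebra_simps)
      with x show ?thesis by simp
    qed
    have "ennreal (t / 2) * emeasure lborel ({x. 2 * t < norm (bil K f g x)} \<inter> Q) \<le> (\<integral>\<^sup>+x. ennreal (norm (L x)) \<partial>lborel)"
      using big S2m by (intro markov_le) (auto intro!: ennreal_leI)
    also note Lint
    \<comment> \<open>Two losses when returning from R to the part of E in Q: 2^d from parent to
      child, and 2 from the density.\<close>
    also have "measure lborel R = 2 ^ DIM('a) * measure lborel Q"
    proof -
      have "(2::real) powi (-(k-1)) = 2 * 2 powi (-k)"
        by (simp add: power_int_diff power_int_minus field_simps)
      then show ?thesis by (simp only: R_def kc(1) measure_dyadic_cube power_mult_distrib)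
    qed
    also have "measure lborel Q \<le> 2 * measure lborel (E \<inter> Q)" using kc(2) by (simp add: P_def kc(1))
    finally have *: "ennreal (t / 2) * emeasure lborel ({x. 2 * t < norm (bil K f g x)} \<inter> Q)
       \<le> ennreal (w * B * V * (2 ^ DIM('a) * (2 * measure lborel (E \<inter> Q))))"
      using w B_pos V by (auto simp: mult_left_mono ennreal_leI)
    have "ennreal (2 / t) * (ennreal (t / 2) * emeasure lborel ({x. 2 * t < norm (bil K f g x)} \<inter> Q))
       \<le> ennreal (2 / t) * ennreal (w * B * V * (2 ^ DIM('a) * (2 * measure lborel (E \<inter> Q))))"
      by (intro mult_left_mono *) simp
    also have "ennreal (2 / t) * (ennreal (t / 2) * emeasure lborel ({x. 2 * t < norm (bil K f g x)} \<inter> Q))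
      = emeasure lborel ({x. 2 * t < norm (bil K f g x)} \<inter> Q)"
      using t by (simp add: mult.assoc[symmetric] ennreal_mult'[symmetric])
    also have "ennreal (2 / t) * ennreal (w * B * V * (2 ^ DIM('a) * (2 * measure lborel (E \<inter> Q))))
      = ennreal (4 * w * B * V * 2 ^ DIM('a) / t) * emeasure lborel (E \<inter> Q)"
      using t w B_pos V by (subst subfin(1)) (auto simp: ennreal_mult'[symmetric] field_simps)
    finally show "emeasure lborel ({x. 2 * t < norm (bil K f g x)} \<inter> Q)
      \<le> ennreal (4 * w * B * V * 2 ^ DIM('a) / t) * emeasure lborel (E \<inter> Q)" .
  qed (use S2m in auto)
  then show ?thesis by (simp add: V_def E_def)
qed

end

lemma nn_norm_integrable:
  fixes f :: "'a \<Rightarrow> complex"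
  assumes "integrable M f"
  shows "(\<integral>\<^sup>+x. ennreal (norm (f x)) \<partial>M) = ennreal (LINT x|M. norm (f x))"
  using assms by (intro nn_integral_eq_integral) auto

context bilinear_kernel
begin

text \<open>Combines the ratio of ball to cube with the ratio 2^d of parent to child.\<close>

definition U :: real where "U = ball_const DIM('a) * 2 ^ DIM('a)"

text \<open>The fixed point of W \<mapsto> W/2 + \<open>weak_const\<close>/2. Half of it is the cost
  of one step: 4U/\<eta> for the enlarged cubes, with 1/\<eta> = 32BU + 2H, and 4H for the bad part
  away from them.\<close>

definition weak_const :: real where "weak_const = 8 * U * (32 * B * U + 2 * H) + 8 * H"

lemma U_pos: "U > 0" unfolding U_def by (simp add: ball_const_pos)

text \<open>The value is constant on a cube of known volume. The bound depends on \<open>M\<close>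
  and is used only to justify additivity of \<open>bil\<close> in its first input.\<close>

lemma step_integrable_bounded:
  fixes f :: "'a \<Rightarrow> complex"
  assumes int: "integrable lborel f" and step: "\<And>x y. y \<in> dyadic_cube M x \<Longrightarrow> f y = f x"
  shows "norm (f x) \<le> (LINT x|lborel. norm (f x)) / (2 powi (-M)) ^ DIM('a)"
proof -
  have "(2 powi (-M)) ^ DIM('a) * norm (f x) = (LINT y|lborel. indicator (dyadic_cube M x) y * norm (f x))"
    by (simp add: measure_dyadic_cube)
  also have "\<dots> \<le> (LINT y|lborel. norm (f y))"
  proof (rule integral_mono)
    show "integrable lborel (\<lambda>y. indicator (dyadic_cube M x) y * norm (f x))"
      by (intro integrable_mult_left integrable_real_indicator) (auto simp: emeasure_dyadic_cube)
    show "integrable lborel (\<lambda>y. norm (f y))" using int by auto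
    fix y show "indicator (dyadic_cube M x) y * norm (f x) \<le> norm (f y)"
      by (cases "y \<in> dyadic_cube M x") (simp_all add: step)
  qed
  finally show ?thesis by (simp add: field_simps)
qed

text \<open>At level s = 4t each of the good part \<open>u\<close> and the bad part \<open>b\<close>
  is examined at level 2t. For \<open>u\<close> the good-\<lambda> inequality leads to level t with
  a small factor, and there the a priori bound \<open>IH\<close> applies because \<open>u\<close>
  belongs to the same class as \<open>f\<close>; hence \<open>IH\<close> is assumed for all members
  and all levels. For \<open>b\<close> no a priori bound is needed, only the union of enlarged cubes
  and the Hormander estimate.\<close>

lemma weak_type_step:
  assumes [measurable]: "g \<in> borel_measurable borel" and g: "\<And>x. norm (g x) \<le> 1"
    and fint: "integrable lborel f" and step: "\<And>x y. y \<in> dyadic_cube M x \<Longrightarrow> f y = f x" and s: "s > 0"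
    and IH: "\<And>f t. integrable lborel f \<Longrightarrow> (\<And>x y. y \<in> dyadic_cube M x \<Longrightarrow> f y = f x) \<Longrightarrow> t > 0 \<Longrightarrow>
       ennreal t * emeasure lborel {x. t < norm (bil K f g x)} \<le> ennreal (W * (LINT x|lborel. norm (f x)))"
    and W: "W \<ge> 0"
  shows "ennreal s * emeasure lborel {x. s < norm (bil K f g x)} \<le> ennreal ((W / 2 + weak_const / 2) * (LINT x|lborel. norm (f x)))"
proof -
  define V where "V = ball_const DIM('a)"
  have V: "V > 0" unfolding V_def by (rule ball_const_pos) simp
  have UV: "U = V * 2 ^ DIM('a)" "V \<le> U" using V by (auto simp: U_def V_def)
  \<comment> \<open>The denominator serves two demands: \<eta> (4BV + H) \<le> 1/2 is the smallness
    required by \<open>good_lambda\<close>, and 4\<eta>BU \<le> 1/8 makes its factor at most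
    1/8.\<close>
  define \<eta> where "\<eta> = 1 / (32 * B * U + 2 * H)"
  have den: "0 < 32 * B * U + 2 * H" using B_pos U_pos H_nonneg by (simp add: add_pos_nonneg)
  have \<eta>: "\<eta> > 0" using den by (simp add: \<eta>_def)
  have eta1: "\<eta> * (4 * B * V + H) \<le> 1 / 2"
  proof -
    have "B * V \<le> B * U" using UV B_pos by simp
    moreover have "0 \<le> B * U" using B_pos U_pos by simp
    ultimately have "2 * (4 * B * V + H) \<le> 32 * B * U + 2 * H" by (simp add: algebra_simps)
    then show ?thesis using den by (simp add: \<eta>_def field_simps)
  qed
  have eta2: "4 * \<eta> * B * U \<le> 1 / 8"
    using den H_nonneg by (simp add: \<eta>_def field_simps)
  define t where "t = s / 4"
  have t: "t > 0" "s = 4 * t" using s by (auto simp: t_def)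
  define w where "w = \<eta> * t"
  have w: "w > 0" using \<eta> t by (simp add: w_def)
  define N where "N = (LINT x|lborel. norm (f x))"
  have N0: "N \<ge> 0" by (simp add: N_def)
  have [measurable]: "f \<in> borel_measurable borel" using fint by auto
  \<comment> \<open>The decomposition bounds \<open>u\<close> by 2^d times the height, so this
    height makes |u| \<le> w.\<close>
  define h where "h = w / 2 ^ DIM('a)"
  have h: "h > 0" using w by (simp add: h_def)
  have "\<exists>u \<Q>. finite \<Q> \<and> disjoint \<Q> \<and> (\<forall>Q\<in>\<Q>. \<exists>k x. Q = dyadic_cube k x) \<and>
    integrable lborel u \<and> (\<forall>x y. y \<in> dyadic_cube M x \<longrightarrow> u y = u x) \<and>
    (\<forall>x. norm (u x) \<le> 2 ^ DIM('a) * h) \<and>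
    (LINT x|lborel. norm (u x)) \<le> (LINT x|lborel. norm (f x)) \<and>
    (\<forall>x. x \<notin> \<Union>\<Q> \<longrightarrow> f x = u x) \<and>
    (\<forall>Q\<in>\<Q>. (LINT x|lborel. indicator Q x * (f x - u x)) = 0) \<and>
    h * (\<Sum>Q\<in>\<Q>. measure lborel Q) \<le> (LINT x|lborel. norm (f x))"
    by (rule calderon_zygmund[OF fint _ h]) (rule step)
  then obtain u \<Q> where CZ: "finite \<Q> \<and> disjoint \<Q> \<and> (\<forall>Q\<in>\<Q>. \<exists>k x. Q = dyadic_cube k x) \<and>
    integrable lborel u \<and> (\<forall>x y. y \<in> dyadic_cube M x \<longrightarrow> u y = u x) \<and>
    (\<forall>x. norm (u x) \<le> 2 ^ DIM('a) * h) \<and>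
    (LINT x|lborel. norm (u x)) \<le> (LINT x|lborel. norm (f x)) \<and>
    (\<forall>x. x \<notin> \<Union>\<Q> \<longrightarrow> f x = u x) \<and>
    (\<forall>Q\<in>\<Q>. (LINT x|lborel. indicator Q x * (f x - u x)) = 0) \<and>
    h * (\<Sum>Q\<in>\<Q>. measure lborel Q) \<le> (LINT x|lborel. norm (f x))"
    by (elim exE)
  then have \<Q>: "finite \<Q>" "disjoint \<Q>" "\<forall>Q\<in>\<Q>. \<exists>p. Q = dyadic_cube (fst p) (snd p)"
    and u: "integrable lborel u" "\<And>x y. y \<in> dyadic_cube M x \<Longrightarrow> u y = u x"
    "\<And>x. norm (u x) \<le> 2 ^ DIM('a) * h"
    "(LINT x|lborel. norm (u x)) \<le> (LINT x|lborel. norm (f x))"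
    "\<And>x. x \<notin> \<Union>\<Q> \<Longrightarrow> f x = u x"
    and uQ: "\<And>Q. Q \<in> \<Q> \<Longrightarrow> (LINT x|lborel. indicator Q x * (f x - u x)) = 0"
    and vol: "h * (\<Sum>Q\<in>\<Q>. measure lborel Q) \<le> (LINT x|lborel. norm (f x))"
    by simp_all
  have [measurable]: "u \<in> borel_measurable borel" using u(1) by auto
  have uw: "norm (u x) \<le> w" for x using u(3)[of x] by (simp add: h_def)
  define wf where "wf = N / (2 powi (-M)) ^ DIM('a)"
  have fw: "norm (f x) \<le> wf" for x unfolding wf_def N_def by (rule step_integrable_bounded[OF fint step])
  define b where "b x = f x - u x" for x
  have [measurable]: "b \<in> borel_measurable borel" unfolding b_def[abs_def] by measurable
  have bw: "norm (b x) \<le> wf + w" for x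
    unfolding b_def using fw[of x] uw[of x] norm_triangle_ineq4[of "f x" "u x"] by linarith
  have split: "bil K f g x = bil K u g x + bil K b g x" for x
  proof -
    have "bil K (\<lambda>x. f x - u x) g x = bil K f g x - bil K u g x"
      by (rule bil_diff[OF K_integrable _ _ _ fw uw g]) measurable
    then show ?thesis by (simp add: b_def[abs_def])
  qed
  have part1: "ennreal s * emeasure lborel {x. 2 * t < norm (bil K u g x)} \<le> ennreal (W / 2 * N)"
  proof -
    have "emeasure lborel {x. 2 * t < norm (bil K u g x)}
      \<le> ennreal (4 * w * B * ball_const DIM('a) * 2 ^ DIM('a) / t) * emeasure lborel {x. t < norm (bil K u g x)}"
    proof (rule good_lambda)
      show "(\<integral>\<^sup>+x. ennreal (norm (u x)) \<partial>lborel) < \<infinity>" using u(1) by (simp add: integrable_iff_bounded)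
      show "w * (4 * B * ball_const DIM('a) + H) \<le> t / 2"
        using mult_right_mono[OF eta1, of t] t by (simp add: w_def V_def mult_ac)
    qed (use uw g t w in auto)
    also have "\<dots> \<le> ennreal (1 / 8) * emeasure lborel {x. t < norm (bil K u g x)}"
      using eta2 t by (intro mult_right_mono ennreal_leI) (auto simp: w_def U_def mult_ac)
    finally have "ennreal s * emeasure lborel {x. 2 * t < norm (bil K u g x)} \<le> ennreal s * (ennreal (1 / 8) * emeasure lborel {x. t < norm (bil K u g x)})"
      by (rule mult_left_mono) simp
    \<comment> \<open>Here s/8 = t/2: the factor 1/8 pays for the passage from s to t and leaves the
      1/2 that halves W.\<close>
    also have "\<dots> = ennreal (1 / 2) * (ennreal t * emeasure lborel {x. t < norm (bil K u g x)})"
    proof -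
      have "ennreal s * ennreal (1 / 8) = ennreal (s * (1 / 8))" using s by (intro ennreal_mult'[symmetric]) simp
      also have "s * (1 / 8) = 1 / 2 * t" using t by simp
      also have "ennreal (1 / 2 * t) = ennreal (1 / 2) * ennreal t" by (rule ennreal_mult') simp
      finally show ?thesis by (simp only: mult.assoc[symmetric])
    qed
    also have "\<dots> \<le> ennreal (1 / 2) * ennreal (W * (LINT x|lborel. norm (u x)))"
      by (intro mult_left_mono IH u t) auto
    also have "\<dots> \<le> ennreal (1 / 2) * ennreal (W * N)"
      using u(4) W by (intro mult_left_mono ennreal_leI) (auto simp: N_def)
    also have "\<dots> = ennreal (1 / 2 * (W * N))" by (rule ennreal_mult'[symmetric]) simp
    also have "1 / 2 * (W * N) = W / 2 * N" by simp
    finally show ?thesis .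
  qed
  from bchoice[OF \<Q>(3)] obtain p where p: "\<forall>Q\<in>\<Q>. Q = dyadic_cube (fst (p Q)) (snd (p Q))" by (rule exE)
  define kf where "kf Q = fst (p Q)" for Q
  define cf where "cf Q = snd (p Q)" for Q
  have kc: "Q = dyadic_cube (kf Q) (cf Q)" if "Q \<in> \<Q>" for Q
    using p that unfolding kf_def cf_def by (rule bspec)
  define r where "r Q = real DIM('a) * 2 powi (- kf Q)" for Q
  have r: "r Q > 0" for Q by (simp add: r_def)
  have Qb [measurable]: "Q \<in> sets borel" if "Q \<in> \<Q>" for Q by (subst kc[OF that]) simp
  \<comment> \<open>Radius 3r is more than the 2r required by \<open>bad_part\<close>; it matches
    the ball whose volume is already compared with the cube.\<close>
  define X where "X = (\<Union>Q\<in>\<Q>. cball (cf Q) (3 * r Q))"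
  have [measurable]: "X \<in> sets borel" unfolding X_def using \<Q>(1) by (intro sets.finite_UN) auto
  have Xm: "emeasure lborel X \<le> ennreal (U / w * N)"
  proof -
    have "emeasure lborel X \<le> (\<Sum>Q\<in>\<Q>. emeasure lborel (cball (cf Q) (3 * r Q)))"
      unfolding X_def using \<Q>(1) by (intro emeasure_subadditive_finite) auto
    also have "\<dots> = (\<Sum>Q\<in>\<Q>. ennreal (V * measure lborel Q))"
    proof (intro sum.cong refl)
      fix Q assume Q: "Q \<in> \<Q>"
      show "emeasure lborel (cball (cf Q) (3 * r Q)) = ennreal (V * measure lborel Q)"
        using emeasure_cball_dyadic[of "cf Q" "kf Q" "cf Q"] unfolding V_def r_def kc[OF Q, symmetric] .
    qed
    also have "\<dots> = ennreal (V * (\<Sum>Q\<in>\<Q>. measure lborel Q))"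
      using V by (simp add: sum_ennreal sum_distrib_left)
    also have "\<dots> \<le> ennreal (V * (N / h))"
      using vol h V by (intro ennreal_leI mult_left_mono) (auto simp: N_def field_simps)
    also have "V * (N / h) = U / w * N" by (simp add: UV(1) h_def)
    finally show ?thesis .
  qed
  define bQ where "bQ Q x = indicator Q x * b x" for Q x
  have bQm [measurable]: "bQ Q \<in> borel_measurable borel" if "Q \<in> \<Q>" for Q
    unfolding bQ_def[abs_def] using Qb[OF that] by measurable
  have wfw: "0 \<le> wf + w" using bw[of 0] norm_ge_zero order_trans by blast
  have bQw: "norm (bQ Q x) \<le> wf + w" for Q x using bw wfw by (simp add: bQ_def indicator_def)
  have ind1: "(\<Sum>Q\<in>\<Q>. indicator Q x) = (1::'c::comm_semiring_1)" if x: "x \<in> \<Union>\<Q>" for x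
  proof -
    obtain Q where Q: "Q \<in> \<Q>" "x \<in> Q" using x by auto
    have "(\<Sum>R\<in>\<Q>. indicator R x :: 'c) = (\<Sum>R\<in>{Q}. indicator R x)"
      using Q \<Q>(1,2) by (intro sum.mono_neutral_right) (auto simp: indicator_def disjoint_def)
    then show ?thesis using Q by simp
  qed
  have bsum: "b x = (\<Sum>Q\<in>\<Q>. bQ Q x)" for x
    by (cases "x \<in> \<Union>\<Q>") (simp_all add: bQ_def sum_distrib_right[symmetric] ind1 u(5) b_def)
  have nbsum: "(\<Sum>Q\<in>\<Q>. ennreal (norm (bQ Q x))) = ennreal (norm (b x))" for x
  proof -
    have "(\<Sum>Q\<in>\<Q>. norm (bQ Q x)) = (\<Sum>Q\<in>\<Q>. indicator Q x) * norm (b x)"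
      unfolding sum_distrib_right by (intro sum.cong) (auto simp: bQ_def norm_mult indicator_def)
    also have "\<dots> = norm (b x)"
      by (cases "x \<in> \<Union>\<Q>") (simp_all add: ind1 u(5) b_def)
    finally show ?thesis by (simp add: sum_ennreal)
  qed
  have Sb: "bil K b g x = (\<Sum>Q\<in>\<Q>. bil K (bQ Q) g x)" for x
    unfolding bsum[abs_def] by (rule bil_sum_right[OF K_integrable]) (use bQw g in auto)
  have bnorm: "(\<integral>\<^sup>+x. ennreal (norm (b x)) \<partial>lborel) \<le> ennreal (2 * N)"
  proof -
    have "(\<integral>\<^sup>+x. ennreal (norm (b x)) \<partial>lborel) \<le> (\<integral>\<^sup>+x. ennreal (norm (f x)) + ennreal (norm (u x)) \<partial>lborel)"
      unfolding b_def by (intro nn_integral_mono)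
       (simp add: ennreal_plus[symmetric] norm_triangle_ineq4 del: ennreal_plus)
    also have "\<dots> = ennreal N + ennreal (LINT x|lborel. norm (u x))"
      by (subst nn_integral_add) (auto simp: nn_norm_integrable fint u(1) N_def)
    also have "\<dots> \<le> ennreal N + ennreal N" using u(4) by (intro add_mono ennreal_leI) (auto simp: N_def)
    also have "\<dots> = ennreal (2 * N)" using N0 by (simp add: ennreal_plus[symmetric] del: ennreal_plus)
    finally show ?thesis .
  qed
  have off: "(\<integral>\<^sup>+x. indicator (- X) x * ennreal (norm (bil K b g x)) \<partial>lborel) \<le> ennreal (2 * H * N)"
  proof -
    let ?I = "\<lambda>Q. {x. 2 * r Q \<le> norm (x - cf Q)}"
    have "(\<integral>\<^sup>+x. indicator (- X) x * ennreal (norm (bil K b g x)) \<partial>lborel)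
      \<le> (\<integral>\<^sup>+x. (\<Sum>Q\<in>\<Q>. indicator (?I Q) x * ennreal (norm (bil K (bQ Q) g x))) \<partial>lborel)"
    proof (rule nn_integral_mono)
      fix x
      show "indicator (- X) x * ennreal (norm (bil K b g x)) \<le> (\<Sum>Q\<in>\<Q>. indicator (?I Q) x * ennreal (norm (bil K (bQ Q) g x)))"
      proof (cases "x \<in> X")
        case False
        have "2 * r Q \<le> norm (x - cf Q)" if "Q \<in> \<Q>" for Q
          using False that r[of Q] by (auto simp: X_def dist_norm norm_minus_commute not_le)
        then have "(\<Sum>Q\<in>\<Q>. indicator (?I Q) x * ennreal (norm (bil K (bQ Q) g x))) = (\<Sum>Q\<in>\<Q>. ennreal (norm (bil K (bQ Q) g x)))"
          by (intro sum.cong) auto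
        moreover have "norm (bil K b g x) \<le> (\<Sum>Q\<in>\<Q>. norm (bil K (bQ Q) g x))" unfolding Sb by (rule norm_sum)
        ultimately show ?thesis by (simp add: sum_ennreal ennreal_leI indicator_def)
      qed simp
    qed
    also have "\<dots> = (\<Sum>Q\<in>\<Q>. \<integral>\<^sup>+x. indicator (?I Q) x * ennreal (norm (bil K (bQ Q) g x)) \<partial>lborel)"
      by (intro nn_integral_sum) measurable
    also have "\<dots> \<le> (\<Sum>Q\<in>\<Q>. ennreal H * (\<integral>\<^sup>+x. ennreal (norm (bQ Q x)) \<partial>lborel))"
    proof (intro sum_mono bad_part[OF bQm _ r _ bQw g])
      fix Q assume Q: "Q \<in> \<Q>"
      show "Q \<in> \<Q>" "g \<in> borel_measurable borel" by fact+
      show "(LINT z|lborel. bQ Q z) = 0" using uQ[OF Q] by (simp add: bQ_def b_def)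
      fix z assume "bQ Q z \<noteq> 0"
      then have "z \<in> Q" by (auto simp: bQ_def indicator_def split: if_splits)
      then have "z \<in> dyadic_cube (kf Q) (cf Q)" using kc[OF Q] by simp
      then show "norm (z - cf Q) \<le> r Q" unfolding r_def by (rule dyadic_cube_dist)
    qed
    also have "\<dots> = ennreal H * (\<integral>\<^sup>+x. (\<Sum>Q\<in>\<Q>. ennreal (norm (bQ Q x))) \<partial>lborel)"
      by (subst nn_integral_sum) (auto simp: sum_distrib_left)
    also have "\<dots> \<le> ennreal H * ennreal (2 * N)" unfolding nbsum by (intro mult_left_mono bnorm) auto
    also have "\<dots> = ennreal (2 * H * N)" using H_nonneg by (simp add: ennreal_mult'[symmetric] mult_ac)
    finally show ?thesis .
  qed
  have part2: "ennreal s * emeasure lborel {x. 2 * t < norm (bil K b g x)} \<le> ennreal (s * (U / w * N) + 4 * H * N)"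
  proof -
    let ?S = "{x. 2 * t < norm (bil K b g x)}"
    have [measurable]: "?S \<in> sets borel" by measurable
    have "ennreal s * emeasure lborel ?S \<le> ennreal s * (emeasure lborel X + emeasure lborel (?S - X))"
      by (intro mult_left_mono order_trans[OF emeasure_mono emeasure_subadditive]) auto
    also have "\<dots> = ennreal s * emeasure lborel X + ennreal 2 * (ennreal (2 * t) * emeasure lborel (?S - X))"
      using t by (simp add: distrib_left mult.assoc[symmetric] ennreal_mult'[symmetric] del: ennreal_numeral)
    also have "\<dots> \<le> ennreal s * ennreal (U / w * N) + ennreal 2 * ennreal (2 * H * N)"
    proof (intro add_mono mult_left_mono Xm)
      have "ennreal (2 * t) * emeasure lborel (?S - X) \<le> (\<integral>\<^sup>+x. indicator (- X) x * ennreal (norm (bil K b g x)) \<partial>lborel)"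
        by (rule markov_le) (auto intro!: ennreal_leI)
      also note off
      finally show "ennreal (2 * t) * emeasure lborel (?S - X) \<le> ennreal (2 * H * N)" .
    qed auto
    also have "\<dots> = ennreal (s * (U / w * N) + 4 * H * N)"
      using s U_pos w N0 H_nonneg
      by (simp add: ennreal_mult'[symmetric] ennreal_plus[symmetric] mult_ac del: ennreal_plus ennreal_numeral)
    finally show ?thesis .
  qed
  have "ennreal s * emeasure lborel {x. s < norm (bil K f g x)}
    \<le> ennreal s * (emeasure lborel {x. 2 * t < norm (bil K u g x)} + emeasure lborel {x. 2 * t < norm (bil K b g x)})"
  proof (intro mult_left_mono order_trans[OF emeasure_mono emeasure_subadditive])
    show "{x. s < norm (bil K f g x)} \<subseteq> {x. 2 * t < norm (bil K u g x)} \<union> {x. 2 * t < norm (bil K b g x)}"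
    proof
      fix x assume "x \<in> {x. s < norm (bil K f g x)}"
      then have "4 * t < norm (bil K u g x) + norm (bil K b g x)"
        using norm_triangle_ineq[of "bil K u g x" "bil K b g x"] t by (simp add: split)
      then show "x \<in> {x. 2 * t < norm (bil K u g x)} \<union> {x. 2 * t < norm (bil K b g x)}" by auto
    qed
  qed auto
  also have "\<dots> \<le> ennreal (W / 2 * N) + ennreal (s * (U / w * N) + 4 * H * N)"
    unfolding distrib_left by (intro add_mono part1 part2)
  also have "\<dots> = ennreal ((W / 2 + weak_const / 2) * N)"
  proof -
    have "s * (U / w * N) = 4 * U * (32 * B * U + 2 * H) * N"
      using t w by (simp add: w_def \<eta>_def field_simps)
    then have "W / 2 * N + (s * (U / w * N) + 4 * H * N) = (W / 2 + weak_const / 2) * N"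
      by (simp add: weak_const_def algebra_simps)
    moreover have "0 \<le> W / 2 * N" "0 \<le> s * (U / w * N) + 4 * H * N"
      using W N0 s U_pos w H_nonneg by auto
    ultimately show ?thesis by (simp add: ennreal_plus[symmetric] del: ennreal_plus)
  qed
  finally show ?thesis by (simp add: N_def)
qed

text \<open>The starting constant is \<open>weak_const\<close> plus the L^1 norm \<open>W0\<close>
  of the kernel. Each step halves the excess over \<open>weak_const\<close>, and the limit removes
  \<open>W0\<close>, the only quantity in which the size of the truncation enters.\<close>

lemma weak_type_dyadic:
  assumes [measurable]: "g \<in> borel_measurable borel" and g: "\<And>x. norm (g x) \<le> 1"
    and fint: "integrable lborel f" and step: "\<And>x y. y \<in> dyadic_cube M x \<Longrightarrow> f y = f x" and s: "s > 0"
  shows "ennreal s * emeasure lborel {x. s < norm (bil K f g x)} \<le> ennreal (weak_const * (LINT x|lborel. norm (f x)))"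
proof -
  define W0 where "W0 = (LINT y|lborel. norm (K y))"
  have wc: "weak_const \<ge> 0" unfolding weak_const_def using U_pos H_nonneg B_pos by simp
  have W0: "W0 \<ge> 0" by (simp add: W0_def)
  have iter: "ennreal s * emeasure lborel {x. s < norm (bil K f g x)} \<le> ennreal ((weak_const + W0 / 2 ^ n) * (LINT x|lborel. norm (f x)))"
    if "integrable lborel f" "\<And>x y. y \<in> dyadic_cube M x \<Longrightarrow> f y = f x" "s > 0" for n f s
    using that
  proof (induction n arbitrary: f s)
    case 0
    have [measurable]: "f \<in> borel_measurable borel" using 0 by auto
    have "ennreal s * emeasure lborel {x. s < norm (bil K f g x)} \<le> (\<integral>\<^sup>+x. ennreal (norm (bil K f g x)) \<partial>lborel)"
      by (rule markov_le) (auto intro!: ennreal_leI)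
    also have "\<dots> \<le> (\<integral>\<^sup>+y. ennreal (norm (K y)) \<partial>lborel) * (\<integral>\<^sup>+x. ennreal (norm (f x)) \<partial>lborel)"
      by (rule bil_L1_bound) (use g in auto)
    also have "\<dots> = ennreal (W0 * (LINT x|lborel. norm (f x)))"
      using W0 by (simp add: nn_norm_integrable 0(1) K_integrable W0_def ennreal_mult')
    also have "\<dots> \<le> ennreal ((weak_const + W0 / 2 ^ 0) * (LINT x|lborel. norm (f x)))"
      using wc by (intro ennreal_leI mult_right_mono) auto
    finally show ?case .
  next
    case (Suc n)
    have "ennreal s * emeasure lborel {x. s < norm (bil K f g x)}
      \<le> ennreal (((weak_const + W0 / 2 ^ n) / 2 + weak_const / 2) * (LINT x|lborel. norm (f x)))"
      by (rule weak_type_step[OF assms(1) g Suc.prems(1) _ Suc.prems(3)])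
         (use Suc wc W0 in \<open>auto\<close>)
    also have "(weak_const + W0 / 2 ^ n) / 2 + weak_const / 2 = weak_const + W0 / 2 ^ Suc n"
      by (simp add: field_simps)
    finally show ?case .
  qed
  have "(\<lambda>n. weak_const + W0 * (1/2) ^ n) \<longlonglongrightarrow> weak_const + W0 * 0"
    by (intro tendsto_intros LIMSEQ_realpow_zero) auto
  then have "(\<lambda>n. ennreal ((weak_const + W0 / 2 ^ n) * (LINT x|lborel. norm (f x)))) \<longlonglongrightarrow> ennreal (weak_const * (LINT x|lborel. norm (f x)))"
    by (intro tendsto_ennrealI tendsto_mult_right) (simp add: power_one_over field_simps)
  then show ?thesis by (rule LIMSEQ_le_const) (use iter[OF fint step s] in auto)
qed

text \<open>A uniform error \<epsilon> in \<open>f\<close> changes the output by at most \<kappa>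
  \<epsilon>, with \<kappa> the L^1 norm of the kernel, so it lowers the level slightly. The level
  set E is kept fixed and has finite measure; therefore the inequality for real numbers
  \<open>key\<close> can be followed to the limit \<epsilon> \<rightarrow> 0.\<close>

lemma weak_type_approx:
  assumes [measurable]: "g \<in> borel_measurable borel" and g: "\<And>x. norm (g x) \<le> 1"
    and fint: "integrable lborel f" and fw: "\<And>x. norm (f x) \<le> w" and t: "t > 0"
    and approx: "\<And>\<epsilon>. \<epsilon> > 0 \<Longrightarrow> \<exists>f' M. integrable lborel f' \<and> (\<forall>x y. y \<in> dyadic_cube M x \<longrightarrow> f' y = f' x) \<and>
       (\<forall>x. norm (f' x - f x) \<le> \<epsilon>) \<and> (LINT x|lborel. norm (f' x)) \<le> (LINT x|lborel. norm (f x)) + \<epsilon>"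
  shows "ennreal t * emeasure lborel {x. t < norm (bil K f g x)} \<le> ennreal (weak_const * (LINT x|lborel. norm (f x)))"
proof -
  have [measurable]: "f \<in> borel_measurable borel" using fint by auto
  have wc: "weak_const \<ge> 0" unfolding weak_const_def using U_pos H_nonneg B_pos by simp
  define \<kappa> where "\<kappa> = (LINT y|lborel. norm (K y))"
  have \<kappa>: "\<kappa> \<ge> 0" by (simp add: \<kappa>_def)
  define N where "N = (LINT x|lborel. norm (f x))"
  have N: "N \<ge> 0" by (simp add: N_def)
  define E where "E = {x. t < norm (bil K f g x)}"
  have [measurable]: "E \<in> sets borel" unfolding E_def by measurable
  have "ennreal t * emeasure lborel E \<le> (\<integral>\<^sup>+x. ennreal (norm (bil K f g x)) \<partial>lborel)"
    by (rule markov_le) (auto simp: E_def intro!: ennreal_leI)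
  also have "\<dots> \<le> (\<integral>\<^sup>+y. ennreal (norm (K y)) \<partial>lborel) * (\<integral>\<^sup>+x. ennreal (norm (f x)) \<partial>lborel)"
    by (rule bil_L1_bound) (use g in auto)
  also have "\<dots> < \<infinity>"
    using fint K_integrable by (auto simp: integrable_iff_bounded ennreal_mult_less_top)
  finally have finE: "emeasure lborel E < \<infinity>" using t by (auto simp: ennreal_mult_less_top)
  define e where "e = measure lborel E"
  have emE: "emeasure lborel E = ennreal e" unfolding e_def using finE by (intro emeasure_eq_ennreal_measure) auto
  have e0: "e \<ge> 0" by (simp add: e_def)
  have key: "(t - \<kappa> * \<epsilon>) * e \<le> weak_const * (N + \<epsilon>)" if \<epsilon>: "\<epsilon> > 0" for \<epsilon>
  proof (cases "t - \<kappa> * \<epsilon> > 0")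
    case True
    obtain f' M where f': "integrable lborel f'" "\<forall>x y. y \<in> dyadic_cube M x \<longrightarrow> f' y = f' x"
      "\<forall>x. norm (f' x - f x) \<le> \<epsilon>" "(LINT x|lborel. norm (f' x)) \<le> N + \<epsilon>"
      using approx[OF \<epsilon>] unfolding N_def by blast
    have [measurable]: "f' \<in> borel_measurable borel" using f' by auto
    have dw: "norm (f' x - f x) \<le> \<epsilon>" for x using f'(3) by blast
    have f'w: "norm (f' x) \<le> w + \<epsilon>" for x
      using dw[of x] fw[of x] norm_triangle_sub[of "f' x" "f x"] by simp
    have sub: "E \<subseteq> {x. t - \<kappa> * \<epsilon> < norm (bil K f' g x)}"
    proof
      fix x assume "x \<in> E"
      have "bil K (\<lambda>x. f' x - f x) g x = bil K f' g x - bil K f g x"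
        by (rule bil_diff[OF K_integrable _ _ _ f'w fw g]) measurable
      moreover have "norm (bil K (\<lambda>x. f' x - f x) g x) \<le> \<kappa> * (\<epsilon> * 1)"
        unfolding \<kappa>_def by (rule bil_norm_bound[OF K_integrable _ _ dw g]) measurable
      ultimately have "norm (bil K f g x) \<le> norm (bil K f' g x) + \<kappa> * \<epsilon>"
        using norm_triangle_sub[of "bil K f g x" "bil K f' g x"] by (simp add: norm_minus_commute)
      then show "x \<in> {x. t - \<kappa> * \<epsilon> < norm (bil K f' g x)}" using \<open>x \<in> E\<close> by (simp add: E_def)
    qed
    have "ennreal ((t - \<kappa> * \<epsilon>) * e) = ennreal (t - \<kappa> * \<epsilon>) * emeasure lborel E"
      using True by (simp add: emE ennreal_mult')
    also have "\<dots> \<le> ennreal (t - \<kappa> * \<epsilon>) * emeasure lborel {x. t - \<kappa> * \<epsilon> < norm (bil K f' g x)}"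
      using sub by (intro mult_left_mono emeasure_mono) auto
    also have "\<dots> \<le> ennreal (weak_const * (LINT x|lborel. norm (f' x)))"
      by (rule weak_type_dyadic[where M=M, OF assms(1) g f'(1) _ True]) (use f'(2) in blast)
    also have "\<dots> \<le> ennreal (weak_const * (N + \<epsilon>))"
      using f'(4) wc by (intro ennreal_leI mult_left_mono)
    finally show ?thesis using wc N \<epsilon> by (subst (asm) ennreal_le_iff) auto
  next
    case False
    then have "(t - \<kappa> * \<epsilon>) * e \<le> 0" using e0 by (simp add: mult_nonpos_nonneg)
    also have "0 \<le> weak_const * (N + \<epsilon>)" using wc N \<epsilon> by simp
    finally show ?thesis .
  qed
  have "t * e \<le> weak_const * N"
  proof (rule field_le_epsilon)
    fix \<delta> :: real assume \<delta>: "\<delta> > 0"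
    \<comment> \<open>With \<epsilon> = \<delta> / c the total error \<epsilon> (\<kappa> e +
      \<open>weak_const\<close>) stays below \<delta>; the summand 1 keeps c positive.\<close>
    define c where "c = \<kappa> * e + weak_const + 1"
    have c: "c > 0" using \<kappa> e0 wc by (simp add: c_def add_nonneg_pos)
    have "t * e \<le> weak_const * N + (\<delta> / c) * (\<kappa> * e + weak_const)"
      using key[of "\<delta> / c"] \<delta> c by (simp add: algebra_simps)
    also have "(\<delta> / c) * (\<kappa> * e + weak_const) \<le> (\<delta> / c) * c"
      using \<delta> c by (intro mult_left_mono) (auto simp: c_def)
    also have "(\<delta> / c) * c = \<delta>" using c by simp
    finally show "t * e \<le> weak_const * N + \<delta>" by simp
  qed
  then show ?thesis using t by (simp add: E_def[symmetric] emE ennreal_mult'[symmetric] N_def ennreal_leI)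
qed

end

section \<open>Schwartz functions\<close>

lemma iter_partial_append: "iter_partial bs (iter_partial cs f) = iter_partial (bs @ cs) f"
  by (induction bs) auto

lemma schwartz_iter_partial:
  assumes "schwartz f" "cs \<in> lists Basis"
  shows "schwartz (iter_partial cs f)"
  using assms unfolding schwartz_def iter_partial_append by (metis append_in_lists_conv)

lemma schwartz_differentiable: "schwartz f \<Longrightarrow> f differentiable (at x)"
  unfolding schwartz_def by (metis iter_partial.simps(1) lists.Nil)

lemma schwartz_continuous: "schwartz f \<Longrightarrow> continuous_on UNIV f"
  by (intro continuous_at_imp_continuous_on ballI differentiable_imp_continuous_within schwartz_differentiable)

lemma schwartz_borel [measurable_dest]: "schwartz f \<Longrightarrow> f \<in> borel_measurable borel"
  by (intro borel_measurable_continuous_onI schwartz_continuous)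

text \<open>The definition bounds each power of |x| separately; the binomial formula combines them
  into the weight (1 + |x|)^m, which is also useful near the origin.\<close>

lemma schwartz_decay:
  assumes "schwartz f"
  obtains C where "C \<ge> 0" "\<And>x. norm (f x) * (1 + norm x) ^ m \<le> C"
proof -
  have "\<exists>C. \<forall>x. norm x ^ k * norm (f x) \<le> C" for k
  proof -
    have "bounded (range (\<lambda>x. of_real (norm x ^ k) * f x))"
      using assms unfolding schwartz_def by (metis iter_partial.simps(1) lists.Nil)
    then obtain C where "\<forall>y\<in>range (\<lambda>x. of_real (norm x ^ k) * f x). norm y \<le> C" unfolding bounded_iff by blast
    then have "\<forall>x. norm x ^ k * norm (f x) \<le> C" by (auto simp: norm_mult norm_power)
    then show ?thesis by blast
  qed
  then obtain c where c: "\<And>k x. norm x ^ k * norm (f x) \<le> c k" by metis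
  have "norm (f x) * (1 + norm x) ^ m \<le> (\<Sum>k\<le>m. of_nat (m choose k) * c k)" for x
  proof -
    have "norm (f x) * (1 + norm x) ^ m = (\<Sum>k\<le>m. of_nat (m choose k) * (norm x ^ k * norm (f x)))"
      unfolding add.commute[of 1] binomial_ring by (simp add: sum_distrib_left mult_ac)
    also have "\<dots> \<le> (\<Sum>k\<le>m. of_nat (m choose k) * c k)" by (intro sum_mono mult_left_mono c) auto
    finally show ?thesis .
  qed
  then show ?thesis using that[of "max 0 (\<Sum>k\<le>m. of_nat (m choose k) * c k)"] by (simp add: le_max_iff_disj)
qed

lemma schwartz_bounded: "schwartz f \<Longrightarrow> \<exists>C\<ge>0. \<forall>x. norm (f x) \<le> C"
  by (rule schwartz_decay[of f 0]) auto

lemma frechet_derivative_basis: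
  fixes f :: "'a::euclidean_space \<Rightarrow> complex"
  assumes "f differentiable (at x)"
  shows "frechet_derivative f (at x) v = (\<Sum>b\<in>Basis. (v \<bullet> b) *\<^sub>R iter_partial [b] f x)"
proof -
  have lin: "linear (frechet_derivative f (at x))" using assms by (rule linear_frechet_derivative)
  have "frechet_derivative f (at x) v = frechet_derivative f (at x) (\<Sum>b\<in>Basis. (v \<bullet> b) *\<^sub>R b)"
    by (simp add: euclidean_representation)
  also have "\<dots> = (\<Sum>b\<in>Basis. (v \<bullet> b) *\<^sub>R frechet_derivative f (at x) b)"
    using lin by (simp add: linear_sum linear_scale)
  finally show ?thesis by simp
qed

lemma norm_sum_basis_le:
  fixes c :: "'a::euclidean_space \<Rightarrow> complex"
  shows "norm (\<Sum>b\<in>Basis. (v \<bullet> b) *\<^sub>R c b) \<le> norm v * (\<Sum>b\<in>Basis. norm (c b))"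
proof -
  have "norm (\<Sum>b\<in>Basis. (v \<bullet> b) *\<^sub>R c b) \<le> (\<Sum>b\<in>Basis. norm ((v \<bullet> b) *\<^sub>R c b))" by (rule norm_sum)
  also have "\<dots> \<le> (\<Sum>b\<in>Basis. norm v * norm (c b))"
    by (intro sum_mono) (auto intro!: mult_right_mono simp: Basis_le_norm)
  finally show ?thesis by (simp add: sum_distrib_left)
qed

text \<open>The mean value inequality in two ranges. For |v| \<le> 1 the weight survives, since 1 +
  |x| \<le> 2(1 + |y|) for y in the unit ball around x; for arbitrary v only the unweighted
  Lipschitz bound is kept.\<close>

lemma schwartz_diff_bound:
  fixes f :: "'a::euclidean_space \<Rightarrow> complex"
  assumes f: "schwartz f"
  shows "\<exists>C\<ge>0. (\<forall>x v. norm v \<le> 1 \<longrightarrow> norm (f (x + v) - f x) * (1 + norm x) ^ m \<le> C * norm v) \<and>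
    (\<forall>x v. norm (f (x + v) - f x) \<le> C * norm v)"
proof -
  have "\<exists>C\<ge>0. \<forall>x. norm (iter_partial [b] f x) * (1 + norm x) ^ m \<le> C" if "b \<in> Basis" for b :: 'a
    using schwartz_decay[OF schwartz_iter_partial[OF f, of "[b]"], of m] that by auto
  then obtain c where c: "\<And>b. b \<in> Basis \<Longrightarrow> c b \<ge> 0"
    "\<And>b x. b \<in> Basis \<Longrightarrow> norm (iter_partial [b] f x) * (1 + norm x) ^ m \<le> c b" by metis
  define C where "C = (\<Sum>b\<in>(Basis::'a set). c b)"
  have C: "C \<ge> 0" unfolding C_def by (intro sum_nonneg c)
  have D: "norm (frechet_derivative f (at x) v) * (1 + norm x) ^ m \<le> C * norm v" for x v
  proof -
    have "norm (frechet_derivative f (at x) v) * (1 + norm x) ^ m \<le> norm v * (\<Sum>b\<in>Basis. norm (iter_partial [b] f x)) * (1 + norm x) ^ m"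
      unfolding frechet_derivative_basis[OF schwartz_differentiable[OF f]]
      by (intro mult_right_mono norm_sum_basis_le) auto
    also have "\<dots> = norm v * (\<Sum>b\<in>Basis. norm (iter_partial [b] f x) * (1 + norm x) ^ m)"
      by (simp add: sum_distrib_right)
    also have "\<dots> \<le> norm v * C" unfolding C_def by (intro mult_left_mono sum_mono c) auto
    finally show ?thesis by (simp add: mult.commute)
  qed
  have hd: "(f has_derivative frechet_derivative f (at x)) (at x within S)" for x S
    using schwartz_differentiable[OF f, of x] by (auto simp: frechet_derivative_works intro: has_derivative_at_withinI)
  have glob: "norm (f (x + v) - f x) \<le> C * norm v" for x v
  proof -
    have "norm (f (x + v) - f x) \<le> C * norm (x + v - x)"
    proof (rule differentiable_bound[where S=UNIV and f'="\<lambda>x. frechet_derivative f (at x)"])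
      fix y
      show "onorm (frechet_derivative f (at y)) \<le> C"
      proof (rule onorm_le)
        fix u
        have "norm (frechet_derivative f (at y) u) * 1 \<le> norm (frechet_derivative f (at y) u) * (1 + norm y) ^ m"
          by (intro mult_left_mono) auto
        with D[of y u] show "norm (frechet_derivative f (at y) u) \<le> C * norm u" by simp
      qed
    qed (use hd in auto)
    then show ?thesis by simp
  qed
  have loc: "norm (f (x + v) - f x) * (1 + norm x) ^ m \<le> (2 ^ m * C) * norm v" if v: "norm v \<le> 1" for x v
  proof -
    have "norm (f (x + v) - f x) \<le> (2 ^ m * C / (1 + norm x) ^ m) * norm (x + v - x)"
    proof (rule differentiable_bound[where S="cball x 1" and f'="\<lambda>x. frechet_derivative f (at x)"])
      fix y assume y: "y \<in> cball x 1"
      have "norm x \<le> norm y + norm (x - y)" using norm_triangle_sub by blast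
      moreover have "norm (x - y) \<le> 1" using y by (simp add: dist_norm norm_minus_commute)
      ultimately have "1 + norm x \<le> 2 * (1 + norm y)" by (smt (verit) norm_ge_zero)
      then have p: "(1 + norm x) ^ m \<le> (2 * (1 + norm y)) ^ m" by (intro power_mono) auto
      show "onorm (frechet_derivative f (at y)) \<le> 2 ^ m * C / (1 + norm x) ^ m"
      proof (rule onorm_le)
        fix u
        have "norm (frechet_derivative f (at y) u) * (1 + norm x) ^ m \<le> norm (frechet_derivative f (at y) u) * (2 * (1 + norm y)) ^ m"
          by (intro mult_left_mono p) auto
        also have "\<dots> = 2 ^ m * (norm (frechet_derivative f (at y) u) * (1 + norm y) ^ m)"
          by (simp only: power_mult_distrib mult_ac)
        also have "\<dots> \<le> 2 ^ m * (C * norm u)" by (intro mult_left_mono D) auto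
        finally show "norm (frechet_derivative f (at y) u) \<le> 2 ^ m * C / (1 + norm x) ^ m * norm u"
          by (simp add: pos_le_divide_eq add_pos_nonneg mult.assoc)
      qed
    qed (use hd v in \<open>auto simp: dist_norm\<close>)
    then show ?thesis by (simp add: pos_le_divide_eq add_pos_nonneg)
  qed
  have "norm (f (x + v) - f x) \<le> 2 ^ m * C * norm v" for x v
  proof -
    have "C * norm v \<le> 2 ^ m * C * norm v" using C by (intro mult_right_mono) (auto simp: mult_le_cancel_right1)
    with glob[of x v] show ?thesis by linarith
  qed
  then show ?thesis using C loc by (intro exI[of _ "2 ^ m * C"]) simp
qed

section \<open>Integrability and approximation of Schwartz functions\<close>

definition weight :: "'a::euclidean_space \<Rightarrow> real" where
  "weight x = 1 / (1 + norm x) ^ (2 * DIM('a))"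

lemma weight_nonneg [simp]: "0 \<le> weight x" by (simp add: weight_def)

lemma weight_borel [measurable]: "weight \<in> borel_measurable borel"
  unfolding weight_def[abs_def] by measurable

text \<open>The exponent twice the dimension makes \<open>weight\<close> at most the product over
  coordinates of 1 / (1 + t^2), and that integral splits into finite one-dimensional ones.\<close>

lemma integrable_weight: "integrable lborel (weight :: 'a::euclidean_space \<Rightarrow> real)"
proof (rule integrableI_bounded)
  have line: "(\<integral>\<^sup>+t. ennreal (inverse (1 + t\<^sup>2)) \<partial>lborel) < \<infinity>"
  proof -
    have "set_integrable lborel UNIV (\<lambda>x::real. inverse (1 + x\<^sup>2))"
      using integrable_inverse_1_plus_square by (simp add: einterval_def)
    then have "integrable lborel (\<lambda>x::real. inverse (1 + x\<^sup>2))" by (simp add: set_integrable_def)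
    moreover have "norm (inverse (1 + x\<^sup>2)) = inverse (1 + x\<^sup>2)" for x :: real by (simp add: add_nonneg_nonneg)
    ultimately show ?thesis by (simp add: integrable_iff_bounded)
  qed
  have "(\<integral>\<^sup>+x. ennreal (norm (weight (x::'a))) \<partial>lborel) \<le> (\<integral>\<^sup>+x. (\<Prod>b\<in>(Basis::'a set). ennreal (inverse (1 + (x \<bullet> b)\<^sup>2))) \<partial>lborel)"
  proof (rule nn_integral_mono)
    fix x :: 'a
    have "(\<Prod>b\<in>(Basis::'a set). 1 + (x \<bullet> b)\<^sup>2) \<le> (\<Prod>b\<in>(Basis::'a set). (1 + norm x)\<^sup>2)"
    proof (rule prod_mono)
      fix b :: 'a assume "b \<in> Basis"
      then have "(x \<bullet> b)\<^sup>2 \<le> (norm x)\<^sup>2" by (metis Basis_le_norm abs_le_square_iff abs_norm_cancel)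
      then have "1 + (x \<bullet> b)\<^sup>2 \<le> 1 + (norm x)\<^sup>2" by simp
      also have "\<dots> \<le> (1 + norm x)\<^sup>2" by (simp add: power2_sum)
      finally show "0 \<le> 1 + (x \<bullet> b)\<^sup>2 \<and> 1 + (x \<bullet> b)\<^sup>2 \<le> (1 + norm x)\<^sup>2" by simp
    qed
    also have "\<dots> = (1 + norm x) ^ (2 * DIM('a))" by (simp add: power_mult)
    finally have "weight x \<le> inverse (\<Prod>b\<in>(Basis::'a set). 1 + (x \<bullet> b)\<^sup>2)"
      unfolding weight_def inverse_eq_divide
      by (intro divide_left_mono) (auto intro!: prod_pos mult_pos_pos zero_less_power simp: add_pos_nonneg)
    also have "\<dots> = (\<Prod>b\<in>(Basis::'a set). inverse (1 + (x \<bullet> b)\<^sup>2))" by (simp add: prod_inversef[symmetric] comp_def)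
    finally show "ennreal (norm (weight x)) \<le> (\<Prod>b\<in>(Basis::'a set). ennreal (inverse (1 + (x \<bullet> b)\<^sup>2)))"
      by (subst prod_ennreal) (auto intro!: ennreal_leI simp: add_nonneg_nonneg)
  qed
  also have "\<dots> = (\<Prod>b\<in>(Basis::'a set). \<integral>\<^sup>+t. ennreal (inverse (1 + t\<^sup>2)) \<partial>lborel)"
    by (subst nn_integral_lborel_prod) auto
  also have "\<dots> < \<infinity>" using line by (simp add: less_top[symmetric] power_eq_top_ennreal)
  finally show "(\<integral>\<^sup>+x. ennreal (norm (weight (x::'a))) \<partial>lborel) < \<infinity>" .
qed simp

lemma schwartz_integrable:
  fixes f :: "'a::euclidean_space \<Rightarrow> complex"
  assumes f: "schwartz f"
  shows "integrable lborel f" "integrable lborel (\<lambda>x. norm x * norm (f x))"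
proof -
  have [measurable]: "f \<in> borel_measurable borel" using f by (rule schwartz_borel)
  obtain C where C: "C \<ge> 0" "\<And>x. norm (f x) * (1 + norm x) ^ (2 * DIM('a) + 1) \<le> C"
    using schwartz_decay[OF f, of "2 * DIM('a) + 1"] by auto
  have le: "(1 + norm x) * norm (f x) \<le> C * weight x" for x
    using C(2)[of x] by (simp add: weight_def pos_le_divide_eq add_pos_nonneg mult_ac)
  have Cw: "integrable lborel (\<lambda>x::'a. C * weight x)" using integrable_weight by auto
  have le1: "norm (f x) \<le> norm (C * weight x)" for x
    using le[of x] C(1) mult_right_mono[of 1 "1 + norm x" "norm (f x)"] by simp
  have le2: "norm (norm x * norm (f x)) \<le> norm (C * weight x)" for x
    using le[of x] C(1) mult_right_mono[of "norm x" "1 + norm x" "norm (f x)"] by simp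
  show "integrable lborel f"
    by (rule Bochner_Integration.integrable_bound[OF Cw]) (use le1 in auto)
  show "integrable lborel (\<lambda>x. norm x * norm (f x))"
    by (rule Bochner_Integration.integrable_bound[OF Cw]) (use le2 in auto)
qed

text \<open>Short shifts use the weighted difference bound against an integrable weight; for |v| > 1
  the triangle inequality suffices, since a constant is then at most that constant times
  |v|.\<close>

lemma schwartz_L1_smooth:
  fixes f :: "'a::euclidean_space \<Rightarrow> complex"
  assumes f: "schwartz f"
  shows "\<exists>C\<ge>0. \<forall>v. (\<integral>\<^sup>+x. ennreal (norm (f (x + v) - f x)) \<partial>lborel) \<le> ennreal (C * norm v)"
proof -
  have [measurable]: "f \<in> borel_measurable borel" using f by (rule schwartz_borel)
  obtain C where C0: "C \<ge> 0 \<and> (\<forall>x v. norm v \<le> 1 \<longrightarrow> norm (f (x + v) - f x) * (1 + norm x) ^ (2 * DIM('a)) \<le> C * norm v) \<and>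
    (\<forall>x v. norm (f (x + v) - f x) \<le> C * norm v)"
    using schwartz_diff_bound[OF f, of "2 * DIM('a)"] by (elim exE)
  have C: "C \<ge> 0" "\<And>x v. norm v \<le> 1 \<Longrightarrow> norm (f (x + v) - f x) * (1 + norm x) ^ (2 * DIM('a)) \<le> C * norm v"
    using C0 by simp_all
  define I where "I = (LINT x|lborel. weight (x::'a))"
  define N where "N = (LINT x|lborel. norm (f x))"
  have I: "I \<ge> 0" "N \<ge> 0" by (auto simp: I_def N_def)
  have "(\<integral>\<^sup>+x. ennreal (norm (f (x + v) - f x)) \<partial>lborel) \<le> ennreal ((C * I + 2 * N) * norm v)" for v
  proof (cases "norm v \<le> 1")
    case True
    have "(\<integral>\<^sup>+x. ennreal (norm (f (x + v) - f x)) \<partial>lborel) \<le> (\<integral>\<^sup>+x. ennreal (C * norm v) * ennreal (weight (x::'a)) \<partial>lborel)"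
    proof (rule nn_integral_mono)
      fix x
      have "norm (f (x + v) - f x) \<le> C * norm v * weight x"
        using C(2)[OF True, of x] by (simp add: weight_def pos_le_divide_eq add_pos_nonneg)
      then show "ennreal (norm (f (x + v) - f x)) \<le> ennreal (C * norm v) * ennreal (weight x)"
        using C(1) by (simp add: ennreal_mult'[symmetric] ennreal_leI)
    qed
    also have "\<dots> = ennreal (C * norm v) * ennreal I"
      unfolding I_def nn_integral_eq_integral[OF integrable_weight AE_I2[OF weight_nonneg], symmetric]
      by (rule nn_integral_cmult) measurable
    also have "\<dots> = ennreal (C * norm v * I)"
      using C(1) by (intro ennreal_mult'[symmetric]) simp
    also have "\<dots> \<le> ennreal ((C * I + 2 * N) * norm v)"
      using I by (intro ennreal_leI) (simp add: algebra_simps)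
    finally show ?thesis .
  next
    case False
    have "(\<integral>\<^sup>+x. ennreal (norm (f (x + v) - f x)) \<partial>lborel) \<le> (\<integral>\<^sup>+x. ennreal (norm (f (x + v))) + ennreal (norm (f x)) \<partial>lborel)"
      by (intro nn_integral_mono) (simp add: ennreal_plus[symmetric] norm_triangle_ineq4 del: ennreal_plus)
    also have "\<dots> = ennreal N + ennreal N"
      using nn_integral_lborel_shift[of "\<lambda>x. ennreal (norm (f x))" v]
      by (subst nn_integral_add) (auto simp: nn_norm_integrable[OF schwartz_integrable(1)[OF f]] N_def)
    also have "\<dots> = ennreal (2 * N)" using I by (simp add: ennreal_plus[symmetric] del: ennreal_plus)
    also have "2 * N \<le> (C * I + 2 * N) * norm v"
    proof -
      have "2 * N * 1 \<le> 2 * N * norm v" using False I by (intro mult_left_mono) auto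
      then show ?thesis using C(1) I by (simp add: algebra_simps add_increasing)
    qed
    finally show ?thesis using ennreal_leI by blast
  qed
  then show ?thesis using C(1) I by (intro exI[of _ "C * I + 2 * N"]) simp
qed

text \<open>Sampling \<open>f\<close> at one corner of each cube. The error is bounded by a small
  multiple of \<open>weight\<close>, which controls it uniformly and in L^1 at once.\<close>

lemma schwartz_dyadic_approx:
  fixes f :: "'a::euclidean_space \<Rightarrow> complex"
  assumes f: "schwartz f" and \<epsilon>: "\<epsilon> > 0"
  shows "\<exists>f' M. integrable lborel f' \<and> (\<forall>x y. y \<in> dyadic_cube M x \<longrightarrow> f' y = f' x) \<and>
       (\<forall>x. norm (f' x - f x) \<le> \<epsilon>) \<and> (LINT x|lborel. norm (f' x)) \<le> (LINT x|lborel. norm (f x)) + \<epsilon>"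
proof -
  have [measurable]: "f \<in> borel_measurable borel" using f by (rule schwartz_borel)
  obtain C where C0: "C \<ge> 0 \<and> (\<forall>x v. norm v \<le> 1 \<longrightarrow> norm (f (x + v) - f x) * (1 + norm x) ^ (2 * DIM('a)) \<le> C * norm v) \<and>
    (\<forall>x v. norm (f (x + v) - f x) \<le> C * norm v)"
    using schwartz_diff_bound[OF f, of "2 * DIM('a)"] by (elim exE)
  have C: "C \<ge> 0" "\<And>x v. norm v \<le> 1 \<Longrightarrow> norm (f (x + v) - f x) * (1 + norm x) ^ (2 * DIM('a)) \<le> C * norm v"
    using C0 by simp_all
  define I where "I = (LINT x|lborel. weight (x::'a))"
  have I: "I \<ge> 0" by (auto simp: I_def)
  define d where "d = real DIM('a)"
  \<comment> \<open>Any power 2^M above this number makes \<eta> = d / 2^M at most 1, so that the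
    weighted bound applies, and also makes C \<eta> (1 + I) \<le> \<epsilon>.\<close>
  define c where "c = d + d * C * (1 + I) / \<epsilon>"
  have d: "d > 0" by (simp add: d_def)
  obtain M :: nat where M: "c < 2 ^ M" using real_arch_pow[of 2 c] by auto
  have cc: "d \<le> c" "d * C * (1 + I) / \<epsilon> \<le> c" using d C I \<epsilon> by (auto simp: c_def)
  define \<eta> where "\<eta> = d / 2 ^ M"
  have e1: "\<eta> \<le> 1" using M cc by (simp add: \<eta>_def)
  have e2: "C * \<eta> * (1 + I) \<le> \<epsilon>"
  proof -
    have "d * C * (1 + I) / \<epsilon> \<le> 2 ^ M" using cc(2) M by simp
    then show ?thesis using \<epsilon> by (simp add: \<eta>_def field_simps)
  qed
  have e0: "\<eta> \<ge> 0" using d by (simp add: \<eta>_def)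
  \<comment> \<open>The corner of the cube with smallest coordinates; it depends on the cube only
    and belongs to it.\<close>
  define q where "q x = (\<Sum>b\<in>Basis. (of_int \<lfloor>2 powi (int M) * (x \<bullet> b)\<rfloor> / 2 powi (int M)) *\<^sub>R b)" for x :: 'a
  have [measurable]: "q \<in> borel_measurable borel" unfolding q_def[abs_def] by measurable
  have qcube: "q x \<in> dyadic_cube (int M) x" for x
    by (auto simp: dyadic_cube_def q_def inner_sum_left_Basis)
  have qn: "norm (q x - x) \<le> \<eta>" for x
    using dyadic_cube_dist[OF qcube, of x] by (simp add: \<eta>_def d_def power_int_minus divide_inverse)
  define f' where "f' x = f (q x)" for x
  have [measurable]: "f' \<in> borel_measurable borel" unfolding f'_def[abs_def] by measurable
  have diff: "norm (f' x - f x) \<le> C * \<eta> * weight x" for x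
  proof -
    have n1: "norm (q x - x) \<le> 1" using qn[of x] e1 by linarith
    have "norm (f' x - f x) * (1 + norm x) ^ (2 * DIM('a)) \<le> C * norm (q x - x)"
      using C(2)[OF n1, of x] by (simp add: f'_def)
    also have "\<dots> \<le> C * \<eta>" using qn C by (intro mult_left_mono) auto
    finally show ?thesis by (simp add: weight_def pos_le_divide_eq add_pos_nonneg)
  qed
  have fi: "integrable lborel (\<lambda>x. norm (f x))" using schwartz_integrable(1)[OF f] by auto
  have wi: "integrable lborel (\<lambda>x::'a. C * \<eta> * weight x)" using integrable_weight by auto
  have bd: "norm (f' x) \<le> norm (f x) + C * \<eta> * weight x" for x
    using diff[of x] norm_triangle_sub[of "f' x" "f x"] by linarith
  have f'i: "integrable lborel f'"
    by (rule Bochner_Integration.integrable_bound[OF Bochner_Integration.integrable_add[OF fi wi]])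
      (use bd in \<open>auto intro: order_trans[OF _ abs_ge_self]\<close>)
  have "f' y = f' x" if "y \<in> dyadic_cube (int M) x" for x y
  proof -
    have "q y = q x" unfolding q_def using that by (intro sum.cong) (auto simp: dyadic_cube_def)
    then show ?thesis by (simp add: f'_def)
  qed
  moreover have "norm (f' x - f x) \<le> \<epsilon>" for x
  proof -
    have "weight x \<le> 1" by (simp add: weight_def divide_le_eq add_pos_nonneg)
    then have "C * \<eta> * weight x \<le> C * \<eta> * 1" using C e0 by (intro mult_left_mono) auto
    also have "\<dots> \<le> C * \<eta> * (1 + I)" using C e0 I by (intro mult_left_mono) auto
    finally show ?thesis using diff[of x] e2 by linarith
  qed
  moreover have "(LINT x|lborel. norm (f' x)) \<le> (LINT x|lborel. norm (f x)) + \<epsilon>"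
  proof -
    have "(LINT x|lborel. norm (f' x)) \<le> (LINT x|lborel. norm (f x) + C * \<eta> * weight x)"
      using f'i fi wi bd by (intro integral_mono) auto
    also have "\<dots> = (LINT x|lborel. norm (f x)) + C * \<eta> * I"
      using fi wi by (simp add: I_def)
    also have "C * \<eta> * I \<le> C * \<eta> * (1 + I)" using C e0 by (intro mult_left_mono) auto
    finally show ?thesis using e2 by linarith
  qed
  ultimately show ?thesis using f'i by blast
qed

section \<open>Polynomials times Gaussians as Schwartz functions\<close>

lemma real_polynomial_derivative:
  fixes p :: "'a::euclidean_space \<Rightarrow> real"
  assumes "real_polynomial_function p"
  shows "\<exists>D. (\<forall>x. (p has_derivative D x) (at x)) \<and> (\<forall>b. real_polynomial_function (\<lambda>x. D x b))"
  using assms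
proof induction
  case (linear f)
  then have "(f has_derivative f) (at x)" for x by (rule bounded_linear_imp_has_derivative)
  then show ?case by (intro exI[of _ "\<lambda>x. f"]) (auto intro: real_polynomial_function.intros(2))
next
  case (const c)
  show ?case by (intro exI[of _ "\<lambda>x v. 0"]) (auto intro: real_polynomial_function.intros(2))
next
  case (add f g)
  then obtain D E where D: "\<And>x. (f has_derivative D x) (at x)" "\<And>b. real_polynomial_function (\<lambda>x. D x b)"
    and E: "\<And>x. (g has_derivative E x) (at x)" "\<And>b. real_polynomial_function (\<lambda>x. E x b)" by blast
  show ?case
    by (intro exI[of _ "\<lambda>x v. D x v + E x v"]) (auto intro!: has_derivative_add D E real_polynomial_function.intros(3))
next
  case (mult f g)
  then obtain D E where D: "\<And>x. (f has_derivative D x) (at x)" "\<And>b. real_polynomial_function (\<lambda>x. D x b)"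
    and E: "\<And>x. (g has_derivative E x) (at x)" "\<And>b. real_polynomial_function (\<lambda>x. E x b)" by blast
  show ?case
    by (intro exI[of _ "\<lambda>x v. f x * E x v + D x v * g x"])
       (auto intro!: has_derivative_mult D E real_polynomial_function.intros(3) real_polynomial_function.intros(4) mult.hyps)
qed

lemma real_polynomial_growth:
  fixes p :: "'a::euclidean_space \<Rightarrow> real"
  assumes "real_polynomial_function p"
  shows "\<exists>C m. C \<ge> 0 \<and> (\<forall>x. \<bar>p x\<bar> \<le> C * (1 + norm x) ^ m)"
  using assms
proof induction
  case (linear f)
  then obtain K where "\<And>x. norm (f x) \<le> norm x * K" "0 < K" using bounded_linear.pos_bounded by blast
  have "\<bar>f x\<bar> \<le> K * (1 + norm x) ^ 1" for x
  proof -
    have "\<bar>f x\<bar> \<le> norm x * K" using \<open>\<And>x. norm (f x) \<le> norm x * K\<close>[of x] by simp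
    also have "\<dots> \<le> (1 + norm x) * K" using \<open>0 < K\<close> by (intro mult_right_mono) auto
    finally show ?thesis by (simp add: mult.commute)
  qed
  then show ?case using \<open>0 < K\<close> by (intro exI[of _ K] exI[of _ 1]) auto
next
  case (const c)
  show ?case by (intro exI[of _ "\<bar>c\<bar>"] exI[of _ 0]) auto
next
  case (add f g)
  then obtain C m D n where *: "C \<ge> 0" "\<And>x. \<bar>f x\<bar> \<le> C * (1 + norm x) ^ m" "D \<ge> 0" "\<And>x. \<bar>g x\<bar> \<le> D * (1 + norm x) ^ n" by blast
  have "\<bar>f x + g x\<bar> \<le> (C + D) * (1 + norm x) ^ (m + n)" for x
  proof -
    have "(1 + norm x) ^ m \<le> (1 + norm x) ^ (m + n)" "(1 + norm x) ^ n \<le> (1 + norm x) ^ (m + n)"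
      by (intro power_increasing; simp)+
    then have "C * (1 + norm x) ^ m \<le> C * (1 + norm x) ^ (m + n)" "D * (1 + norm x) ^ n \<le> D * (1 + norm x) ^ (m + n)"
      using * by (auto intro: mult_left_mono)
    then show ?thesis using *(2)[of x] *(4)[of x] by (simp add: distrib_right)
  qed
  then show ?case using * by (intro exI[of _ "C + D"] exI[of _ "m + n"]) auto
next
  case (mult f g)
  then obtain C m D n where *: "C \<ge> 0" "\<And>x. \<bar>f x\<bar> \<le> C * (1 + norm x) ^ m" "D \<ge> 0" "\<And>x. \<bar>g x\<bar> \<le> D * (1 + norm x) ^ n" by blast
  have "\<bar>f x * g x\<bar> \<le> (C * D) * (1 + norm x) ^ (m + n)" for x
  proof -
    have "\<bar>f x\<bar> * \<bar>g x\<bar> \<le> (C * (1 + norm x) ^ m) * (D * (1 + norm x) ^ n)"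
      by (intro mult_mono *) (auto simp: *)
    then show ?thesis by (simp add: abs_mult power_add mult_ac)
  qed
  then show ?case using * by (intro exI[of _ "C * D"] exI[of _ "m + n"]) auto
qed

text \<open>Polynomial growth is absorbed by 1 + |x| \<le> exp |x|, and completing the square bounds
  n|x| - a|x|^2 by n^2 / (4a).\<close>

lemma poly_gaussian_bounded:
  fixes p :: "'a::euclidean_space \<Rightarrow> real"
  assumes p: "real_polynomial_function p" and a: "a > 0"
  shows "\<exists>B. \<forall>x. norm x ^ k * \<bar>p x * exp (- a * (x \<bullet> x))\<bar> \<le> B"
proof -
  obtain C m where C: "C \<ge> 0" "\<And>x. \<bar>p x\<bar> \<le> C * (1 + norm x) ^ m"
    using real_polynomial_growth[OF p] by blast
  define n where "n = real (k + m)"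
  have "norm x ^ k * \<bar>p x * exp (- a * (x \<bullet> x))\<bar> \<le> C * exp (n\<^sup>2 / (4 * a))" for x
  proof -
    have "norm x ^ k * \<bar>p x\<bar> \<le> (1 + norm x) ^ k * (C * (1 + norm x) ^ m)"
      by (intro mult_mono C power_mono) auto
    also have "\<dots> = C * (1 + norm x) ^ (k + m)" by (simp add: power_add mult_ac)
    also have "\<dots> \<le> C * exp (norm x) ^ (k + m)"
      by (intro mult_left_mono power_mono C) (auto simp: exp_ge_add_one_self)
    also have "\<dots> = C * exp (n * norm x)" by (simp only: n_def exp_of_nat_mult)
    finally have 1: "norm x ^ k * \<bar>p x\<bar> \<le> C * exp (n * norm x)" .
    have "0 \<le> (2 * a * norm x - n)\<^sup>2 / (4 * a)" using a by simp
    also have "\<dots> = a * (norm x)\<^sup>2 - n * norm x + n\<^sup>2 / (4 * a)"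
      using a by (simp add: power2_diff field_simps power2_eq_square)
    finally have 2: "n * norm x + - a * (x \<bullet> x) \<le> n\<^sup>2 / (4 * a)" by (simp add: power2_norm_eq_inner)
    have "norm x ^ k * \<bar>p x * exp (- a * (x \<bullet> x))\<bar> = (norm x ^ k * \<bar>p x\<bar>) * exp (- a * (x \<bullet> x))"
      by (simp add: abs_mult)
    also have "\<dots> \<le> (C * exp (n * norm x)) * exp (- a * (x \<bullet> x))" by (intro mult_right_mono 1) auto
    also have "\<dots> = C * exp (n * norm x + - a * (x \<bullet> x))" by (simp only: exp_add mult.assoc)
    also have "\<dots> \<le> C * exp (n\<^sup>2 / (4 * a))" using 2 C by (intro mult_left_mono) auto
    finally show ?thesis .
  qed
  then show ?thesis by blast
qed

lemma poly_gaussian_derivative: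
  fixes p :: "'a::euclidean_space \<Rightarrow> real"
  assumes p: "real_polynomial_function p"
  shows "\<exists>D. (\<forall>x. ((\<lambda>x. complex_of_real (p x * exp (- a * (x \<bullet> x)))) has_derivative D x) (at x)) \<and>
    (\<forall>b. \<exists>q. real_polynomial_function q \<and> (\<forall>x. D x b = complex_of_real (q x * exp (- a * (x \<bullet> x)))))"
proof -
  obtain D where D: "\<And>x. (p has_derivative D x) (at x)" "\<And>b. real_polynomial_function (\<lambda>x. D x b)"
    using real_polynomial_derivative[OF p] by blast
  define E where "E x v = complex_of_real ((D x v + p x * (- 2 * a * (x \<bullet> v))) * exp (- a * (x \<bullet> x)))" for x v
  have "((\<lambda>x. complex_of_real (p x * exp (- a * (x \<bullet> x)))) has_derivative E x) (at x)" for x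
    unfolding E_def
    by (rule has_derivative_of_real) (auto intro!: derivative_eq_intros D simp: algebra_simps inner_commute)
  moreover have "real_polynomial_function (\<lambda>x. D x b + p x * (- 2 * a * (x \<bullet> b)))" for b
    by (intro real_polynomial_function.intros D p bounded_linear_inner_left)
  then have "\<exists>q. real_polynomial_function q \<and> (\<forall>x. E x b = complex_of_real (q x * exp (- a * (x \<bullet> x))))" for b
    unfolding E_def by blast
  ultimately show ?thesis by blast
qed

text \<open>Products of a polynomial with one fixed Gaussian are closed under partial derivatives,
  so every iterated derivative is of the form already bounded.\<close>

lemma poly_gaussian_schwartz:
  fixes p :: "'a::euclidean_space \<Rightarrow> real"
  assumes p: "real_polynomial_function p" and a: "a > 0"
  shows "schwartz (\<lambda>x. complex_of_real (p x * exp (- a * (x \<bullet> x))))"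
proof -
  let ?G = "\<lambda>q x. complex_of_real (q x * exp (- a * (x \<bullet> x)))"
  have ex: "\<exists>q. real_polynomial_function q \<and> iter_partial bs (?G p) = ?G q" for bs
  proof (induction bs)
    case Nil
    show ?case using p by (intro exI[of _ p]) simp
  next
    case (Cons b bs)
    then obtain q where q: "real_polynomial_function q" "iter_partial bs (?G p) = ?G q" by blast
    obtain D where D: "\<And>x. (?G q has_derivative D x) (at x)"
      "\<And>b. \<exists>r. real_polynomial_function r \<and> (\<forall>x. D x b = ?G r x)"
      using poly_gaussian_derivative[OF q(1), of a] by blast
    obtain r where r: "real_polynomial_function r" "\<And>x. D x b = ?G r x" using D(2)[of b] by blast
    have "frechet_derivative (?G q) (at x) b = ?G r x" for x
      by (subst frechet_derivative_at[OF D(1), symmetric]) (rule r(2))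
    then have "iter_partial (b # bs) (?G p) = ?G r"
      unfolding iter_partial.simps q(2) by (rule ext)
    then show ?case using r(1) by blast
  qed
  show ?thesis unfolding schwartz_def
  proof (intro ballI conjI allI)
    fix bs :: "'a list"
    obtain q where q: "real_polynomial_function q" "iter_partial bs (?G p) = ?G q" using ex by blast
    show "iter_partial bs (?G p) differentiable (at x)" for x
      unfolding q(2) using poly_gaussian_derivative[OF q(1), of a] by (auto simp: differentiable_def)
    fix k :: nat
    obtain B where "\<forall>x. norm x ^ k * \<bar>q x * exp (- a * (x \<bullet> x))\<bar> \<le> B"
      using poly_gaussian_bounded[OF q(1) a] by blast
    then show "bounded (range (\<lambda>x. of_real (norm x ^ k) * iter_partial bs (?G p) x))"
      unfolding q(2) bounded_iff by (intro exI[of _ B]) (auto simp: norm_mult norm_power abs_mult)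
  qed
qed

text \<open>The second derivatives of a Schwartz function are bounded, so its first-order Taylor
  remainder is at most C |v|^2 uniformly in the base point. Integrating it against |h| gives the
  derivative of the convolution directly. The derivative is expanded in the coordinate partials to
  match \<open>iter_partial\<close>.\<close>

lemma has_derivative_convol:
  fixes \<phi> h :: "'a::euclidean_space \<Rightarrow> complex"
  assumes \<phi>: "schwartz \<phi>" and h: "integrable lborel h"
  shows "(convol \<phi> h has_derivative (\<lambda>v. \<Sum>b\<in>Basis. (v \<bullet> b) *\<^sub>R convol (iter_partial [b] \<phi>) h x)) (at x)"
proof -
  have [measurable]: "h \<in> borel_measurable borel" using h by auto
  have [measurable]: "\<phi> \<in> borel_measurable borel" using \<phi> by (rule schwartz_borel)
  define D where "D y v = (\<Sum>b\<in>Basis. (v \<bullet> b) *\<^sub>R iter_partial [b] \<phi> y)" for y v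
  have hd: "(\<phi> has_derivative D y) (at y within S)" for y S
  proof -
    have "(\<phi> has_derivative frechet_derivative \<phi> (at y)) (at y)"
      using schwartz_differentiable[OF \<phi>] by (simp add: frechet_derivative_works[symmetric])
    moreover have "frechet_derivative \<phi> (at y) = D y"
      unfolding D_def[abs_def] by (intro ext frechet_derivative_basis schwartz_differentiable \<phi>)
    ultimately show ?thesis by (auto intro: has_derivative_at_withinI)
  qed
  have sb: "schwartz (iter_partial [b] \<phi>)" if "b \<in> Basis" for b
    using that by (intro schwartz_iter_partial \<phi>) auto
  have "\<forall>b\<in>Basis. \<exists>C. C \<ge> 0 \<and> (\<forall>y v. norm (iter_partial [b] \<phi> (y + v) - iter_partial [b] \<phi> y) \<le> C * norm v)"
  proof
    fix b :: 'a assume "b \<in> Basis"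
    from schwartz_diff_bound[OF sb[OF this], of 0]
    show "\<exists>C. C \<ge> 0 \<and> (\<forall>y v. norm (iter_partial [b] \<phi> (y + v) - iter_partial [b] \<phi> y) \<le> C * norm v)" by auto
  qed
  from bchoice[OF this] obtain c where c: "\<forall>b\<in>Basis. c b \<ge> 0 \<and> (\<forall>y v. norm (iter_partial [b] \<phi> (y + v) - iter_partial [b] \<phi> y) \<le> c b * norm v)"
    by (rule exE)
  have c2: "norm (iter_partial [b] \<phi> (y + v) - iter_partial [b] \<phi> y) \<le> c b * norm v" if "b \<in> Basis" for b y v
    using c that by blast
  define C where "C = (\<Sum>b\<in>(Basis::'a set). c b)"
  have C: "C \<ge> 0" unfolding C_def using c by (intro sum_nonneg) auto
  have rem: "norm (\<phi> (y + v) - \<phi> y - D y v) \<le> norm v * (C * norm v)" for y v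
  proof -
    have "norm (\<phi> (y + v) - \<phi> y - D y (y + v - y)) \<le> norm (y + v - y) * (C * norm v)"
    proof (rule differentiable_bound_linearization[where S="cball y (norm v)" and f'=D])
      fix t :: real assume "t \<in> {0..1}"
      then show "y + t *\<^sub>R (y + v - y) \<in> cball y (norm v)"
        by (auto simp: dist_norm mult_left_le_one_le)
    next
      fix \<xi> assume \<xi>: "\<xi> \<in> cball y (norm v)"
      show "onorm (D \<xi> - D y) \<le> C * norm v"
      proof (rule onorm_le)
        fix u
        have "(D \<xi> - D y) u = (\<Sum>b\<in>Basis. (u \<bullet> b) *\<^sub>R (iter_partial [b] \<phi> (y + (\<xi> - y)) - iter_partial [b] \<phi> y))"
          by (simp add: D_def sum_subtractf[symmetric] scaleR_diff_right)
        also have "norm \<dots> \<le> norm u * (\<Sum>b\<in>Basis. norm (iter_partial [b] \<phi> (y + (\<xi> - y)) - iter_partial [b] \<phi> y))"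
          by (rule norm_sum_basis_le)
        also have "\<dots> \<le> norm u * (\<Sum>b\<in>Basis. c b * norm (\<xi> - y))"
          by (intro mult_left_mono sum_mono c2) auto
        also have "\<dots> = C * norm (\<xi> - y) * norm u" by (simp add: C_def sum_distrib_right[symmetric] mult_ac)
        also have "\<dots> \<le> C * norm v * norm u"
          using \<xi> C by (intro mult_right_mono mult_left_mono) (auto simp: dist_norm norm_minus_commute)
        finally show "norm ((D \<xi> - D y) u) \<le> C * norm v * norm u" .
      qed
    qed (use hd in auto)
    then show ?thesis by simp
  qed
  have int: "integrable lborel (\<lambda>z. \<psi> (y - z) * h z)" if \<psi>: "schwartz \<psi>" for \<psi> and y :: 'a
  proof -
    have [measurable]: "\<psi> \<in> borel_measurable borel" using \<psi> by (rule schwartz_borel)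
    obtain B where "\<And>x. norm (\<psi> x) \<le> B" using schwartz_bounded[OF \<psi>] by blast
    then have B: "norm (\<psi> x) \<le> \<bar>B\<bar>" for x by (meson abs_ge_self order_trans)
    show ?thesis
      by (rule Bochner_Integration.integrable_bound[where f="\<lambda>z. \<bar>B\<bar> * norm (h z)"])
        (use h B in \<open>auto simp: norm_mult intro!: mult_right_mono\<close>)
  qed
  define N where "N = (LINT z|lborel. norm (h z))"
  have N: "N \<ge> 0" by (simp add: N_def)
  let ?F' = "\<lambda>v. \<Sum>b\<in>Basis. (v \<bullet> b) *\<^sub>R convol (iter_partial [b] \<phi>) h x"
  have main: "norm (convol \<phi> h y - convol \<phi> h x - ?F' (y - x)) \<le> C * N * norm (y - x) * norm (y - x)" for y
  proof -
    define v where "v = y - x"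
    have bint: "integrable lborel (\<lambda>z. (v \<bullet> b) *\<^sub>R (iter_partial [b] \<phi> (x - z) * h z))" if "b \<in> Basis" for b
      by (intro integrable_scaleR_right int sb that)
    have Dint: "integrable lborel (\<lambda>z. D (x - z) v * h z)"
      unfolding D_def sum_distrib_right mult_scaleR_left by (rule Bochner_Integration.integrable_sum) (rule bint)
    have "(LINT z|lborel. (\<Sum>b\<in>Basis. (v \<bullet> b) *\<^sub>R (iter_partial [b] \<phi> (x - z) * h z)))
      = (\<Sum>b\<in>Basis. LINT z|lborel. (v \<bullet> b) *\<^sub>R (iter_partial [b] \<phi> (x - z) * h z))"
      by (rule Bochner_Integration.integral_sum) (rule bint)
    then have F': "?F' v = (LINT z|lborel. D (x - z) v * h z)"
      unfolding convol_def D_def sum_distrib_right mult_scaleR_left by (simp only: integral_scaleR_right)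
    have e: "convol \<phi> h y - convol \<phi> h x - ?F' v = (LINT z|lborel. \<phi> (y - z) * h z - \<phi> (x - z) * h z - D (x - z) v * h z)"
      unfolding F' unfolding convol_def by (simp add: int \<phi> Dint)
    have "norm (convol \<phi> h y - convol \<phi> h x - ?F' v) \<le> (LINT z|lborel. norm (\<phi> (y - z) * h z - \<phi> (x - z) * h z - D (x - z) v * h z))"
      unfolding e by (rule integral_norm_bound)
    also have "\<dots> \<le> (LINT z|lborel. (norm v * (C * norm v)) * norm (h z))"
    proof (rule integral_mono)
      show "integrable lborel (\<lambda>z. norm (\<phi> (y - z) * h z - \<phi> (x - z) * h z - D (x - z) v * h z))"
        by (intro integrable_norm Bochner_Integration.integrable_diff int[OF \<phi>, of y] int[OF \<phi>, of x] Dint)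
      show "integrable lborel (\<lambda>z. (norm v * (C * norm v)) * norm (h z))" using h by auto
      fix z
      have "norm (\<phi> (y - z) * h z - \<phi> (x - z) * h z - D (x - z) v * h z) = norm (\<phi> ((x - z) + v) - \<phi> (x - z) - D (x - z) v) * norm (h z)"
      proof -
        have "x - z + v = y - z" by (simp add: v_def)
        then show ?thesis by (simp only: norm_mult[symmetric] left_diff_distrib)
      qed
      also have "\<dots> \<le> (norm v * (C * norm v)) * norm (h z)" by (intro mult_right_mono rem) auto
      finally show "norm (\<phi> (y - z) * h z - \<phi> (x - z) * h z - D (x - z) v * h z) \<le> (norm v * (C * norm v)) * norm (h z)" .
    qed
    also have "\<dots> = C * N * norm v * norm v" by (simp add: N_def)
    finally show ?thesis by (simp add: v_def)
  qed
  show ?thesis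
  proof (rule has_derivativeI_sandwich[where e=1 and H="\<lambda>y. C * N * norm (y - x)"])
    show "bounded_linear ?F'"
      by (intro bounded_linear_sum bounded_linear_scaleR_left[THEN bounded_linear_compose] bounded_linear_inner_left)
    fix y assume "y \<noteq> x"
    then show "norm (convol \<phi> h y - convol \<phi> h x - ?F' (y - x)) / norm (y - x) \<le> C * N * norm (y - x)"
      using main[of y] by (simp add: divide_le_eq)
  next
    have "((\<lambda>y. C * N * norm (y - x)) \<longlongrightarrow> C * N * norm (x - x)) (at x)" by (intro tendsto_intros)
    then show "((\<lambda>y. C * N * norm (y - x)) \<longlongrightarrow> 0) (at x)" by simp
  qed simp
qed

text \<open>All derivatives fall on the Schwartz factor, and bounded support of \<open>h\<close>
  transfers decay: |x| \<le> (1 + |x - z|)(1 + R) when |z| \<le> R. This makes mollified bounded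
  functions admissible in the decay hypothesis.\<close>

lemma schwartz_convol:
  fixes \<phi> h :: "'a::euclidean_space \<Rightarrow> complex"
  assumes \<phi>: "schwartz \<phi>" and h: "integrable lborel h" and supp: "\<And>z. h z \<noteq> 0 \<Longrightarrow> norm z \<le> R" and R: "R \<ge> 0"
  shows "schwartz (convol \<phi> h)"
proof -
  have it: "iter_partial bs (convol \<phi> h) = convol (iter_partial bs \<phi>) h" if "bs \<in> lists Basis" for bs
    using that
  proof (induction bs)
    case (Cons b bs)
    have b: "b \<in> Basis" "bs \<in> lists Basis" using Cons by auto
    have s: "schwartz (iter_partial bs \<phi>)" by (rule schwartz_iter_partial[OF \<phi> b(2)])
    have "frechet_derivative (convol (iter_partial bs \<phi>) h) (at x) b = convol (iter_partial [b] (iter_partial bs \<phi>)) h x" for x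
    proof -
      have "frechet_derivative (convol (iter_partial bs \<phi>) h) (at x) b
        = (\<Sum>c\<in>Basis. (b \<bullet> c) *\<^sub>R convol (iter_partial [c] (iter_partial bs \<phi>)) h x)"
        by (subst frechet_derivative_at[OF has_derivative_convol[OF s h], symmetric]) simp
      also have "\<dots> = (\<Sum>c\<in>{b}. (b \<bullet> c) *\<^sub>R convol (iter_partial [c] (iter_partial bs \<phi>)) h x)"
        using b by (intro sum.mono_neutral_right) (auto simp: inner_not_same_Basis)
      finally show ?thesis using b by simp
    qed
    then show ?case using Cons.IH b(2) by (simp add: iter_partial_append)
  qed simp
  have [measurable]: "h \<in> borel_measurable borel" using h by auto
  show ?thesis unfolding schwartz_def
  proof (intro ballI conjI allI)
    fix bs :: "'a list" assume bs: "bs \<in> lists Basis"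
    define \<psi> where "\<psi> = iter_partial bs \<phi>"
    have s: "schwartz \<psi>" unfolding \<psi>_def by (rule schwartz_iter_partial[OF \<phi> bs])
    have [measurable]: "\<psi> \<in> borel_measurable borel" using s by (rule schwartz_borel)
    show "iter_partial bs (convol \<phi> h) differentiable (at x)" for x
      unfolding it[OF bs] differentiable_def using has_derivative_convol[OF s h] unfolding \<psi>_def by blast
    fix k :: nat
    obtain C where C: "C \<ge> 0" "\<And>x. norm (\<psi> x) * (1 + norm x) ^ k \<le> C" using schwartz_decay[OF s, of k] by auto
    have "norm x ^ k * norm (convol \<psi> h x) \<le> C * (1 + R) ^ k * (LINT z|lborel. norm (h z))" for x
    proof -
      have "norm x ^ k * norm (convol \<psi> h x) \<le> norm x ^ k * (LINT z|lborel. norm (\<psi> (x - z) * h z))"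
        unfolding convol_def by (intro mult_left_mono integral_norm_bound) auto
      also have "\<dots> = (LINT z|lborel. norm x ^ k * norm (\<psi> (x - z) * h z))" by simp
      also have "\<dots> \<le> (LINT z|lborel. (C * (1 + R) ^ k) * norm (h z))"
      proof (rule integral_mono')
        show "integrable lborel (\<lambda>z. (C * (1 + R) ^ k) * norm (h z))" using h by auto
        fix z
        show "norm x ^ k * norm (\<psi> (x - z) * h z) \<le> (C * (1 + R) ^ k) * norm (h z)"
        proof (cases "h z = 0")
          case False
          have z: "norm z \<le> R" using supp[OF False] .
          have "norm x \<le> norm (x - z) + norm z" using norm_triangle_sub[of x z] by simp
          \<comment> \<open>Nonnegative terms are added so that the right-hand side factors as (1 +
            |x - z|)(1 + R).\<close>
          also have "\<dots> \<le> norm (x - z) + R + (1 + norm (x - z) * R)"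
          proof -
            have "0 \<le> 1 + norm (x - z) * R" using R by (intro add_nonneg_nonneg mult_nonneg_nonneg) auto
            then show ?thesis using z by linarith
          qed
          also have "\<dots> = (1 + norm (x - z)) * (1 + R)" by (simp add: algebra_simps)
          finally have "norm x ^ k \<le> ((1 + norm (x - z)) * (1 + R)) ^ k" by (intro power_mono) auto
          then have "norm x ^ k * norm (\<psi> (x - z)) \<le> ((1 + norm (x - z)) * (1 + R)) ^ k * norm (\<psi> (x - z))"
            by (rule mult_right_mono) simp
          also have "\<dots> = (1 + R) ^ k * (norm (\<psi> (x - z)) * (1 + norm (x - z)) ^ k)"
            by (simp only: power_mult_distrib mult_ac)
          also have "\<dots> \<le> (1 + R) ^ k * C" using R by (intro mult_left_mono C) auto
          finally have "norm x ^ k * norm (\<psi> (x - z)) * norm (h z) \<le> (C * (1 + R) ^ k) * norm (h z)"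
            by (intro mult_right_mono) (auto simp: mult.commute)
          then show ?thesis by (simp add: norm_mult mult.assoc)
        qed simp
        show "0 \<le> (C * (1 + R) ^ k) * norm (h z)" using C R by simp
      qed
      also have "\<dots> = C * (1 + R) ^ k * (LINT z|lborel. norm (h z))" by simp
      finally show ?thesis .
    qed
    then show "bounded (range (\<lambda>x. of_real (norm x ^ k) * iter_partial bs (convol \<phi> h) x))"
      unfolding it[OF bs] \<psi>_def[symmetric] bounded_iff
      by (intro exI[of _ "C * (1 + R) ^ k * (LINT z|lborel. norm (h z))"]) (auto simp: norm_mult norm_power)
  qed
qed

section \<open>Gaussian mollifiers\<close>

lemma fubini_lborel:
  fixes f :: "'a::euclidean_space \<times> 'b::euclidean_space \<Rightarrow> complex"
  assumes [measurable]: "f \<in> borel_measurable borel" and fin: "(\<integral>\<^sup>+x. \<integral>\<^sup>+y. ennreal (norm (f (x, y))) \<partial>lborel \<partial>lborel) < \<infinity>"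
  shows "(LINT x|lborel. LINT y|lborel. f (x, y)) = (LINT y|lborel. LINT x|lborel. f (x, y))"
proof -
  have "(\<integral>\<^sup>+z. ennreal (norm (f z)) \<partial>lborel) < \<infinity>"
    using fin by (subst nn_integral_lborel_prod_fst) auto
  then have "integrable lborel f" by (intro integrableI_bounded) auto
  then have "integrable (lborel \<Otimes>\<^sub>M lborel) (\<lambda>(x, y). f (x, y))" by (simp add: lborel_prod)
  from lborel_pair.Fubini_integral[OF this] show ?thesis by simp
qed

lemma nn_integral_lborel_scale:
  fixes f :: "'a::euclidean_space \<Rightarrow> ennreal"
  assumes [measurable]: "f \<in> borel_measurable borel" and c: "c > 0"
  shows "(\<integral>\<^sup>+x. ennreal (c ^ DIM('a)) * f (c *\<^sub>R x) \<partial>lborel) = (\<integral>\<^sup>+x. f x \<partial>lborel)"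
proof -
  have "(\<integral>\<^sup>+x. f x \<partial>lborel) = (\<integral>\<^sup>+x. f x \<partial>density (distr lborel borel (\<lambda>x. 0 + c *\<^sub>R x)) (\<lambda>_. ennreal (\<bar>c\<bar> ^ DIM('a))))"
    by (subst lborel_affine[of c 0]) (use c in auto)
  also have "\<dots> = (\<integral>\<^sup>+x. ennreal (c ^ DIM('a)) * f x \<partial>distr lborel borel (\<lambda>x. 0 + c *\<^sub>R x))"
    using c by (subst nn_integral_density) auto
  also have "\<dots> = (\<integral>\<^sup>+x. ennreal (c ^ DIM('a)) * f (c *\<^sub>R x) \<partial>lborel)"
    by (subst nn_integral_distr) auto
  finally show ?thesis by simp
qed

lemma dyadic_borel [measurable]:
  assumes [measurable]: "\<Phi> \<in> borel_measurable borel"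
  shows "dyadic \<Phi> j \<in> borel_measurable borel"
  unfolding dyadic_def[abs_def] by measurable

lemma norm_dyadic: "norm (dyadic \<Phi> j x) = (2 powi j) ^ DIM('a) * norm (\<Phi> ((2 powi j) *\<^sub>R x))"
  for x :: "'a::euclidean_space"
  by (simp only: dyadic_def norm_mult norm_of_real) simp

text \<open>Change of variables by 2^j. These scalings are the origin of the powers of 2 in the
  moment and smoothness bounds of the kernels.\<close>

lemma dyadic_L1:
  fixes \<Phi> :: "'a::euclidean_space \<Rightarrow> complex"
  assumes [measurable]: "\<Phi> \<in> borel_measurable borel"
  shows "(\<integral>\<^sup>+x. ennreal (norm (dyadic \<Phi> j x)) \<partial>lborel) = (\<integral>\<^sup>+x. ennreal (norm (\<Phi> x)) \<partial>lborel)"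
    and "(\<integral>\<^sup>+x. ennreal (norm x * norm (dyadic \<Phi> j x)) \<partial>lborel) = ennreal (2 powi (-j)) * (\<integral>\<^sup>+x. ennreal (norm x * norm (\<Phi> x)) \<partial>lborel)"
    and "(\<integral>\<^sup>+x. ennreal (norm (dyadic \<Phi> j (x + v) - dyadic \<Phi> j x)) \<partial>lborel) = (\<integral>\<^sup>+x. ennreal (norm (\<Phi> (x + (2 powi j) *\<^sub>R v) - \<Phi> x)) \<partial>lborel)"
proof -
  define c :: real where "c = 2 powi j"
  have c: "c > 0" by (simp add: c_def)
  have n: "norm (dyadic \<Phi> j x) = c ^ DIM('a) * norm (\<Phi> (c *\<^sub>R x))" for x
    by (simp only: norm_dyadic c_def)
  show "(\<integral>\<^sup>+x. ennreal (norm (dyadic \<Phi> j x)) \<partial>lborel) = (\<integral>\<^sup>+x. ennreal (norm (\<Phi> x)) \<partial>lborel)"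
    unfolding n using c nn_integral_lborel_scale[of "\<lambda>x. ennreal (norm (\<Phi> x))", OF _ c]
    by (simp add: ennreal_mult')
  have "ennreal (norm x * norm (dyadic \<Phi> j x)) = ennreal (c ^ DIM('a)) * (ennreal (1 / c) * ennreal (norm (c *\<^sub>R x) * norm (\<Phi> (c *\<^sub>R x))))" for x
    unfolding n using c by (simp add: ennreal_mult'[symmetric] del: ennreal_1 ennreal_numeral)
  then have "(\<integral>\<^sup>+x. ennreal (norm x * norm (dyadic \<Phi> j x)) \<partial>lborel) = (\<integral>\<^sup>+x. ennreal (1 / c) * ennreal (norm x * norm (\<Phi> x)) \<partial>lborel)"
    using nn_integral_lborel_scale[of "\<lambda>x. ennreal (1 / c) * ennreal (norm x * norm (\<Phi> x))", OF _ c] by simp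
  also have "\<dots> = ennreal (2 powi (-j)) * (\<integral>\<^sup>+x. ennreal (norm x * norm (\<Phi> x)) \<partial>lborel)"
    by (subst nn_integral_cmult) (auto simp: c_def power_int_minus divide_inverse)
  finally show "(\<integral>\<^sup>+x. ennreal (norm x * norm (dyadic \<Phi> j x)) \<partial>lborel) = ennreal (2 powi (-j)) * (\<integral>\<^sup>+x. ennreal (norm x * norm (\<Phi> x)) \<partial>lborel)" .
  have "norm (dyadic \<Phi> j (x + v) - dyadic \<Phi> j x) = c ^ DIM('a) * norm (\<Phi> (c *\<^sub>R x + c *\<^sub>R v) - \<Phi> (c *\<^sub>R x))" for x
  proof -
    have "dyadic \<Phi> j (x + v) - dyadic \<Phi> j x = of_real (c ^ DIM('a)) * (\<Phi> (c *\<^sub>R x + c *\<^sub>R v) - \<Phi> (c *\<^sub>R x))"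
      by (simp only: dyadic_def c_def right_diff_distrib scaleR_add_right)
    then show ?thesis using c by (simp only: norm_mult norm_of_real) simp
  qed
  then show "(\<integral>\<^sup>+x. ennreal (norm (dyadic \<Phi> j (x + v) - dyadic \<Phi> j x)) \<partial>lborel) = (\<integral>\<^sup>+x. ennreal (norm (\<Phi> (x + (2 powi j) *\<^sub>R v) - \<Phi> x)) \<partial>lborel)"
    using c nn_integral_lborel_scale[of "\<lambda>x. ennreal (norm (\<Phi> (x + c *\<^sub>R v) - \<Phi> x))", OF _ c]
    by (simp add: ennreal_mult' c_def[symmetric])
qed

lemma dyadic_integral:
  assumes "\<Phi> \<in> borel_measurable borel"
  shows "(LINT x|lborel. dyadic \<Phi> j x) = (LINT x|lborel. \<Phi> x)"
  using fourier_dyadic[OF assms, of j 0] by (simp add: fourier_def)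

text \<open>Its value \<pi>^(d/2) is not evaluated; positivity and multiplicativity over products
  suffice.\<close>

definition gauss_mass :: "'a::euclidean_space itself \<Rightarrow> real" where
  "gauss_mass _ = (LINT x|lborel. exp (- ((x::'a) \<bullet> x)))"

text \<open>The factor \<open>- 1\<close> is kept so that the body matches the pattern exp(-a |x|^2)
  of the Gaussian lemmas.\<close>

definition mollifier :: "'a::euclidean_space \<Rightarrow> complex" where
  "mollifier x = complex_of_real ((1 / gauss_mass TYPE('a)) * exp (- 1 * (x \<bullet> x)))"

lemma gauss_schwartz: "a > 0 \<Longrightarrow> schwartz (\<lambda>x::'a::euclidean_space. complex_of_real (c * exp (- a * (x \<bullet> x))))"
  by (rule poly_gaussian_schwartz) (rule real_polynomial_function.intros(2))

lemma gauss_integrable: "integrable lborel (\<lambda>x::'a::euclidean_space. exp (- (x \<bullet> x)))"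
proof -
  have "integrable lborel (\<lambda>x::'a. complex_of_real (1 * exp (- 1 * (x \<bullet> x))))"
    by (intro schwartz_integrable gauss_schwartz) simp
  then have "integrable lborel (\<lambda>x::'a. Re (complex_of_real (1 * exp (- 1 * (x \<bullet> x)))))" by (rule integrable_Re)
  then show ?thesis by simp
qed

lemma gauss_mass_pos: "gauss_mass TYPE('a::euclidean_space) > 0"
proof -
  let ?g = "\<lambda>x::'a. exp (- (x \<bullet> x))"
  have "ennreal (exp (-1)) * emeasure lborel (cball (0::'a) 1) \<le> (\<integral>\<^sup>+x. ennreal (?g x) \<partial>lborel)"
  proof (rule markov_le)
    fix x :: 'a assume "x \<in> cball 0 1"
    then have "x \<bullet> x \<le> 1" by (simp add: dist_norm power2_norm_eq_inner[symmetric] power_le_one)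
    then show "ennreal (exp (-1)) \<le> ennreal (?g x)" by (intro ennreal_leI) simp
  qed auto
  also have "\<dots> = ennreal (gauss_mass TYPE('a))"
    unfolding gauss_mass_def by (intro nn_integral_eq_integral gauss_integrable) auto
  finally have "ennreal (exp (-1)) * emeasure lborel (cball (0::'a) 1) \<le> ennreal (gauss_mass TYPE('a))" .
  moreover have "ennreal (exp (-1)) * emeasure lborel (cball (0::'a) 1) > 0"
    by (simp add: emeasure_cball ennreal_zero_less_mult_iff)
  ultimately show ?thesis by (metis ennreal_less_zero_iff leD not_le order_less_le_trans)
qed

lemma mollifier_schwartz: "schwartz (mollifier :: 'a::euclidean_space \<Rightarrow> complex)"
  unfolding mollifier_def[abs_def] by (rule gauss_schwartz) simp

lemma mollifier_borel [measurable]: "mollifier \<in> borel_measurable borel"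
  by (rule schwartz_borel[OF mollifier_schwartz])

lemma mollifier_integral: "(LINT x|lborel. mollifier (x::'a::euclidean_space)) = 1"
proof -
  have "(LINT x|lborel. mollifier (x::'a)) = complex_of_real (LINT x|lborel. (1 / gauss_mass TYPE('a)) * exp (- ((x::'a) \<bullet> x)))"
    unfolding mollifier_def integral_complex_of_real[symmetric] by simp
  also have "(LINT x|lborel. (1 / gauss_mass TYPE('a)) * exp (- ((x::'a) \<bullet> x))) = (1 / gauss_mass TYPE('a)) * gauss_mass TYPE('a)"
    unfolding gauss_mass_def by (rule integral_mult_right_zero)
  also have "\<dots> = 1" using gauss_mass_pos[where 'a='a] by simp
  finally show ?thesis by simp
qed

lemma mollifier_nonneg: "mollifier (x::'a::euclidean_space) = complex_of_real (norm (mollifier x))"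
  using gauss_mass_pos[where 'a='a] by (simp add: mollifier_def norm_mult norm_divide)

text \<open>The squared norm of a pair is a sum, so the Gaussian factors, and by Fubini so does its
  mass. This is what turns mollified inputs into a mollified kernel.\<close>

lemma mollifier_Pair:
  fixes x y :: "'a::euclidean_space"
  shows "mollifier (x, y) = mollifier x * mollifier y"
proof -
  let ?g = "\<lambda>x::'a. complex_of_real (exp (- (x \<bullet> x)))"
  have i: "integrable lborel ?g" using gauss_integrable by (rule integrable_of_real)
  have e: "complex_of_real (exp (- (z \<bullet> z))) = ?g (fst z) * ?g (snd z)" for z :: "'a \<times> 'a"
    unfolding of_real_mult[symmetric] exp_add[symmetric] by (simp add: inner_prod_def)
  have "complex_of_real (gauss_mass TYPE('a \<times> 'a)) = (LINT z|lborel. ?g (fst z) * ?g (snd z))"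
    unfolding gauss_mass_def integral_complex_of_real[symmetric] e ..
  also have "\<dots> = complex_of_real (gauss_mass TYPE('a)) * complex_of_real (gauss_mass TYPE('a))"
    unfolding integrable_tensor(2)[OF i i] gauss_mass_def by (simp only: integral_complex_of_real)
  finally have Z: "gauss_mass TYPE('a \<times> 'a) = gauss_mass TYPE('a) * gauss_mass TYPE('a)"
    by (simp only: of_real_mult[symmetric] of_real_eq_iff)
  have e2: "exp (- 1 * ((x, y) \<bullet> (x, y))) = exp (- 1 * (x \<bullet> x)) * exp (- 1 * (y \<bullet> y))"
    unfolding exp_add[symmetric] by (simp add: inner_Pair)
  show ?thesis
    unfolding mollifier_def Z e2 of_real_mult[symmetric] by (intro arg_cong[where f=complex_of_real]) simp
qed

lemma dyadic_mollifier_schwartz: "schwartz (dyadic (mollifier :: 'a::euclidean_space \<Rightarrow> complex) j)"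
proof -
  have "dyadic (mollifier :: 'a \<Rightarrow> complex) j =
    (\<lambda>x. complex_of_real (((2 powi j) ^ DIM('a) / gauss_mass TYPE('a)) * exp (- ((2 powi j)\<^sup>2) * (x \<bullet> x))))"
    by (auto simp: fun_eq_iff dyadic_def mollifier_def power2_eq_square)
  then show ?thesis by (simp only:) (rule gauss_schwartz, simp)
qed

lemma dyadic_mollifier_Pair:
  fixes x y :: "'a::euclidean_space"
  shows "dyadic mollifier j (x, y) = dyadic mollifier j x * dyadic mollifier j y"
  by (simp add: dyadic_def mollifier_Pair power_add)

lemma dyadic_mollifier_nonneg: "dyadic mollifier j x = complex_of_real (norm (dyadic mollifier j x))"
  unfolding norm_dyadic of_real_mult mollifier_nonneg[symmetric] by (simp only: dyadic_def)

lemma dyadic_mollifier_L1: "(\<integral>\<^sup>+x. ennreal (norm (dyadic mollifier j (x::'a::euclidean_space))) \<partial>lborel) = 1"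
proof -
  have "complex_of_real (LINT x|lborel. norm (dyadic mollifier j (x::'a))) = (LINT x|lborel. dyadic mollifier j (x::'a))"
    unfolding integral_complex_of_real[symmetric] dyadic_mollifier_nonneg[symmetric] ..
  also have "\<dots> = 1" by (simp add: dyadic_integral mollifier_integral)
  finally have "(LINT x|lborel. norm (dyadic mollifier j (x::'a))) = 1" by (simp only: of_real_eq_1_iff)
  then show ?thesis
    using nn_norm_integrable[OF schwartz_integrable(1)[OF dyadic_mollifier_schwartz[where 'a='a and j=j]]] by simp
qed

section \<open>L^1 estimates for convolutions\<close>

lemma convol_borel [measurable]:
  assumes [measurable]: "g \<in> borel_measurable borel" "h \<in> borel_measurable borel"
  shows "convol g h \<in> borel_measurable borel"
  unfolding convol_def[abs_def] by measurable

lemma convol_nn: "ennreal (norm (convol g h y)) \<le> (\<integral>\<^sup>+z. ennreal (norm (g (y - z))) * ennreal (norm (h z)) \<partial>lborel)"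
proof -
  have "ennreal (norm (convol g h y)) \<le> (\<integral>\<^sup>+z. ennreal (norm (g (y - z) * h z)) \<partial>lborel)"
    unfolding convol_def by (rule norm_le_nn)
  then show ?thesis by (simp add: norm_mult ennreal_mult')
qed

text \<open>The common pattern of the convolution estimates: Tonelli, followed by the translation y
  = u + z at fixed z.\<close>

lemma nn_convol_swap:
  fixes w :: "'a::euclidean_space \<Rightarrow> 'a \<Rightarrow> ennreal"
  assumes [measurable]: "(\<lambda>(y, z). w y z) \<in> borel_measurable borel" and w: "\<And>z. (\<integral>\<^sup>+u. w (u + z) z \<partial>lborel) \<le> c * v z"
    and [measurable]: "v \<in> borel_measurable borel"
  shows "(\<integral>\<^sup>+y. \<integral>\<^sup>+z. w y z \<partial>lborel \<partial>lborel) \<le> c * (\<integral>\<^sup>+z. v z \<partial>lborel)"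
proof -
  have m: "(\<lambda>(y, z). w y z) \<in> borel_measurable (lborel \<Otimes>\<^sub>M lborel)" unfolding lborel_prod by measurable
  have "(\<integral>\<^sup>+y. \<integral>\<^sup>+z. w y z \<partial>lborel \<partial>lborel) = (\<integral>\<^sup>+z. \<integral>\<^sup>+y. w y z \<partial>lborel \<partial>lborel)"
    using lborel_pair.Fubini'[OF m] by simp
  also have "\<dots> = (\<integral>\<^sup>+z. \<integral>\<^sup>+u. w (u + z) z \<partial>lborel \<partial>lborel)"
  proof (rule nn_integral_cong)
    fix z :: 'a
    have "(\<lambda>y. w y z) \<in> borel_measurable borel"
      using measurable_compose[OF _ assms(1), of "\<lambda>y. (y, z)" borel] by (simp add: borel_measurable_Pair)
    from nn_integral_lborel_shift[OF this, of z]
    show "(\<integral>\<^sup>+y. w y z \<partial>lborel) = (\<integral>\<^sup>+u. w (u + z) z \<partial>lborel)" by simp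
  qed
  also have "\<dots> \<le> (\<integral>\<^sup>+z. c * v z \<partial>lborel)" by (intro nn_integral_mono w)
  also have "\<dots> = c * (\<integral>\<^sup>+z. v z \<partial>lborel)" by (rule nn_integral_cmult) simp
  finally show ?thesis .
qed

lemma convol_L1:
  fixes g h :: "'a::euclidean_space \<Rightarrow> complex"
  assumes [measurable]: "g \<in> borel_measurable borel" "h \<in> borel_measurable borel"
  shows "(\<integral>\<^sup>+y. ennreal (norm (convol g h y)) \<partial>lborel) \<le> (\<integral>\<^sup>+u. ennreal (norm (g u)) \<partial>lborel) * (\<integral>\<^sup>+z. ennreal (norm (h z)) \<partial>lborel)"
proof -
  have "(\<integral>\<^sup>+y. ennreal (norm (convol g h y)) \<partial>lborel) \<le> (\<integral>\<^sup>+y. \<integral>\<^sup>+z. ennreal (norm (g (y - z))) * ennreal (norm (h z)) \<partial>lborel \<partial>lborel)"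
    by (intro nn_integral_mono convol_nn)
  also have "\<dots> \<le> (\<integral>\<^sup>+u. ennreal (norm (g u)) \<partial>lborel) * (\<integral>\<^sup>+z. ennreal (norm (h z)) \<partial>lborel)"
    by (rule nn_convol_swap) (simp_all add: nn_integral_multc)
  finally show ?thesis .
qed

lemma convol_integrand:
  fixes g h :: "'a::euclidean_space \<Rightarrow> complex"
  assumes [measurable]: "g \<in> borel_measurable borel" and g: "\<And>x. norm (g x) \<le> G" and h: "integrable lborel h"
  shows "integrable lborel (\<lambda>z. g (y - z) * h z)"
proof (rule Bochner_Integration.integrable_bound[where f="\<lambda>z. G * norm (h z)"])
  have "0 \<le> G" using g[of 0] norm_ge_zero order_trans by blast
  then show "AE z in lborel. norm (g (y - z) * h z) \<le> norm (G * norm (h z))"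
    using g by (intro AE_I2) (simp add: norm_mult mult_right_mono)
qed (use h in auto)

lemma convol_smooth:
  fixes g h :: "'a::euclidean_space \<Rightarrow> complex"
  assumes [measurable]: "g \<in> borel_measurable borel" and g: "\<And>x. norm (g x) \<le> G" and h: "integrable lborel h"
  shows "(\<integral>\<^sup>+y. ennreal (norm (convol g h (y + v) - convol g h y)) \<partial>lborel)
    \<le> (\<integral>\<^sup>+u. ennreal (norm (g (u + v) - g u)) \<partial>lborel) * (\<integral>\<^sup>+z. ennreal (norm (h z)) \<partial>lborel)"
proof -
  have [measurable]: "h \<in> borel_measurable borel" using h by auto
  have e: "convol g h (y + v) - convol g h y = convol (\<lambda>u. g (u + v) - g u) h y" for y
    unfolding convol_def
    using convol_integrand[OF assms(1) g h, of "y + v"] convol_integrand[OF assms(1) g h, of y]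
    by (subst Bochner_Integration.integral_diff[symmetric]) (auto simp: left_diff_distrib algebra_simps)
  show ?thesis unfolding e by (rule convol_L1) auto
qed

text \<open>Splits |y| \<le> |y - z| + |z|, so each summand carries the moment of one factor and the
  mass of the other.\<close>

lemma convol_moment:
  fixes g h :: "'a::euclidean_space \<Rightarrow> complex"
  assumes [measurable]: "g \<in> borel_measurable borel" "h \<in> borel_measurable borel"
  shows "(\<integral>\<^sup>+y. ennreal (norm y * norm (convol g h y)) \<partial>lborel)
    \<le> (\<integral>\<^sup>+u. ennreal (norm u * norm (g u)) \<partial>lborel) * (\<integral>\<^sup>+z. ennreal (norm (h z)) \<partial>lborel)
      + (\<integral>\<^sup>+u. ennreal (norm (g u)) \<partial>lborel) * (\<integral>\<^sup>+z. ennreal (norm z * norm (h z)) \<partial>lborel)"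
proof -
  have "(\<integral>\<^sup>+y. ennreal (norm y * norm (convol g h y)) \<partial>lborel)
    \<le> (\<integral>\<^sup>+y. (\<integral>\<^sup>+z. ennreal (norm (y - z) * norm (g (y - z))) * ennreal (norm (h z)) \<partial>lborel)
        + (\<integral>\<^sup>+z. ennreal (norm (g (y - z))) * ennreal (norm z * norm (h z)) \<partial>lborel) \<partial>lborel)"
  proof (rule nn_integral_mono)
    fix y :: 'a
    have "ennreal (norm y * norm (convol g h y)) \<le> ennreal (norm y) * (\<integral>\<^sup>+z. ennreal (norm (g (y - z))) * ennreal (norm (h z)) \<partial>lborel)"
      using mult_left_mono[OF convol_nn[of g h y], of "ennreal (norm y)"] by (simp add: ennreal_mult')
    also have "\<dots> = (\<integral>\<^sup>+z. ennreal (norm y) * (ennreal (norm (g (y - z))) * ennreal (norm (h z))) \<partial>lborel)"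
      by (rule nn_integral_cmult[symmetric]) measurable
    also have "\<dots> \<le> (\<integral>\<^sup>+z. ennreal (norm (y - z) * norm (g (y - z))) * ennreal (norm (h z))
        + ennreal (norm (g (y - z))) * ennreal (norm z * norm (h z)) \<partial>lborel)"
    proof (rule nn_integral_mono)
      fix z :: 'a
      have "norm y \<le> norm (y - z) + norm z" using norm_triangle_sub[of y z] by simp
      then have "norm y * (norm (g (y - z)) * norm (h z)) \<le> (norm (y - z) + norm z) * (norm (g (y - z)) * norm (h z))"
        by (rule mult_right_mono) simp
      also have "\<dots> = norm (y - z) * norm (g (y - z)) * norm (h z) + norm (g (y - z)) * (norm z * norm (h z))"
        by (simp add: algebra_simps)
      finally show "ennreal (norm y) * (ennreal (norm (g (y - z))) * ennreal (norm (h z))) \<le>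
        ennreal (norm (y - z) * norm (g (y - z))) * ennreal (norm (h z)) + ennreal (norm (g (y - z))) * ennreal (norm z * norm (h z))"
        by (simp add: ennreal_mult'[symmetric] ennreal_plus[symmetric] ennreal_leI del: ennreal_plus)
    qed
    also have "\<dots> = (\<integral>\<^sup>+z. ennreal (norm (y - z) * norm (g (y - z))) * ennreal (norm (h z)) \<partial>lborel)
        + (\<integral>\<^sup>+z. ennreal (norm (g (y - z))) * ennreal (norm z * norm (h z)) \<partial>lborel)"
      by (rule nn_integral_add) measurable
    finally show "ennreal (norm y * norm (convol g h y)) \<le> \<dots>" .
  qed
  also have "\<dots> = (\<integral>\<^sup>+y. \<integral>\<^sup>+z. ennreal (norm (y - z) * norm (g (y - z))) * ennreal (norm (h z)) \<partial>lborel \<partial>lborel)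
        + (\<integral>\<^sup>+y. \<integral>\<^sup>+z. ennreal (norm (g (y - z))) * ennreal (norm z * norm (h z)) \<partial>lborel \<partial>lborel)"
    by (rule nn_integral_add) measurable
  also have "\<dots> \<le> (\<integral>\<^sup>+u. ennreal (norm u * norm (g u)) \<partial>lborel) * (\<integral>\<^sup>+z. ennreal (norm (h z)) \<partial>lborel)
      + (\<integral>\<^sup>+u. ennreal (norm (g u)) \<partial>lborel) * (\<integral>\<^sup>+z. ennreal (norm z * norm (h z)) \<partial>lborel)"
    by (intro add_mono nn_convol_swap) (simp_all add: nn_integral_multc)
  finally show ?thesis .
qed

lemma convol_integral_zero:
  fixes g h :: "'a::euclidean_space \<Rightarrow> complex"
  assumes g: "integrable lborel g" and h: "integrable lborel h" and g0: "(LINT u|lborel. g u) = 0"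
  shows "(LINT y|lborel. convol g h y) = 0"
proof -
  have [measurable]: "g \<in> borel_measurable borel" "h \<in> borel_measurable borel" using g h by auto
  have "(\<integral>\<^sup>+y. \<integral>\<^sup>+z. ennreal (norm (g (y - z) * h z)) \<partial>lborel \<partial>lborel)
    \<le> (\<integral>\<^sup>+u. ennreal (norm (g u)) \<partial>lborel) * (\<integral>\<^sup>+z. ennreal (norm (h z)) \<partial>lborel)"
    by (rule nn_convol_swap) (simp_all add: nn_integral_multc norm_mult ennreal_mult')
  also have "\<dots> < \<infinity>" using g h by (simp add: integrable_iff_bounded ennreal_mult_less_top)
  finally have "(LINT y|lborel. LINT z|lborel. g (y - z) * h z) = (LINT z|lborel. LINT y|lborel. g (y - z) * h z)"
    using fubini_lborel[of "\<lambda>p. g (fst p - snd p) * h (snd p)"] by simp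
  also have "\<dots> = (LINT (z::'a)|lborel. 0)"
  proof (rule Bochner_Integration.integral_cong)
    fix z
    have "(LINT y|lborel. g (y - z)) = (LINT y|lborel. g ((0 - y) - z))"
      using integral_lborel_reflect[of "\<lambda>y. g (y - z)" 0] by simp
    also have "\<dots> = (LINT y|lborel. g y)"
    proof -
      have q: "(0 - y) - z = - z - y" for y :: 'a by simp
      show ?thesis unfolding q by (rule integral_lborel_reflect) measurable
    qed
    finally show "(LINT y|lborel. g (y - z) * h z) = 0" using g0 by simp
  qed simp
  finally show ?thesis by (simp add: convol_def)
qed

text \<open>As \<open>k\<close> has integral zero, \<psi> y may be subtracted from \<psi> (y - z).
  The gain is the modulus of continuity of \<psi> times the first moment of
  \<open>k\<close>.\<close>

lemma convol_cancel:
  fixes \<psi> k :: "'a::euclidean_space \<Rightarrow> complex"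
  assumes [measurable]: "\<psi> \<in> borel_measurable borel" and \<psi>: "\<And>x. norm (\<psi> x) \<le> G" and k: "integrable lborel k" and k0: "(LINT z|lborel. k z) = 0"
    and L: "\<And>v. (\<integral>\<^sup>+u. ennreal (norm (\<psi> (u + v) - \<psi> u)) \<partial>lborel) \<le> ennreal L * ennreal (norm v)"
  shows "(\<integral>\<^sup>+y. ennreal (norm (convol \<psi> k y)) \<partial>lborel) \<le> ennreal L * (\<integral>\<^sup>+z. ennreal (norm z * norm (k z)) \<partial>lborel)"
proof -
  have [measurable]: "k \<in> borel_measurable borel" using k by auto
  have e: "convol \<psi> k y = (LINT z|lborel. (\<psi> (y - z) - \<psi> y) * k z)" for y
    unfolding convol_def left_diff_distrib using convol_integrand[OF assms(1) \<psi> k, of y] k k0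
    by (subst Bochner_Integration.integral_diff) auto
  have "(\<integral>\<^sup>+y. ennreal (norm (convol \<psi> k y)) \<partial>lborel) \<le> (\<integral>\<^sup>+y. \<integral>\<^sup>+z. ennreal (norm ((\<psi> (y - z) - \<psi> y) * k z)) \<partial>lborel \<partial>lborel)"
    unfolding e by (intro nn_integral_mono norm_le_nn)
  also have "\<dots> \<le> ennreal L * (\<integral>\<^sup>+z. ennreal (norm z * norm (k z)) \<partial>lborel)"
  proof (rule nn_convol_swap)
    fix z
    have "(\<integral>\<^sup>+u. ennreal (norm ((\<psi> (u + z - z) - \<psi> (u + z)) * k z)) \<partial>lborel)
      = (\<integral>\<^sup>+u. ennreal (norm (\<psi> (u + z) - \<psi> u)) * ennreal (norm (k z)) \<partial>lborel)"
      by (simp add: norm_mult ennreal_mult' norm_minus_commute)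
    also have "\<dots> = (\<integral>\<^sup>+u. ennreal (norm (\<psi> (u + z) - \<psi> u)) \<partial>lborel) * ennreal (norm (k z))"
      by (rule nn_integral_multc) measurable
    also have "\<dots> \<le> ennreal L * ennreal (norm z) * ennreal (norm (k z))" by (intro mult_right_mono L) auto
    also have "\<dots> = ennreal L * ennreal (norm z * norm (k z))" by (simp add: ennreal_mult' mult.assoc)
    finally show "(\<integral>\<^sup>+u. ennreal (norm ((\<psi> (u + z - z) - \<psi> (u + z)) * k z)) \<partial>lborel) \<le> \<dots>" .
  qed measurable
  finally show ?thesis .
qed

text \<open>The mirror image of \<open>convol_cancel\<close>: as \<psi> has integral 1,
  \<open>k y\<close> can be brought under the integral, and now the modulus of continuity of
  \<open>k\<close> meets the first moment of \<psi>.\<close>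

lemma convol_approx:
  fixes \<psi> k :: "'a::euclidean_space \<Rightarrow> complex"
  assumes \<psi>: "integrable lborel \<psi>" and \<psi>b: "\<And>x. norm (\<psi> x) \<le> G" and k: "integrable lborel k" and \<psi>1: "(LINT u|lborel. \<psi> u) = 1"
    and L: "\<And>v. (\<integral>\<^sup>+u. ennreal (norm (k (u + v) - k u)) \<partial>lborel) \<le> ennreal L * ennreal (norm v)"
  shows "(\<integral>\<^sup>+y. ennreal (norm (convol \<psi> k y - k y)) \<partial>lborel) \<le> ennreal L * (\<integral>\<^sup>+z. ennreal (norm z * norm (\<psi> z)) \<partial>lborel)"
proof -
  have [measurable]: "k \<in> borel_measurable borel" "\<psi> \<in> borel_measurable borel" using k \<psi> by auto
  have e: "convol \<psi> k y - k y = (LINT z|lborel. \<psi> z * (k (y - z) - k y))" for y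
  proof -
    have i: "integrable lborel (\<lambda>z. \<psi> (y - (y - z)) * k (y - z))"
      by (rule integrable_lborel_reflect[where f="\<lambda>z. \<psi> (y - z) * k z"]) (rule convol_integrand[OF _ \<psi>b k], measurable)
    have "convol \<psi> k y = (LINT z|lborel. \<psi> (y - (y - z)) * k (y - z))"
      unfolding convol_def by (rule integral_lborel_reflect[where f="\<lambda>z. \<psi> (y - z) * k z", symmetric]) measurable
    moreover have "k y = (LINT z|lborel. \<psi> z * k y)" using \<psi>1 by simp
    ultimately show ?thesis
      unfolding right_diff_distrib using i \<psi> by (subst Bochner_Integration.integral_diff) auto
  qed
  have "(\<integral>\<^sup>+y. ennreal (norm (convol \<psi> k y - k y)) \<partial>lborel) \<le> (\<integral>\<^sup>+y. \<integral>\<^sup>+z. ennreal (norm (\<psi> z * (k (y - z) - k y))) \<partial>lborel \<partial>lborel)"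
    unfolding e by (intro nn_integral_mono norm_le_nn)
  also have "\<dots> \<le> ennreal L * (\<integral>\<^sup>+z. ennreal (norm z * norm (\<psi> z)) \<partial>lborel)"
  proof (rule nn_convol_swap)
    fix z
    have "(\<integral>\<^sup>+u. ennreal (norm (\<psi> z * (k (u + z - z) - k (u + z)))) \<partial>lborel)
      = (\<integral>\<^sup>+u. ennreal (norm (\<psi> z)) * ennreal (norm (k (u + z) - k u)) \<partial>lborel)"
      by (simp add: norm_mult ennreal_mult' norm_minus_commute)
    also have "\<dots> = ennreal (norm (\<psi> z)) * (\<integral>\<^sup>+u. ennreal (norm (k (u + z) - k u)) \<partial>lborel)"
      by (rule nn_integral_cmult) measurable
    also have "\<dots> \<le> ennreal (norm (\<psi> z)) * (ennreal L * ennreal (norm z))" by (intro mult_left_mono L) auto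
    also have "\<dots> = ennreal L * ennreal (norm z * norm (\<psi> z))" by (simp add: ennreal_mult' mult_ac)
    finally show "(\<integral>\<^sup>+u. ennreal (norm (\<psi> z * (k (u + z - z) - k (u + z)))) \<partial>lborel) \<le> \<dots>" .
  qed measurable
  finally show ?thesis .
qed

section \<open>Local estimates from the decay hypothesis\<close>

text \<open>The unordered sum over the integers is a limit along finite sets; measurability and
  Fatou arguments need a sequence.\<close>

lemma symmetric_sums_tendsto:
  fixes f :: "int \<Rightarrow> complex"
  assumes "f summable_on UNIV"
  shows "(\<lambda>M. \<Sum>i\<in>{- int M..int M}. f i) \<longlonglongrightarrow> (\<Sum>\<^sub>\<infinity>i. f i)"
proof -
  have "filterlim (\<lambda>M. {- int M..int M}) (finite_subsets_at_top UNIV) sequentially"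
    unfolding filterlim_finite_subsets_at_top
  proof (intro allI impI)
    fix X :: "int set" assume X: "finite X \<and> X \<subseteq> UNIV"
    define N where "N = (\<Sum>x\<in>X. nat \<bar>x\<bar>)"
    have "X \<subseteq> {- int M..int M}" if "M \<ge> N" for M
    proof
      fix x assume "x \<in> X"
      then have "nat \<bar>x\<bar> \<le> N" unfolding N_def using X by (intro member_le_sum) auto
      then show "x \<in> {- int M..int M}" using that by auto
    qed
    then show "\<forall>\<^sub>F M in sequentially. finite {- int M..int M} \<and> X \<subseteq> {- int M..int M} \<and> {- int M..int M} \<subseteq> UNIV"
      by (auto simp: eventually_sequentially intro!: exI[of _ N])
  qed
  moreover have "(sum f \<longlongrightarrow> (\<Sum>\<^sub>\<infinity>i. f i)) (finite_subsets_at_top UNIV)"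
    using has_sum_infsum[OF assms] by (simp add: has_sum_def)
  ultimately show ?thesis by (rule filterlim_compose[rotated])
qed

lemma summable_on_int_decay:
  fixes f :: "int \<Rightarrow> complex"
  assumes "\<And>i. norm (f i) \<le> C * 2 powi (- \<bar>i\<bar>)"
  shows "f summable_on UNIV"
proof -
  have C: "C \<ge> 0" using order_trans[OF norm_ge_zero assms[of 0]] by simp
  have b: "sum (\<lambda>i. norm (f i)) F \<le> 4 * C" if F: "finite F" for F
  proof -
    have "sum (\<lambda>i. norm (f i)) F \<le> (\<Sum>i\<in>F. C * 2 powi (- \<bar>i\<bar>))" by (intro sum_mono assms)
    also have "\<dots> = C * (\<Sum>i\<in>F. 2 powi (- \<bar>i\<bar>))" by (simp add: sum_distrib_left)
    also have "(\<Sum>i\<in>F. 2 powi (- \<bar>i\<bar>)) = (\<Sum>i\<in>{i\<in>F. 0 \<le> i}. 2 powi (- \<bar>i\<bar>)) + (\<Sum>i\<in>{i\<in>F. i < 0}. (2::real) powi (- \<bar>i\<bar>))"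
      using F by (subst sum.union_disjoint[symmetric]) (auto intro!: sum.cong)
    also have "(\<Sum>i\<in>{i\<in>F. 0 \<le> i}. (2::real) powi (- \<bar>i\<bar>)) = (\<Sum>i\<in>{i\<in>F. 0 \<le> i}. 2 powi (0 - i))" by (intro sum.cong) auto
    also have "(\<Sum>i\<in>{i\<in>F. i < 0}. (2::real) powi (- \<bar>i\<bar>)) = (\<Sum>i\<in>{i\<in>F. i < 0}. 2 powi (i - 0))" by (intro sum.cong) auto
    also have "(\<Sum>i\<in>{i\<in>F. 0 \<le> i}. (2::real) powi (0 - i)) + (\<Sum>i\<in>{i\<in>F. i < 0}. 2 powi (i - 0)) \<le> 2 + 2"
      using F by (intro add_mono sum_powi_upper sum_powi_lower) auto
    finally show ?thesis using C by (simp add: mult_left_mono)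
  qed
  have "(\<lambda>i. norm (f i)) summable_on UNIV"
    by (rule nonneg_bdd_above_summable_on) (auto intro!: bdd_aboveI2[where M="4 * C"] b)
  then show ?thesis by (rule abs_summable_summable)
qed

lemma fatou_bound:
  fixes u :: "nat \<Rightarrow> 'a \<Rightarrow> complex"
  assumes [measurable]: "\<And>n. u n \<in> borel_measurable M" and lim: "\<And>x. (\<lambda>n. u n x) \<longlonglongrightarrow> v x"
    and bd: "\<And>n. n \<ge> N \<Longrightarrow> (\<integral>\<^sup>+x. ennreal (norm (u n x)) \<partial>M) \<le> c"
  shows "(\<integral>\<^sup>+x. ennreal (norm (v x)) \<partial>M) \<le> c"
proof -
  have "ennreal (norm (v x)) = liminf (\<lambda>n. ennreal (norm (u (n + N) x)))" for x
  proof -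
    have "(\<lambda>n. ennreal (norm (u (n + N) x))) \<longlonglongrightarrow> ennreal (norm (v x))"
      by (intro tendsto_ennrealI tendsto_norm LIMSEQ_ignore_initial_segment lim)
    then show ?thesis by (intro lim_imp_Liminf[symmetric]) auto
  qed
  then have "(\<integral>\<^sup>+x. ennreal (norm (v x)) \<partial>M) = (\<integral>\<^sup>+x. liminf (\<lambda>n. ennreal (norm (u (n + N) x))) \<partial>M)" by simp
  also have "\<dots> \<le> liminf (\<lambda>n. \<integral>\<^sup>+x. ennreal (norm (u (n + N) x)) \<partial>M)"
    by (rule nn_integral_liminf) measurable
  also have "\<dots> \<le> liminf (\<lambda>n. c)" by (intro Liminf_mono always_eventually allI bd) simp
  also have "\<dots> = c" by (simp add: Liminf_const)
  finally show ?thesis .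
qed

lemma bil_kernel_diff:
  assumes k: "integrable lborel k" "integrable lborel k'" and [measurable]: "f \<in> borel_measurable borel" "g \<in> borel_measurable borel"
    and f: "\<And>x. norm (f x) \<le> u" and g: "\<And>x. norm (g x) \<le> v"
  shows "bil (\<lambda>y. k y - k' y) f g x = bil k f g x - bil k' f g x"
proof -
  have "integrable lborel (\<lambda>y. k y * f (x - fst y) * g (x - snd y))" "integrable lborel (\<lambda>y. k' y * f (x - fst y) * g (x - snd y))"
    by (rule bil_integrable[OF k(1) _ _ f g] bil_integrable[OF k(2) _ _ f g]; measurable)+
  then show ?thesis unfolding bil_def left_diff_distrib by (rule Bochner_Integration.integral_diff)
qed

text \<open>Both expressions are the double integral of k y * \<psi> ((x, x) - y - z) * h1 (fst z) *
  h2 (snd z). The tensor property of \<psi> combines the two input convolutions, and Fubini then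
  attaches \<psi> to the kernel.\<close>

lemma bil_convol:
  fixes k :: "'a::euclidean_space \<times> 'a \<Rightarrow> complex"
  assumes k: "integrable lborel k" and h: "integrable lborel h1" "integrable lborel h2"
    and [measurable]: "\<psi> \<in> borel_measurable borel" "\<phi> \<in> borel_measurable borel" and \<psi>: "\<And>x. norm (\<psi> x) \<le> G"
    and \<phi>: "\<And>x. norm (\<phi> x) \<le> G'"
    and tensor: "\<And>x y. \<psi> (x, y) = \<phi> x * \<phi> y"
  shows "bil k (convol \<phi> h1) (convol \<phi> h2) x = bil (convol \<psi> k) h1 h2 x"
proof -
  have [measurable]: "k \<in> borel_measurable borel" "h1 \<in> borel_measurable borel" "h2 \<in> borel_measurable borel"
    using k h by auto
  define X where "X = (x, x)"
  define Hh where "Hh z = h1 (fst z) * h2 (snd z)" for z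
  have Hi: "integrable lborel Hh" unfolding Hh_def[abs_def] by (rule integrable_tensor(1)[OF h])
  have [measurable]: "Hh \<in> borel_measurable borel" unfolding Hh_def[abs_def] by measurable
  have G: "G \<ge> 0" using \<psi>[of undefined] norm_ge_zero order_trans by blast
  have inner: "convol \<phi> h1 (x - fst y) * convol \<phi> h2 (x - snd y) = (LINT z|lborel. \<psi> (X - y - z) * Hh z)" for y
  proof -
    have "convol \<phi> h1 (x - fst y) * convol \<phi> h2 (x - snd y)
      = (LINT z|lborel. (\<phi> (x - fst y - fst z) * h1 (fst z)) * (\<phi> (x - snd y - snd z) * h2 (snd z)))"
      unfolding convol_def
      by (rule integrable_tensor(2)[symmetric]; rule convol_integrand[OF _ \<phi>]; (rule h | measurable))
    also have "\<dots> = (LINT z|lborel. \<psi> (X - y - z) * Hh z)"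
    proof (rule Bochner_Integration.integral_cong[OF refl])
      fix z :: "'a \<times> 'a"
      have "\<psi> (X - y - z) = \<phi> (x - fst y - fst z) * \<phi> (x - snd y - snd z)"
        unfolding tensor[symmetric] X_def by (intro arg_cong[where f=\<psi>]) (simp add: prod_eq_iff)
      then show "(\<phi> (x - fst y - fst z) * h1 (fst z)) * (\<phi> (x - snd y - snd z) * h2 (snd z)) = \<psi> (X - y - z) * Hh z"
        by (simp add: Hh_def)
    qed
    finally show ?thesis .
  qed
  have "bil k (convol \<phi> h1) (convol \<phi> h2) x = (LINT y|lborel. LINT z|lborel. k y * (\<psi> (X - y - z) * Hh z))"
    unfolding bil_def mult.assoc inner by simp
  also have "\<dots> = (LINT z|lborel. LINT y|lborel. k y * (\<psi> (X - y - z) * Hh z))"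
  proof -
    have "(\<integral>\<^sup>+y. \<integral>\<^sup>+z. ennreal (norm (k y * (\<psi> (X - y - z) * Hh z))) \<partial>lborel \<partial>lborel)
      \<le> (\<integral>\<^sup>+y. \<integral>\<^sup>+z. ennreal (G * norm (k y)) * ennreal (norm (Hh z)) \<partial>lborel \<partial>lborel)"
    proof (intro nn_integral_mono)
      fix y z
      have "norm (k y) * norm (\<psi> (X - y - z)) * norm (Hh z) \<le> norm (k y) * G * norm (Hh z)"
        by (intro mult_right_mono mult_left_mono \<psi>) auto
      then show "ennreal (norm (k y * (\<psi> (X - y - z) * Hh z))) \<le> ennreal (G * norm (k y)) * ennreal (norm (Hh z))"
        using G by (simp add: norm_mult mult_ac ennreal_mult'[symmetric] ennreal_leI)
    qed
    also have "\<dots> = (\<integral>\<^sup>+y. ennreal (G * norm (k y)) \<partial>lborel) * (\<integral>\<^sup>+z. ennreal (norm (Hh z)) \<partial>lborel)"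
      by (subst nn_integral_cmult, measurable) (rule nn_integral_multc, measurable)
    also have "\<dots> < \<infinity>"
      using k Hi G by (simp add: integrable_iff_bounded ennreal_mult_less_top ennreal_mult' nn_integral_cmult)
    finally show ?thesis
      using fubini_lborel[of "\<lambda>p. k (fst p) * (\<psi> (X - fst p - snd p) * Hh (snd p))"] by simp
  qed
  also have "\<dots> = (LINT z|lborel. convol \<psi> k (X - z) * Hh z)"
  proof (rule Bochner_Integration.integral_cong[OF refl])
    fix z
    have "(LINT y|lborel. k y * (\<psi> (X - y - z) * Hh z)) = (LINT y|lborel. (\<psi> (X - z - y) * k y) * Hh z)"
    proof (rule Bochner_Integration.integral_cong[OF refl])
      fix y
      have e: "X - y - z = X - z - y" by (simp add: algebra_simps)
      show "k y * (\<psi> (X - y - z) * Hh z) = (\<psi> (X - z - y) * k y) * Hh z" unfolding e by (simp only: mult_ac)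
    qed
    then show "(LINT y|lborel. k y * (\<psi> (X - y - z) * Hh z)) = convol \<psi> k (X - z) * Hh z"
      by (simp only: convol_def integral_mult_left_zero)
  qed
  also have "\<dots> = bil (convol \<psi> k) h1 h2 x"
    unfolding X_def Hh_def by (rule bil_reflect[symmetric]) measurable
  finally show ?thesis .
qed

text \<open>All scales at once. \<open>zero\<close> and \<open>sup\<close> make the sum over i
  converge for Schwartz inputs, at fine and at coarse scales respectively, and \<open>zero\<close>
  also lets mollification annihilate the fine pieces. The constant \<open>S\<close> may depend on
  everything and enters no final bound.\<close>

locale kernel_family =
  fixes k :: "int \<Rightarrow> 'a::euclidean_space \<times> 'a \<Rightarrow> complex" and A :: real and \<mu> :: int and S :: real
  assumes A_nonneg: "0 \<le> A" and mu_nonneg: "0 \<le> \<mu>" and S_nonneg: "0 \<le> S"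
    and meas [measurable]: "\<And>i. k i \<in> borel_measurable borel"
    and mass: "\<And>i. (\<integral>\<^sup>+y. ennreal (norm (k i y)) \<partial>lborel) \<le> ennreal A"
    and moment: "\<And>i. (\<integral>\<^sup>+y. ennreal (norm y * norm (k i y)) \<partial>lborel) \<le> ennreal (A * 2 powi (-i))"
    and smooth: "\<And>i v. (\<integral>\<^sup>+y. ennreal (norm (k i (y + v) - k i y)) \<partial>lborel) \<le> ennreal (A * 2 powi (\<mu> + i) * norm v)"
    and zero: "\<And>i. (LINT y|lborel. k i y) = 0"
    and sup: "\<And>i y. i \<le> 0 \<Longrightarrow> norm (k i y) \<le> S * 2 powi i"
begin

lemma k_integrable: "integrable lborel (k i)"
  using mass[of i] by (intro integrableI_bounded) (auto simp: less_top[symmetric] top_unique)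

definition T :: "('a \<Rightarrow> complex) \<Rightarrow> ('a \<Rightarrow> complex) \<Rightarrow> 'a \<Rightarrow> complex" where
  "T f1 f2 x = (\<Sum>\<^sub>\<infinity>i. bil (k i) f1 f2 x)"

text \<open>For i \<ge> 0 the vanishing integral allows the value at y = 0 to be subtracted, and the
  Lipschitz bound of the inputs meets the first moment 2^-i. For i \<le> 0 the supremum bound 2^i
  meets the L^1 norms of the inputs.\<close>

lemma bil_decay:
  assumes f: "schwartz f1" "schwartz f2"
  shows "\<exists>C. \<forall>i. norm (bil (k i) f1 f2 x) \<le> C * 2 powi (- \<bar>i\<bar>)"
proof -
  have [measurable]: "f1 \<in> borel_measurable borel" "f2 \<in> borel_measurable borel" using f by (auto intro: schwartz_borel)
  obtain B1 where B1: "B1 \<ge> 0" "\<And>x. norm (f1 x) \<le> B1" using schwartz_bounded[OF f(1)] by blast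
  obtain B2 where B2: "B2 \<ge> 0" "\<And>x. norm (f2 x) \<le> B2" using schwartz_bounded[OF f(2)] by blast
  obtain L1 where L1: "L1 \<ge> 0" "\<And>x v. norm (f1 (x + v) - f1 x) \<le> L1 * norm v" using schwartz_diff_bound[OF f(1), of 0] by auto
  obtain L2 where L2: "L2 \<ge> 0" "\<And>x v. norm (f2 (x + v) - f2 x) \<le> L2 * norm v" using schwartz_diff_bound[OF f(2), of 0] by auto
  define L where "L = L1 * B2 + B1 * L2"
  have L: "L \<ge> 0" using B1 B2 L1 L2 by (simp add: L_def)
  define N where "N = (LINT x|lborel. norm (f1 x)) * (LINT x|lborel. norm (f2 x))"
  have N: "N \<ge> 0" by (simp add: N_def)
  define F where "F y = f1 (x - fst y) * f2 (x - snd y)" for y :: "'a \<times> 'a"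
  have [measurable]: "F \<in> borel_measurable borel" unfolding F_def[abs_def] by measurable
  have FL: "norm (F y - F 0) \<le> L * norm y" for y
  proof -
    have e: "F y - F 0 = (f1 (x + (- fst y)) - f1 x) * f2 (x - snd y) + f1 x * (f2 (x + (- snd y)) - f2 x)"
      by (simp add: F_def algebra_simps)
    have "norm (F y - F 0) \<le> norm (f1 (x + (- fst y)) - f1 x) * norm (f2 (x - snd y)) + norm (f1 x) * norm (f2 (x + (- snd y)) - f2 x)"
      unfolding e norm_mult[symmetric] by (rule norm_triangle_ineq)
    also have "\<dots> \<le> (L1 * norm (- fst y)) * B2 + B1 * (L2 * norm (- snd y))"
      by (intro add_mono mult_mono L1 L2 B1 B2) (auto simp: L1 L2 B1 B2)
    also have "\<dots> \<le> (L1 * norm y) * B2 + B1 * (L2 * norm y)"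
      using norm_fst_le[of "fst y" "snd y"] norm_snd_le[of "snd y" "fst y"] L1(1) L2(1) B1(1) B2(1)
      by (intro add_mono mult_left_mono mult_right_mono) auto
    finally show ?thesis by (simp add: L_def algebra_simps)
  qed
  have pos: "norm (bil (k i) f1 f2 x) \<le> (L * A) * 2 powi (- \<bar>i\<bar>)" if i: "i \<ge> 0" for i
  proof -
    have kF: "integrable lborel (\<lambda>y. k i y * F y)"
    proof -
      have "integrable lborel (\<lambda>y. k i y * f1 (x - fst y) * f2 (x - snd y))"
        by (rule bil_integrable[OF k_integrable _ _ B1(2) B2(2)]) measurable
      then show ?thesis by (simp add: F_def mult.assoc)
    qed
    have "bil (k i) f1 f2 x = (LINT y|lborel. k i y * F y) - (LINT y|lborel. k i y * F 0)"
      by (simp add: bil_def F_def mult.assoc zero)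
    also have "\<dots> = (LINT y|lborel. k i y * (F y - F 0))"
      unfolding right_diff_distrib using kF k_integrable by (intro Bochner_Integration.integral_diff[symmetric]) auto
    finally have e: "bil (k i) f1 f2 x = (LINT y|lborel. k i y * (F y - F 0))" .
    have "ennreal (norm (bil (k i) f1 f2 x)) \<le> (\<integral>\<^sup>+y. ennreal (norm (k i y * (F y - F 0))) \<partial>lborel)"
      unfolding e by (rule norm_le_nn)
    also have "\<dots> \<le> (\<integral>\<^sup>+y. ennreal L * ennreal (norm y * norm (k i y)) \<partial>lborel)"
    proof (rule nn_integral_mono)
      fix y
      have "norm (k i y) * norm (F y - F 0) \<le> norm (k i y) * (L * norm y)" by (intro mult_left_mono FL) auto
      then show "ennreal (norm (k i y * (F y - F 0))) \<le> ennreal L * ennreal (norm y * norm (k i y))"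
        using L by (simp add: norm_mult ennreal_mult'[symmetric] mult_ac ennreal_leI)
    qed
    also have "\<dots> = ennreal L * (\<integral>\<^sup>+y. ennreal (norm y * norm (k i y)) \<partial>lborel)" by (rule nn_integral_cmult) measurable
    also have "\<dots> \<le> ennreal L * ennreal (A * 2 powi (-i))" by (intro mult_left_mono moment) auto
    also have "\<dots> = ennreal ((L * A) * 2 powi (- \<bar>i\<bar>))" using L i by (simp add: ennreal_mult'[symmetric] mult.assoc)
    finally show ?thesis using L A_nonneg by (subst (asm) ennreal_le_iff) auto
  qed
  have neg: "norm (bil (k i) f1 f2 x) \<le> (S * N) * 2 powi (- \<bar>i\<bar>)" if i: "i \<le> 0" for i
  proof -
    have "ennreal (norm (bil (k i) f1 f2 x)) \<le> (\<integral>\<^sup>+y. ennreal (norm (k i y * f1 (x - fst y) * f2 (x - snd y))) \<partial>lborel)"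
      unfolding bil_def by (rule norm_le_nn)
    also have "\<dots> \<le> (\<integral>\<^sup>+y. ennreal (S * 2 powi i) * (ennreal (norm (f1 (x - fst y))) * ennreal (norm (f2 (x - snd y)))) \<partial>lborel)"
    proof (rule nn_integral_mono)
      fix y
      have "norm (k i y) * (norm (f1 (x - fst y)) * norm (f2 (x - snd y))) \<le> (S * 2 powi i) * (norm (f1 (x - fst y)) * norm (f2 (x - snd y)))"
        by (intro mult_right_mono sup i) auto
      then show "ennreal (norm (k i y * f1 (x - fst y) * f2 (x - snd y))) \<le> ennreal (S * 2 powi i) * (ennreal (norm (f1 (x - fst y))) * ennreal (norm (f2 (x - snd y))))"
        using S_nonneg by (simp add: norm_mult ennreal_mult'[symmetric] mult.assoc ennreal_leI)
    qed
    also have "\<dots> = ennreal (S * 2 powi i) * (\<integral>\<^sup>+y. ennreal (norm (f1 (x - fst y))) * ennreal (norm (f2 (x - snd y))) \<partial>lborel)"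
      by (rule nn_integral_cmult) measurable
    also have "(\<integral>\<^sup>+y. ennreal (norm (f1 (x - fst y))) * ennreal (norm (f2 (x - snd y))) \<partial>lborel)
      = (\<integral>\<^sup>+y1. \<integral>\<^sup>+y2. ennreal (norm (f1 (x - y1))) * ennreal (norm (f2 (x - y2))) \<partial>lborel \<partial>lborel)"
      by (subst nn_integral_lborel_prod_fst) auto
    also have "\<dots> = (\<integral>\<^sup>+y1. ennreal (norm (f1 (x - y1))) \<partial>lborel) * (\<integral>\<^sup>+y2. ennreal (norm (f2 (x - y2))) \<partial>lborel)"
      by (subst nn_integral_cmult, measurable) (rule nn_integral_multc, measurable)
    also have "\<dots> = ennreal N"
      using nn_integral_lborel_reflect[of "\<lambda>y. ennreal (norm (f1 y))" x] nn_integral_lborel_reflect[of "\<lambda>y. ennreal (norm (f2 y))" x]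
      by (simp add: nn_norm_integrable schwartz_integrable(1) f N_def ennreal_mult')
    also have "ennreal (S * 2 powi i) * ennreal N = ennreal ((S * N) * 2 powi (- \<bar>i\<bar>))"
      using S_nonneg i by (subst ennreal_mult'[symmetric]) (auto simp: mult_ac)
    finally show ?thesis using S_nonneg N by (subst (asm) ennreal_le_iff) auto
  qed
  have "norm (bil (k i) f1 f2 x) \<le> (L * A + S * N) * 2 powi (- \<bar>i\<bar>)" for i
  proof (cases "i \<ge> 0")
    case True
    have "(L * A) * 2 powi (- \<bar>i\<bar>) \<le> (L * A + S * N) * 2 powi (- \<bar>i\<bar>)" using S_nonneg N by (intro mult_right_mono) auto
    with pos[OF True] show ?thesis by linarith
  next
    case False
    have "(S * N) * 2 powi (- \<bar>i\<bar>) \<le> (L * A + S * N) * 2 powi (- \<bar>i\<bar>)" using L A_nonneg by (intro mult_right_mono) auto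
    with neg[of i] False show ?thesis by linarith
  qed
  then show ?thesis by blast
qed

lemma T_tendsto:
  assumes "schwartz f1" "schwartz f2"
  shows "(\<lambda>M. \<Sum>i\<in>{- int M..int M}. bil (k i) f1 f2 x) \<longlonglongrightarrow> T f1 f2 x"
proof -
  obtain C where "\<forall>i. norm (bil (k i) f1 f2 x) \<le> C * 2 powi (- \<bar>i\<bar>)" using bil_decay[OF assms] by (rule exE)
  then show ?thesis unfolding T_def by (intro symmetric_sums_tendsto summable_on_int_decay[where C=C]) blast
qed

lemma T_borel:
  assumes "schwartz f1" "schwartz f2"
  shows "T f1 f2 \<in> borel_measurable borel"
proof (rule borel_measurable_LIMSEQ_metric)
  have [measurable]: "f1 \<in> borel_measurable borel" "f2 \<in> borel_measurable borel" using assms by (auto intro: schwartz_borel)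
  show "(\<lambda>x. \<Sum>i\<in>{- int M..int M}. bil (k i) f1 f2 x) \<in> borel_measurable borel" for M by measurable
qed (rule T_tendsto[OF assms])

end

lemma norm_le_indicator:
  fixes a :: complex
  assumes "norm a \<le> indicator E x"
  shows "norm a \<le> 1" "ennreal (norm a) \<le> indicator E x" "x \<notin> E \<Longrightarrow> a = 0"
  using order_trans[OF assms indicator_le_1] assms by (cases "x \<in> E"; simp)+

text \<open>One constant for moment and smoothness; c \<ge> 1 lets it dominate the mass 1 of the
  mollifier as well.\<close>

lemma mollifier_constant:
  "\<exists>c\<ge>1. (\<integral>\<^sup>+z. ennreal (norm z * norm (mollifier (z::'a::euclidean_space))) \<partial>lborel) \<le> ennreal c \<and>
    (\<forall>v. (\<integral>\<^sup>+u. ennreal (norm (mollifier (u + v) - mollifier (u::'a))) \<partial>lborel) \<le> ennreal (c * norm v))"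
proof -
  obtain C where C: "C \<ge> 0 \<and> (\<forall>v. (\<integral>\<^sup>+u. ennreal (norm (mollifier (u + v) - mollifier (u::'a))) \<partial>lborel) \<le> ennreal (C * norm v))"
    using schwartz_L1_smooth[OF mollifier_schwartz] by (elim exE)
  define m where "m = (LINT z|lborel. norm z * norm (mollifier (z::'a)))"
  have m: "m \<ge> 0" by (simp add: m_def)
  have e: "(\<integral>\<^sup>+z. ennreal (norm z * norm (mollifier (z::'a))) \<partial>lborel) = ennreal m"
    unfolding m_def by (intro nn_integral_eq_integral schwartz_integrable(2) mollifier_schwartz) auto
  have "(\<integral>\<^sup>+u. ennreal (norm (mollifier (u + v) - mollifier (u::'a))) \<partial>lborel) \<le> ennreal ((1 + C + m) * norm v)" for v
  proof -
    have "C * norm v \<le> (1 + C + m) * norm v" using m by (intro mult_right_mono) auto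
    then show ?thesis using C by (meson ennreal_leI order_trans)
  qed
  then show ?thesis using C m e by (intro exI[of _ "1 + C + m"]) (auto intro!: ennreal_leI)
qed

context kernel_family
begin

text \<open>For \<open>i \<le> b\<close> mollification barely changes the kernel since its modulus of continuity is small; for
  \<open>i > b\<close> it nearly annihilates the kernel since the integral vanishes and the first moment is small.\<close>

lemma mollified_piece:
  assumes c: "c \<ge> 1" "(\<integral>\<^sup>+z. ennreal (norm z * norm (mollifier (z::'a \<times> 'a))) \<partial>lborel) \<le> ennreal c"
    "\<And>v. (\<integral>\<^sup>+u. ennreal (norm (mollifier (u + v) - mollifier (u::'a \<times> 'a))) \<partial>lborel) \<le> ennreal (c * norm v)"
    and r: "r = 2 powi (- (\<mu> + b))"
  shows "(\<integral>\<^sup>+y. ennreal (norm (convol (dyadic mollifier (\<mu> + b)) (k i) y - (if i \<le> b then k i y else 0))) \<partial>lborel)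
    \<le> ennreal (c * A * min 1 (min (2 powi (\<mu> + i) * r) (1 / (2 powi i * r))))"
proof -
  let ?\<psi> = "dyadic mollifier (\<mu> + b) :: 'a \<times> 'a \<Rightarrow> complex"
  have sch: "schwartz ?\<psi>" by (rule dyadic_mollifier_schwartz)
  have pm [measurable]: "?\<psi> \<in> borel_measurable borel" by (rule schwartz_borel[OF sch])
  obtain G where "G \<ge> 0 \<and> (\<forall>x. norm (?\<psi> x) \<le> G)" using schwartz_bounded[OF sch] by (elim exE)
  then have G: "norm (?\<psi> x) \<le> G" for x by blast
  \<comment> \<open>With this r the two nontrivial entries of the minimum are 2^(i-b) and
    2^(\<mu>+b-i), so \<open>dyadic_sum_bound\<close> also sums the mollification errors.\<close>
  have x: "2 powi (\<mu> + i) * r = 2 powi (i - b)" and t: "1 / (2 powi i * r) = 2 powi (\<mu> + b - i)"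
    by (simp_all add: r power_int_add power_int_diff power_int_minus field_simps)
  show ?thesis
  proof (cases "i \<le> b")
    case True
    have "(\<integral>\<^sup>+y. ennreal (norm (convol ?\<psi> (k i) y - k i y)) \<partial>lborel)
      \<le> ennreal (A * 2 powi (\<mu> + i)) * (\<integral>\<^sup>+z. ennreal (norm z * norm (?\<psi> z)) \<partial>lborel)"
    proof (rule convol_approx[OF schwartz_integrable(1)[OF sch] G k_integrable])
      show "(LINT u|lborel. ?\<psi> u) = 1" by (simp add: dyadic_integral mollifier_integral)
      show "(\<integral>\<^sup>+u. ennreal (norm (k i (u + v) - k i u)) \<partial>lborel) \<le> ennreal (A * 2 powi (\<mu> + i)) * ennreal (norm v)" for v
        using smooth[of i v] A_nonneg by (simp add: ennreal_mult')
    qed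
    also have "\<dots> \<le> ennreal (A * 2 powi (\<mu> + i)) * (ennreal r * ennreal c)"
      unfolding dyadic_L1(2)[OF mollifier_borel] r by (intro mult_left_mono c) auto
    also have "\<dots> = ennreal (A * 2 powi (\<mu> + i) * (r * c))"
      using A_nonneg c by (simp add: ennreal_mult'[symmetric] r del: ennreal_mult'')
    also have "A * 2 powi (\<mu> + i) * (r * c) = c * A * 2 powi (i - b)" unfolding x[symmetric] by (simp add: mult_ac)
    \<comment> \<open>For i \<le> b the smallest entry is 2^(i-b), because i - b \<le> 0 \<le> \<mu>
      + b - i.\<close>
    also have "2 powi (i - b) = min 1 (min (2 powi (\<mu> + i) * r) (1 / (2 powi i * r)))"
    proof -
      have "2 powi (i - b) \<le> (2::real) powi 0" "2 powi (i - b) \<le> (2::real) powi (\<mu> + b - i)"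
        using True mu_nonneg by (intro power_int_increasing; simp)+
      then show ?thesis unfolding x t by simp
    qed
    finally show ?thesis using True by simp
  next
    case False
    have m1: "(\<integral>\<^sup>+y. ennreal (norm (convol ?\<psi> (k i) y)) \<partial>lborel) \<le> ennreal (c * A * 1)"
    proof -
      have "(\<integral>\<^sup>+y. ennreal (norm (convol ?\<psi> (k i) y)) \<partial>lborel) \<le> 1 * ennreal A"
        using convol_L1[OF pm meas, of i] mult_left_mono[OF mass[of i], of 1] unfolding dyadic_mollifier_L1 by (rule order_trans) simp
      also have "\<dots> \<le> ennreal (c * A * 1)" using c A_nonneg by (simp add: ennreal_leI mult_le_cancel_right1)
      finally show ?thesis .
    qed
    have m2: "(\<integral>\<^sup>+y. ennreal (norm (convol ?\<psi> (k i) y)) \<partial>lborel) \<le> ennreal (c * A * 2 powi (\<mu> + b - i))"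
    proof -
      have "(\<integral>\<^sup>+y. ennreal (norm (convol ?\<psi> (k i) y)) \<partial>lborel) \<le> ennreal (c * 2 powi (\<mu> + b)) * (\<integral>\<^sup>+z. ennreal (norm z * norm (k i z)) \<partial>lborel)"
      proof (rule convol_cancel[OF pm G k_integrable zero])
        fix v
        show "(\<integral>\<^sup>+u. ennreal (norm (?\<psi> (u + v) - ?\<psi> u)) \<partial>lborel) \<le> ennreal (c * 2 powi (\<mu> + b)) * ennreal (norm v)"
          unfolding dyadic_L1(3)[OF mollifier_borel]
          using c(3)[of "(2 powi (\<mu> + b)) *\<^sub>R v"] c(1) by (simp add: ennreal_mult'[symmetric] mult.assoc)
      qed
      also have "\<dots> \<le> ennreal (c * 2 powi (\<mu> + b)) * ennreal (A * 2 powi (-i))" by (intro mult_left_mono moment) auto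
      also have "\<dots> = ennreal (c * A * 2 powi (\<mu> + b - i))"
      proof -
        have e: "c * 2 powi (\<mu> + b) * (A * 2 powi (-i)) = c * A * 2 powi (\<mu> + b - i)"
          by (simp add: power_int_diff power_int_minus divide_inverse mult_ac)
        show ?thesis unfolding e[symmetric] using c(1) by (intro ennreal_mult'[symmetric]) simp
      qed
      finally show ?thesis .
    qed
    have "(1::real) = 2 powi 0" by simp
    also have "(2::real) powi 0 \<le> 2 powi (i - b)" using False by (intro power_int_increasing) auto
    finally have big: "1 \<le> (2::real) powi (i - b)" .
    \<comment> \<open>For i > b the entry 2^(i-b) is at least 1 and drops out, leaving the trivial
      bound and the cancellation bound.\<close>
    have "min 1 (min (2 powi (\<mu> + i) * r) (1 / (2 powi i * r))) = min 1 (2 powi (\<mu> + b - i))"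
      unfolding x t using big by (auto simp: min_def)
    then show ?thesis using m1 m2 False by (simp add: min_def)
  qed
qed

text \<open>Each error kernel is small in L^1, so \<open>bil_L1_bound\<close> applies with the L^1
  norm of \<open>h1\<close> at most the measure of E. The sum over scales is uniform in
  \<open>b\<close> and in the finite set \<open>G\<close>.\<close>

lemma residual_bound:
  assumes c: "c \<ge> 1" "(\<integral>\<^sup>+z. ennreal (norm z * norm (mollifier (z::'a \<times> 'a))) \<partial>lborel) \<le> ennreal c"
    "\<And>v. (\<integral>\<^sup>+u. ennreal (norm (mollifier (u + v) - mollifier (u::'a \<times> 'a))) \<partial>lborel) \<le> ennreal (c * norm v)"
    and G: "finite G" and [measurable]: "E \<in> sets borel" "h1 \<in> borel_measurable borel" "h2 \<in> borel_measurable borel"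
    and h: "\<And>x. norm (h1 x) \<le> indicator E x" "\<And>x. norm (h2 x) \<le> indicator E x"
  shows "(\<integral>\<^sup>+x. ennreal (norm (\<Sum>i\<in>G. bil (\<lambda>y. convol (dyadic mollifier (\<mu> + b)) (k i) y - (if i \<le> b then k i y else 0)) h1 h2 x)) \<partial>lborel)
    \<le> ennreal (c * A * (of_int \<mu> + 5)) * emeasure lborel E"
proof -
  let ?\<psi> = "dyadic mollifier (\<mu> + b) :: 'a \<times> 'a \<Rightarrow> complex"
  let ?D = "\<lambda>i y. convol ?\<psi> (k i) y - (if i \<le> b then k i y else 0)"
  define r :: real where "r = 2 powi (- (\<mu> + b))"
  let ?m = "\<lambda>i. min 1 (min (2 powi (\<mu> + i) * r) (1 / (2 powi i * r)))"
  have [measurable]: "?\<psi> \<in> borel_measurable borel" by (rule schwartz_borel[OF dyadic_mollifier_schwartz])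
  have Dm [measurable]: "?D i \<in> borel_measurable borel" for i by (cases "i \<le> b") (simp_all, measurable)
  have r: "r > 0" by (simp add: r_def)
  have h2: "norm (h2 x) \<le> 1" for x by (rule norm_le_indicator[OF h(2)])
  have h1: "(\<integral>\<^sup>+x. ennreal (norm (h1 x)) \<partial>lborel) \<le> emeasure lborel E"
  proof -
    have "(\<integral>\<^sup>+x. ennreal (norm (h1 x)) \<partial>lborel) \<le> (\<integral>\<^sup>+x. indicator E x \<partial>lborel)"
      by (intro nn_integral_mono norm_le_indicator h)
    then show ?thesis by simp
  qed
  have "(\<integral>\<^sup>+x. ennreal (norm (\<Sum>i\<in>G. bil (?D i) h1 h2 x)) \<partial>lborel) \<le> (\<integral>\<^sup>+x. (\<Sum>i\<in>G. ennreal (norm (bil (?D i) h1 h2 x))) \<partial>lborel)"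
    by (intro nn_integral_mono) (simp add: sum_ennreal norm_sum ennreal_leI)
  also have "\<dots> = (\<Sum>i\<in>G. \<integral>\<^sup>+x. ennreal (norm (bil (?D i) h1 h2 x)) \<partial>lborel)"
    by (rule nn_integral_sum) measurable
  also have "\<dots> \<le> (\<Sum>i\<in>G. ennreal (c * A * ?m i) * emeasure lborel E)"
  proof (rule sum_mono)
    fix i
    have "(\<integral>\<^sup>+x. ennreal (norm (bil (?D i) h1 h2 x)) \<partial>lborel) \<le> (\<integral>\<^sup>+y. ennreal (norm (?D i y)) \<partial>lborel) * (\<integral>\<^sup>+x. ennreal (norm (h1 x)) \<partial>lborel)"
      by (rule bil_L1_bound[OF Dm _ _ h2]) measurable
    also have "\<dots> \<le> ennreal (c * A * ?m i) * emeasure lborel E"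
      by (intro mult_mono h1 mollified_piece[OF c r_def]) auto
    finally show "(\<integral>\<^sup>+x. ennreal (norm (bil (?D i) h1 h2 x)) \<partial>lborel) \<le> ennreal (c * A * ?m i) * emeasure lborel E" .
  qed
  also have "\<dots> = ennreal (c * A * (\<Sum>i\<in>G. ?m i)) * emeasure lborel E"
    using c A_nonneg r by (simp add: sum_distrib_right[symmetric] sum_ennreal sum_distrib_left)
  also have "\<dots> \<le> ennreal (c * A * (of_int \<mu> + 5)) * emeasure lborel E"
    using c A_nonneg dyadic_sum_bound[OF G r mu_nonneg] by (intro mult_right_mono ennreal_leI mult_left_mono) auto
  finally show ?thesis .
qed

text \<open>Averaging keeps the bound 1 and the L^1 bound e, and |f|^2 \<le> |f| for |f| \<le>
  1.\<close>

lemma mollified_L2: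
  fixes h :: "'a \<Rightarrow> complex"
  assumes [measurable]: "E \<in> sets borel" "h \<in> borel_measurable borel" and e: "emeasure lborel E = ennreal e" "e \<ge> 0"
    and h: "\<And>x. norm (h x) \<le> indicator E x"
  shows "Lp_norm 2 lborel (convol (dyadic mollifier j) h) \<le> ennreal (sqrt e)"
proof -
  let ?\<phi> = "dyadic mollifier j :: 'a \<Rightarrow> complex"
  let ?f = "convol ?\<phi> h"
  have pm [measurable]: "?\<phi> \<in> borel_measurable borel" by (rule schwartz_borel[OF dyadic_mollifier_schwartz])
  have f1: "norm (?f x) \<le> 1" for x
  proof -
    have "ennreal (norm (?f x)) \<le> (\<integral>\<^sup>+z. ennreal (norm (?\<phi> (x - z))) * ennreal (norm (h z)) \<partial>lborel)" by (rule convol_nn)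
    also have "\<dots> \<le> (\<integral>\<^sup>+z. ennreal (norm (?\<phi> (x - z))) * 1 \<partial>lborel)"
    proof (intro nn_integral_mono mult_left_mono)
      fix z have "norm (h z) \<le> 1" by (rule norm_le_indicator[OF h])
      then show "ennreal (norm (h z)) \<le> 1" by simp
    qed auto
    also have "\<dots> = 1"
      using nn_integral_lborel_reflect[of "\<lambda>z. ennreal (norm (?\<phi> z))" x] by (simp add: dyadic_mollifier_L1)
    finally show ?thesis by simp
  qed
  have "(\<integral>\<^sup>+x. ennreal (norm (?f x) powr enn2real 2) \<partial>lborel) \<le> (\<integral>\<^sup>+x. ennreal (norm (?f x)) \<partial>lborel)"
  proof (intro nn_integral_mono ennreal_leI)
    fix x
    have "(norm (?f x))\<^sup>2 \<le> norm (?f x)" using f1[of x] by (simp add: power2_eq_square mult_left_le)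
    then show "norm (?f x) powr enn2real 2 \<le> norm (?f x)" by simp
  qed
  also have "\<dots> \<le> (\<integral>\<^sup>+u. ennreal (norm (?\<phi> u)) \<partial>lborel) * (\<integral>\<^sup>+z. ennreal (norm (h z)) \<partial>lborel)"
    by (rule convol_L1) measurable
  also have "\<dots> \<le> 1 * (\<integral>\<^sup>+z. indicator E z \<partial>lborel)"
    unfolding dyadic_mollifier_L1 by (intro mult_left_mono nn_integral_mono norm_le_indicator h) simp
  also have "\<dots> = ennreal e" using e by simp
  finally have I: "(\<integral>\<^sup>+x. ennreal (norm (?f x) powr enn2real 2) \<partial>lborel) \<le> ennreal e" .
  define J where "J = (\<integral>\<^sup>+x. ennreal (norm (?f x) powr enn2real 2) \<partial>lborel)"
  have J: "J \<le> ennreal e" "J \<noteq> \<infinity>" using I by (auto simp: J_def top_unique)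
  have "Lp_norm 2 lborel ?f = ennreal (enn2real J powr (1 / 2))"
    using J(2) unfolding Lp_norm_def J_def by (simp add: Let_def)
  also have "enn2real J powr (1 / 2) = sqrt (enn2real J)" by (simp add: powr_half_sqrt)
  also have "ennreal \<dots> \<le> ennreal (sqrt e)"
    using J(1) e(2) by (intro ennreal_leI real_sqrt_le_mono enn2real_leI) auto
  finally show ?thesis .
qed

text \<open>Up to the residual, T applied to inputs mollified at parameter b is the sum of
  \<open>bil (k i) h1 h2\<close> over i \<le> b. Subtracting the cases b = N and b = -N - 1 leaves
  exactly the window from -N to N. Each of the two T terms costs B0 e, as the two L^2 norms are at
  most sqrt e, and each residual costs \<rho> e; hence the factors 2.\<close>

lemma local_bound:
  assumes c: "c \<ge> 1" "(\<integral>\<^sup>+z. ennreal (norm z * norm (mollifier (z::'a \<times> 'a))) \<partial>lborel) \<le> ennreal c"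
    "\<And>v. (\<integral>\<^sup>+u. ennreal (norm (mollifier (u + v) - mollifier (u::'a \<times> 'a))) \<partial>lborel) \<le> ennreal (c * norm v)"
    and E [measurable]: "E \<in> sets borel" and bE: "bounded E"
    and hm [measurable]: "h1 \<in> borel_measurable borel" "h2 \<in> borel_measurable borel"
    and h: "\<And>x. norm (h1 x) \<le> indicator E x" "\<And>x. norm (h2 x) \<le> indicator E x"
    and B0: "B0 \<ge> 0"
    and L2: "\<And>f1 f2. schwartz f1 \<Longrightarrow> schwartz f2 \<Longrightarrow>
      (\<integral>\<^sup>+x. ennreal (norm (T f1 f2 x)) \<partial>lborel) \<le> ennreal B0 * Lp_norm 2 lborel f1 * Lp_norm 2 lborel f2"
  shows "(\<integral>\<^sup>+x. ennreal (norm (bil (\<lambda>y. \<Sum>i\<in>{- int N..int N}. k i y) h1 h2 x)) \<partial>lborel)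
    \<le> ennreal (2 * B0 + 2 * (c * A * (of_int \<mu> + 5))) * emeasure lborel E"
proof -
  define \<rho> where "\<rho> = c * A * (of_int \<mu> + 5)"
  have \<rho>: "\<rho> \<ge> 0" using c A_nonneg mu_nonneg by (simp add: \<rho>_def)
  obtain R where R: "R > 0" "\<forall>x\<in>E. norm x \<le> R" using bE bounded_pos by blast
  have finE: "emeasure lborel E < \<infinity>" using emeasure_bounded_finite[OF bE] by simp
  define e where "e = measure lborel E"
  have e: "emeasure lborel E = ennreal e" "e \<ge> 0"
    unfolding e_def using finE by (auto intro: emeasure_eq_ennreal_measure)
  have h1: "norm (h1 x) \<le> 1" "norm (h2 x) \<le> 1" for x
    by (rule norm_le_indicator[OF h(1)], rule norm_le_indicator[OF h(2)])
  have hi: "integrable lborel h1" "integrable lborel h2"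
    using finE h1 norm_le_indicator(3)[OF h(1)] norm_le_indicator(3)[OF h(2)]
    by (auto intro!: integrableI_bounded_set[where A=E and B=1])
  have hR: "norm z \<le> R" if "h1 z \<noteq> 0 \<or> h2 z \<noteq> 0" for z
    using that norm_le_indicator(3)[OF h(1)[of z]] norm_le_indicator(3)[OF h(2)[of z]] R(2) by (cases "z \<in> E") simp_all
  define \<phi> where "\<phi> b = (dyadic mollifier (\<mu> + b) :: 'a \<Rightarrow> complex)" for b
  define \<psi> where "\<psi> b = (dyadic mollifier (\<mu> + b) :: 'a \<times> 'a \<Rightarrow> complex)" for b
  have sp: "schwartz (\<phi> b)" "schwartz (\<psi> b)" for b
    unfolding \<phi>_def \<psi>_def by (rule dyadic_mollifier_schwartz)+
  have [measurable]: "\<phi> b \<in> borel_measurable borel" "\<psi> b \<in> borel_measurable borel" for b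
    by (rule schwartz_borel[OF sp(1)], rule schwartz_borel[OF sp(2)])
  define f1 where "f1 b = convol (\<phi> b) h1" for b
  define f2 where "f2 b = convol (\<phi> b) h2" for b
  have fs: "schwartz (f1 b)" "schwartz (f2 b)" for b
    unfolding f1_def f2_def using R(1) hR by (auto intro!: schwartz_convol[OF sp(1) hi(1), of R] schwartz_convol[OF sp(1) hi(2), of R])
  have Tf: "(\<integral>\<^sup>+x. ennreal (norm (T (f1 b) (f2 b) x)) \<partial>lborel) \<le> ennreal (B0 * e)" for b
  proof -
    have "(\<integral>\<^sup>+x. ennreal (norm (T (f1 b) (f2 b) x)) \<partial>lborel) \<le> ennreal B0 * Lp_norm 2 lborel (f1 b) * Lp_norm 2 lborel (f2 b)"
      by (rule L2[OF fs])
    also have "\<dots> \<le> ennreal B0 * ennreal (sqrt e) * ennreal (sqrt e)"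
      unfolding f1_def f2_def \<phi>_def using e h by (intro mult_mono mollified_L2[OF E]) auto
    also have "\<dots> = ennreal (B0 * e)"
      using B0 e by (simp add: ennreal_mult'[symmetric] mult.assoc)
    finally show ?thesis .
  qed
  define Rs where "Rs b M x = (\<Sum>i\<in>{- int M..int M}. bil (\<lambda>y. convol (\<psi> b) (k i) y - (if i \<le> b then k i y else 0)) h1 h2 x)" for b M x
  have Rsb: "(\<integral>\<^sup>+x. ennreal (norm (Rs b M x)) \<partial>lborel) \<le> ennreal (\<rho> * e)" for b M
  proof -
    have "(\<integral>\<^sup>+x. ennreal (norm (Rs b M x)) \<partial>lborel) \<le> ennreal \<rho> * emeasure lborel E"
      unfolding Rs_def \<psi>_def \<rho>_def by (rule residual_bound[OF c _ E hm h]) simp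
    then show ?thesis using \<rho> e by (simp add: ennreal_mult')
  qed
  have Rsm [measurable]: "Rs b M \<in> borel_measurable borel" for b M
  proof -
    have "(\<lambda>y. convol (\<psi> b) (k i) y - (if i \<le> b then k i y else 0)) \<in> borel_measurable borel" for i
      by (cases "i \<le> b") (simp_all, measurable)
    then show ?thesis unfolding Rs_def[abs_def] by measurable
  qed
  have Rs_eq: "Rs b M x = (\<Sum>i\<in>{- int M..int M}. bil (k i) (f1 b) (f2 b) x) - (\<Sum>i\<in>{- int M..int M}. if i \<le> b then bil (k i) h1 h2 x else 0)" for b M x
  proof -
    obtain G where "G \<ge> 0 \<and> (\<forall>x. norm (\<psi> b x) \<le> G)" using schwartz_bounded[OF sp(2)[of b]] by (elim exE)
    then have G: "norm (\<psi> b x) \<le> G" for x by blast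
    obtain G' where "G' \<ge> 0 \<and> (\<forall>x. norm (\<phi> b x) \<le> G')" using schwartz_bounded[OF sp(1)[of b]] by (elim exE)
    then have G': "norm (\<phi> b x) \<le> G'" for x by blast
    have ci: "integrable lborel (convol (\<psi> b) (k i))" for i
    proof (rule integrableI_bounded)
      have "(\<integral>\<^sup>+y. ennreal (norm (convol (\<psi> b) (k i) y)) \<partial>lborel) \<le> 1 * ennreal A"
        using convol_L1[of "\<psi> b" "k i"] mult_left_mono[OF mass[of i], of 1]
        unfolding \<psi>_def dyadic_mollifier_L1 by (intro order_trans[OF convol_L1]) (auto simp: dyadic_mollifier_L1 mass)
      also have "\<dots> < \<infinity>" by simp
      finally show "(\<integral>\<^sup>+y. ennreal (norm (convol (\<psi> b) (k i) y)) \<partial>lborel) < \<infinity>" .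
    qed measurable
    have "bil (\<lambda>y. convol (\<psi> b) (k i) y - (if i \<le> b then k i y else 0)) h1 h2 x
      = bil (k i) (f1 b) (f2 b) x - (if i \<le> b then bil (k i) h1 h2 x else 0)" for i
    proof -
      have fe: "bil (k i) (f1 b) (f2 b) x = bil (convol (\<psi> b) (k i)) h1 h2 x"
        unfolding f1_def f2_def
        by (rule bil_convol[OF k_integrable hi _ _ G G']) (simp_all add: \<phi>_def \<psi>_def dyadic_mollifier_Pair)
      show ?thesis
      proof (cases "i \<le> b")
        case True
        then show ?thesis unfolding fe using bil_kernel_diff[OF ci k_integrable hm h1, of i i x] by simp
      next
        case False then show ?thesis unfolding fe by simp
      qed
    qed
    then show ?thesis by (simp add: Rs_def sum_subtractf)
  qed
  \<comment> \<open>One below the window, so that the conditions i \<le> N and i \<le> a differ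
    exactly for i from -N to N.\<close>
  define a where "a = - int N - 1"
  define F where "F x = (\<Sum>i\<in>{- int N..int N}. bil (k i) h1 h2 x)" for x
  \<comment> \<open>The limit of the difference of the two residuals. For M \<ge> N the finite sums
    over \<open>h1\<close>, \<open>h2\<close> cancel down to F, so only the T terms pass to a limit,
    and Fatou carries the residual bound over.\<close>
  define v where "v x = (T (f1 (int N)) (f2 (int N)) x - T (f1 a) (f2 a) x) - F x" for x
  have ev: "(\<lambda>M. Rs (int N) M x - Rs a M x) \<longlonglongrightarrow> v x" for x
  proof -
    have "(\<lambda>M. ((\<Sum>i\<in>{- int M..int M}. bil (k i) (f1 (int N)) (f2 (int N)) x) - (\<Sum>i\<in>{- int M..int M}. bil (k i) (f1 a) (f2 a) x)) - F x) \<longlonglongrightarrow> v x"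
      unfolding v_def by (intro tendsto_intros T_tendsto fs)
    moreover have "\<forall>\<^sub>F M in sequentially. ((\<Sum>i\<in>{- int M..int M}. bil (k i) (f1 (int N)) (f2 (int N)) x) - (\<Sum>i\<in>{- int M..int M}. bil (k i) (f1 a) (f2 a) x)) - F x
      = Rs (int N) M x - Rs a M x"
      unfolding eventually_sequentially
    proof (intro exI allI impI)
      fix M assume M: "N \<le> M"
      have "(\<Sum>i\<in>{- int M..int M}. if i \<le> int N then bil (k i) h1 h2 x else 0) - (\<Sum>i\<in>{- int M..int M}. if i \<le> a then bil (k i) h1 h2 x else 0)
        = (\<Sum>i\<in>{- int M..int M}. if i \<in> {- int N..int N} then bil (k i) h1 h2 x else 0)"
        unfolding sum_subtractf[symmetric] by (intro sum.cong) (auto simp: a_def)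
      also have "\<dots> = F x"
        unfolding F_def using M by (subst sum.inter_restrict[symmetric]) (auto intro!: sum.cong)
      finally have XY: "(\<Sum>i\<in>{- int M..int M}. if i \<le> int N then bil (k i) h1 h2 x else 0) - (\<Sum>i\<in>{- int M..int M}. if i \<le> a then bil (k i) h1 h2 x else 0) = F x" .
      show "((\<Sum>i\<in>{- int M..int M}. bil (k i) (f1 (int N)) (f2 (int N)) x) - (\<Sum>i\<in>{- int M..int M}. bil (k i) (f1 a) (f2 a) x)) - F x
        = Rs (int N) M x - Rs a M x" unfolding Rs_eq XY[symmetric] by simp
    qed
    ultimately show ?thesis by (rule Lim_transform_eventually)
  qed
  have vb: "(\<integral>\<^sup>+x. ennreal (norm (v x)) \<partial>lborel) \<le> ennreal (2 * (\<rho> * e))"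
  proof (rule fatou_bound[OF _ ev])
    fix M
    have "(\<integral>\<^sup>+x. ennreal (norm (Rs (int N) M x - Rs a M x)) \<partial>lborel) \<le> (\<integral>\<^sup>+x. ennreal (norm (Rs (int N) M x)) + ennreal (norm (Rs a M x)) \<partial>lborel)"
      by (intro nn_integral_mono) (simp add: ennreal_plus[symmetric] norm_triangle_ineq4 del: ennreal_plus)
    also have "\<dots> = (\<integral>\<^sup>+x. ennreal (norm (Rs (int N) M x)) \<partial>lborel) + (\<integral>\<^sup>+x. ennreal (norm (Rs a M x)) \<partial>lborel)"
      by (rule nn_integral_add) measurable
    also have "\<dots> \<le> ennreal (\<rho> * e) + ennreal (\<rho> * e)" by (intro add_mono Rsb)
    also have "\<dots> = ennreal (2 * (\<rho> * e))" using \<rho> e by (simp add: ennreal_plus[symmetric] del: ennreal_plus)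
    finally show "(\<integral>\<^sup>+x. ennreal (norm (Rs (int N) M x - Rs a M x)) \<partial>lborel) \<le> ennreal (2 * (\<rho> * e))" .
  qed measurable
  have Tm [measurable]: "T (f1 b) (f2 b) \<in> borel_measurable borel" for b by (rule T_borel[OF fs])
  have [measurable]: "F \<in> borel_measurable borel" unfolding F_def[abs_def] by measurable
  have [measurable]: "v \<in> borel_measurable borel" unfolding v_def[abs_def] by measurable
  have "(\<integral>\<^sup>+x. ennreal (norm (F x)) \<partial>lborel)
    \<le> (\<integral>\<^sup>+x. ennreal (norm (T (f1 (int N)) (f2 (int N)) x)) + (ennreal (norm (T (f1 a) (f2 a) x)) + ennreal (norm (v x))) \<partial>lborel)"
  proof (rule nn_integral_mono)
    fix x
    have "norm (F x) = norm (T (f1 (int N)) (f2 (int N)) x - (T (f1 a) (f2 a) x + v x))" by (simp add: v_def)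
    also have "\<dots> \<le> norm (T (f1 (int N)) (f2 (int N)) x) + norm (T (f1 a) (f2 a) x + v x)" by (rule norm_triangle_ineq4)
    also have "\<dots> \<le> norm (T (f1 (int N)) (f2 (int N)) x) + (norm (T (f1 a) (f2 a) x) + norm (v x))"
      by (intro add_left_mono norm_triangle_ineq)
    finally show "ennreal (norm (F x)) \<le> ennreal (norm (T (f1 (int N)) (f2 (int N)) x)) + (ennreal (norm (T (f1 a) (f2 a) x)) + ennreal (norm (v x)))"
      by (simp add: ennreal_plus[symmetric] ennreal_leI del: ennreal_plus)
  qed
  also have "\<dots> = (\<integral>\<^sup>+x. ennreal (norm (T (f1 (int N)) (f2 (int N)) x)) \<partial>lborel)
      + ((\<integral>\<^sup>+x. ennreal (norm (T (f1 a) (f2 a) x)) \<partial>lborel) + (\<integral>\<^sup>+x. ennreal (norm (v x)) \<partial>lborel))"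
    by (subst nn_integral_add, measurable, subst nn_integral_add, measurable)
  also have "\<dots> \<le> ennreal (B0 * e) + (ennreal (B0 * e) + ennreal (2 * (\<rho> * e)))" by (intro add_mono Tf vb)
  also have "\<dots> = ennreal ((2 * B0 + 2 * \<rho>) * e)"
    using B0 e \<rho> by (simp add: ennreal_plus[symmetric] distrib_right del: ennreal_plus)
  also have "\<dots> = ennreal (2 * B0 + 2 * \<rho>) * emeasure lborel E" using B0 \<rho> e by (simp add: ennreal_mult')
  finally have "(\<integral>\<^sup>+x. ennreal (norm (F x)) \<partial>lborel) \<le> ennreal (2 * B0 + 2 * \<rho>) * emeasure lborel E" .
  moreover have "bil (\<lambda>y. \<Sum>i\<in>{- int N..int N}. k i y) h1 h2 x = F x" for x
    unfolding F_def by (rule bil_sum[OF k_integrable hm h1])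
  ultimately show ?thesis by (simp add: \<rho>_def)
qed

end

section \<open>The pieces of the rough kernel\<close>

lemma Lp_norm_1: "Lp_norm 1 M f = (\<integral>\<^sup>+x. ennreal (norm (f x)) \<partial>M)"
  by (simp add: Lp_norm_def Let_def ennreal_enn2real_if)

text \<open>A substitute for Hoelder with constant v + 1, valid for all q > 1 including \<infinity>.
  With l the L^q norm, s \<le> l (1 + s^p / l^p) for every s \<ge> 0, since s \<le> l or else s/l
  \<le> (s/l)^p; integration gives v + 1.\<close>

lemma L1_le_Lq:
  assumes [measurable]: "f \<in> borel_measurable M" and M: "emeasure M (space M) = ennreal v" "v \<ge> 0" and q: "1 < q" and fin: "Lp_norm q M f < \<infinity>"
  shows "(\<integral>\<^sup>+x. ennreal (norm (f x)) \<partial>M) \<le> ennreal (v + 1) * Lp_norm q M f"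
proof (cases "q = \<infinity>")
  case True
  then have L: "Lp_norm q M f = esssup M (\<lambda>x. ennreal (norm (f x)))" by (simp add: Lp_norm_def)
  have "(\<integral>\<^sup>+x. ennreal (norm (f x)) \<partial>M) \<le> (\<integral>\<^sup>+x. esssup M (\<lambda>x. ennreal (norm (f x))) \<partial>M)"
    by (intro nn_integral_mono_AE esssup_AE)
  also have "\<dots> = ennreal v * Lp_norm q M f" by (simp add: M L mult.commute)
  also have "\<dots> \<le> ennreal (v + 1) * Lp_norm q M f" by (intro mult_right_mono ennreal_leI) auto
  finally show ?thesis .
next
  case False
  define p where "p = enn2real q"
  have qp: "q = ennreal p" using False by (simp add: p_def less_top)
  have p: "p > 1" using q qp by (metis ennreal_1 ennreal_less_iff zero_le_one)
  define J where "J = (\<integral>\<^sup>+x. ennreal (norm (f x) powr p) \<partial>M)"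
  have J: "J < \<infinity>" using fin False unfolding Lp_norm_def J_def p_def by (auto simp: Let_def less_top split: if_splits)
  define i where "i = enn2real J"
  have Ji: "J = ennreal i" "i \<ge> 0" using J by (auto simp: i_def less_top)
  define l where "l = i powr (1 / p)"
  have L: "Lp_norm q M f = ennreal l" using False J by (simp add: Lp_norm_def J_def[symmetric] p_def[symmetric] Let_def l_def i_def)
  show ?thesis
  \<comment> \<open>A vanishing norm is treated apart because the pointwise inequality divides by i
    = l^p.\<close>
  proof (cases "i = 0")
    case True
    then have "AE x in M. ennreal (norm (f x) powr p) = 0" using Ji(1) unfolding J_def by (subst nn_integral_0_iff_AE[symmetric]) auto
    then have "AE x in M. ennreal (norm (f x)) = 0" by (rule AE_mp) (auto intro!: AE_I2 simp: ennreal_eq_0_iff dest!: antisym[OF _ powr_ge_zero])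
    then have "(\<integral>\<^sup>+x. ennreal (norm (f x)) \<partial>M) = 0" by (subst nn_integral_0_iff_AE) auto
    then show ?thesis by simp
  next
    case False
    then have i: "i > 0" using Ji by simp
    then have l: "l > 0" by (simp add: l_def)
    have lp: "l powr p = i" using i p by (simp add: l_def powr_powr)
    have pt: "s \<le> l * (1 + s powr p / i)" if s: "s \<ge> 0" for s
    proof (cases "s \<le> l")
      case True
      have "l * 1 \<le> l * (1 + s powr p / i)" using l i by (intro mult_left_mono) auto
      then show ?thesis using True by linarith
    next
      case False
      then have sl: "s / l > 1" using l by simp
      have "(s / l) powr 1 \<le> (s / l) powr p" using sl p by (intro powr_mono) auto
      then have "s / l \<le> s powr p / i" using sl s l by (simp add: powr_divide lp)
      then have "l * (s / l) \<le> l * (1 + s powr p / i)" using l by (intro mult_left_mono) auto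
      then show ?thesis using l by simp
    qed
    have "(\<integral>\<^sup>+x. ennreal (norm (f x)) \<partial>M) \<le> (\<integral>\<^sup>+x. ennreal l * (1 + ennreal (1 / i) * ennreal (norm (f x) powr p)) \<partial>M)"
    proof (rule nn_integral_mono)
      fix x
      have "ennreal (norm (f x)) \<le> ennreal (l * (1 + norm (f x) powr p / i))" by (intro ennreal_leI pt) simp
      also have "\<dots> = ennreal l * (1 + ennreal (1 / i * (norm (f x) powr p)))"
        using l i by (simp add: ennreal_mult' ennreal_plus)
      also have "ennreal (1 / i * (norm (f x) powr p)) = ennreal (1 / i) * ennreal (norm (f x) powr p)"
        using i by (intro ennreal_mult') simp
      finally show "ennreal (norm (f x)) \<le> ennreal l * (1 + ennreal (1 / i) * ennreal (norm (f x) powr p))" .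
    qed
    also have "\<dots> = ennreal l * (emeasure M (space M) + ennreal (1 / i) * J)"
      unfolding J_def by (simp add: nn_integral_cmult nn_integral_add)
    also have "ennreal (1 / i) * J = ennreal (1 / i * i)" unfolding Ji using i by (intro ennreal_mult'[symmetric]) simp
    also have "emeasure M (space M) + ennreal (1 / i * i) = ennreal (v + 1)" using i M by (simp add: ennreal_plus)
    finally show ?thesis by (simp add: L mult.commute)
  qed
qed

lemma sphere_projection_measurable:
  "(\<lambda>x::'a::euclidean_space. x /\<^sub>R norm x) \<in> measurable (restrict_space borel (- {0})) (restrict_space borel (sphere 0 1))"
proof (rule measurable_restrict_space2)
  show "(\<lambda>x::'a. x /\<^sub>R norm x) \<in> space (restrict_space borel (- {0})) \<rightarrow> sphere 0 1"
    by (auto simp: space_restrict_space)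
  show "(\<lambda>x::'a. x /\<^sub>R norm x) \<in> borel_measurable (restrict_space borel (- {0}))"
    by (intro measurable_restrict_space1) simp
qed

text \<open>A pullback of the definition to the punctured unit ball; no radial integration takes
  place.\<close>

lemma nn_integral_sphere:
  fixes g :: "'a::euclidean_space \<Rightarrow> ennreal"
  assumes g: "g \<in> borel_measurable (restrict_space borel (sphere 0 1))"
  shows "(\<integral>\<^sup>+\<theta>. g \<theta> \<partial>sphere_measure) = of_nat DIM('a) * (\<integral>\<^sup>+y. g (y /\<^sub>R norm y) * indicator (ball 0 1 - {0}) y \<partial>lborel)"
proof -
  let ?N = "restrict_space lborel (ball 0 1 - {0}) :: 'a measure"
  have meas: "(\<lambda>x. x /\<^sub>R norm x) \<in> measurable ?N (restrict_space borel (sphere 0 1))"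
  proof (rule measurable_restrict_space2)
    show "(\<lambda>x. x /\<^sub>R norm x) \<in> space ?N \<rightarrow> sphere 0 1"
      by (auto simp: space_restrict_space)
    show "(\<lambda>x. x /\<^sub>R norm x) \<in> borel_measurable ?N"
      by (intro measurable_restrict_space1) simp
  qed
  show ?thesis
    unfolding sphere_measure_def using g
    by (simp add: nn_integral_scale_measure nn_integral_distr[OF meas] nn_integral_restrict_space)
qed

lemma sphere_measure_finite:
  "\<exists>v\<ge>0. emeasure sphere_measure (space (sphere_measure :: 'a::euclidean_space measure)) = ennreal v"
proof -
  have "emeasure (sphere_measure :: 'a measure) (sphere 0 1) = (\<integral>\<^sup>+\<theta>. 1 \<partial>(sphere_measure :: 'a measure))" by simp
  also have "\<dots> = of_nat DIM('a) * (\<integral>\<^sup>+y. indicator (ball 0 1 - {0}) y \<partial>(lborel :: 'a measure))"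
    by (subst nn_integral_sphere) simp_all
  also have "(\<integral>\<^sup>+y. indicator (ball 0 1 - {0}) y \<partial>(lborel :: 'a measure)) \<le> emeasure lborel (ball (0::'a) 1)"
    by (subst nn_integral_indicator) (auto intro!: emeasure_mono)
  also have "of_nat DIM('a) * emeasure lborel (ball (0::'a) 1) < \<infinity>"
    using emeasure_lborel_ball_finite[of "0::'a" 1] by (simp add: ennreal_mult_less_top of_nat_less_top)
  finally have "emeasure (sphere_measure :: 'a measure) (sphere 0 1) < \<infinity>" by (simp add: mult_left_mono)
  then show ?thesis
    by (intro exI[of _ "enn2real (emeasure (sphere_measure :: 'a measure) (sphere 0 1))"]) (simp add: less_top)
qed

text \<open>Measurability of \<Omega> is known on the sphere only, so it is transported by radial
  projection to the complement of the origin and glued there with the value 0.\<close>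

lemma rough_kernel_borel:
  fixes \<Omega> :: "'n::finite vpair \<Rightarrow> complex"
  assumes "\<Omega> \<in> borel_measurable sphere_measure"
  shows "rough_kernel \<Omega> \<in> borel_measurable borel"
proof -
  have "\<Omega> \<in> borel_measurable (restrict_space borel (sphere 0 1))" using assms by (simp cong: measurable_cong_sets)
  from measurable_compose[OF sphere_projection_measurable this]
  have [measurable]: "(\<lambda>y::'n vpair. \<Omega> (y /\<^sub>R norm y)) \<in> borel_measurable (restrict_space borel (- {0}))" .
  have n: "(\<lambda>y::'n vpair. complex_of_real (norm y ^ (2 * CARD('n)))) \<in> borel_measurable (restrict_space borel (- {0}))"
    by (intro measurable_restrict_space1) measurable
  have "(\<lambda>y::'n vpair. \<Omega> (y /\<^sub>R norm y) / complex_of_real (norm y ^ (2 * CARD('n)))) \<in> borel_measurable (restrict_space borel (- {0}))"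
    using n by measurable
  moreover have "- {0} = {y::'n vpair. y \<noteq> 0}" by auto
  ultimately show ?thesis unfolding rough_kernel_def[abs_def]
    by (subst measurable_If_restrict_space_iff) auto
qed

lemma fourier_borel:
  assumes [measurable]: "\<Phi> \<in> borel_measurable borel"
  shows "fourier \<Phi> \<in> borel_measurable borel"
  unfolding fourier_def[abs_def] by measurable

lemma fourier_bound:
  assumes "integrable lborel \<Phi>"
  shows "norm (fourier \<Phi> \<xi>) \<le> (LINT x|lborel. norm (\<Phi> x))"
proof -
  have "norm (fourier \<Phi> \<xi>) \<le> (LINT x|lborel. norm (\<Phi> x * exp (- 2 * of_real pi * \<i> * of_real (x \<bullet> \<xi>))))"
    unfolding fourier_def by (rule integral_norm_bound)
  also have "\<dots> = (LINT x|lborel. norm (\<Phi> x))" by (simp add: norm_mult)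
  finally show ?thesis .
qed

text \<open>With c = 2^\<gamma>, the cutoff forces 1/2 \<le> c |y| \<le> 2, where |y|^-D \<le>
  (2c)^D. So the piece is dominated by a constant times c^D |\<Omega> (y / |y|)|, which is
  homogeneous of degree 0 in y; dilating the support into the unit ball turns its integral into one
  of |\<Omega>| over the sphere, uniformly in \<gamma>.\<close>

lemma kernel_piece_facts:
  fixes \<Phi> \<Omega> :: "'n::finite vpair \<Rightarrow> complex"
  assumes \<Phi>: "littlewood_paley \<Phi>" and \<Omega>: "\<Omega> \<in> borel_measurable sphere_measure"
    and I: "(\<integral>\<^sup>+\<theta>. ennreal (norm (\<Omega> \<theta>)) \<partial>sphere_measure) \<le> ennreal w" and w: "w \<ge> 0"
    and P: "P = (LINT x|lborel. norm (\<Phi> x)) * 8 ^ (2 * CARD('n))"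
  shows "kernel_piece \<Phi> \<Omega> \<gamma> \<in> borel_measurable borel"
    and "(\<integral>\<^sup>+y. ennreal (norm (kernel_piece \<Phi> \<Omega> \<gamma> y)) \<partial>lborel) \<le> ennreal (P * w)"
    and "kernel_piece \<Phi> \<Omega> \<gamma> y \<noteq> 0 \<Longrightarrow> norm y \<le> 2 * 2 powi (-\<gamma>)"
proof -
  define D where "D = 2 * CARD('n)"
  have D: "DIM('n vpair) = D" by (simp add: D_def)
  have s: "schwartz \<Phi>" using \<Phi> by (simp add: littlewood_paley_def)
  have [measurable]: "\<Phi> \<in> borel_measurable borel" by (rule schwartz_borel[OF s])
  have [measurable]: "fourier \<Phi> \<in> borel_measurable borel" by (rule fourier_borel) measurable
  have [measurable]: "rough_kernel \<Omega> \<in> borel_measurable borel" by (rule rough_kernel_borel[OF \<Omega>])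
  show km [measurable]: "kernel_piece \<Phi> \<Omega> \<gamma> \<in> borel_measurable borel"
    unfolding kernel_piece_def[abs_def] by measurable
  define M where "M = (LINT x|lborel. norm (\<Phi> x))"
  have M: "M \<ge> 0" "\<And>\<xi>. norm (fourier \<Phi> \<xi>) \<le> M"
    unfolding M_def by (simp, rule fourier_bound[OF schwartz_integrable(1)[OF s]])
  define c :: real where "c = 2 powi \<gamma>"
  have c: "c > 0" by (simp add: c_def)
  have cm: "2 powi (-\<gamma>) = 1 / c" by (simp add: c_def power_int_minus inverse_eq_divide)
  have supp: "1 / 2 \<le> c * norm y \<and> c * norm y \<le> 2" if "kernel_piece \<Phi> \<Omega> \<gamma> y \<noteq> 0" for y
  proof -
    have "fourier \<Phi> (c *\<^sub>R y) \<noteq> 0" using that by (auto simp: kernel_piece_def c_def)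
    then have "c *\<^sub>R y \<in> closure {\<xi>. fourier \<Phi> \<xi> \<noteq> 0}" by (intro closure_subset[THEN subsetD]) simp
    then have "c *\<^sub>R y \<in> {\<xi>. 1 / 2 \<le> norm \<xi> \<and> norm \<xi> \<le> 2}" using \<Phi> unfolding littlewood_paley_def by blast
    then show ?thesis using c by simp
  qed
  show "norm y \<le> 2 * 2 powi (-\<gamma>)" if "kernel_piece \<Phi> \<Omega> \<gamma> y \<noteq> 0"
    using supp[OF that] c by (simp add: cm field_simps)
  \<comment> \<open>Dilation by c/4 sends |y| \<le> 2/c into the ball of radius 1/2. As 2c = 8a,
    this choice produces the 8 in P.\<close>
  define a where "a = c / 4"
  have a: "a > 0" using c by (simp add: a_def)
  let ?g = "\<lambda>y. ennreal (norm (\<Omega> (y /\<^sub>R norm y))) * indicator (ball 0 1 - {0}) y"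
  have "\<Omega> \<in> borel_measurable (restrict_space borel (sphere 0 1))" using \<Omega> by (simp cong: measurable_cong_sets)
  from measurable_compose[OF sphere_projection_measurable this]
  have pm: "(\<lambda>y::'n vpair. \<Omega> (y /\<^sub>R norm y)) \<in> borel_measurable (restrict_space borel (- {0}))" .
  have [measurable]: "ball 0 1 - {0::'n vpair} \<in> sets borel" by auto
  have gm: "?g \<in> borel_measurable borel"
  proof -
    have "(\<lambda>y::'n vpair. if y \<noteq> 0 then \<Omega> (y /\<^sub>R norm y) else 0) \<in> borel_measurable borel"
    proof (subst measurable_If_restrict_space_iff)
      have "- {0} = {y::'n vpair. y \<noteq> 0}" by auto
      then show "(\<lambda>y::'n vpair. \<Omega> (y /\<^sub>R norm y)) \<in> borel_measurable (restrict_space borel {y. y \<noteq> 0}) \<and>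
        (\<lambda>y. 0) \<in> borel_measurable (restrict_space borel {y::'n vpair. \<not> y \<noteq> 0})" using pm by simp
    qed simp
    then have "(\<lambda>y::'n vpair. ennreal (norm (if y \<noteq> 0 then \<Omega> (y /\<^sub>R norm y) else 0)) * indicator (ball 0 1 - {0}) y) \<in> borel_measurable borel"
      by measurable
    moreover have "(\<lambda>y::'n vpair. ennreal (norm (if y \<noteq> 0 then \<Omega> (y /\<^sub>R norm y) else 0)) * indicator (ball 0 1 - {0}) y) = ?g"
      by (auto simp: fun_eq_iff indicator_def)
    ultimately show ?thesis by simp
  qed
  have "(\<integral>\<^sup>+y. ennreal (norm (kernel_piece \<Phi> \<Omega> \<gamma> y)) \<partial>lborel)
    \<le> (\<integral>\<^sup>+y. ennreal (M * 8 ^ D) * (ennreal (a ^ DIM('n vpair)) * ?g (a *\<^sub>R y)) \<partial>lborel)"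
  proof (rule nn_integral_mono)
    fix y :: "'n vpair"
    show "ennreal (norm (kernel_piece \<Phi> \<Omega> \<gamma> y)) \<le> ennreal (M * 8 ^ D) * (ennreal (a ^ DIM('n vpair)) * ?g (a *\<^sub>R y))"
    proof (cases "kernel_piece \<Phi> \<Omega> \<gamma> y = 0")
      case False
      then have y: "1 / 2 \<le> c * norm y" "c * norm y \<le> 2" using supp by auto
      then have y0: "y \<noteq> 0" by auto
      have mem: "a *\<^sub>R y \<in> ball 0 1 - {0}" using y y0 a by (simp add: a_def dist_norm)
      have nv: "(a *\<^sub>R y) /\<^sub>R norm (a *\<^sub>R y) = y /\<^sub>R norm y" using a by simp
      have g: "?g (a *\<^sub>R y) = ennreal (norm (\<Omega> (y /\<^sub>R norm y)))"
        unfolding nv using mem by (simp only: indicator_simps mult_1_right)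
      have "norm (kernel_piece \<Phi> \<Omega> \<gamma> y) = norm (fourier \<Phi> (c *\<^sub>R y)) * (norm (\<Omega> (y /\<^sub>R norm y)) / norm y ^ D)"
        using y0 by (simp add: kernel_piece_def rough_kernel_def c_def norm_mult norm_divide norm_power D_def)
      also have "\<dots> \<le> M * (norm (\<Omega> (y /\<^sub>R norm y)) * (2 * c) ^ D)"
      proof (intro mult_mono M)
        have "1 \<le> (2 * c * norm y) ^ D" using y(1) by (intro one_le_power) simp
        then have "1 / norm y ^ D \<le> (2 * c) ^ D" using y0 by (simp add: power_mult_distrib field_simps)
        then have "norm (\<Omega> (y /\<^sub>R norm y)) * (1 / norm y ^ D) \<le> norm (\<Omega> (y /\<^sub>R norm y)) * (2 * c) ^ D"
          by (rule mult_left_mono) simp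
        then show "norm (\<Omega> (y /\<^sub>R norm y)) / norm y ^ D \<le> norm (\<Omega> (y /\<^sub>R norm y)) * (2 * c) ^ D" by simp
      qed (use M in auto)
      also have "2 * c = 8 * a" by (simp add: a_def)
      also have "M * (norm (\<Omega> (y /\<^sub>R norm y)) * (8 * a) ^ D) = M * 8 ^ D * (a ^ D * norm (\<Omega> (y /\<^sub>R norm y)))"
        by (simp only: power_mult_distrib mult_ac)
      finally have "ennreal (norm (kernel_piece \<Phi> \<Omega> \<gamma> y)) \<le> ennreal (M * 8 ^ D * (a ^ D * norm (\<Omega> (y /\<^sub>R norm y))))"
        by (rule ennreal_leI)
      also have "\<dots> = ennreal (M * 8 ^ D) * (ennreal (a ^ D) * ennreal (norm (\<Omega> (y /\<^sub>R norm y))))"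
        using M a by (subst ennreal_mult', simp, subst (2) ennreal_mult') auto
      finally show ?thesis unfolding g D .
    qed simp
  qed
  also have "\<dots> = ennreal (M * 8 ^ D) * (\<integral>\<^sup>+y. ennreal (a ^ DIM('n vpair)) * ?g (a *\<^sub>R y) \<partial>lborel)"
  proof (rule nn_integral_cmult)
    have "(\<lambda>y. ?g (a *\<^sub>R y)) \<in> borel_measurable borel" by (rule measurable_compose[OF _ gm]) simp
    then show "(\<lambda>y. ennreal (a ^ DIM('n vpair)) * ?g (a *\<^sub>R y)) \<in> borel_measurable lborel" by measurable
  qed
  also have "(\<integral>\<^sup>+y. ennreal (a ^ DIM('n vpair)) * ?g (a *\<^sub>R y) \<partial>lborel) = (\<integral>\<^sup>+y. ?g y \<partial>lborel)"
    by (rule nn_integral_lborel_scale[OF gm a])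
  \<comment> \<open>The dimension is at least 1; the factor is inserted to match the normalisation
    of \<open>sphere_measure\<close>.\<close>
  also have "\<dots> \<le> of_nat DIM('n vpair) * (\<integral>\<^sup>+y. ?g y \<partial>lborel)"
  proof -
    have "(1::ennreal) \<le> of_nat DIM('n vpair)" using DIM_positive[where 'a="'n vpair"] by (metis One_nat_def Suc_leI of_nat_1 of_nat_mono)
    from mult_right_mono[OF this, of "\<integral>\<^sup>+y. ?g y \<partial>lborel"] show ?thesis by simp
  qed
  also have "\<dots> = (\<integral>\<^sup>+\<theta>. ennreal (norm (\<Omega> \<theta>)) \<partial>sphere_measure)"
    using \<open>\<Omega> \<in> borel_measurable (restrict_space borel (sphere 0 1))\<close> by (subst nn_integral_sphere) auto
  also have "\<dots> \<le> ennreal w" by (rule I)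
  finally have "(\<integral>\<^sup>+y. ennreal (norm (kernel_piece \<Phi> \<Omega> \<gamma> y)) \<partial>lborel) \<le> ennreal (M * 8 ^ D) * ennreal w"
    by (simp add: mult_left_mono)
  then show "(\<integral>\<^sup>+y. ennreal (norm (kernel_piece \<Phi> \<Omega> \<gamma> y)) \<partial>lborel) \<le> ennreal (P * w)"
    using M w by (simp add: P M_def D_def ennreal_mult'')
qed

text \<open>Convolution with the dyadic \<Phi> supplies smoothness at scale 2^-(\<mu>+\<gamma>), and
  the vanishing integral is inherited from \<Phi>, whose Fourier transform vanishes at the origin.
  \<open>C\<close> depends on \<Phi> only; \<Omega> enters through \<open>w\<close>, and only
  \<open>S\<close> is allowed to depend on \<mu>.\<close>

lemma kernel_smooth_piece_family:
  fixes \<Phi> :: "'n::finite vpair \<Rightarrow> complex"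
  assumes \<Phi>: "littlewood_paley \<Phi>"
  shows "\<exists>C\<ge>0. \<forall>\<Omega> w \<mu>. \<Omega> \<in> borel_measurable sphere_measure \<longrightarrow>
    (\<integral>\<^sup>+\<theta>. ennreal (norm (\<Omega> \<theta>)) \<partial>sphere_measure) \<le> ennreal w \<longrightarrow> 0 \<le> w \<longrightarrow> 0 \<le> \<mu> \<longrightarrow>
    (\<exists>S. kernel_family (kernel_smooth_piece \<Phi> \<Omega> \<mu>) (C * w) \<mu> S)"
proof -
  have s: "schwartz \<Phi>" using \<Phi> by (simp add: littlewood_paley_def)
  have \<Phi>m [measurable]: "\<Phi> \<in> borel_measurable borel" by (rule schwartz_borel[OF s])
  have \<Phi>0: "(LINT x|lborel. \<Phi> x) = 0"
  proof -
    have "fourier \<Phi> 0 = 0"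
    proof (rule ccontr)
      assume "fourier \<Phi> 0 \<noteq> 0"
      then have "0 \<in> closure {\<xi>. fourier \<Phi> \<xi> \<noteq> 0}" by (intro closure_subset[THEN subsetD]) simp
      then have "0 \<in> {\<xi>::'n vpair. 1 / 2 \<le> norm \<xi> \<and> norm \<xi> \<le> 2}" using \<Phi> unfolding littlewood_paley_def by blast
      then show False by simp
    qed
    then show ?thesis by (simp add: fourier_def)
  qed
  define a0 where "a0 = (LINT x|lborel. norm (\<Phi> x))"
  define a1 where "a1 = (LINT x|lborel. norm x * norm (\<Phi> x))"
  have a01: "a0 \<ge> 0" "a1 \<ge> 0" by (simp_all add: a0_def a1_def)
  have nn0: "(\<integral>\<^sup>+x. ennreal (norm (\<Phi> x)) \<partial>lborel) = ennreal a0"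
    unfolding a0_def by (rule nn_norm_integrable[OF schwartz_integrable(1)[OF s]])
  have nn1: "(\<integral>\<^sup>+x. ennreal (norm x * norm (\<Phi> x)) \<partial>lborel) = ennreal a1"
    unfolding a1_def by (intro nn_integral_eq_integral schwartz_integrable(2) s) auto
  obtain a2 where a2: "a2 \<ge> 0 \<and> (\<forall>v. (\<integral>\<^sup>+x. ennreal (norm (\<Phi> (x + v) - \<Phi> x)) \<partial>lborel) \<le> ennreal (a2 * norm v))"
    using schwartz_L1_smooth[OF s] by (elim exE)
  obtain G where G: "G \<ge> 0 \<and> (\<forall>x. norm (\<Phi> x) \<le> G)" using schwartz_bounded[OF s] by (elim exE)
  define P where "P = (LINT x|lborel. norm (\<Phi> x)) * 8 ^ (2 * CARD('n))"
  have P: "P \<ge> 0" by (simp add: P_def)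
  \<comment> \<open>a0 bounds the mass. The moment needs a1 from \<Phi> and 2 * a0 from the support
    radius 2 * 2^-\<gamma> of the piece; a2 is the smoothness constant of \<Phi>.\<close>
  define C where "C = (3 * a0 + a1 + a2) * P"
  have C: "C \<ge> 0" using a01 a2 P by (simp add: C_def)
  have "\<exists>S. kernel_family (kernel_smooth_piece \<Phi> \<Omega> \<mu>) (C * w) \<mu> S"
    if \<Omega>: "\<Omega> \<in> borel_measurable sphere_measure"
      and I: "(\<integral>\<^sup>+\<theta>. ennreal (norm (\<Omega> \<theta>)) \<partial>sphere_measure) \<le> ennreal w" and w: "0 \<le> w" and \<mu>: "0 \<le> \<mu>" for \<Omega> w \<mu>
  proof -
    define p where "p = P * w"
    have p: "p \<ge> 0" using P w by (simp add: p_def)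
    have Cw: "C * w = (3 * a0 + a1 + a2) * p" by (simp add: C_def p_def)
    define \<kappa> where "\<kappa> = kernel_piece \<Phi> \<Omega>"
    have km [measurable]: "\<kappa> i \<in> borel_measurable borel" for i
      unfolding \<kappa>_def by (rule kernel_piece_facts(1)[OF \<Phi> \<Omega> I w P_def])
    have k1: "(\<integral>\<^sup>+y. ennreal (norm (\<kappa> i y)) \<partial>lborel) \<le> ennreal p" for i
      unfolding \<kappa>_def p_def by (rule kernel_piece_facts(2)[OF \<Phi> \<Omega> I w P_def])
    have ki: "integrable lborel (\<kappa> i)" for i
      using k1[of i] by (intro integrableI_bounded) (auto simp: less_top[symmetric] top_unique)
    have k2: "(\<integral>\<^sup>+y. ennreal (norm y * norm (\<kappa> i y)) \<partial>lborel) \<le> ennreal (2 * 2 powi (-i) * p)" for i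
    proof -
      have "(\<integral>\<^sup>+y. ennreal (norm y * norm (\<kappa> i y)) \<partial>lborel) \<le> (\<integral>\<^sup>+y. ennreal (2 * 2 powi (-i)) * ennreal (norm (\<kappa> i y)) \<partial>lborel)"
      proof (rule nn_integral_mono)
        fix y
        have "norm y * norm (\<kappa> i y) \<le> (2 * 2 powi (-i)) * norm (\<kappa> i y)"
        proof (cases "\<kappa> i y = 0")
          case False
          have "norm y \<le> 2 * 2 powi (-i)"
            by (rule kernel_piece_facts(3)[OF \<Phi> \<Omega> I w P_def]) (use False in \<open>simp add: \<kappa>_def\<close>)
          then show ?thesis by (rule mult_right_mono) simp
        qed simp
        then show "ennreal (norm y * norm (\<kappa> i y)) \<le> ennreal (2 * 2 powi (-i)) * ennreal (norm (\<kappa> i y))"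
          by (subst ennreal_mult'[symmetric]) (auto intro: ennreal_leI)
      qed
      also have "\<dots> = ennreal (2 * 2 powi (-i)) * (\<integral>\<^sup>+y. ennreal (norm (\<kappa> i y)) \<partial>lborel)" by (rule nn_integral_cmult) measurable
      also have "\<dots> \<le> ennreal (2 * 2 powi (-i)) * ennreal p" by (intro mult_left_mono k1) auto
      also have "\<dots> = ennreal (2 * 2 powi (-i) * p)" by (rule ennreal_mult'[symmetric]) simp
      finally show ?thesis .
    qed
    define \<phi> where "\<phi> i = dyadic \<Phi> (\<mu> + i)" for i
    have pm [measurable]: "\<phi> i \<in> borel_measurable borel" for i unfolding \<phi>_def by measurable
    have p0: "(\<integral>\<^sup>+x. ennreal (norm (\<phi> i x)) \<partial>lborel) = ennreal a0" for i
      unfolding \<phi>_def dyadic_L1(1)[OF \<Phi>m] nn0 ..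
    have p1: "(\<integral>\<^sup>+x. ennreal (norm x * norm (\<phi> i x)) \<partial>lborel) = ennreal (2 powi (-(\<mu> + i)) * a1)" for i
      unfolding \<phi>_def dyadic_L1(2)[OF \<Phi>m] nn1 by (rule ennreal_mult'[symmetric]) simp
    have p2: "(\<integral>\<^sup>+x. ennreal (norm (\<phi> i (x + v) - \<phi> i x)) \<partial>lborel) \<le> ennreal (a2 * 2 powi (\<mu> + i) * norm v)" for i v
    proof -
      have "(\<integral>\<^sup>+x. ennreal (norm (\<phi> i (x + v) - \<phi> i x)) \<partial>lborel) \<le> ennreal (a2 * norm ((2 powi (\<mu> + i)) *\<^sub>R v))"
        unfolding \<phi>_def dyadic_L1(3)[OF \<Phi>m] using a2 by blast
      then show ?thesis by (simp add: mult.assoc)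
    qed
    have pint: "integrable lborel (\<phi> i)" for i
      using p0[of i] by (intro integrableI_bounded) auto
    have pb: "norm (\<phi> i y) \<le> (2 powi (\<mu> + i)) ^ DIM('n vpair) * G" for i y
      unfolding \<phi>_def norm_dyadic by (intro mult_left_mono) (use G in blast, simp)
    have eq: "kernel_smooth_piece \<Phi> \<Omega> \<mu> i = convol (\<phi> i) (\<kappa> i)" for i
      by (simp add: kernel_smooth_piece_def \<phi>_def \<kappa>_def)
    \<comment> \<open>The dyadic \<Phi> is bounded by 2^((\<mu>+i)D) G, with D the dimension; for i
      \<le> 0 the power 2^(iD) is at most 2^i.\<close>
    define S where "S = (2 powi \<mu>) ^ DIM('n vpair) * G * p"
    have S: "S \<ge> 0" using G p by (simp add: S_def)
    have "kernel_family (kernel_smooth_piece \<Phi> \<Omega> \<mu>) (C * w) \<mu> S"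
    proof
      show "0 \<le> C * w" "0 \<le> \<mu>" "0 \<le> S" using C w \<mu> S by auto
      fix i :: int
      show "kernel_smooth_piece \<Phi> \<Omega> \<mu> i \<in> borel_measurable borel" unfolding eq by measurable
      have "(\<integral>\<^sup>+y. ennreal (norm (convol (\<phi> i) (\<kappa> i) y)) \<partial>lborel) \<le> ennreal a0 * ennreal p"
        using convol_L1[OF pm km, of i i] mult_left_mono[OF k1[of i], of "ennreal a0"] unfolding p0 by (rule order_trans) simp
      also have "\<dots> = ennreal (a0 * p)" using a01 by (intro ennreal_mult'[symmetric])
      also have "\<dots> \<le> ennreal (C * w)" unfolding Cw using a01 a2 p by (intro ennreal_leI mult_right_mono) auto
      finally show "(\<integral>\<^sup>+y. ennreal (norm (kernel_smooth_piece \<Phi> \<Omega> \<mu> i y)) \<partial>lborel) \<le> ennreal (C * w)" unfolding eq .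
      have "(\<integral>\<^sup>+y. ennreal (norm y * norm (convol (\<phi> i) (\<kappa> i) y)) \<partial>lborel)
        \<le> ennreal (2 powi (-(\<mu> + i)) * a1) * (\<integral>\<^sup>+y. ennreal (norm (\<kappa> i y)) \<partial>lborel) + ennreal a0 * (\<integral>\<^sup>+y. ennreal (norm y * norm (\<kappa> i y)) \<partial>lborel)"
        using convol_moment[OF pm km, of i i] unfolding p0 p1 .
      also have "\<dots> \<le> ennreal (2 powi (-(\<mu> + i)) * a1) * ennreal p + ennreal a0 * ennreal (2 * 2 powi (-i) * p)"
        by (intro add_mono mult_left_mono k1 k2) auto
      also have "\<dots> = ennreal (2 powi (-(\<mu> + i)) * a1 * p) + ennreal (a0 * (2 * 2 powi (-i) * p))"
        using a01 by (intro arg_cong2[where f="(+)"] ennreal_mult'[symmetric]) auto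
      also have "\<dots> = ennreal (2 powi (-(\<mu> + i)) * a1 * p + a0 * (2 * 2 powi (-i) * p))"
        using a01 p by (intro ennreal_plus[symmetric]) auto
      also have "\<dots> \<le> ennreal (C * w * 2 powi (-i))"
      proof (rule ennreal_leI)
        have "2 powi (-(\<mu> + i)) \<le> (2::real) powi (-i)" using \<mu> by (intro power_int_increasing) auto
        then have "2 powi (-(\<mu> + i)) * (a1 * p) \<le> 2 powi (-i) * (a1 * p)" using a01 p by (intro mult_right_mono) auto
        moreover have "0 \<le> (a0 + a2) * (p * 2 powi (-i))" using a01 a2 p by simp
        ultimately show "2 powi (-(\<mu> + i)) * a1 * p + a0 * (2 * 2 powi (-i) * p) \<le> C * w * 2 powi (-i)"
          unfolding Cw by (simp add: algebra_simps)
      qed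
      finally show "(\<integral>\<^sup>+y. ennreal (norm y * norm (kernel_smooth_piece \<Phi> \<Omega> \<mu> i y)) \<partial>lborel) \<le> ennreal (C * w * 2 powi (-i))" unfolding eq .
      show "(LINT y|lborel. kernel_smooth_piece \<Phi> \<Omega> \<mu> i y) = 0"
        unfolding eq by (rule convol_integral_zero[OF pint ki]) (simp add: \<phi>_def dyadic_integral \<Phi>0)
      fix v :: "'n vpair"
      have "(\<integral>\<^sup>+y. ennreal (norm (convol (\<phi> i) (\<kappa> i) (y + v) - convol (\<phi> i) (\<kappa> i) y)) \<partial>lborel)
        \<le> (\<integral>\<^sup>+x. ennreal (norm (\<phi> i (x + v) - \<phi> i x)) \<partial>lborel) * (\<integral>\<^sup>+y. ennreal (norm (\<kappa> i y)) \<partial>lborel)"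
        by (rule convol_smooth[OF pm pb ki])
      also have "\<dots> \<le> ennreal (a2 * 2 powi (\<mu> + i) * norm v) * ennreal p" by (intro mult_mono p2 k1) auto
      also have "\<dots> = ennreal (a2 * 2 powi (\<mu> + i) * norm v * p)" using a2 by (intro ennreal_mult'[symmetric]) auto
      also have "\<dots> \<le> ennreal (C * w * 2 powi (\<mu> + i) * norm v)"
      proof (rule ennreal_leI)
        have "0 \<le> (3 * a0 + a1) * (p * (2 powi (\<mu> + i) * norm v))" using a01 p by simp
        then show "a2 * 2 powi (\<mu> + i) * norm v * p \<le> C * w * 2 powi (\<mu> + i) * norm v"
          unfolding Cw by (simp add: algebra_simps)
      qed
      finally show "(\<integral>\<^sup>+y. ennreal (norm (kernel_smooth_piece \<Phi> \<Omega> \<mu> i (y + v) - kernel_smooth_piece \<Phi> \<Omega> \<mu> i y)) \<partial>lborel)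
        \<le> ennreal (C * w * 2 powi (\<mu> + i) * norm v)" unfolding eq .
    next
      fix i :: int and y :: "'n vpair" assume i: "i \<le> 0"
      let ?g = "(2 powi (\<mu> + i)) ^ DIM('n vpair) * G"
      have g: "?g \<ge> 0" using G by simp
      have "ennreal (norm (convol (\<phi> i) (\<kappa> i) y)) \<le> (\<integral>\<^sup>+z. ennreal (norm (\<phi> i (y - z))) * ennreal (norm (\<kappa> i z)) \<partial>lborel)"
        by (rule convol_nn)
      also have "\<dots> \<le> (\<integral>\<^sup>+z. ennreal ?g * ennreal (norm (\<kappa> i z)) \<partial>lborel)"
        by (intro nn_integral_mono mult_right_mono ennreal_leI pb) auto
      also have "\<dots> = ennreal ?g * (\<integral>\<^sup>+z. ennreal (norm (\<kappa> i z)) \<partial>lborel)" by (rule nn_integral_cmult) measurable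
      also have "\<dots> \<le> ennreal ?g * ennreal p" by (intro mult_left_mono k1) auto
      also have "\<dots> = ennreal (?g * p)" using g by (rule ennreal_mult'[symmetric])
      finally have "norm (convol (\<phi> i) (\<kappa> i) y) \<le> ?g * p" using g p by (subst (asm) ennreal_le_iff) auto
      also have "?g * p = S * (2 powi i) ^ DIM('n vpair)" by (simp add: S_def power_int_add power_mult_distrib)
      also have "\<dots> \<le> S * 2 powi i"
      proof (intro mult_left_mono S)
        have "(2::real) powi i \<le> 2 powi 0" using i by (intro power_int_increasing) auto
        then have "((2::real) powi i) ^ DIM('n vpair) \<le> (2 powi i) ^ Suc 0"
          by (intro power_decreasing DIM_ge_Suc0) simp_all
        then show "((2::real) powi i) ^ DIM('n vpair) \<le> 2 powi i" by simp
      qed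
      finally show "norm (kernel_smooth_piece \<Phi> \<Omega> \<mu> i y) \<le> S * 2 powi i" unfolding eq .
    qed
    then show ?thesis by blast
  qed
  then show ?thesis using C by blast
qed

section \<open>Removal of the truncation\<close>

text \<open>Fatou for indicators: because the inequality defining the level set is strict, t < |v x|
  implies t < |u n x| for all large n.\<close>

lemma weak_bound_limit:
  fixes u :: "nat \<Rightarrow> 'a \<Rightarrow> complex"
  assumes [measurable]: "\<And>n. u n \<in> borel_measurable M" and lim: "\<And>x. (\<lambda>n. u n x) \<longlonglongrightarrow> v x"
    and bd: "\<And>n. ennreal t * emeasure M {x \<in> space M. t < norm (u n x)} \<le> c"
  shows "ennreal t * emeasure M {x \<in> space M. t < norm (v x)} \<le> c"
proof -
  have [measurable]: "v \<in> borel_measurable M" by (rule borel_measurable_LIMSEQ_metric[OF _ lim]) measurable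
  have "ennreal t * emeasure M {x \<in> space M. t < norm (v x)} = (\<integral>\<^sup>+x. ennreal t * indicator {x \<in> space M. t < norm (v x)} x \<partial>M)"
    by (subst nn_integral_cmult_indicator) auto
  also have "\<dots> \<le> (\<integral>\<^sup>+x. liminf (\<lambda>n. ennreal t * indicator {x \<in> space M. t < norm (u n x)} x) \<partial>M)"
  proof (rule nn_integral_mono)
    fix x assume x: "x \<in> space M"
    show "ennreal t * indicator {x \<in> space M. t < norm (v x)} x \<le> liminf (\<lambda>n. ennreal t * indicator {x \<in> space M. t < norm (u n x)} x)"
    proof (cases "t < norm (v x)")
      case True
      have "(\<lambda>n. norm (u n x)) \<longlonglongrightarrow> norm (v x)" by (intro tendsto_norm lim)
      then have "\<forall>\<^sub>F n in sequentially. t < norm (u n x)" using True by (rule order_tendstoD)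
      then have "\<forall>\<^sub>F n in sequentially. ennreal t * 1 \<le> ennreal t * indicator {x \<in> space M. t < norm (u n x)} x"
        by eventually_elim (simp add: x)
      then have "ennreal t * 1 \<le> liminf (\<lambda>n. ennreal t * indicator {x \<in> space M. t < norm (u n x)} x)"
        by (rule Liminf_bounded)
      then show ?thesis using True x by simp
    qed simp
  qed
  also have "\<dots> \<le> liminf (\<lambda>n. \<integral>\<^sup>+x. ennreal t * indicator {x \<in> space M. t < norm (u n x)} x \<partial>M)"
    by (rule nn_integral_liminf) measurable
  also have "\<dots> \<le> liminf (\<lambda>n. c)"
  proof (intro Liminf_mono always_eventually allI)
    fix n
    have "(\<integral>\<^sup>+x. ennreal t * indicator {x \<in> space M. t < norm (u n x)} x \<partial>M) = ennreal t * emeasure M {x \<in> space M. t < norm (u n x)}"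
      by (rule nn_integral_cmult_indicator) measurable
    then show "(\<integral>\<^sup>+x. ennreal t * indicator {x \<in> space M. t < norm (u n x)} x \<partial>M) \<le> c" using bd by simp
  qed
  also have "\<dots> = c" by (simp add: Liminf_const)
  finally show ?thesis .
qed

lemma (in bilinear_kernel) weak_type_schwartz:
  assumes f: "schwartz f" and gm [measurable]: "g \<in> borel_measurable borel" and g: "\<And>x. norm (g x) \<le> m" and m: "m > 0" and t: "t > 0"
  shows "ennreal t * emeasure lborel {x. t < norm (bil K f g x)} \<le> ennreal (weak_const * m * (LINT x|lborel. norm (f x)))"
proof -
  define h where "h x = of_real (1 / m) * g x" for x
  have hm [measurable]: "h \<in> borel_measurable borel" unfolding h_def[abs_def] by measurable
  have h: "norm (h x) \<le> 1" for x using g[of x] m by (simp add: h_def norm_mult norm_divide)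
  have gh: "bil K f g x = of_real m * bil K f h x" for x
    unfolding bil_cmult2[symmetric] using m by (simp add: h_def)
  obtain G where "G \<ge> 0 \<and> (\<forall>x. norm (f x) \<le> G)" using schwartz_bounded[OF f] by (elim exE)
  then have G: "norm (f x) \<le> G" for x by blast
  have tm: "t / m > 0" using t m by simp
  have eq: "{x. t < norm (bil K f g x)} = {x. t / m < norm (bil K f h x)}"
    using m by (auto simp: gh norm_mult field_simps)
  have "ennreal (t / m) * emeasure lborel {x. t / m < norm (bil K f h x)} \<le> ennreal (weak_const * (LINT x|lborel. norm (f x)))"
    by (rule weak_type_approx[OF hm h schwartz_integrable(1)[OF f] G tm schwartz_dyadic_approx[OF f]])
  then have "ennreal m * (ennreal (t / m) * emeasure lborel {x. t / m < norm (bil K f h x)}) \<le> ennreal m * ennreal (weak_const * (LINT x|lborel. norm (f x)))"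
    by (rule mult_left_mono) simp
  also have "ennreal m * (ennreal (t / m) * emeasure lborel {x. t / m < norm (bil K f h x)}) = ennreal t * emeasure lborel {x. t < norm (bil K f g x)}"
    unfolding eq using m t by (simp add: mult.assoc[symmetric] ennreal_mult'[symmetric])
  also have "ennreal m * ennreal (weak_const * (LINT x|lborel. norm (f x))) = ennreal (weak_const * m * (LINT x|lborel. norm (f x)))"
    using m by (subst ennreal_mult'[symmetric]) (auto simp: mult_ac)
  finally show ?thesis .
qed

lemma nn_integral_lborel_swap:
  fixes f :: "'a::euclidean_space \<times> 'b::euclidean_space \<Rightarrow> ennreal"
  assumes [measurable]: "f \<in> borel_measurable borel"
  shows "(\<integral>\<^sup>+y. f (prod.swap y) \<partial>lborel) = (\<integral>\<^sup>+y. f y \<partial>lborel)"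
proof -
  have "(\<integral>\<^sup>+y. f y \<partial>lborel) = (\<integral>\<^sup>+y. f y \<partial>distr lborel borel prod.swap)" by (simp add: lborel_distr_swap)
  then show ?thesis by (subst (asm) nn_integral_distr) auto
qed

lemma norm_swap: "norm (prod.swap y) = norm y"
  by (cases y) (simp add: norm_Pair add.commute)

lemma (in bilinear_kernel) swapped_kernel: "bilinear_kernel (\<lambda>i. k i \<circ> prod.swap) F A B \<mu>"
proof
  fix i
  show "k i \<circ> prod.swap \<in> borel_measurable borel" unfolding comp_def by measurable
  show "(\<integral>\<^sup>+y. ennreal (norm ((k i \<circ> prod.swap) y)) \<partial>lborel) \<le> ennreal A"
    using mass[of i] nn_integral_lborel_swap[of "\<lambda>y. ennreal (norm (k i y))"] by simp
  show "(\<integral>\<^sup>+y. ennreal (norm y * norm ((k i \<circ> prod.swap) y)) \<partial>lborel) \<le> ennreal (A * 2 powi - i)"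
    using moment[of i] nn_integral_lborel_swap[of "\<lambda>y. ennreal (norm y * norm (k i y))"] by (simp add: norm_swap)
  fix v
  have "(k i \<circ> prod.swap) (y + v) = k i (prod.swap y + prod.swap v)" for y by (simp add: prod.swap_def)
  then show "(\<integral>\<^sup>+y. ennreal (norm ((k i \<circ> prod.swap) (y + v) - (k i \<circ> prod.swap) y)) \<partial>lborel) \<le> ennreal (A * 2 powi (\<mu> + i) * norm v)"
    using smooth[of i "prod.swap v"] nn_integral_lborel_swap[of "\<lambda>y. ennreal (norm (k i (y + prod.swap v) - k i y))"]
    by (simp add: norm_swap)
next
  fix E :: "'a set" and f g :: "'a \<Rightarrow> complex"
  assume "E \<in> sets borel" "bounded E" and fg: "f \<in> borel_measurable borel" "g \<in> borel_measurable borel"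
    and "\<And>x. norm (f x) \<le> indicator E x" "\<And>x. norm (g x) \<le> indicator E x"
  then have "(\<integral>\<^sup>+x. ennreal (norm (bil K g f x)) \<partial>lborel) \<le> ennreal B * emeasure lborel E"
    unfolding K_def[abs_def] by (intro local)
  moreover have "bil (\<lambda>y. \<Sum>i\<in>F. (k i \<circ> prod.swap) y) f g x = bil K g f x" for x
    using bil_swap[OF K_borel fg(2,1), of x] by (simp add: K_def[abs_def] comp_def)
  ultimately show "(\<integral>\<^sup>+x. ennreal (norm (bil (\<lambda>y. \<Sum>i\<in>F. (k i \<circ> prod.swap) y) f g x)) \<partial>lborel) \<le> ennreal B * emeasure lborel E"
    by simp
qed (use finite_F A_nonneg B_pos mu_nonneg in auto)

context kernel_family
begin

text \<open>Each window from -N to N is a \<open>bilinear_kernel\<close> with the same A and B, so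
  its weak-type constant, here written out as \<open>W\<close>, does not depend on N and survives
  the limit.\<close>

lemma T_weak_type:
  fixes f1 f2 :: "'a \<Rightarrow> complex"
  assumes c: "c \<ge> 1" "(\<integral>\<^sup>+z. ennreal (norm z * norm (mollifier (z::'a \<times> 'a))) \<partial>lborel) \<le> ennreal c"
    "\<And>v. (\<integral>\<^sup>+u. ennreal (norm (mollifier (u + v) - mollifier (u::'a \<times> 'a))) \<partial>lborel) \<le> ennreal (c * norm v)"
    and B0: "B0 \<ge> 0"
    and L2: "\<And>f1 f2. schwartz f1 \<Longrightarrow> schwartz f2 \<Longrightarrow>
      (\<integral>\<^sup>+x. ennreal (norm (T f1 f2 x)) \<partial>lborel) \<le> ennreal B0 * Lp_norm 2 lborel f1 * Lp_norm 2 lborel f2"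
    and B: "B > 0" "2 * B0 + 2 * (c * A * (of_int \<mu> + 5)) \<le> B"
    and W: "W = 8 * U * (32 * B * U + 4 * A * (of_int \<mu> + 5)) + 16 * A * (of_int \<mu> + 5)"
    and U: "U = ball_const DIM('a) * 2 ^ DIM('a)"
    and f: "schwartz f1" "schwartz f2" and m: "m > 0" and t: "t > 0"
  shows "(\<And>x. norm (f2 x) \<le> m) \<Longrightarrow> ennreal t * emeasure lborel {x. t < norm (T f1 f2 x)} \<le> ennreal (W * m * (LINT x|lborel. norm (f1 x)))"
    and "(\<And>x. norm (f1 x) \<le> m) \<Longrightarrow> ennreal t * emeasure lborel {x. t < norm (T f1 f2 x)} \<le> ennreal (W * m * (LINT x|lborel. norm (f2 x)))"
proof -
  have fm [measurable]: "f1 \<in> borel_measurable borel" "f2 \<in> borel_measurable borel" using f by (auto intro: schwartz_borel)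
  obtain G1 where "G1 \<ge> 0 \<and> (\<forall>x. norm (f1 x) \<le> G1)" using schwartz_bounded[OF f(1)] by (elim exE)
  then have G1: "norm (f1 x) \<le> G1" for x by blast
  obtain G2 where "G2 \<ge> 0 \<and> (\<forall>x. norm (f2 x) \<le> G2)" using schwartz_bounded[OF f(2)] by (elim exE)
  then have G2: "norm (f2 x) \<le> G2" for x by blast
  have bk: "bilinear_kernel k {- int N..int N} A B \<mu>" for N
  proof
    fix E :: "'a set" and f g :: "'a \<Rightarrow> complex"
    assume a: "E \<in> sets borel" "bounded E" "f \<in> borel_measurable borel" "g \<in> borel_measurable borel"
      "\<And>x. norm (f x) \<le> indicator E x" "\<And>x. norm (g x) \<le> indicator E x"
    have "(\<integral>\<^sup>+x. ennreal (norm (bil (\<lambda>y. \<Sum>i\<in>{- int N..int N}. k i y) f g x)) \<partial>lborel)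
      \<le> ennreal (2 * B0 + 2 * (c * A * (of_int \<mu> + 5))) * emeasure lborel E"
      by (rule local_bound[OF c a B0 L2])
    also have "\<dots> \<le> ennreal B * emeasure lborel E" using B(2) by (intro mult_right_mono ennreal_leI) auto
    finally show "(\<integral>\<^sup>+x. ennreal (norm (bil (\<lambda>y. \<Sum>i\<in>{- int N..int N}. k i y) f g x)) \<partial>lborel) \<le> ennreal B * emeasure lborel E" .
  qed (use A_nonneg mu_nonneg B mass moment smooth in auto)
  define u where "u N x = (\<Sum>i\<in>{- int N..int N}. bil (k i) f1 f2 x)" for N x
  have um [measurable]: "u N \<in> borel_measurable lborel" for N unfolding u_def[abs_def] by measurable
  have ulim: "(\<lambda>N. u N x) \<longlonglongrightarrow> T f1 f2 x" for x unfolding u_def by (rule T_tendsto[OF f])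
  have uK: "u N x = bil (bilinear_kernel.K k {- int N..int N}) f1 f2 x" for N x
    unfolding u_def bilinear_kernel.K_def[OF bk, abs_def] by (rule bil_sum[OF k_integrable fm G1 G2, symmetric])
  have Wc: "bilinear_kernel.weak_const TYPE('a) A B \<mu> = W" for N
    unfolding bilinear_kernel.weak_const_def[OF bk] bilinear_kernel.U_def[OF bk] bilinear_kernel.H_def[OF bk] W U
    by (simp add: algebra_simps)
  show "ennreal t * emeasure lborel {x. t < norm (T f1 f2 x)} \<le> ennreal (W * m * (LINT x|lborel. norm (f1 x)))"
    if "\<And>x. norm (f2 x) \<le> m"
  proof -
    have "ennreal t * emeasure lborel {x. t < norm (u N x)} \<le> ennreal (W * m * (LINT x|lborel. norm (f1 x)))" for N
      unfolding uK Wc[symmetric] by (rule bilinear_kernel.weak_type_schwartz[OF bk f(1) fm(2) that m t])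
    then show ?thesis using weak_bound_limit[OF um ulim, of t] by simp
  qed
  show "ennreal t * emeasure lborel {x. t < norm (T f1 f2 x)} \<le> ennreal (W * m * (LINT x|lborel. norm (f2 x)))"
    if "\<And>x. norm (f1 x) \<le> m"
  proof -
    have bs: "bilinear_kernel (\<lambda>i. k i \<circ> prod.swap) {- int N..int N} A B \<mu>" for N
      by (rule bilinear_kernel.swapped_kernel[OF bk])
    have "u N x = bil (bilinear_kernel.K (\<lambda>i. k i \<circ> prod.swap) {- int N..int N}) f2 f1 x" for N x
      unfolding uK bilinear_kernel.K_def[OF bs, abs_def]
      using bil_swap[OF bilinear_kernel.K_borel[OF bk[of N]] fm, of x] by (simp add: bilinear_kernel.K_def[OF bk, abs_def] comp_def)
    then have "ennreal t * emeasure lborel {x. t < norm (u N x)} \<le> ennreal (W * m * (LINT x|lborel. norm (f2 x)))" for N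
      unfolding Wc[symmetric] using bilinear_kernel.weak_type_schwartz[OF bs[of N] f(2) fm(1) that m t] by simp
    then show ?thesis using weak_bound_limit[OF um ulim, of t] by simp
  qed
qed

end

text \<open>For a continuous function a nonempty strict superlevel set is open and contains a ball
  of positive measure. The maximum with 0 is there because \<open>ennreal\<close> sends negative m
  to 0.\<close>

lemma continuous_le_esssup:
  fixes f :: "'a::euclidean_space \<Rightarrow> complex"
  assumes f: "continuous_on UNIV f" and m: "esssup lborel (\<lambda>x. ennreal (norm (f x))) \<le> ennreal m"
  shows "norm (f x) \<le> max 0 m"
proof (rule ccontr)
  assume n: "\<not> norm (f x) \<le> max 0 m"
  define V where "V = {y. max 0 m < norm (f y)}"
  have "open V" unfolding V_def by (intro open_Collect_less continuous_intros f)
  moreover have "x \<in> V" using n unfolding V_def mem_Collect_eq by (simp only: not_le)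
  ultimately obtain e where e: "e > 0" "ball x e \<subseteq> V" using open_contains_ball by blast
  have [measurable]: "f \<in> borel_measurable borel" using f by (rule borel_measurable_continuous_onI)
  have "AE y in lborel. ennreal (norm (f y)) \<le> esssup lborel (\<lambda>x. ennreal (norm (f x)))"
    by (rule esssup_AE)
  then have "AE y in lborel. y \<notin> ball x e"
  proof (rule AE_mp, intro AE_I2 impI)
    fix y assume "ennreal (norm (f y)) \<le> esssup lborel (\<lambda>x. ennreal (norm (f x)))"
    also note m
    also have "ennreal m \<le> ennreal (max 0 m)" by (intro ennreal_leI) simp
    finally have "ennreal (norm (f y)) \<le> ennreal (max 0 m)" .
    then have "norm (f y) \<le> max 0 m" by (subst (asm) ennreal_le_iff) auto
    then have "y \<notin> V" unfolding V_def mem_Collect_eq by (simp only: not_less)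
    then show "y \<notin> ball x e" using e(2) by blast
  qed
  then have "emeasure lborel (ball x e) = 0" by (subst (asm) AE_iff_measurable[of "ball x e"]) auto
  then show False using e(1) unit_ball_vol_pos[of "real DIM('a)"] by (simp add: emeasure_ball)
qed

text \<open>Here 2^(\<delta> x) absorbs the number of scales, by exp y \<ge> 1 + y. The constant
  grows like 1/\<delta> as \<delta> tends to 0.\<close>

lemma linear_le_powr:
  fixes x \<delta> :: real
  assumes "\<delta> > 0" "x \<ge> 0"
  shows "x + 5 \<le> (5 + 1 / (\<delta> * ln 2)) * 2 powr (\<delta> * x)"
proof -
  have d: "\<delta> * ln 2 > 0" using assms by simp
  have e: "1 + \<delta> * x * ln 2 \<le> 2 powr (\<delta> * x)"
    using exp_ge_add_one_self[of "\<delta> * x * ln 2"] by (simp add: powr_def)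
  have p: "1 \<le> 2 powr (\<delta> * x)" using assms by (intro ge_one_powr_ge_zero) auto
  have "x = 1 / (\<delta> * ln 2) * (\<delta> * x * ln 2)" using assms(1) by simp
  also have "\<dots> \<le> 1 / (\<delta> * ln 2) * 2 powr (\<delta> * x)" using e d by (intro mult_left_mono) auto
  finally have "x \<le> 1 / (\<delta> * ln 2) * 2 powr (\<delta> * x)" .
  moreover have "5 * 1 \<le> 5 * 2 powr (\<delta> * x)" using p by (intro mult_left_mono) auto
  ultimately show ?thesis by (simp add: distrib_right)
qed

text \<open>The perturbation \<open>\<eta>\<close> keeps \<open>B\<close> and the supremum of the bounded input strictly positive, which
  \<^locale>\<open>bilinear_kernel\<close> and the normalisation of that input require.\<close>

lemma ennreal_le_of_perturbed:
  assumes "\<And>\<eta>. \<eta> > 0 \<Longrightarrow> X \<le> ennreal ((a + b * \<eta>) * (m + \<eta>) * N)"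
  shows "X \<le> ennreal (a * m * N)"
proof -
  have "(\<lambda>n. (a + b * (1 / real (Suc n))) * (m + 1 / real (Suc n)) * N) \<longlonglongrightarrow> (a + b * 0) * (m + 0) * N"
    by (intro tendsto_intros LIMSEQ_Suc lim_1_over_n)
  then have "(\<lambda>n. ennreal ((a + b * (1 / real (Suc n))) * (m + 1 / real (Suc n)) * N)) \<longlonglongrightarrow> ennreal (a * m * N)"
    using tendsto_ennrealI by fastforce
  then show ?thesis by (rule LIMSEQ_le_const) (intro exI[of _ 0] allI impI assms, simp)
qed

theorem proposition4p3:
  fixes \<Phi> :: "'n::finite vpair \<Rightarrow> complex"
    and q :: ennreal and \<delta> :: real and \<mu>0 :: int
  assumes "littlewood_paley \<Phi>"
    and "\<delta> > 0"
    and "ennreal (4 / 3) < q"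
    and "\<mu>0 > 0"
    and "L2_decay \<Phi> q \<mu>0"
  shows "\<exists>C::real. C > 0 \<and>
    (\<forall>\<mu>\<ge>\<mu>0. \<forall>\<Omega>\<in>mean_zero_Lq q. \<forall>f1 f2. schwartz f1 \<longrightarrow> schwartz f2 \<longrightarrow>
       weak_L1_norm lborel (bilinear_op \<Phi> \<Omega> \<mu> f1 f2)
         \<le> ennreal (C * 2 powr (\<delta> * real_of_int \<mu>)) * Lp_norm q sphere_measure \<Omega>
            * Lp_norm 1 lborel f1 * Lp_norm \<infinity> lborel f2 \<and>
       weak_L1_norm lborel (bilinear_op \<Phi> \<Omega> \<mu> f1 f2)
         \<le> ennreal (C * 2 powr (\<delta> * real_of_int \<mu>)) * Lp_norm q sphere_measure \<Omega>
            * Lp_norm \<infinity> lborel f1 * Lp_norm 1 lborel f2)"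
proof -
  obtain Ck where Ck: "Ck \<ge> 0 \<and> (\<forall>\<Omega> w \<mu>. \<Omega> \<in> borel_measurable sphere_measure \<longrightarrow>
    (\<integral>\<^sup>+\<theta>. ennreal (norm (\<Omega> \<theta>)) \<partial>sphere_measure) \<le> ennreal w \<longrightarrow> 0 \<le> w \<longrightarrow> 0 \<le> \<mu> \<longrightarrow>
    (\<exists>S. kernel_family (kernel_smooth_piece \<Phi> \<Omega> \<mu>) (Ck * w) \<mu> S))"
    using kernel_smooth_piece_family[OF assms(1)] by (elim exE)
  obtain c where c: "c \<ge> 1 \<and> (\<integral>\<^sup>+z. ennreal (norm z * norm (mollifier (z::'n vpair))) \<partial>lborel) \<le> ennreal c \<and>
    (\<forall>v. (\<integral>\<^sup>+u. ennreal (norm (mollifier (u + v) - mollifier (u::'n vpair))) \<partial>lborel) \<le> ennreal (c * norm v))"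
    using mollifier_constant by (elim exE)
  obtain v where v: "v \<ge> 0 \<and> emeasure sphere_measure (space (sphere_measure :: 'n vpair measure)) = ennreal v"
    using sphere_measure_finite by (elim exE)
  obtain \<epsilon>1 C1 where \<epsilon>1: "\<epsilon>1 > 0" and C1: "C1 > 0" and
    L2: "\<forall>\<mu>\<ge>\<mu>0. \<forall>\<Omega>\<in>mean_zero_Lq q. \<forall>f1 f2. schwartz f1 \<longrightarrow> schwartz f2 \<longrightarrow>
       Lp_norm 1 lborel (bilinear_op \<Phi> \<Omega> \<mu> f1 f2)
         \<le> ennreal (C1 * 2 powr (- \<epsilon>1 * real_of_int \<mu>)) * Lp_norm q sphere_measure \<Omega>
            * Lp_norm 2 lborel f1 * Lp_norm 2 lborel f2"
    using assms(5) unfolding L2_decay_def by blast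
  define U where "U = ball_const DIM(real ^ 'n) * 2 ^ DIM(real ^ 'n)"
  have U: "U > 0" unfolding U_def by (intro mult_pos_pos ball_const_pos) auto
  \<comment> \<open>With \<omega> the L^q norm of \<Omega>, the kernel constant is A = a * \<omega>:
    \<open>Ck\<close> from the kernel estimates, v + 1 from the passage from L^1 to L^q on the
    sphere.\<close>
  define a where "a = Ck * (v + 1)"
  have a: "a \<ge> 0" using Ck v by (simp add: a_def)
  \<comment> \<open>The constant of \<open>T_weak_type\<close> with the common factor \<omega> * s
    removed, where s = \<mu> + 5.\<close>
  define \<kappa> where "\<kappa> = 8 * U * (32 * U * (2 * C1 + 2 * c * a) + 4 * a) + 16 * a"
  have \<kappa>: "\<kappa> \<ge> 0" unfolding \<kappa>_def using U C1 c a by simp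
  define C' where "C' = 5 + 1 / (\<delta> * ln 2)"
  have C': "C' > 0" unfolding C'_def using assms(2) by (simp add: add_pos_nonneg)
  \<comment> \<open>The summand 1 yields C > 0 from \<kappa> \<ge> 0 alone.\<close>
  define C where "C = \<kappa> * C' + 1"
  have C: "C > 0" unfolding C_def using \<kappa> C' by (simp add: add_nonneg_pos)
  have main: "weak_L1_norm lborel (bilinear_op \<Phi> \<Omega> \<mu> f1 f2)
         \<le> ennreal (C * 2 powr (\<delta> * real_of_int \<mu>)) * Lp_norm q sphere_measure \<Omega>
            * Lp_norm 1 lborel f1 * Lp_norm \<infinity> lborel f2 \<and>
       weak_L1_norm lborel (bilinear_op \<Phi> \<Omega> \<mu> f1 f2)
         \<le> ennreal (C * 2 powr (\<delta> * real_of_int \<mu>)) * Lp_norm q sphere_measure \<Omega>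
            * Lp_norm \<infinity> lborel f1 * Lp_norm 1 lborel f2"
    if \<mu>: "\<mu> \<ge> \<mu>0" and \<Omega>: "\<Omega> \<in> mean_zero_Lq q" and f1: "schwartz f1" and f2: "schwartz f2"
    for \<mu> \<Omega> and f1 f2 :: "real ^ 'n \<Rightarrow> complex"
  proof -
    have \<mu>0: "\<mu> \<ge> 0" using \<mu> assms(4) by simp
    define s where "s = real_of_int \<mu> + 5"
    have s: "s \<ge> 1" using \<mu>0 by (simp add: s_def)
    have \<Omega>m: "\<Omega> \<in> borel_measurable sphere_measure" and \<Omega>f: "Lp_norm q sphere_measure \<Omega> < \<infinity>"
      using \<Omega> by (auto simp: mean_zero_Lq_def Lp_space_def)
    define \<omega> where "\<omega> = enn2real (Lp_norm q sphere_measure \<Omega>)"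
    have \<omega>: "Lp_norm q sphere_measure \<Omega> = ennreal \<omega>" "\<omega> \<ge> 0" using \<Omega>f by (auto simp: \<omega>_def less_top)
    have "(1::ennreal) < ennreal (4 / 3)" by (simp add: ennreal_less_iff flip: ennreal_1)
    then have q: "1 < q" using assms(3) by (rule less_trans)
    have "(\<integral>\<^sup>+\<theta>. ennreal (norm (\<Omega> \<theta>)) \<partial>sphere_measure) \<le> ennreal (v + 1) * Lp_norm q sphere_measure \<Omega>"
      using v by (intro L1_le_Lq[OF \<Omega>m _ _ q \<Omega>f]) auto
    also have "\<dots> = ennreal ((v + 1) * \<omega>)" unfolding \<omega>(1) using v by (intro ennreal_mult'[symmetric]) simp
    finally have I: "(\<integral>\<^sup>+\<theta>. ennreal (norm (\<Omega> \<theta>)) \<partial>sphere_measure) \<le> ennreal ((v + 1) * \<omega>)" .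
    have "\<exists>S. kernel_family (kernel_smooth_piece \<Phi> \<Omega> \<mu>) (Ck * ((v + 1) * \<omega>)) \<mu> S"
      using Ck \<Omega>m I v \<omega>(2) \<mu>0 by simp
    then obtain S where "kernel_family (kernel_smooth_piece \<Phi> \<Omega> \<mu>) (Ck * ((v + 1) * \<omega>)) \<mu> S" by (elim exE)
    then have kf: "kernel_family (kernel_smooth_piece \<Phi> \<Omega> \<mu>) (a * \<omega>) \<mu> S" by (simp add: a_def mult.assoc)
    interpret kernel_family "kernel_smooth_piece \<Phi> \<Omega> \<mu>" "a * \<omega>" \<mu> S by (rule kf)
    have T: "T g1 g2 = bilinear_op \<Phi> \<Omega> \<mu> g1 g2" for g1 g2
      by (simp add: fun_eq_iff T_def bilinear_op_def bil_def)
    have L2T: "(\<integral>\<^sup>+x. ennreal (norm (T g1 g2 x)) \<partial>lborel) \<le> ennreal (C1 * \<omega>) * Lp_norm 2 lborel g1 * Lp_norm 2 lborel g2"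
      if "schwartz g1" "schwartz g2" for g1 g2
    proof -
      have "(\<integral>\<^sup>+x. ennreal (norm (T g1 g2 x)) \<partial>lborel) \<le> ennreal (C1 * 2 powr (- \<epsilon>1 * real_of_int \<mu>)) * Lp_norm q sphere_measure \<Omega>
            * Lp_norm 2 lborel g1 * Lp_norm 2 lborel g2"
        using L2 \<mu> \<Omega> that unfolding T Lp_norm_1[symmetric] by blast
      also have "\<dots> \<le> ennreal C1 * ennreal \<omega> * Lp_norm 2 lborel g1 * Lp_norm 2 lborel g2"
      proof -
        \<comment> \<open>The decay factor is at most 1 because \<mu> is nonnegative.\<close>
        have "2 powr (- \<epsilon>1 * real_of_int \<mu>) \<le> 2 powr 0" using \<epsilon>1 \<mu>0 by (intro powr_mono) (auto simp: mult_nonneg_nonneg)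
        then have "C1 * 2 powr (- \<epsilon>1 * real_of_int \<mu>) \<le> C1" using C1 by (simp add: mult_left_le)
        then show ?thesis unfolding \<omega>(1) by (intro mult_right_mono ennreal_leI) auto
      qed
      also have "ennreal C1 * ennreal \<omega> = ennreal (C1 * \<omega>)" using C1 by (intro ennreal_mult'[symmetric]) simp
      finally show ?thesis .
    qed
    define B where "B \<eta> = 2 * (C1 * \<omega>) + 2 * (c * (a * \<omega>) * s) + \<eta>" for \<eta>
    define W where "W \<eta> = 8 * U * (32 * B \<eta> * U + 4 * (a * \<omega>) * s) + 16 * (a * \<omega>) * s" for \<eta>
    \<comment> \<open>s \<ge> 1 lets the term with C1 * \<omega>, which carries no factor s, be
      bounded by its multiple with s. The coefficient 256 U^2 is 8U * 32U.\<close>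
    have Wle: "W \<eta> \<le> \<kappa> * \<omega> * s + (256 * U\<^sup>2) * \<eta>" for \<eta>
    proof -
      have "C1 * \<omega> * 1 \<le> C1 * \<omega> * s" using s C1 \<omega>(2) by (intro mult_left_mono) auto
      then have "U\<^sup>2 * (C1 * \<omega>) \<le> U\<^sup>2 * (C1 * \<omega> * s)" by (intro mult_left_mono) auto
      then show ?thesis unfolding W_def B_def \<kappa>_def by (simp add: algebra_simps power2_eq_square)
    qed
    \<comment> \<open>f is the input measured in L^1 and g the bounded one; the two estimates are
      the instances (f1, f2) and (f2, f1), while the operator stays applied to f1, f2.\<close>
    have fin: "weak_L1_norm lborel (bilinear_op \<Phi> \<Omega> \<mu> f1 f2) \<le> ennreal (C * 2 powr (\<delta> * real_of_int \<mu>)) * Lp_norm q sphere_measure \<Omega> * (Lp_norm 1 lborel f * Lp_norm \<infinity> lborel g)"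
      if f: "schwartz f" and g: "schwartz g"
        and key: "\<And>t m \<eta>. t > 0 \<Longrightarrow> m > 0 \<Longrightarrow> \<eta> > 0 \<Longrightarrow> (\<And>x. norm (g x) \<le> m) \<Longrightarrow>
          ennreal t * emeasure lborel {x. t < norm (T f1 f2 x)} \<le> ennreal (W \<eta> * m * (LINT x|lborel. norm (f x)))"
      for f g :: "real ^ 'n \<Rightarrow> complex"
    proof -
      define N where "N = (LINT x|lborel. norm (f x))"
      have N: "N \<ge> 0" "Lp_norm 1 lborel f = ennreal N"
        unfolding N_def Lp_norm_1 using nn_norm_integrable[OF schwartz_integrable(1)[OF f]] by simp_all
      obtain G where G: "G \<ge> 0 \<and> (\<forall>x. norm (g x) \<le> G)" using schwartz_bounded[OF g] by (elim exE)
      have gm: "g \<in> borel_measurable borel" by (rule schwartz_borel[OF g])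
      have ess: "Lp_norm \<infinity> lborel g = esssup lborel (\<lambda>x. ennreal (norm (g x)))" by (simp add: Lp_norm_def)
      have "Lp_norm \<infinity> lborel g \<le> ennreal G"
        unfolding ess using gm G by (intro esssup_I AE_I2 ennreal_leI) auto
      then have fing: "Lp_norm \<infinity> lborel g < \<infinity>" by (rule order_le_less_trans) simp
      define m where "m = enn2real (Lp_norm \<infinity> lborel g)"
      have m: "Lp_norm \<infinity> lborel g = ennreal m" "m \<ge> 0" using fing by (auto simp: m_def less_top)
      \<comment> \<open>The essential supremum bounds g at every point by continuity, as the
        pointwise bound in \<open>key\<close> demands.\<close>
      have gle: "norm (g x) \<le> m" for x
        using continuous_le_esssup[OF schwartz_continuous[OF g], of m x] m ess by simp
      have bd: "ennreal t * emeasure lborel {x. t < norm (T f1 f2 x)} \<le> ennreal (\<kappa> * \<omega> * s * m * N)" if t: "t > 0" for t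
      proof (rule ennreal_le_of_perturbed[where b="256 * U\<^sup>2"])
        fix \<eta> :: real assume \<eta>: "\<eta> > 0"
        have "norm (g x) \<le> m + \<eta>" for x using gle[of x] \<eta> by simp
        then have "ennreal t * emeasure lborel {x. t < norm (T f1 f2 x)} \<le> ennreal (W \<eta> * (m + \<eta>) * N)"
          unfolding N_def using \<eta> m t by (intro key) auto
        also have "\<dots> \<le> ennreal ((\<kappa> * \<omega> * s + 256 * U\<^sup>2 * \<eta>) * (m + \<eta>) * N)"
          using Wle[of \<eta>] m \<eta> N by (intro ennreal_leI mult_right_mono) auto
        finally show "ennreal t * emeasure lborel {x. t < norm (T f1 f2 x)} \<le> ennreal ((\<kappa> * \<omega> * s + 256 * U\<^sup>2 * \<eta>) * (m + \<eta>) * N)" .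
      qed
      have sC: "\<kappa> * s \<le> C * 2 powr (\<delta> * real_of_int \<mu>)"
      proof -
        have "s \<le> C' * 2 powr (\<delta> * real_of_int \<mu>)"
          unfolding s_def C'_def using \<mu>0 assms(2) by (intro linear_le_powr) auto
        then have "\<kappa> * s \<le> \<kappa> * (C' * 2 powr (\<delta> * real_of_int \<mu>))" using \<kappa> by (rule mult_left_mono)
        also have "\<dots> \<le> C * 2 powr (\<delta> * real_of_int \<mu>)" unfolding C_def by (simp add: distrib_right)
        finally show ?thesis .
      qed
      have "weak_L1_norm lborel (bilinear_op \<Phi> \<Omega> \<mu> f1 f2) \<le> ennreal (\<kappa> * \<omega> * s * m * N)"
        unfolding weak_L1_norm_def T[symmetric] using bd by (intro SUP_least) simp
      also have "\<dots> \<le> ennreal (C * 2 powr (\<delta> * real_of_int \<mu>) * (\<omega> * (N * m)))"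
      proof (rule ennreal_leI)
        have "(\<kappa> * s) * (\<omega> * (N * m)) \<le> C * 2 powr (\<delta> * real_of_int \<mu>) * (\<omega> * (N * m))"
          using \<omega>(2) N m by (intro mult_right_mono sC) auto
        then show "\<kappa> * \<omega> * s * m * N \<le> C * 2 powr (\<delta> * real_of_int \<mu>) * (\<omega> * (N * m))" by (simp only: mult_ac)
      qed
      also have "\<dots> = ennreal (C * 2 powr (\<delta> * real_of_int \<mu>)) * (ennreal \<omega> * (ennreal N * ennreal m))"
        using C \<omega>(2) N(1) by (simp add: ennreal_mult')
      finally show ?thesis unfolding \<omega>(1) N(2) m(1) by (simp only: mult.assoc)
    qed
    have c3: "c \<ge> 1" "(\<integral>\<^sup>+z. ennreal (norm z * norm (mollifier (z::'n vpair))) \<partial>lborel) \<le> ennreal c"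
      "\<And>v. (\<integral>\<^sup>+u. ennreal (norm (mollifier (u + v) - mollifier (u::'n vpair))) \<partial>lborel) \<le> ennreal (c * norm v)"
      using c by blast+
    have Bp: "B \<eta> > 0" "2 * (C1 * \<omega>) + 2 * (c * (a * \<omega>) * (of_int \<mu> + 5)) \<le> B \<eta>" if "\<eta> > 0" for \<eta>
    proof -
      have "0 \<le> C1 * \<omega>" "0 \<le> c * (a * \<omega>) * s" using C1 c a \<omega>(2) s by auto
      then show "B \<eta> > 0" using that unfolding B_def by linarith
      show "2 * (C1 * \<omega>) + 2 * (c * (a * \<omega>) * (of_int \<mu> + 5)) \<le> B \<eta>" using that by (simp add: B_def s_def)
    qed
    have C1\<omega>: "0 \<le> C1 * \<omega>" using C1 \<omega>(2) by simp
    have "weak_L1_norm lborel (bilinear_op \<Phi> \<Omega> \<mu> f1 f2) \<le> ennreal (C * 2 powr (\<delta> * real_of_int \<mu>)) * Lp_norm q sphere_measure \<Omega> * (Lp_norm 1 lborel f1 * Lp_norm \<infinity> lborel f2)"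
    proof (rule fin[OF f1 f2])
      fix t m \<eta> :: real assume t: "t > 0" "m > 0" "\<eta> > 0" and b: "\<And>x. norm (f2 x) \<le> m"
      show "ennreal t * emeasure lborel {x. t < norm (T f1 f2 x)} \<le> ennreal (W \<eta> * m * (LINT x|lborel. norm (f1 x)))"
        by (rule T_weak_type(1)[OF c3 C1\<omega> L2T Bp[OF t(3)] _ U_def f1 f2 t(2,1) b]) (simp_all add: W_def s_def)
    qed
    moreover have "weak_L1_norm lborel (bilinear_op \<Phi> \<Omega> \<mu> f1 f2) \<le> ennreal (C * 2 powr (\<delta> * real_of_int \<mu>)) * Lp_norm q sphere_measure \<Omega> * (Lp_norm 1 lborel f2 * Lp_norm \<infinity> lborel f1)"
    proof (rule fin[OF f2 f1])
      fix t m \<eta> :: real assume t: "t > 0" "m > 0" "\<eta> > 0" and b: "\<And>x. norm (f1 x) \<le> m"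
      show "ennreal t * emeasure lborel {x. t < norm (T f1 f2 x)} \<le> ennreal (W \<eta> * m * (LINT x|lborel. norm (f2 x)))"
        by (rule T_weak_type(2)[OF c3 C1\<omega> L2T Bp[OF t(3)] _ U_def f1 f2 t(2,1) b]) (simp_all add: W_def s_def)
    qed
    ultimately show ?thesis by (simp only: mult.assoc mult.commute[of "Lp_norm 1 lborel f2"])
  qed
  then show ?thesis using C by blast
qed

end
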